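(* Fix $p>\max\{2,d/2\}$. Let $\lambda_k:\Omega\to\Omega_0$, $k\in\mathcal L$, be a family of independent random variables on the probability space $(\Omega,\mathcal A,\mathbb P)$ with values in a measurable space $\Omega_0$, and let $u:\Omega_0\times\mathbb R^d\to[0,\infty)$ be (jointly) measurable, $u_\lambda:=u(\lambda,\cdot)$. Let $W_\omega(x):=\sum_{k\in\mathcal L}u_{\lambda_k(\omega)}(x-k)$, and assume that $$\sup_{\omega\in\Omega}\sup_{x\in\mathbb R^d}\|W_\omega\mathbf 1_{\mathcal D+x}\|_{L^p}<\infty$$ and that for all $\kappa>0$ and all $k\in\mathcal L$ $$\mathbb P\{\|u_{\lambda_k}\|_{L^p(\mathbb R^d)}\le\kappa\}>0.$$ Let $V_{\mathrm{per}}\in L^\infty(\mathbb R^d,\mathbb R)$ be $\mathcal L$-periodic, $H_{\mathrm{per}}:=-\Delta+V_{\mathrm{per}}$, $E_0:=\inf\sigma(H_{\mathrm{per}})$ and $H_\omega:=H_{\mathrm{per}}+W_\omega$. Then for all $\varepsilon>0$ $$\mathbb P\{\omega\in\Omega:\inf\sigma(H_\omega)\le E_0+\varepsilon\}>0.$$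
   Context: $\mathcal M$ is a real invertible $d\times d$ matrix with positive determinant, $\mathcal L=\mathcal M\mathbb Z^d$ and $\mathcal D=\mathcal M(-\tfrac12,\tfrac12)^d$. The operators act in $L^2(\mathbb R^d)$ and are self-adjoint on the domain of $\Delta$. *)

theory Defs
  imports "HOL-Probability.Probability"
begin

definition lattice :: "real^'d^'d \<Rightarrow> (real^'d) set" where
  "lattice M = {M *v z | z. \<forall>i. z $ i \<in> \<int>}"

definition unit_cell :: "real^'d^'d \<Rightarrow> (real^'d) set" where
  "unit_cell M = {M *v t | t. \<forall>i. - 1/2 < t $ i \<and> t $ i < 1/2}"

(* Only used for exponents a > 0, hence the value at infinity. *)
definition ennreal_powr :: "ennreal \<Rightarrow> real \<Rightarrow> ennreal" where
  "ennreal_powr x a = (if x = \<infinity> then \<infinity> else ennreal (enn2real x powr a))"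

definition Lp_norm :: "real \<Rightarrow> (real^'d \<Rightarrow> ennreal) \<Rightarrow> ennreal" where
  "Lp_norm p f = ennreal_powr (\<integral>\<^sup>+x. ennreal_powr (f x) p \<partial>lborel) (1 / p)"

(* The sum is taken in [0,\<infinity>], so it is always defined, possibly with value \<infinity>. *)
definition alloy_potential ::
    "real^'d^'d \<Rightarrow> ('o \<Rightarrow> real^'d \<Rightarrow> real) \<Rightarrow> (real^'d \<Rightarrow> 'w \<Rightarrow> 'o) \<Rightarrow> 'w \<Rightarrow> real^'d \<Rightarrow> ennreal" where
  "alloy_potential M u lam \<omega> x = (\<Sum>\<^sub>\<infinity>k\<in>lattice M. ennreal (u (lam k \<omega>) (x - k)))"

(* Classes of L^\<infinity> are represented by Lebesgue measurable functions. *)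
definition Linfty :: "(real^'d \<Rightarrow> real) set" where
  "Linfty = {V. V \<in> borel_measurable lebesgue \<and> (\<exists>C. AE x in lborel. \<bar>V x\<bar> \<le> C)}"

definition periodic :: "(real^'d) set \<Rightarrow> (real^'d \<Rightarrow> real) \<Rightarrow> bool" where
  "periodic L V \<longleftrightarrow> (\<forall>k\<in>L. AE x in lborel. V (x + k) = V x)"

(* Elements of the complex Hilbert space L^2(R^d) are represented by Borel functions (every class
   contains one); all notions below are invariant under changes on null sets. *)
definition L2 :: "(real^'d \<Rightarrow> complex) set" where
  "L2 = {f. f \<in> borel_measurable borel \<and> integrable lborel (\<lambda>x. (cmod (f x))\<^sup>2)}"

definition L2_norm :: "(real^'d \<Rightarrow> complex) \<Rightarrow> real" where
  "L2_norm f = sqrt (\<integral>x. (cmod (f x))\<^sup>2 \<partial>lborel)"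

definition partial :: "'d \<Rightarrow> (real^'d \<Rightarrow> complex) \<Rightarrow> real^'d \<Rightarrow> complex" where
  "partial i f x = frechet_derivative f (at x) (axis i 1)"

(* Membership in C_c^\<infinity>(R^d): all iterated partial derivatives exist and are (totally)
   differentiable, and the support is compact. *)
definition test_function :: "(real^'d \<Rightarrow> complex) \<Rightarrow> bool" where
  "test_function f \<longleftrightarrow>
     (\<forall>is. foldr partial is f differentiable_on UNIV) \<and> compact (closure {x. f x \<noteq> 0})"

definition classical_laplacian :: "(real^'d \<Rightarrow> complex) \<Rightarrow> real^'d \<Rightarrow> complex" where
  "classical_laplacian f x = (\<Sum>i\<in>UNIV. partial i (partial i f) x)"

(* Unbounded operators are given by their graphs. The domain of the Laplacian consists of all f in L^2
   whose distributional Laplacian lies in L^2, which is the Sobolev space H^2(R^d). *)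
definition laplacian :: "((real^'d \<Rightarrow> complex) \<times> (real^'d \<Rightarrow> complex)) set" where
  "laplacian = {(f, g). f \<in> L2 \<and> g \<in> L2 \<and>
     (\<forall>\<phi>. test_function \<phi> \<longrightarrow>
       (\<integral>x. f x * classical_laplacian \<phi> x \<partial>lborel) = (\<integral>x. g x * \<phi> x \<partial>lborel))}"

(* The operator -\<Delta> + V on the functions f in the domain of the Laplacian with V f in L^2. For the
   Laplace-bounded potentials V under consideration this is the whole domain of the Laplacian. *)
definition schroedinger ::
    "(real^'d \<Rightarrow> real) \<Rightarrow> ((real^'d \<Rightarrow> complex) \<times> (real^'d \<Rightarrow> complex)) set" where
  "schroedinger V = {(f, h). h \<in> L2 \<and>
     (\<exists>g. (f, g) \<in> laplacian \<and> (AE x in lborel. h x = - g x + complex_of_real (V x) * f x))}"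

(* z is in the resolvent set iff T - z maps the domain of T onto L^2 and is bounded below, that is,
   T - z is bijective (up to null sets) with bounded inverse. *)
definition resolvent_set :: "((real^'d \<Rightarrow> complex) \<times> (real^'d \<Rightarrow> complex)) set \<Rightarrow> complex set" where
  "resolvent_set T = {z.
     (\<forall>h\<in>L2. \<exists>(f, g)\<in>T. AE x in lborel. g x - z * f x = h x) \<and>
     (\<exists>C. \<forall>(f, g)\<in>T. L2_norm f \<le> C * L2_norm (\<lambda>x. g x - z * f x))}"

definition spectrum :: "((real^'d \<Rightarrow> complex) \<times> (real^'d \<Rightarrow> complex)) set \<Rightarrow> complex set" where
  "spectrum T = - resolvent_set T"

(* The spectra of interest are real, as the operators are self-adjoint; Re only converts the type.
   The infimum is taken in the extended reals. *)
definition inf_spectrum :: "((real^'d \<Rightarrow> complex) \<times> (real^'d \<Rightarrow> complex)) set \<Rightarrow> ereal" where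
  "inf_spectrum T = (INF z\<in>spectrum T. ereal (Re z))"

end

theory Submission imports Defs "HOL-Real_Asymp.Real_Asymp"
begin

text \<open>
  The infimum of the spectrum of \<open>-\<Delta> + U\<close> is the infimum of its quadratic form over normalised test
  functions, provided that \<open>U\<close> is infinitesimally \<open>\<Delta>\<close>-bounded. Both this bound for \<open>W\<^sub>\<omega>\<close> and the density
  of the range of \<open>\<mu> - \<Delta>\<close> come from one identity \<open>c \<phi> = A\<^sub>s \<phi> - G\<^sub>s \<Delta>\<phi>\<close> with nonnegative integral kernels
  supported in the ball of radius \<open>s\<close>; it replaces Sobolev spaces and the Fourier transform.

  Given \<open>\<epsilon>\<close>, choose a test function \<open>\<phi>\<close> whose energy for \<open>H\<^sub>p\<^sub>e\<^sub>r\<close> is less than \<open>E\<^sub>0 + \<epsilon>\<close>. Then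
  \<open>inf \<sigma>(H\<^sub>\<omega>) \<le> E\<^sub>0 + \<epsilon>\<close> as soon as \<open>W\<^sub>\<omega>\<close> has small integral over the support of \<open>\<phi>\<close>. This integral is a
  sum of independent nonnegative variables whose total mean is finite: the tail of the sum is small with
  positive probability by Markov's inequality, and each of the remaining finitely many terms is small with
  positive probability by hypothesis. The event in question is measurable because countably many
  test functions suffice to compute the infimum.\<close>

section \<open>Smooth functions\<close>

text \<open>The exponent condition p > max {2, d/2} is exactly what makes a uniformly local L^p
  potential infinitesimally Laplace-bounded. In the coordinates x + r y with r in [0, s] and |y| <=
  1 the Green kernel has density at most r; after Cauchy-Schwarz its interaction with W^2 costs r^(1
  - d/p), whose integral is a multiple of s^(2 - d/p). Letting s tend to 0 makes the constant before
  the Laplacian as small as desired. Tying s to \<mu> instead turns the same identity into an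
  approximate right inverse of \<mu> - \<Delta>. The operators are graphs with a distributional
  Laplacian, so information about the form on test functions does not reach the resolvent by itself:
  the test functions must be a core, and the ranges of H - z on them must be dense below the bottom.
  Both rest on the dense range of \<mu> - \<Delta>. Smallness of single sites says nothing about
  infinitely many sites at once; it is the uniform bound on W that makes the mean masses over a ball
  summable and so controls the tail.\<close>

definition smooth :: "(real^'d \<Rightarrow> complex) \<Rightarrow> bool" where
  "smooth f \<longleftrightarrow> (\<forall>is. foldr partial is f differentiable_on UNIV)"

text \<open>A direct induction would need formulas for all iterated partial derivatives of products
  and composites. It is enough to exhibit a class of differentiable functions that is closed under
  every \<open>partial i\<close>; each smoothness proof then only has to find the right
  class.\<close>

lemma smooth_coinduct:
  assumes "X f"
    and "\<And>g. X g \<Longrightarrow> g differentiable_on UNIV"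
    and "\<And>g i. X g \<Longrightarrow> X (partial i g)"
  shows "smooth f"
proof -
  have "X (foldr partial is f)" for "is"
    by (induction "is") (use assms in auto)
  then show ?thesis
    using assms(2) by (auto simp: smooth_def)
qed

lemma smooth_differentiable_on: "smooth f \<Longrightarrow> f differentiable_on UNIV"
  unfolding smooth_def by (metis foldr_Nil id_apply)

lemma smooth_differentiable: "smooth f \<Longrightarrow> f differentiable (at x)"
  using smooth_differentiable_on differentiable_on_eq_differentiable_at open_UNIV by blast

lemma smooth_partial: "smooth f \<Longrightarrow> smooth (partial i f)"
  unfolding smooth_def
proof
  fix "is" assume *: "\<forall>is. foldr partial is f differentiable_on UNIV"
  have "foldr partial is (partial i f) = foldr partial (is @ [i]) f" by simp
  then show "foldr partial is (partial i f) differentiable_on UNIV" using * by metis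
qed

lemma smooth_continuous_on: "smooth f \<Longrightarrow> continuous_on A f"
  by (meson continuous_on_subset differentiable_imp_continuous_on smooth_differentiable_on subset_UNIV)

lemma smooth_borel_measurable: "smooth f \<Longrightarrow> f \<in> borel_measurable borel"
  by (intro borel_measurable_continuous_onI smooth_continuous_on)

lemma smooth_has_derivative: "smooth f \<Longrightarrow> (f has_derivative frechet_derivative f (at x)) (at x)"
  using frechet_derivative_works smooth_differentiable by blast

lemma partial_eq: "(f has_derivative F) (at x) \<Longrightarrow> partial i f x = F (axis i 1)"
  unfolding partial_def using frechet_derivative_at by metis

text \<open>Iterated partial derivatives are all that \<open>smooth\<close> controls; this recovers
  the total derivative from them, both for Lipschitz bounds and for derivatives in the radial
  variable.\<close>

lemma frechet_eq_sum_partial: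
  fixes f :: "real^'d \<Rightarrow> complex"
  assumes "f differentiable (at x)"
  shows "frechet_derivative f (at x) v = (\<Sum>i\<in>UNIV. complex_of_real (v $ i) * partial i f x)"
proof -
  have lin: "linear (frechet_derivative f (at x))"
    using assms linear_frechet_derivative by blast
  have "frechet_derivative f (at x) v = frechet_derivative f (at x) (\<Sum>i\<in>UNIV. v $ i *\<^sub>R axis i 1)"
    by (simp add: basis_expansion flip: vector_scalar_mult_def scalar_mult_eq_scaleR)
  also have "\<dots> = (\<Sum>i\<in>UNIV. complex_of_real (v $ i) * partial i f x)"
    unfolding linear_sum[OF lin] linear_scale[OF lin] partial_def by (simp add: scaleR_conv_of_real)
  finally show ?thesis .
qed

lemma partial_add:
  assumes "f differentiable (at x)" "g differentiable (at x)"
  shows "partial i (\<lambda>x. f x + g x) x = partial i f x + partial i g x"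
  by (subst partial_eq[OF has_derivative_add])
    (use assms in \<open>auto simp: frechet_derivative_works partial_def\<close>)

lemma partial_mult:
  assumes "f differentiable (at x)" "g differentiable (at x)"
  shows "partial i (\<lambda>x. f x * g x) x = f x * partial i g x + partial i f x * g x"
  by (subst partial_eq[OF has_derivative_mult])
    (use assms in \<open>auto simp: frechet_derivative_works partial_def\<close>)

lemma smooth_add:
  assumes "smooth f" "smooth g"
  shows "smooth (\<lambda>x. f x + g x)"
proof (rule smooth_coinduct[where X = "\<lambda>h. \<exists>f g. smooth f \<and> smooth g \<and> h = (\<lambda>x. f x + g x)"])
  show "\<exists>f' g'. smooth f' \<and> smooth g' \<and> (\<lambda>x. f x + g x) = (\<lambda>x. f' x + g' x)" using assms by blast
next
  fix h assume "\<exists>f g. smooth f \<and> smooth g \<and> h = (\<lambda>x. f x + g x)"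
  then show "h differentiable_on UNIV"
    by (auto simp: smooth_differentiable_on)
next
  fix h i assume "\<exists>f g. smooth f \<and> smooth g \<and> h = (\<lambda>x. f x + g x)"
  then obtain f g where *: "smooth f" "smooth g" "h = (\<lambda>x. f x + g x)" by blast
  then have "partial i h = (\<lambda>x. partial i f x + partial i g x)"
    by (auto simp: partial_add smooth_differentiable)
  then show "\<exists>f g. smooth f \<and> smooth g \<and> partial i h = (\<lambda>x. f x + g x)"
    using * smooth_partial by blast
qed

text \<open>Products alone are not closed under partial derivatives, but their finite sums are.\<close>

inductive sum_of_products :: "(real^'d \<Rightarrow> complex) \<Rightarrow> bool" where
  prod: "smooth f \<Longrightarrow> smooth g \<Longrightarrow> sum_of_products (\<lambda>x. f x * g x)"
| add: "sum_of_products f \<Longrightarrow> sum_of_products g \<Longrightarrow> sum_of_products (\<lambda>x. f x + g x)"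

lemma sum_of_products_differentiable: "sum_of_products f \<Longrightarrow> f differentiable_on UNIV"
  by (induction rule: sum_of_products.induct) (auto simp: smooth_differentiable_on)

lemma sum_of_products_partial: "sum_of_products f \<Longrightarrow> sum_of_products (partial i f)"
proof (induction rule: sum_of_products.induct)
  case (prod f g)
  then have "partial i (\<lambda>x. f x * g x) = (\<lambda>x. f x * partial i g x + partial i f x * g x)"
    by (auto simp: partial_mult smooth_differentiable)
  then show ?case
    using prod by (auto intro!: sum_of_products.intros smooth_partial)
next
  case (add f g)
  then have "partial i (\<lambda>x. f x + g x) = (\<lambda>x. partial i f x + partial i g x)"
    using sum_of_products_differentiable
    by (intro ext partial_add) (auto simp: differentiable_on_eq_differentiable_at)
  then show ?case
    using add by (auto intro!: sum_of_products.intros)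
qed

lemma smooth_mult: "smooth f \<Longrightarrow> smooth g \<Longrightarrow> smooth (\<lambda>x. f x * g x)"
  by (rule smooth_coinduct[where X = sum_of_products])
    (auto intro: sum_of_products.prod sum_of_products_differentiable sum_of_products_partial)

lemma partial_const: "partial i (\<lambda>x. c) = (\<lambda>x. 0)"
  by (auto simp: partial_def)

lemma smooth_const: "smooth (\<lambda>x. c)"
  by (rule smooth_coinduct[where X = "\<lambda>h. \<exists>c. h = (\<lambda>x. c)"]) (auto simp: partial_const)

lemma smooth_cmult: "smooth f \<Longrightarrow> smooth (\<lambda>x. c * f x)"
  by (intro smooth_mult smooth_const)

lemma partial_cmult: "f differentiable (at x) \<Longrightarrow> partial i (\<lambda>x. c * f x) x = c * partial i f x"
  by (subst partial_mult) (auto simp: partial_const)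

lemma smooth_prod: "(\<And>i. i \<in> I \<Longrightarrow> smooth (f i)) \<Longrightarrow> smooth (\<lambda>x. \<Prod>i\<in>I. f i x)"
  by (induction I rule: infinite_finite_induct) (auto intro: smooth_mult smooth_const)

lemma smooth_exp_has_derivative:
  assumes "smooth f"
  shows "((\<lambda>x. exp (f x)) has_derivative (\<lambda>v. exp (f x) * frechet_derivative f (at x) v)) (at x)"
  using has_derivative_compose[OF smooth_has_derivative[OF assms] DERIV_exp[unfolded has_field_derivative_def]]
  by simp

text \<open>Every derivative of \<open>exp f\<close> is a smooth multiple of \<open>exp f\<close>,
  so the invariant class carries a free factor \<open>g\<close>, starting from
  \<open>g = 1\<close>.\<close>

lemma smooth_exp:
  assumes "smooth f"
  shows "smooth (\<lambda>x. exp (f x))"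
proof (rule smooth_coinduct[where X = "\<lambda>h. \<exists>g. smooth g \<and> h = (\<lambda>x. g x * exp (f x))"])
  show "\<exists>g. smooth g \<and> (\<lambda>x. exp (f x)) = (\<lambda>x. g x * exp (f x))"
    by (intro exI[of _ "\<lambda>x. 1"]) (auto simp: smooth_const)
next
  fix h assume "\<exists>g. smooth g \<and> h = (\<lambda>x. g x * exp (f x))"
  then show "h differentiable_on UNIV"
    using smooth_exp_has_derivative[OF assms] by (auto simp: differentiable_on_eq_differentiable_at
        intro!: differentiable_mult intro: smooth_differentiable differentiableI)
next
  fix h i assume "\<exists>g. smooth g \<and> h = (\<lambda>x. g x * exp (f x))"
  then obtain g where g: "smooth g" "h = (\<lambda>x. g x * exp (f x))" by blast
  note e = smooth_exp_has_derivative[OF assms]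
  have "partial i h x = (partial i g x + g x * partial i f x) * exp (f x)" for x
    unfolding g(2)
    by (subst partial_mult)
      (use e g(1) in \<open>auto intro: smooth_has_derivative simp: differentiable_def partial_eq[OF e] partial_def[symmetric] algebra_simps\<close>)
  then show "\<exists>g. smooth g \<and> partial i h = (\<lambda>x. g x * exp (f x))"
    using g(1) assms
    by (intro exI[of _ "\<lambda>x. partial i g x + g x * partial i f x"])
      (auto intro!: smooth_add smooth_mult smooth_partial)
qed

lemma partial_cnj:
  assumes "f differentiable (at x)"
  shows "partial i (\<lambda>x. cnj (f x)) x = cnj (partial i f x)"
  by (subst partial_eq[OF bounded_linear.has_derivative[OF bounded_linear_cnj]])
    (use assms in \<open>auto simp: frechet_derivative_works partial_def\<close>)

lemma smooth_cnj:
  assumes "smooth f"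
  shows "smooth (\<lambda>x. cnj (f x))"
proof (rule smooth_coinduct[where X = "\<lambda>h. \<exists>f. smooth f \<and> h = (\<lambda>x. cnj (f x))"])
  show "\<exists>g. smooth g \<and> (\<lambda>x. cnj (f x)) = (\<lambda>x. cnj (g x))" using assms by blast
next
  fix h assume "\<exists>f. smooth f \<and> h = (\<lambda>x. cnj (f x))"
  then show "h differentiable_on UNIV"
    using smooth_has_derivative bounded_linear.has_derivative[OF bounded_linear_cnj]
    by (auto simp: differentiable_on_eq_differentiable_at differentiable_def) blast
next
  fix h i assume "\<exists>f. smooth f \<and> h = (\<lambda>x. cnj (f x))"
  then obtain f where f: "smooth f" "h = (\<lambda>x. cnj (f x))" by blast
  then have "partial i h = (\<lambda>x. cnj (partial i f x))"
    by (auto simp: partial_cnj smooth_differentiable)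
  then show "\<exists>f. smooth f \<and> partial i h = (\<lambda>x. cnj (f x))"
    using f smooth_partial by blast
qed

text \<open>The class of these functions contains \<open>exp (- 1 / t)\<close> on the positive half line and is closed
  under differentiation.\<close>

definition flat_exp :: "real poly \<Rightarrow> real \<Rightarrow> real" where
  "flat_exp P t = (if t > 0 then poly P (1 / t) * exp (- (1 / t)) else 0)"

lemma poly_exp_tendsto_0: "((\<lambda>s::real. poly P s * exp (- s)) \<longlongrightarrow> 0) at_top"
proof -
  have "((\<lambda>s::real. \<Sum>i\<le>degree P. coeff P i * (s ^ i / exp s)) \<longlongrightarrow> (\<Sum>i\<le>degree P. coeff P i * 0)) at_top"
    by (intro tendsto_intros tendsto_power_div_exp_0)
  then show ?thesis
    by (simp add: poly_altdef sum_distrib_right exp_minus field_simps sum_divide_distrib)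
qed

text \<open>With s = 1/t, differentiation in t sends P(s) exp(-s) to s^2 (P(s) - P'(s)) exp(-s), and
  \<open>[:0, 0, 1:]\<close> is the polynomial s^2. At t = 0 the right difference quotient is s P(s)
  exp(-s) with s tending to infinity.\<close>

lemma flat_exp_has_derivative:
  "(flat_exp P has_real_derivative flat_exp ([:0, 0, 1:] * (P - pderiv P)) t) (at t)"
proof -
  consider "t > 0" | "t < 0" | "t = 0" by linarith
  then show ?thesis
  proof cases
    case 1
    have "((\<lambda>t. poly P (1 / t) * exp (- (1 / t))) has_real_derivative
        flat_exp ([:0, 0, 1:] * (P - pderiv P)) t) (at t)"
      using 1
      by (auto intro!: derivative_eq_intros simp: flat_exp_def field_simps power2_eq_square)
    then show ?thesis
      by (rule has_field_derivative_transform_within_open[where S = "{0<..}"]) (use 1 in \<open>auto simp: flat_exp_def\<close>)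
  next
    case 2
    have "((\<lambda>t. 0) has_real_derivative flat_exp ([:0, 0, 1:] * (P - pderiv P)) t) (at t)"
      using 2 by (auto simp: flat_exp_def)
    then show ?thesis
      by (rule has_field_derivative_transform_within_open[where S = "{..<0}"]) (use 2 in \<open>auto simp: flat_exp_def\<close>)
  next
    case 3
    have "((\<lambda>h. flat_exp P h / h) \<longlongrightarrow> 0) (at_right 0)"
    proof -
      have "((\<lambda>h::real. poly ([:0,1:] * P) (inverse h) * exp (- (inverse h))) \<longlongrightarrow> 0) (at_right 0)"
        using filterlim_compose[OF poly_exp_tendsto_0 filterlim_inverse_at_top_right] .
      then show ?thesis
        by (rule tendsto_cong[THEN iffD1, rotated])
          (auto simp: flat_exp_def eventually_at_filter field_simps)
    qed
    moreover have "((\<lambda>h. flat_exp P h / h) \<longlongrightarrow> 0) (at_left 0)"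
      by (rule tendsto_eventually) (auto simp: flat_exp_def eventually_at_filter)
    ultimately have "((\<lambda>h. flat_exp P h / h) \<longlongrightarrow> 0) (at 0)"
      using filterlim_split_at by blast
    then show ?thesis
      using 3 by (simp add: has_field_derivative_iff flat_exp_def)
  qed
qed

lemma smooth_flat_exp: "smooth (\<lambda>x. complex_of_real (flat_exp P (s * (x $ i) + c)))"
\<comment> \<open>The constant \<open>k\<close> collects the chain-rule factors
  \<open>s * axis j 1 $ i\<close>, which vanish unless \<open>j = i\<close>.\<close>
proof (rule smooth_coinduct[where X = "\<lambda>h. \<exists>P k. h = (\<lambda>x. complex_of_real (k * flat_exp P (s * (x $ i) + c)))"])
  show "\<exists>Q k. (\<lambda>x. complex_of_real (flat_exp P (s * (x $ i) + c))) = (\<lambda>x. complex_of_real (k * flat_exp Q (s * (x $ i) + c)))"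
    by (intro exI[of _ P] exI[of _ 1]) simp
next
  have *: "((\<lambda>x::real^'a. complex_of_real (k * flat_exp P (s * (x $ i) + c))) has_derivative
     (\<lambda>v. complex_of_real (k * (flat_exp ([:0, 0, 1:] * (P - pderiv P)) (s * (x $ i) + c) * (s * (v $ i)))))) (at x)" for P k x
  proof -
    have "((\<lambda>x::real^'a. s * (x $ i) + c) has_derivative (\<lambda>v. s * (v $ i))) (at x)"
      by (auto intro!: derivative_eq_intros bounded_linear.has_derivative[OF bounded_linear_vec_nth])
    from has_derivative_compose[OF this flat_exp_has_derivative[unfolded has_field_derivative_def]]
    show ?thesis
      by (auto intro!: derivative_eq_intros simp: algebra_simps)
  qed
  {
    fix h :: "real^'a \<Rightarrow> complex" assume "\<exists>P k. h = (\<lambda>x. complex_of_real (k * flat_exp P (s * (x $ i) + c)))"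
    then show "h differentiable_on UNIV"
      using * by (auto simp: differentiable_on_eq_differentiable_at differentiable_def simp del: of_real_mult)
  next
    fix h :: "real^'a \<Rightarrow> complex" and j assume "\<exists>P k. h = (\<lambda>x. complex_of_real (k * flat_exp P (s * (x $ i) + c)))"
    then obtain P k where h: "h = (\<lambda>x. complex_of_real (k * flat_exp P (s * (x $ i) + c)))" by blast
    have "partial j h = (\<lambda>x. complex_of_real ((k * s * axis j 1 $ i) * flat_exp ([:0, 0, 1:] * (P - pderiv P)) (s * (x $ i) + c)))"
      unfolding h by (subst partial_eq[OF *, abs_def]) (simp add: fun_eq_iff algebra_simps)
    then show "\<exists>P k. partial j h = (\<lambda>x. complex_of_real (k * flat_exp P (s * (x $ i) + c)))" by blast
  }
qed

section \<open>Bump functions and smooth approximations of box indicators\<close>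

definition bump :: "real^'d \<Rightarrow> real^'d \<Rightarrow> real^'d \<Rightarrow> real" where
  "bump a b x = (\<Prod>i\<in>UNIV. flat_exp 1 (x $ i - a $ i) * flat_exp 1 (b $ i - x $ i))"

lemma bump_pos: "x \<in> box a b \<Longrightarrow> bump a b x > 0"
  unfolding bump_def by (intro prod_pos) (auto simp: mem_box_cart flat_exp_def)

lemma bump_zero: "x \<notin> box a b \<Longrightarrow> bump a b x = 0"
  unfolding bump_def by (force simp: mem_box_cart flat_exp_def prod_zero_iff)

lemma bump_nonneg: "bump a b x \<ge> 0"
  by (metis bump_pos bump_zero less_eq_real_def)

lemma smooth_bump: "smooth (\<lambda>x. complex_of_real (bump a b x))"
proof -
  have "smooth (\<lambda>x. \<Prod>i\<in>UNIV. complex_of_real (flat_exp 1 (1 * x $ i + (- (a $ i))))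
      * complex_of_real (flat_exp 1 ((-1) * x $ i + b $ i)))"
    by (intro smooth_prod smooth_mult smooth_flat_exp)
  then show ?thesis
    by (simp add: bump_def)
qed

lemma test_function_iff: "test_function f \<longleftrightarrow> smooth f \<and> bounded {x. f x \<noteq> 0}"
  unfolding test_function_def smooth_def
  by (metis bounded_closure bounded_subset closed_closure closure_subset compact_eq_bounded_closed)

text \<open>These functions vanish off the box and increase to 1 on it as n grows, so box indicators
  are approximated smoothly without mollifiers, and smoothness is an instance of
  \<open>smooth_exp\<close>.\<close>

definition soft_indicator :: "nat \<Rightarrow> real^'d \<Rightarrow> real^'d \<Rightarrow> real^'d \<Rightarrow> complex" where
  "soft_indicator n a b x = 1 - exp (- (of_nat n * complex_of_real (bump a b x)))"

lemma soft_indicator_eq: "soft_indicator n a b x = complex_of_real (1 - exp (- (real n * bump a b x)))"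
  by (simp add: soft_indicator_def exp_of_real[symmetric])

lemma test_function_soft_indicator: "test_function (soft_indicator n a b)"
proof -
  have "smooth (\<lambda>x. 1 + (-1) * exp ((- of_nat n) * complex_of_real (bump a b x)))"
    by (intro smooth_add smooth_const smooth_cmult smooth_exp smooth_bump)
  moreover have "bounded {x. soft_indicator n a b x \<noteq> 0}"
    by (rule bounded_subset[OF bounded_box[of a b]]) (use bump_zero in \<open>fastforce simp: soft_indicator_def\<close>)
  ultimately show ?thesis
    by (simp add: test_function_iff soft_indicator_def[abs_def])
qed

lemma norm_soft_indicator: "cmod (soft_indicator n a b x) \<le> 1"
  unfolding soft_indicator_eq norm_of_real using bump_nonneg[of a b x] by auto

lemma soft_indicator_outside: "x \<notin> box a b \<Longrightarrow> soft_indicator n a b x = 0"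
  by (simp add: soft_indicator_def bump_zero)

lemma soft_indicator_tendsto: "(\<lambda>n. soft_indicator n a b x) \<longlonglongrightarrow> indicator (box a b) x"
proof (cases "x \<in> box a b")
  case True
  have "(\<lambda>n. exp (- (real n * bump a b x))) \<longlonglongrightarrow> 0"
    using bump_pos[OF True] by real_asymp
  then have "(\<lambda>n. complex_of_real (1 - exp (- (real n * bump a b x)))) \<longlonglongrightarrow> of_real (1 - 0)"
    by (intro tendsto_intros)
  then show ?thesis using True by (simp add: soft_indicator_eq)
qed (simp add: soft_indicator_outside)

section \<open>Closure properties of test functions and rules for the classical Laplacian\<close>

lemma test_function_smooth: "test_function f \<Longrightarrow> smooth f"
  by (simp add: test_function_iff)

lemma test_function_support:
  assumes "test_function f"
  obtains R where "R > 0" "\<And>x. norm x > R \<Longrightarrow> f x = 0"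
proof -
  have "bounded {x. f x \<noteq> 0}" using assms by (simp add: test_function_iff)
  then obtain R where "R > 0" "\<And>x. f x \<noteq> 0 \<Longrightarrow> norm x \<le> R"
    unfolding bounded_pos by blast
  then show thesis using that by force
qed

lemma test_functionI:
  assumes "smooth f" "\<And>x. norm x > R \<Longrightarrow> f x = 0"
  shows "test_function f"
proof -
  have "bounded {x. f x \<noteq> 0}"
    unfolding bounded_iff using assms(2) by (intro exI[of _ R]) force
  then show ?thesis using assms(1) by (simp add: test_function_iff)
qed

lemma partial_zero:
  assumes "\<And>x. norm x > R \<Longrightarrow> f x = 0" "norm x > R"
  shows "partial i f x = 0"
proof -
  have o: "open {x::real^'d. norm x > R}"
    by (intro open_Collect_less continuous_intros)
  have "((\<lambda>x. 0::complex) has_derivative (\<lambda>_. 0)) (at x)" by simp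
  then have "(f has_derivative (\<lambda>_. 0)) (at x)"
    by (rule has_derivative_transform_within_open[OF _ o]) (use assms in auto)
  then show ?thesis by (simp add: partial_eq)
qed

lemma test_function_partial: "test_function f \<Longrightarrow> test_function (partial i f)"
proof -
  assume *: "test_function f"
  then obtain R where "\<And>x. norm x > R \<Longrightarrow> f x = 0" using test_function_support by blast
  then show ?thesis
    by (intro test_functionI[where R = R])
      (use * in \<open>auto intro: smooth_partial test_function_smooth partial_zero\<close>)
qed

lemma test_function_mult: "smooth f \<Longrightarrow> test_function g \<Longrightarrow> test_function (\<lambda>x. f x * g x)"
proof -
  assume *: "smooth f" "test_function g"
  from *(2) obtain R where "\<And>x. norm x > R \<Longrightarrow> g x = 0" using test_function_support by blast
  then show ?thesis
    by (intro test_functionI[where R = R])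
      (use * in \<open>auto intro: smooth_mult test_function_smooth\<close>)
qed

lemma test_function_cmult: "test_function g \<Longrightarrow> test_function (\<lambda>x. c * g x)"
  by (intro test_function_mult smooth_const)

lemma test_function_add:
  assumes "test_function f" "test_function g"
  shows "test_function (\<lambda>x. f x + g x)"
proof -
  obtain R where R: "\<And>x. norm x > R \<Longrightarrow> f x = 0" using assms(1) test_function_support by blast
  obtain S where S: "\<And>x. norm x > S \<Longrightarrow> g x = 0" using assms(2) test_function_support by blast
  show ?thesis
    by (rule test_functionI[where R = "max R S"])
      (use assms R S in \<open>auto intro: smooth_add test_function_smooth\<close>)
qed

lemma test_function_zero: "test_function (\<lambda>x. 0)"
  by (rule test_functionI[OF smooth_const]) auto

lemma test_function_diff: "test_function f \<Longrightarrow> test_function g \<Longrightarrow> test_function (\<lambda>x. f x - g x)"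
  using test_function_add[OF _ test_function_cmult[of g "-1"]] by simp

lemma test_function_sum: "(\<And>i. i \<in> I \<Longrightarrow> test_function (f i)) \<Longrightarrow> test_function (\<lambda>x. \<Sum>i\<in>I. f i x)"
  by (induction I rule: infinite_finite_induct) (auto intro: test_function_add test_function_zero)

lemma test_function_cnj: "test_function f \<Longrightarrow> test_function (\<lambda>x. cnj (f x))"
proof -
  assume *: "test_function f"
  then obtain R where "\<And>x. norm x > R \<Longrightarrow> f x = 0" using test_function_support by blast
  then show ?thesis
    by (intro test_functionI[where R = R])
      (use * in \<open>auto intro: smooth_cnj test_function_smooth\<close>)
qed

lemma test_function_laplacian: "test_function f \<Longrightarrow> test_function (classical_laplacian f)"
  unfolding classical_laplacian_def[abs_def] by (intro test_function_sum test_function_partial)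

lemma smooth_partial_differentiable: "smooth f \<Longrightarrow> partial i f differentiable (at x)"
  by (intro smooth_differentiable smooth_partial)

lemma classical_laplacian_add:
  assumes "smooth f" "smooth g"
  shows "classical_laplacian (\<lambda>x. f x + g x) = (\<lambda>x. classical_laplacian f x + classical_laplacian g x)"
proof -
  have "partial i (\<lambda>x. f x + g x) = (\<lambda>x. partial i f x + partial i g x)" for i
    using assms by (auto simp: partial_add smooth_differentiable)
  then show ?thesis
    using assms by (auto simp: classical_laplacian_def partial_add smooth_partial_differentiable sum.distrib)
qed

lemma classical_laplacian_cmult:
  assumes "smooth f"
  shows "classical_laplacian (\<lambda>x. c * f x) = (\<lambda>x. c * classical_laplacian f x)"
proof -
  have "partial i (\<lambda>x. c * f x) = (\<lambda>x. c * partial i f x)" for i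
    using assms by (auto simp: partial_cmult smooth_differentiable)
  then show ?thesis
    using assms by (auto simp: classical_laplacian_def partial_cmult smooth_partial_differentiable sum_distrib_left)
qed

lemma classical_laplacian_diff:
  assumes "smooth f" "smooth g"
  shows "classical_laplacian (\<lambda>x. f x - g x) = (\<lambda>x. classical_laplacian f x - classical_laplacian g x)"
  using classical_laplacian_add[OF assms(1) smooth_cmult[OF assms(2), of "-1"]]
    classical_laplacian_cmult[OF assms(2), of "-1"] by simp

lemma classical_laplacian_cnj:
  assumes "smooth f"
  shows "classical_laplacian (\<lambda>x. cnj (f x)) = (\<lambda>x. cnj (classical_laplacian f x))"
proof -
  have "partial i (\<lambda>x. cnj (f x)) = (\<lambda>x. cnj (partial i f x))" for i
    using assms by (auto simp: partial_cnj smooth_differentiable)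
  then show ?thesis
    using assms by (auto simp: classical_laplacian_def partial_cnj smooth_partial_differentiable)
qed

section \<open>Boundedness, integrability and Lipschitz bounds\<close>

lemma bounded_support_bounded:
  fixes f :: "real^'d \<Rightarrow> complex"
  assumes "continuous_on UNIV f" "\<And>x. norm x > R \<Longrightarrow> f x = 0"
  obtains B where "B \<ge> 0" "\<And>x. cmod (f x) \<le> B"
proof -
  have "compact (f ` cball 0 R)"
    using assms(1) compact_cball compact_continuous_image continuous_on_subset by blast
  then obtain B where B: "B > 0" "\<forall>y\<in>f ` cball 0 R. norm y \<le> B"
    using compact_imp_bounded bounded_pos by metis
  have "cmod (f x) \<le> B" for x
    using B assms(2)[of x] by (cases "norm x > R") auto
  then show thesis using that B(1) by (meson less_imp_le)
qed

lemma bounded_support_integrable: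
  fixes f :: "real^'d \<Rightarrow> 'b::{banach,second_countable_topology}"
  assumes "continuous_on UNIV f" "\<And>x. norm x > R \<Longrightarrow> f x = 0"
  shows "integrable lborel f"
proof -
  have "integrable lborel (\<lambda>x. indicator (cball 0 R) x *\<^sub>R f x)"
    using assms(1) by (intro borel_integrable_compact) (auto intro: continuous_on_subset)
  also have "(\<lambda>x. indicator (cball 0 R) x *\<^sub>R f x) = f"
    using assms(2) by (auto simp: indicator_def fun_eq_iff not_le[symmetric])
  finally show ?thesis .
qed

lemma test_function_bounded:
  assumes "test_function f"
  obtains B where "B \<ge> 0" "\<And>x. cmod (f x) \<le> B"
proof -
  obtain R where "\<And>x. norm x > R \<Longrightarrow> f x = 0" using assms test_function_support by blast
  then show thesis
    using that bounded_support_bounded[of f R] smooth_continuous_on[OF test_function_smooth[OF assms]] by blast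
qed

lemma test_function_integrable:
  assumes "test_function f"
  shows "integrable lborel f"
proof -
  obtain R where "\<And>x. norm x > R \<Longrightarrow> f x = 0" using assms test_function_support by blast
  then show ?thesis
    by (rule bounded_support_integrable[OF smooth_continuous_on[OF test_function_smooth[OF assms]]])
qed

lemma test_function_L2:
  assumes "test_function f"
  shows "f \<in> L2"
proof -
  obtain R where R: "\<And>x. norm x > R \<Longrightarrow> f x = 0" using assms test_function_support by blast
  have s: "smooth f" using assms by (rule test_function_smooth)
  have "integrable lborel (\<lambda>x. (cmod (f x))\<^sup>2)"
    by (rule bounded_support_integrable[where R = R])
      (use R s in \<open>auto intro!: continuous_intros smooth_continuous_on\<close>)
  then show ?thesis using s by (simp add: L2_def smooth_borel_measurable)
qed

text \<open>Partial derivatives are again test functions and hence bounded, so the mean value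
  inequality applies globally. The constant dominates difference quotients when \<open>avg\<close>
  and \<open>radial\<close> are differentiated under the integral.\<close>

lemma test_function_lipschitz:
  assumes "test_function f"
  obtains B where "B \<ge> 0" "\<And>x y. cmod (f y - f x) \<le> B * norm (y - x)"
proof -
  have "\<exists>B\<ge>0. \<forall>x. cmod (partial i f x) \<le> B" for i
    using assms test_function_bounded test_function_partial by metis
  then obtain B where B: "\<And>i. B i \<ge> 0" "\<And>i x. cmod (partial i f x) \<le> B i" by metis
  have "norm (frechet_derivative f (at x) v) \<le> (\<Sum>i\<in>UNIV. B i) * norm v" for x v
  proof -
    have "norm (frechet_derivative f (at x) v) \<le> (\<Sum>i\<in>UNIV. norm (complex_of_real (v $ i) * partial i f x))"
      using assms by (subst frechet_eq_sum_partial) (auto intro: norm_sum smooth_differentiable test_function_smooth)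
    also have "\<dots> \<le> (\<Sum>i\<in>UNIV. norm v * B i)"
      by (intro sum_mono) (auto simp: norm_mult B intro!: mult_mono component_le_norm_cart)
    finally show ?thesis by (simp add: sum_distrib_left mult.commute)
  qed
  then have "onorm (frechet_derivative f (at x)) \<le> (\<Sum>i\<in>UNIV. B i)" for x
    by (intro onorm_le) auto
  then have "cmod (f y - f x) \<le> (\<Sum>i\<in>UNIV. B i) * norm (y - x)" for x y
    using assms
    by (intro differentiable_bound[where S = UNIV]) (auto intro: smooth_has_derivative test_function_smooth)
  then show thesis using that[of "\<Sum>i\<in>UNIV. B i"] B(1) by (simp add: sum_nonneg)
qed

section \<open>Averages and integration by parts\<close>

text \<open>Domination is asked only of the increments from the fixed point \<open>x\<close>, as a
  Lipschitz bound, which is what the integrands below offer directly. Measurability and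
  integrability of \<open>G'\<close> are derived, since \<open>G' z v\<close> is a limit of
  difference quotients.\<close>

lemma has_derivative_integral_dominated:
  fixes G :: "'a::real_normed_vector \<Rightarrow> 'z \<Rightarrow> complex"
  assumes \<delta>: "\<delta> > 0"
    and int: "\<And>y. norm (y - x) < \<delta> \<Longrightarrow> integrable \<nu> (G y)"
    and der: "\<And>z. z \<in> space \<nu> \<Longrightarrow> ((\<lambda>y. G y z) has_derivative G' z) (at x)"
    and bd: "\<And>y z. norm (y - x) < \<delta> \<Longrightarrow> z \<in> space \<nu> \<Longrightarrow> cmod (G y z - G x z) \<le> B z * norm (y - x)"
    and B: "integrable \<nu> B" "\<And>z. B z \<ge> 0"
  shows "((\<lambda>y. \<integral>z. G y z \<partial>\<nu>) has_derivative (\<lambda>v. \<integral>z. G' z v \<partial>\<nu>)) (at x)"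
proof -
  \<comment> \<open>The step \<open>\<delta> / (1 + norm v) / Suc n\<close> stays within distance
    \<open>\<delta>\<close> of \<open>x\<close> for every \<open>n\<close> and every
    \<open>v\<close>, including \<open>v = 0\<close>; after scaling by \<open>Suc n\<close> the
    positive factor \<open>\<delta> / (1 + norm v)\<close> is left on \<open>G' z v\<close> and
    divided out later.\<close>
  have lim: "(\<lambda>n. of_nat (Suc n) * (G (x + (\<delta> / (1 + norm v) / Suc n) *\<^sub>R v) z - G x z)) \<longlonglongrightarrow> (\<delta> / (1 + norm v)) *\<^sub>R G' z v"
    if z: "z \<in> space \<nu>" for z v
  proof (cases "v = 0")
    case True
    then show ?thesis using der[OF z] by (simp add: has_derivative_def linear_simps(3))
  next
    case False
    define c where "c = \<delta> / (1 + norm v)"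
    have "1 + norm v > 0" using norm_ge_zero[of v] by linarith
    then have c: "c > 0" using \<delta> by (auto simp: c_def)
    interpret bounded_linear "G' z" using der[OF z] by (rule has_derivative_bounded_linear)
    define h where "h n = (c / Suc n) *\<^sub>R v" for n
    have h: "norm (h n) = c / Suc n * norm v" "h n \<noteq> 0" for n
      using c False by (simp_all add: h_def del: of_nat_Suc)
    have "(\<lambda>n. (c / Suc n) *\<^sub>R v) \<longlonglongrightarrow> 0 *\<^sub>R v"
      by (intro tendsto_scaleR tendsto_const LIMSEQ_Suc lim_const_over_n)
    then have "h \<longlonglongrightarrow> 0" by (simp add: h_def[abs_def])
    then have h0: "filterlim h (at 0) sequentially"
      unfolding filterlim_at using h(2) by simp
    have d0: "((\<lambda>h. norm (G (x + h) z - G x z - G' z h) / norm h) \<longlongrightarrow> 0) (at 0)"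
      using der[OF z] by (simp add: has_derivative_at)
    have "(\<lambda>n. norm (G (x + h n) z - G x z - G' z (h n)) / norm (h n)) \<longlonglongrightarrow> 0"
      using filterlim_compose[OF d0 h0] .
    then have "(\<lambda>n. norm (G (x + h n) z - G x z - G' z (h n)) / norm (h n) * (c * norm v)) \<longlonglongrightarrow> 0"
      by (rule tendsto_mult_left_zero)
    moreover have "norm (G (x + h n) z - G x z - G' z (h n)) / norm (h n) * (c * norm v)
        = norm (of_nat (Suc n) * (G (x + h n) z - G x z) - c *\<^sub>R G' z v)" for n
    proof -
      have "of_nat (Suc n) * (G (x + h n) z - G x z) - c *\<^sub>R G' z v
          = of_nat (Suc n) * (G (x + h n) z - G x z - G' z (h n))"
        unfolding h_def scale using c by (simp add: scaleR_conv_of_real field_simps del: of_nat_Suc)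
      then show ?thesis
        using c False unfolding h(1) by (simp add: norm_mult del: of_nat_Suc)
    qed
    ultimately have "(\<lambda>n. of_nat (Suc n) * (G (x + h n) z - G x z) - c *\<^sub>R G' z v) \<longlonglongrightarrow> 0"
      by (simp add: tendsto_norm_zero_iff)
    then show ?thesis
      by (simp add: LIM_zero_iff h_def c_def)
  qed
  have small: "norm (x + (\<delta> / (1 + norm v) / Suc n) *\<^sub>R v - x) < \<delta>" for v :: 'a and n
  proof -
    have p: "1 + norm v > 0" using norm_ge_zero[of v] by linarith
    have "\<delta> * norm v < \<delta> * ((1 + norm v) * Suc n)"
    proof -
      have "norm v * \<delta> < (1 + norm v) * \<delta>" using \<delta> by (simp add: algebra_simps)
      also have "\<dots> \<le> (1 + norm v) * \<delta> * Suc n" using \<delta> p by (simp add: algebra_simps)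
      finally show ?thesis by (simp add: algebra_simps)
    qed
    then have "\<delta> * norm v / ((1 + norm v) * Suc n) < \<delta>"
      by (subst pos_divide_less_eq) (use p in \<open>simp_all del: of_nat_Suc\<close>)
    moreover have "norm (x + (\<delta> / (1 + norm v) / Suc n) *\<^sub>R v - x) = \<delta> * norm v / ((1 + norm v) * Suc n)"
      using \<delta> p by simp
    ultimately show ?thesis by argo
  qed
  have bdG': "cmod (G' z v) \<le> B z * norm v" if z: "z \<in> space \<nu>" for z v
  proof -
    define c where "c = \<delta> / (1 + norm v)"
    have "1 + norm v > 0" using norm_ge_zero[of v] by linarith
    then have c: "c > 0" using \<delta> by (auto simp: c_def)
    have "cmod (c *\<^sub>R G' z v) \<le> c * (B z * norm v)"
    proof (rule tendsto_upperbound[OF tendsto_norm[OF lim[OF z, of v, folded c_def]]])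
      show "\<forall>\<^sub>F n in sequentially. cmod (of_nat (Suc n) * (G (x + (c / Suc n) *\<^sub>R v) z - G x z)) \<le> c * (B z * norm v)"
      proof (intro always_eventually allI)
        fix n
        have "cmod (G (x + (c / Suc n) *\<^sub>R v) z - G x z) \<le> B z * norm ((c / Suc n) *\<^sub>R v)"
          using bd[OF small[of v n] z] by (simp add: c_def)
        also have "\<dots> = c * (B z * norm v) / Suc n" using c by simp
        finally show "cmod (of_nat (Suc n) * (G (x + (c / Suc n) *\<^sub>R v) z - G x z)) \<le> c * (B z * norm v)"
          unfolding norm_mult norm_of_nat by (simp add: field_simps del: of_nat_Suc)
      qed
    qed simp
    then show ?thesis using c by simp
  qed
  have measG': "(\<lambda>z. G' z v) \<in> borel_measurable \<nu>" for v
  proof -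
    have "\<delta> / (1 + norm v) \<noteq> 0"
      using \<delta> norm_ge_zero[of v] by (metis divide_eq_0_iff add_nonneg_eq_0_iff less_irrefl zero_le_one zero_neq_one)
    moreover have "(\<lambda>z. (\<delta> / (1 + norm v)) *\<^sub>R G' z v) \<in> borel_measurable \<nu>"
      by (rule borel_measurable_LIMSEQ_metric[OF _ lim])
        (intro borel_measurable_times borel_measurable_const borel_measurable_diff
          borel_measurable_integrable int small; use \<delta> in simp)
    then have "(\<lambda>z. (1 / (\<delta> / (1 + norm v))) *\<^sub>R ((\<delta> / (1 + norm v)) *\<^sub>R G' z v)) \<in> borel_measurable \<nu>"
      by measurable
    ultimately show ?thesis by simp
  qed
  have intG': "integrable \<nu> (\<lambda>z. G' z v)" for v
    by (rule Bochner_Integration.integrable_bound[where f = "\<lambda>z. B z * norm v"])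
      (use bdG' B measG' in \<open>auto intro!: AE_I2\<close>)
  have lin: "linear (G' z)" if "z \<in> space \<nu>" for z
    using der[OF that] has_derivative_linear by blast
  have bl: "bounded_linear (\<lambda>v. \<integral>z. G' z v \<partial>\<nu>)"
  proof (rule bounded_linear_intro)
    fix v w :: 'a and r :: real
    have "(\<integral>z. G' z (v + w) \<partial>\<nu>) = (\<integral>z. G' z v + G' z w \<partial>\<nu>)"
      by (intro Bochner_Integration.integral_cong) (auto simp: linear_add[OF lin])
    then show "(\<integral>z. G' z (v + w) \<partial>\<nu>) = (\<integral>z. G' z v \<partial>\<nu>) + (\<integral>z. G' z w \<partial>\<nu>)"
      by (simp add: Bochner_Integration.integral_add[OF intG' intG'])
    have "(\<integral>z. G' z (r *\<^sub>R v) \<partial>\<nu>) = (\<integral>z. r *\<^sub>R G' z v \<partial>\<nu>)"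
      by (intro Bochner_Integration.integral_cong) (auto simp: linear_scale[OF lin])
    then show "(\<integral>z. G' z (r *\<^sub>R v) \<partial>\<nu>) = r *\<^sub>R (\<integral>z. G' z v \<partial>\<nu>)"
      by simp
    have "norm (\<integral>z. G' z v \<partial>\<nu>) \<le> (\<integral>z. B z * norm v \<partial>\<nu>)"
      by (rule order_trans[OF integral_norm_bound Bochner_Integration.integral_mono]) (use intG' B bdG' in auto)
    then show "norm (\<integral>z. G' z v \<partial>\<nu>) \<le> norm v * (\<integral>z. B z \<partial>\<nu>)"
      by (simp add: mult.commute)
  qed
  \<comment> \<open>The remainder quotient is set to 0 off the punctured \<delta>-ball, so that
    \<open>q h\<close> is integrable and at most \<open>2 * B\<close> for every \<open>h\<close>;
    dominated convergence can then run along arbitrary sequences.\<close>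
  define q where "q h z = (if norm h < \<delta> \<and> h \<noteq> 0 then cmod (G (x + h) z - G x z - G' z h) / norm h else 0)" for h z
  have intq: "integrable \<nu> (q h)" for h
  proof (cases "norm h < \<delta> \<and> h \<noteq> 0")
    case True
    then show ?thesis unfolding q_def
      using int[of "x + h"] int[of x] \<delta> intG'[of h] by simp
  next
    case False
    then have "q h = (\<lambda>_. 0)" by (auto simp: q_def)
    then show ?thesis by simp
  qed
  have qbd: "norm (q h z) \<le> 2 * B z" if "z \<in> space \<nu>" for h z
  proof (cases "norm h < \<delta> \<and> h \<noteq> 0")
    case True
    have "cmod (G (x + h) z - G x z - G' z h) \<le> cmod (G (x + h) z - G x z) + cmod (G' z h)"
      by (rule norm_triangle_ineq4)
    also have "\<dots> \<le> B z * norm h + B z * norm h"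
      using bd[of "x + h" z] bdG'[of z h] True that by (intro add_mono) auto
    finally show ?thesis using True by (simp add: q_def field_simps)
  qed (use B in \<open>auto simp: q_def\<close>)
  have qlim: "((\<lambda>h. q h z) \<longlongrightarrow> 0) (at 0)" if "z \<in> space \<nu>" for z
  proof -
    have "((\<lambda>h. norm (G (x + h) z - G x z - G' z h) / norm h) \<longlongrightarrow> 0) (at 0)"
      using der[OF that] by (simp add: has_derivative_at)
    moreover have "\<forall>\<^sub>F h in at 0. norm (G (x + h) z - G x z - G' z h) / norm h = q h z"
      unfolding eventually_at using \<delta> by (intro exI[of _ \<delta>]) (auto simp: q_def)
    ultimately show ?thesis by (rule tendsto_cong[THEN iffD1, rotated])
  qed
  have "((\<lambda>h. \<integral>z. q h z \<partial>\<nu>) \<longlongrightarrow> 0) (at 0)"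
    unfolding tendsto_at_iff_sequentially o_def
  proof (intro allI impI)
    fix X :: "nat \<Rightarrow> 'a" assume X: "\<forall>i. X i \<in> UNIV - {0}" "X \<longlonglongrightarrow> 0"
    have "(\<lambda>n. \<integral>z. q (X n) z \<partial>\<nu>) \<longlonglongrightarrow> (\<integral>z. 0 \<partial>\<nu>)"
    proof (rule integral_dominated_convergence[where w = "\<lambda>z. 2 * B z"])
      show "AE z in \<nu>. (\<lambda>i. q (X i) z) \<longlonglongrightarrow> 0"
        using qlim X by (intro AE_I2) (auto simp: tendsto_at_iff_sequentially o_def)
    qed (use intq qbd B in auto)
    then show "(\<lambda>n. \<integral>z. q (X n) z \<partial>\<nu>) \<longlonglongrightarrow> 0" by simp
  qed
  then have "((\<lambda>h. norm ((\<integral>z. G (x + h) z \<partial>\<nu>) - (\<integral>z. G x z \<partial>\<nu>) - (\<integral>z. G' z h \<partial>\<nu>)) / norm h) \<longlongrightarrow> 0) (at 0)"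
  proof (rule Lim_null_comparison[rotated])
    show "\<forall>\<^sub>F h in at 0. norm (norm ((\<integral>z. G (x + h) z \<partial>\<nu>) - (\<integral>z. G x z \<partial>\<nu>) - (\<integral>z. G' z h \<partial>\<nu>)) / norm h) \<le> (\<integral>z. q h z \<partial>\<nu>)"
      unfolding eventually_at
    proof (intro exI[of _ \<delta>] conjI ballI impI \<delta>)
      fix h :: 'a assume h: "h \<noteq> 0 \<and> dist h 0 < \<delta>"
      have i1: "integrable \<nu> (G (x + h))" using h by (intro int) auto
      have i2: "integrable \<nu> (G x)" using \<delta> by (intro int) auto
      have "(\<integral>z. G (x + h) z \<partial>\<nu>) - (\<integral>z. G x z \<partial>\<nu>) - (\<integral>z. G' z h \<partial>\<nu>) = (\<integral>z. G (x + h) z - G x z - G' z h \<partial>\<nu>)"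
        using i1 i2 intG'[of h] by simp
      then have "norm ((\<integral>z. G (x + h) z \<partial>\<nu>) - (\<integral>z. G x z \<partial>\<nu>) - (\<integral>z. G' z h \<partial>\<nu>)) / norm h
        \<le> (\<integral>z. norm (G (x + h) z - G x z - G' z h) \<partial>\<nu>) / norm h"
        by (simp add: divide_right_mono integral_norm_bound)
      also have "\<dots> = (\<integral>z. q h z \<partial>\<nu>)" using h by (simp add: q_def)
      finally show "norm (norm ((\<integral>z. G (x + h) z \<partial>\<nu>) - (\<integral>z. G x z \<partial>\<nu>) - (\<integral>z. G' z h \<partial>\<nu>)) / norm h) \<le> (\<integral>z. q h z \<partial>\<nu>)"
        by simp
    qed
  qed
  then show ?thesis using bl by (simp add: has_derivative_at)
qed

text \<open>A superposition of translates of \<open>\<psi>\<close>; translations commute with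
  derivatives, hence so does \<open>avg\<close>. The space carrying \<open>\<nu>\<close> stays
  abstract because the kernels will live on pairs (r, y) rather than on displacements.\<close>

definition avg :: "'z measure \<Rightarrow> ('z \<Rightarrow> real^'d) \<Rightarrow> (real^'d \<Rightarrow> complex) \<Rightarrow> real^'d \<Rightarrow> complex" where
  "avg \<nu> \<tau> \<psi> x = (\<integral>z. \<psi> (x + \<tau> z) \<partial>\<nu>)"

lemma test_function_borel: "test_function f \<Longrightarrow> f \<in> borel_measurable borel"
  by (intro smooth_borel_measurable test_function_smooth)

lemma integrable_avg:
  assumes "finite_measure \<nu>" "\<tau> \<in> borel_measurable \<nu>" "test_function \<psi>"
  shows "integrable \<nu> (\<lambda>z. \<psi> (x + \<tau> z))"
proof -
  interpret finite_measure \<nu> by fact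
  obtain B where B: "\<And>x. cmod (\<psi> x) \<le> B" using assms(3) test_function_bounded by blast
  have [measurable]: "\<psi> \<in> borel_measurable borel" "\<tau> \<in> borel_measurable \<nu>"
    using assms test_function_borel by auto
  show ?thesis
    by (rule integrable_const_bound[where B = B]) (use B in \<open>auto intro!: AE_I2\<close>)
qed

lemma avg_has_derivative:
  assumes "finite_measure \<nu>" "\<tau> \<in> borel_measurable \<nu>" "test_function \<psi>"
  shows "(avg \<nu> \<tau> \<psi> has_derivative (\<lambda>v. \<integral>z. frechet_derivative \<psi> (at (x + \<tau> z)) v \<partial>\<nu>)) (at x)"
proof -
  interpret finite_measure \<nu> by fact
  obtain B where B: "B \<ge> 0" "\<And>x y. cmod (\<psi> y - \<psi> x) \<le> B * norm (y - x)"
    using assms(3) test_function_lipschitz by blast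
  show ?thesis
    unfolding avg_def[abs_def]
  proof (rule has_derivative_integral_dominated[where \<delta> = 1 and B = "\<lambda>_. B"])
    fix z
    have "((\<lambda>y. y + \<tau> z) has_derivative (\<lambda>v. v)) (at x)"
      by (auto intro!: derivative_eq_intros)
    from has_derivative_compose[OF this smooth_has_derivative[OF test_function_smooth[OF assms(3)]]]
    show "((\<lambda>y. \<psi> (y + \<tau> z)) has_derivative frechet_derivative \<psi> (at (x + \<tau> z))) (at x)" .
  next
    fix y z show "cmod (\<psi> (y + \<tau> z) - \<psi> (x + \<tau> z)) \<le> B * norm (y - x)"
      using B(2)[of "y + \<tau> z" "x + \<tau> z"] by simp
  qed (use B(1) integrable_avg[OF assms] in auto)
qed

lemma partial_avg:
  assumes "finite_measure \<nu>" "\<tau> \<in> borel_measurable \<nu>" "test_function \<psi>"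
  shows "partial i (avg \<nu> \<tau> \<psi>) = avg \<nu> \<tau> (partial i \<psi>)"
  by (rule ext, subst partial_eq[OF avg_has_derivative[OF assms]]) (simp add: avg_def partial_def)

lemma smooth_avg:
  assumes "finite_measure \<nu>" "\<tau> \<in> borel_measurable \<nu>" "test_function \<psi>"
  shows "smooth (avg \<nu> \<tau> \<psi>)"
proof (rule smooth_coinduct[where X = "\<lambda>h. \<exists>\<psi>. test_function \<psi> \<and> h = avg \<nu> \<tau> \<psi>"])
  show "\<exists>\<psi>'. test_function \<psi>' \<and> avg \<nu> \<tau> \<psi> = avg \<nu> \<tau> \<psi>'" using assms by blast
next
  fix h assume "\<exists>\<psi>. test_function \<psi> \<and> h = avg \<nu> \<tau> \<psi>"
  then show "h differentiable_on UNIV"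
    using avg_has_derivative[OF assms(1,2)] unfolding differentiable_on_def differentiable_def by auto
next
  fix h i assume "\<exists>\<psi>. test_function \<psi> \<and> h = avg \<nu> \<tau> \<psi>"
  then show "\<exists>\<psi>. test_function \<psi> \<and> partial i h = avg \<nu> \<tau> \<psi>"
    using partial_avg[OF assms(1,2)] test_function_partial by blast
qed

lemma test_function_avg:
  assumes "finite_measure \<nu>" "\<tau> \<in> borel_measurable \<nu>" "test_function \<psi>" "AE z in \<nu>. norm (\<tau> z) \<le> T"
  shows "test_function (avg \<nu> \<tau> \<psi>)"
proof -
  obtain R where R: "\<And>x. norm x > R \<Longrightarrow> \<psi> x = 0" using assms(3) test_function_support by blast
  have "avg \<nu> \<tau> \<psi> x = 0" if "norm x > R + T" for x
  proof -
    have "AE z in \<nu>. \<psi> (x + \<tau> z) = 0"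
      using assms(4)
    proof eventually_elim
      case (elim z)
      have "norm x \<le> norm (x + \<tau> z) + norm (\<tau> z)" using norm_triangle_ineq4[of "x + \<tau> z" "\<tau> z"] by simp
      then show ?case using elim that by (intro R) simp
    qed
    then show ?thesis unfolding avg_def by (rule integral_eq_zero_AE)
  qed
  then show ?thesis using smooth_avg[OF assms(1-3)] by (rule test_functionI[rotated])
qed

lemma classical_laplacian_avg:
  assumes "finite_measure \<nu>" "\<tau> \<in> borel_measurable \<nu>" "test_function \<psi>"
  shows "classical_laplacian (avg \<nu> \<tau> \<psi>) = avg \<nu> \<tau> (classical_laplacian \<psi>)"
proof
  fix x
  have "classical_laplacian (avg \<nu> \<tau> \<psi>) x = (\<Sum>i\<in>UNIV. avg \<nu> \<tau> (partial i (partial i \<psi>)) x)"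
    using assms by (simp add: classical_laplacian_def partial_avg test_function_partial)
  also have "\<dots> = avg \<nu> \<tau> (classical_laplacian \<psi>) x"
    unfolding avg_def classical_laplacian_def
    by (intro Bochner_Integration.integral_sum[symmetric] integrable_avg assms test_function_partial)
  finally show "classical_laplacian (avg \<nu> \<tau> \<psi>) x = avg \<nu> \<tau> (classical_laplacian \<psi>) x" .
qed

section \<open>Translation invariance and integration by parts\<close>

lemma integral_lborel_translate:
  fixes f :: "'a::euclidean_space \<Rightarrow> 'b::{banach,second_countable_topology}"
  assumes [measurable]: "f \<in> borel_measurable borel"
  shows "(\<integral>x. f (x + c) \<partial>lborel) = (\<integral>x. f x \<partial>lborel)"
proof -
  have "(\<integral>x. f x \<partial>lborel) = (\<integral>x. f x \<partial>distr lborel borel ((+) c))" by (simp add: lborel_distr_plus)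
  also have "\<dots> = (\<integral>x. f (c + x) \<partial>lborel)" by (rule integral_distr) auto
  finally show ?thesis by (simp add: add.commute)
qed

text \<open>Differentiate the constant function \<open>s \<mapsto> \<integral> f (x + s e\<^sub>i) dx\<close>.\<close>

lemma integral_partial_zero:
  fixes f :: "real^'d \<Rightarrow> complex"
  assumes diff: "\<And>x. f differentiable (at x)"
    and cont: "continuous_on UNIV (partial i f)"
    and supp: "\<And>x. norm x > R \<Longrightarrow> f x = 0"
  shows "(\<integral>x. partial i f x \<partial>lborel) = 0"
proof -
  define e :: "real^'d" where "e = axis i 1"
  have e1: "norm e = 1" by (simp add: e_def norm_axis_1)
  have fc: "continuous_on UNIV f"
    by (intro continuous_at_imp_continuous_on ballI differentiable_imp_continuous_within diff)
  then have [measurable]: "f \<in> borel_measurable borel" by (rule borel_measurable_continuous_onI)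
  have pz: "partial i f x = 0" if "norm x > R" for x
    using partial_zero[of R f x i] supp that by blast
  obtain B where B: "B \<ge> 0" "\<And>x. cmod (partial i f x) \<le> B"
    using bounded_support_bounded[OF cont pz] by metis
  have der: "((\<lambda>s. f (z + s *\<^sub>R e)) has_derivative (\<lambda>v. v *\<^sub>R partial i f (z + s *\<^sub>R e))) (at s)" for z s
  proof -
    have "((\<lambda>s. z + s *\<^sub>R e) has_derivative (\<lambda>s. s *\<^sub>R e)) (at s)"
      by (auto intro!: derivative_eq_intros)
    from has_derivative_compose[OF this diff[unfolded frechet_derivative_works]]
    show ?thesis
      using linear_scale[OF linear_frechet_derivative[OF diff]] by (simp add: partial_def e_def)
  qed
  have lip: "cmod (f (z + s *\<^sub>R e) - f z) \<le> B * \<bar>s\<bar>" for z s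
  proof -
    have "cmod (f (z + s *\<^sub>R e) - f (z + 0 *\<^sub>R e)) \<le> B * norm (s - 0)"
      by (rule differentiable_bound[where S = UNIV, OF _ der])
        (use B in \<open>auto intro!: onorm_le mult_left_mono simp: mult.commute[of B]\<close>)
    then show ?thesis by simp
  qed
  have int: "integrable lborel (\<lambda>z. f (z + s *\<^sub>R e))" for s
  proof (rule bounded_support_integrable[where R = "R + \<bar>s\<bar>"])
    show "continuous_on UNIV (\<lambda>z. f (z + s *\<^sub>R e))"
      by (intro continuous_on_compose2[OF fc] continuous_intros) auto
    show "f (x + s *\<^sub>R e) = 0" if "R + \<bar>s\<bar> < norm x" for x
    proof (rule supp)
      have "norm x \<le> norm (x + s *\<^sub>R e) + norm (s *\<^sub>R e)"
        using norm_triangle_ineq4[of "x + s *\<^sub>R e" "s *\<^sub>R e"] by simp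
      then show "R < norm (x + s *\<^sub>R e)" using that e1 by simp
    qed
  qed
  have "((\<lambda>s::real. \<integral>z. f (z + s *\<^sub>R e) \<partial>lborel) has_derivative (\<lambda>v. \<integral>z. v *\<^sub>R partial i f (z + 0 *\<^sub>R e) \<partial>lborel)) (at 0)"
  \<comment> \<open>For |s| < 1 both \<open>f (z + s *\<^sub>R e)\<close> and \<open>f z\<close>
    vanish off the ball of radius \<open>R + 1\<close>, which makes the Lipschitz bound
    integrable.\<close>
  proof (rule has_derivative_integral_dominated[where \<delta> = 1 and B = "\<lambda>z. B * indicator (cball 0 (R + 1)) z"])
    fix s :: real and z :: "real^'d" assume s: "norm (s - 0) < 1"
    have "f (z + s *\<^sub>R e) = 0 \<and> f z = 0" if "norm z > R + 1"
    proof -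
      have "norm z \<le> norm (z + s *\<^sub>R e) + norm (s *\<^sub>R e)"
        using norm_triangle_ineq4[of "z + s *\<^sub>R e" "s *\<^sub>R e"] by simp
      then show ?thesis using s that e1 by (auto intro!: supp)
    qed
    then show "cmod (f (z + s *\<^sub>R e) - f (z + 0 *\<^sub>R e)) \<le> B * indicator (cball 0 (R + 1)) z * norm (s - 0)"
      using lip[of z s] by (auto simp: indicator_def)
  next
    show "((\<lambda>s. f (z + s *\<^sub>R e)) has_derivative (\<lambda>v. v *\<^sub>R partial i f (z + 0 *\<^sub>R e))) (at 0)" for z
      by (rule der)
    show "integrable lborel (\<lambda>z::real^'d. B * indicator (cball 0 (R + 1)) z :: real)"
      by (intro integrable_mult_right integrable_real_indicator)
        (use emeasure_lborel_cball_finite[of "0 :: real^'d" "R + 1"] in \<open>auto simp: less_top\<close>)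
  qed (use int B in auto)
  moreover have "(\<lambda>s::real. \<integral>z. f (z + s *\<^sub>R e) \<partial>lborel) = (\<lambda>s. \<integral>z. f z \<partial>lborel)"
    by (simp add: integral_lborel_translate)
  ultimately have "(\<lambda>v. \<integral>z. v *\<^sub>R partial i f (z + 0 *\<^sub>R e) \<partial>lborel) = (\<lambda>_. 0)"
    using has_derivative_unique[OF _ has_derivative_const] by metis
  from fun_cong[OF this, of 1] show ?thesis by simp
qed

text \<open>The regularity is kept low, and the bounded support is placed on \<open>g\<close>,
  because besides test functions \<open>g\<close> will be \<open>sq_cap\<close>, which is C^1 but
  not smooth.\<close>

lemma integral_by_parts:
  fixes f g :: "real^'d \<Rightarrow> complex"
  assumes f: "\<And>x. f differentiable (at x)" "continuous_on UNIV (partial i f)"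
    and g: "\<And>x. g differentiable (at x)" "continuous_on UNIV (partial i g)"
    and supp: "\<And>x. norm x > R \<Longrightarrow> g x = 0"
  shows "(\<integral>x. partial i f x * g x \<partial>lborel) = - (\<integral>x. f x * partial i g x \<partial>lborel)"
proof -
  have c: "continuous_on UNIV f" "continuous_on UNIV g"
    by (intro continuous_at_imp_continuous_on ballI differentiable_imp_continuous_within f g)+
  have p: "partial i (\<lambda>x. f x * g x) = (\<lambda>x. f x * partial i g x + partial i f x * g x)"
    using f g by (auto simp: partial_mult)
  have "(\<integral>x. partial i (\<lambda>x. f x * g x) x \<partial>lborel) = 0"
    by (rule integral_partial_zero[where R = R])
      (use f g supp c in \<open>auto simp: p intro!: continuous_intros differentiable_mult\<close>)
  moreover have "integrable lborel (\<lambda>x. f x * partial i g x)" "integrable lborel (\<lambda>x. partial i f x * g x)"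
    by (rule bounded_support_integrable[where R = R];
        use f g supp c in \<open>auto simp: partial_zero[OF supp] intro!: continuous_intros\<close>)+
  ultimately show ?thesis
    unfolding p by (simp add: add_eq_0_iff)
qed

lemma test_function_by_parts:
  assumes "smooth f" "test_function g"
  shows "(\<integral>x. partial i f x * g x \<partial>lborel) = - (\<integral>x. f x * partial i g x \<partial>lborel)"
proof -
  obtain R where "\<And>x. norm x > R \<Longrightarrow> g x = 0" using assms test_function_support by blast
  then show ?thesis
    using assms
    by (intro integral_by_parts) (auto intro: smooth_differentiable smooth_continuous_on smooth_partial test_function_smooth)
qed

lemma integral_laplacian:
  assumes "test_function f" "test_function g"
  shows "(\<integral>x. classical_laplacian f x * g x \<partial>lborel) = - (\<Sum>i\<in>UNIV. \<integral>x. partial i f x * partial i g x \<partial>lborel)"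
proof -
  have "(\<integral>x. classical_laplacian f x * g x \<partial>lborel) = (\<Sum>i\<in>UNIV. \<integral>x. partial i (partial i f) x * g x \<partial>lborel)"
    unfolding classical_laplacian_def sum_distrib_right using assms
    by (intro Bochner_Integration.integral_sum test_function_integrable test_function_mult)
      (auto intro!: smooth_partial test_function_smooth test_function_partial)
  then show ?thesis
    using assms by (simp add: test_function_by_parts smooth_partial test_function_smooth sum_negf)
qed

lemma laplacian_symmetric:
  assumes "test_function f" "test_function g"
  shows "(\<integral>x. classical_laplacian f x * g x \<partial>lborel) = (\<integral>x. f x * classical_laplacian g x \<partial>lborel)"
proof -
  have "(\<integral>x. f x * classical_laplacian g x \<partial>lborel) = (\<integral>x. classical_laplacian g x * f x \<partial>lborel)"
    by (simp add: mult.commute)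
  also have "\<dots> = - (\<Sum>i\<in>UNIV. \<integral>x. partial i f x * partial i g x \<partial>lborel)"
    by (subst integral_laplacian) (use assms in \<open>simp_all add: mult.commute\<close>)
  finally show ?thesis using integral_laplacian[OF assms] by simp
qed

text \<open>Integration by parts turns the integral into minus the Dirichlet energy.\<close>

lemma laplacian_nonpos:
  assumes "test_function f"
  shows "Re (\<integral>x. classical_laplacian f x * cnj (f x) \<partial>lborel) \<le> 0"
proof -
  have "partial i (\<lambda>x. cnj (f x)) = (\<lambda>x. cnj (partial i f x))" for i
    using assms by (auto simp: partial_cnj smooth_differentiable test_function_smooth)
  then have "(\<integral>x. classical_laplacian f x * cnj (f x) \<partial>lborel) = - (\<Sum>i\<in>UNIV. \<integral>x. complex_of_real ((cmod (partial i f x))\<^sup>2) \<partial>lborel)"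
    by (subst integral_laplacian)
      (use assms in \<open>simp_all add: test_function_cnj complex_norm_square flip: of_real_power\<close>)
  also have "\<dots> = complex_of_real (- (\<Sum>i\<in>UNIV. \<integral>x. (cmod (partial i f x))\<^sup>2 \<partial>lborel))"
    by (simp only: integral_complex_of_real of_real_sum of_real_minus)
  finally have "Re (\<integral>x. classical_laplacian f x * cnj (f x) \<partial>lborel) = - (\<Sum>i\<in>UNIV. \<integral>x. (cmod (partial i f x))\<^sup>2 \<partial>lborel)"
    by (simp only: Re_complex_of_real)
  then show ?thesis by (simp add: sum_nonneg)
qed

section \<open>The space \<open>L\<^sup>2\<close>\<close>

lemma L2_borel: "f \<in> L2 \<Longrightarrow> f \<in> borel_measurable borel"
  by (simp add: L2_def)

lemma L2_integrable: "f \<in> L2 \<Longrightarrow> integrable lborel (\<lambda>x. (cmod (f x))\<^sup>2)"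
  by (simp add: L2_def)

lemma L2_norm_nonneg: "L2_norm f \<ge> 0"
  by (simp add: L2_norm_def)

lemma L2_norm_square: "(L2_norm f)\<^sup>2 = (\<integral>x. (cmod (f x))\<^sup>2 \<partial>lborel)"
  by (simp add: L2_norm_def)

lemma L2_norm_AE_cong:
  assumes "f \<in> borel_measurable borel" "g \<in> borel_measurable borel" "AE x in lborel. f x = g x"
  shows "L2_norm f = L2_norm g"
proof -
  have "(\<integral>x. (cmod (f x))\<^sup>2 \<partial>lborel) = (\<integral>x. (cmod (g x))\<^sup>2 \<partial>lborel)"
    by (rule integral_cong_AE) (use assms in auto)
  then show ?thesis by (simp add: L2_norm_def)
qed

lemma L2_bound:
  assumes "f \<in> L2" "g \<in> borel_measurable borel" "AE x in lborel. cmod (g x) \<le> c * cmod (f x)" "c \<ge> 0"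
  shows "g \<in> L2" "L2_norm g \<le> c * L2_norm f"
proof -
  have *: "AE x in lborel. (cmod (g x))\<^sup>2 \<le> c\<^sup>2 * (cmod (f x))\<^sup>2"
    using assms(3) by eventually_elim (metis norm_ge_zero power_mono power_mult_distrib)
  have fi: "integrable lborel (\<lambda>x. c\<^sup>2 * (cmod (f x))\<^sup>2)"
    using L2_integrable[OF assms(1)] by simp
  have gi: "integrable lborel (\<lambda>x. (cmod (g x))\<^sup>2)"
    by (rule Bochner_Integration.integrable_bound[OF fi])
      (use assms(2) * in \<open>auto elim!: eventually_mono\<close>)
  then show "g \<in> L2" using assms(2) by (simp add: L2_def)
  have "(\<integral>x. (cmod (g x))\<^sup>2 \<partial>lborel) \<le> (\<integral>x. c\<^sup>2 * (cmod (f x))\<^sup>2 \<partial>lborel)"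
    by (rule integral_mono_AE[OF gi fi *])
  then have "(L2_norm g)\<^sup>2 \<le> (c * L2_norm f)\<^sup>2"
    by (simp add: L2_norm_square power_mult_distrib)
  then show "L2_norm g \<le> c * L2_norm f"
    using assms(4) L2_norm_nonneg power2_le_imp_le by (metis mult_nonneg_nonneg)
qed

lemma L2_cmult:
  assumes "f \<in> L2"
  shows "(\<lambda>x. c * f x) \<in> L2" "L2_norm (\<lambda>x. c * f x) = cmod c * L2_norm f"
proof -
  show "(\<lambda>x. c * f x) \<in> L2"
    using assms by (auto simp: L2_def norm_mult power_mult_distrib)
  show "L2_norm (\<lambda>x. c * f x) = cmod c * L2_norm f"
    by (simp add: L2_norm_def norm_mult power_mult_distrib real_sqrt_mult)
qed

lemma L2_cnj: "f \<in> L2 \<Longrightarrow> (\<lambda>x. cnj (f x)) \<in> L2" "L2_norm (\<lambda>x. cnj (f x)) = L2_norm f"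
proof -
  assume "f \<in> L2"
  then have [measurable]: "f \<in> borel_measurable borel" and "integrable lborel (\<lambda>x. (cmod (f x))\<^sup>2)"
    by (auto simp: L2_def)
  moreover have "(\<lambda>x. cnj (f x)) \<in> borel_measurable borel"
    using measurable_compose[OF \<open>f \<in> borel_measurable borel\<close> borel_measurable_continuous_onI[OF continuous_on_cnj[OF continuous_on_id]]] .
  ultimately show "(\<lambda>x. cnj (f x)) \<in> L2" by (simp add: L2_def)
qed (simp add: L2_norm_def)

lemma L2_add:
  assumes "f \<in> L2" "g \<in> L2"
  shows "(\<lambda>x. f x + g x) \<in> L2"
proof -
  have [measurable]: "f \<in> borel_measurable borel" "g \<in> borel_measurable borel"
    using assms by (auto simp: L2_def)
  have i: "integrable lborel (\<lambda>x. 2 * (cmod (f x))\<^sup>2 + 2 * (cmod (g x))\<^sup>2)"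
    using assms by (auto simp: L2_def)
  have "integrable lborel (\<lambda>x. (cmod (f x + g x))\<^sup>2)"
  proof (rule Bochner_Integration.integrable_bound[OF i])
    have "(cmod (f x + g x))\<^sup>2 \<le> 2 * (cmod (f x))\<^sup>2 + 2 * (cmod (g x))\<^sup>2" for x
    proof -
      have "(cmod (f x + g x))\<^sup>2 \<le> (cmod (f x) + cmod (g x))\<^sup>2"
        by (intro power_mono norm_triangle_ineq) auto
      also have "\<dots> \<le> 2 * (cmod (f x))\<^sup>2 + 2 * (cmod (g x))\<^sup>2"
        using sum_squares_bound[of "cmod (f x)" "cmod (g x)"] by (simp add: power2_sum)
      finally show ?thesis .
    qed
    then show "AE x in lborel. norm ((cmod (f x + g x))\<^sup>2) \<le> norm (2 * (cmod (f x))\<^sup>2 + 2 * (cmod (g x))\<^sup>2)"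
      by (auto intro!: AE_I2)
  qed auto
  then show ?thesis by (simp add: L2_def)
qed

lemma L2_diff:
  assumes "f \<in> L2" "g \<in> L2"
  shows "(\<lambda>x. f x - g x) \<in> L2"
  using L2_add[OF assms(1) L2_cmult(1)[OF assms(2), of "-1"]] by simp

lemma L2_mult_integrable:
  assumes "f \<in> L2" "g \<in> L2"
  shows "integrable lborel (\<lambda>x. f x * g x)"
proof -
  have [measurable]: "f \<in> borel_measurable borel" "g \<in> borel_measurable borel"
    using assms by (auto simp: L2_def)
  have i: "integrable lborel (\<lambda>x. (cmod (f x))\<^sup>2 + (cmod (g x))\<^sup>2)"
    using assms by (auto simp: L2_def)
  show ?thesis
  proof (rule Bochner_Integration.integrable_bound[OF i])
    have "cmod (f x) * cmod (g x) \<le> (cmod (f x))\<^sup>2 + (cmod (g x))\<^sup>2" for x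
      using sum_squares_bound[of "cmod (f x)" "cmod (g x)"] mult_nonneg_nonneg[of "cmod (f x)" "cmod (g x)"]
        norm_ge_zero[of "f x"] norm_ge_zero[of "g x"] by linarith
    then show "AE x in lborel. cmod (f x * g x) \<le> norm ((cmod (f x))\<^sup>2 + (cmod (g x))\<^sup>2)"
      by (auto intro!: AE_I2 simp: norm_mult)
  qed auto
qed

text \<open>Integrate 2 |f| |g| <= t |f|^2 + |g|^2 / t and optimise over t.\<close>

lemma L2_cauchy_schwarz_abs:
  assumes "f \<in> L2" "g \<in> L2"
  shows "(\<integral>x. cmod (f x) * cmod (g x) \<partial>lborel) \<le> L2_norm f * L2_norm g"
proof -
  have I: "integrable lborel (\<lambda>x. cmod (f x) * cmod (g x))"
    using integrable_norm[OF L2_mult_integrable[OF assms]] by (simp add: norm_mult)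
  define a b where "a = L2_norm f" and "b = L2_norm g"
  define c where "c = (\<integral>x. cmod (f x) * cmod (g x) \<partial>lborel)"
  have main: "2 * c \<le> t * a\<^sup>2 + b\<^sup>2 / t" if t: "t > 0" for t
  proof -
    have "2 * (cmod (f x) * cmod (g x)) \<le> t * (cmod (f x))\<^sup>2 + (cmod (g x))\<^sup>2 / t" for x
    proof -
      have "2 * (sqrt t * cmod (f x)) * (cmod (g x) / sqrt t) \<le> (sqrt t * cmod (f x))\<^sup>2 + (cmod (g x) / sqrt t)\<^sup>2"
        by (rule sum_squares_bound)
      then show ?thesis using t by (simp add: power_mult_distrib power_divide)
    qed
    then have "(\<integral>x. 2 * (cmod (f x) * cmod (g x)) \<partial>lborel) \<le> (\<integral>x. t * (cmod (f x))\<^sup>2 + (cmod (g x))\<^sup>2 / t \<partial>lborel)"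
      using I assms by (intro Bochner_Integration.integral_mono) (auto simp: L2_def)
    then show ?thesis
      using assms by (simp add: a_def b_def c_def L2_norm_square L2_integrable)
  qed
  have ab: "a \<ge> 0" "b \<ge> 0" by (simp_all add: a_def b_def L2_norm_nonneg)
  \<comment> \<open>The optimal t = b / a is perturbed to
    \<open>(b + \<epsilon>) / (a + \<epsilon>)\<close>, so that vanishing norms need no separate
    treatment.\<close>
  have "c \<le> a * b + \<epsilon> * (a + b)" if e: "\<epsilon> > 0" for \<epsilon>
  proof -
    have p: "a + \<epsilon> > 0" "b + \<epsilon> > 0" using ab e by auto
    have "2 * c \<le> (b + \<epsilon>) / (a + \<epsilon>) * a\<^sup>2 + b\<^sup>2 / ((b + \<epsilon>) / (a + \<epsilon>))"
      using p by (intro main) auto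
    moreover have "(b + \<epsilon>) / (a + \<epsilon>) * a\<^sup>2 \<le> (b + \<epsilon>) * a"
      using ab p e by (simp add: power2_eq_square divide_simps mult_left_mono mult_right_mono)
    moreover have "b\<^sup>2 / ((b + \<epsilon>) / (a + \<epsilon>)) \<le> (a + \<epsilon>) * b"
    proof -
      have "b * b * (a + \<epsilon>) \<le> b * (b + \<epsilon>) * (a + \<epsilon>)"
        using ab p e by (intro mult_right_mono mult_left_mono) auto
      then show ?thesis using p by (simp add: power2_eq_square pos_divide_le_eq mult_ac)
    qed
    ultimately have "2 * c \<le> (b + \<epsilon>) * a + (a + \<epsilon>) * b" by linarith
    also have "\<dots> = 2 * (a * b + \<epsilon> * (a + b) / 2)" by (simp add: algebra_simps)
    finally have "c \<le> a * b + \<epsilon> * (a + b) / 2" by simp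
    also have "\<epsilon> * (a + b) / 2 \<le> \<epsilon> * (a + b)" using ab e by simp
    finally show ?thesis by simp
  qed
  then have *: "c \<le> a * b + e" if "e > 0" for e
  proof -
    have "c \<le> a * b + e / (a + b + 1) * (a + b)"
      using ab that by (intro \<open>\<And>\<epsilon>. \<epsilon> > 0 \<Longrightarrow> c \<le> a * b + \<epsilon> * (a + b)\<close> divide_pos_pos) auto
    also have "e / (a + b + 1) * (a + b) \<le> e"
      using ab that by (simp add: divide_simps mult_left_mono)
    finally show ?thesis by simp
  qed
  show ?thesis using field_le_epsilon[OF *] by (simp add: a_def b_def c_def)
qed

lemma L2_cauchy_schwarz:
  assumes "f \<in> L2" "g \<in> L2"
  shows "cmod (\<integral>x. f x * g x \<partial>lborel) \<le> L2_norm f * L2_norm g"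
  using order_trans[OF integral_norm_bound[of lborel "\<lambda>x. f x * g x", unfolded norm_mult] L2_cauchy_schwarz_abs[OF assms]] .

lemma L2_norm_add_square:
  assumes "f \<in> L2" "g \<in> L2"
  shows "(L2_norm (\<lambda>x. f x + g x))\<^sup>2 = (L2_norm f)\<^sup>2 + (L2_norm g)\<^sup>2 + 2 * Re (\<integral>x. f x * cnj (g x) \<partial>lborel)"
proof -
  have i: "integrable lborel (\<lambda>x. f x * cnj (g x))"
    using L2_mult_integrable[OF assms(1) L2_cnj(1)[OF assms(2)]] .
  have "(cmod (f x + g x))\<^sup>2 = (cmod (f x))\<^sup>2 + (cmod (g x))\<^sup>2 + 2 * Re (f x * cnj (g x))" for x
    unfolding cmod_power2 by (simp add: power2_eq_square algebra_simps)
  then have "(L2_norm (\<lambda>x. f x + g x))\<^sup>2 = (\<integral>x. (cmod (f x))\<^sup>2 + (cmod (g x))\<^sup>2 + 2 * Re (f x * cnj (g x)) \<partial>lborel)"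
    by (simp add: L2_norm_square)
  also have "\<dots> = (\<integral>x. (cmod (f x))\<^sup>2 \<partial>lborel) + (\<integral>x. (cmod (g x))\<^sup>2 \<partial>lborel) + 2 * (\<integral>x. Re (f x * cnj (g x)) \<partial>lborel)"
    using Bochner_Integration.integral_add[OF Bochner_Integration.integrable_add[OF L2_integrable[OF assms(1)] L2_integrable[OF assms(2)]]
        integrable_mult_right[OF integrable_Re[OF i], of 2]]
      Bochner_Integration.integral_add[OF L2_integrable[OF assms(1)] L2_integrable[OF assms(2)]]
    by (simp only: integral_mult_right_zero)
  also have "(\<integral>x. Re (f x * cnj (g x)) \<partial>lborel) = Re (\<integral>x. f x * cnj (g x) \<partial>lborel)"
    by (rule integral_Re[OF i])
  finally show ?thesis by (simp add: L2_norm_square)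
qed

lemma L2_norm_triangle:
  assumes "f \<in> L2" "g \<in> L2"
  shows "L2_norm (\<lambda>x. f x + g x) \<le> L2_norm f + L2_norm g"
proof (rule power2_le_imp_le)
  have "Re (\<integral>x. f x * cnj (g x) \<partial>lborel) \<le> L2_norm f * L2_norm g"
    using order_trans[OF complex_Re_le_cmod L2_cauchy_schwarz[OF assms(1) L2_cnj(1)[OF assms(2)]]]
    by (simp add: L2_cnj(2))
  then show "(L2_norm (\<lambda>x. f x + g x))\<^sup>2 \<le> (L2_norm f + L2_norm g)\<^sup>2"
    unfolding L2_norm_add_square[OF assms] by (simp add: power2_sum)
qed (simp add: L2_norm_nonneg)

lemma L2_norm_minus_commute: "L2_norm (\<lambda>x. f x - g x) = L2_norm (\<lambda>x. g x - f x)"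
  by (simp add: L2_norm_def norm_minus_commute)

lemma L2_norm_triangle_diff:
  assumes "f \<in> L2" "g \<in> L2" "h \<in> L2"
  shows "L2_norm (\<lambda>x. f x - h x) \<le> L2_norm (\<lambda>x. f x - g x) + L2_norm (\<lambda>x. g x - h x)"
  using L2_norm_triangle[OF L2_diff[OF assms(1,2)] L2_diff[OF assms(2,3)]] by simp

lemma L2_norm_triangle_minus:
  assumes "f \<in> L2" "g \<in> L2"
  shows "L2_norm (\<lambda>x. f x - g x) \<le> L2_norm f + L2_norm g"
  using L2_norm_triangle[OF assms(1) L2_cmult(1)[OF assms(2), of "-1"]] L2_cmult(2)[OF assms(2), of "-1"] by simp

lemma L2_norm_reverse_triangle:
  assumes "f \<in> L2" "g \<in> L2"
  shows "\<bar>L2_norm f - L2_norm g\<bar> \<le> L2_norm (\<lambda>x. f x - g x)"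
  using L2_norm_triangle[OF L2_diff[OF assms] assms(2)] L2_norm_triangle[OF L2_diff[OF assms(2,1)] assms(1)]
  unfolding L2_norm_minus_commute[of g f] by simp

lemma L2_zero: "(\<lambda>x. 0) \<in> L2" "L2_norm (\<lambda>x. 0) = 0"
  by (simp_all add: L2_def L2_norm_def)

lemma L2_norm_eq_0:
  assumes "f \<in> L2" "L2_norm f = 0"
  shows "AE x in lborel. f x = 0"
proof -
  have "(\<integral>x. (cmod (f x))\<^sup>2 \<partial>lborel) = 0"
    using assms(2) L2_norm_square[of f] by simp
  then have "AE x in lborel. (cmod (f x))\<^sup>2 = 0"
    using integral_nonneg_eq_0_iff_AE[OF L2_integrable[OF assms(1)]] by simp
  then show ?thesis by simp
qed

lemma L2_tendsto_norm:
  assumes "\<And>n. f n \<in> L2" "g \<in> L2" "(\<lambda>n. L2_norm (\<lambda>x. f n x - g x)) \<longlonglongrightarrow> 0"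
  shows "(\<lambda>n. L2_norm (f n)) \<longlonglongrightarrow> L2_norm g"
proof (rule LIM_zero_cancel)
  show "(\<lambda>n. L2_norm (f n) - L2_norm g) \<longlonglongrightarrow> 0"
    by (rule Lim_null_comparison[OF _ assms(3)])
      (use L2_norm_reverse_triangle[OF assms(1,2)] in \<open>auto simp: abs_minus_commute\<close>)
qed

text \<open>The pairing is bilinear, as in the weak formulation of the Laplacian; where an inner
  product is meant, the conjugate enters through \<open>L2_cnj\<close>.\<close>

lemma L2_tendsto_integral:
  assumes "\<And>n. f n \<in> L2" "g \<in> L2" "(\<lambda>n. L2_norm (\<lambda>x. f n x - g x)) \<longlonglongrightarrow> 0"
    and "\<And>n. f' n \<in> L2" "g' \<in> L2" "(\<lambda>n. L2_norm (\<lambda>x. f' n x - g' x)) \<longlonglongrightarrow> 0"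
  shows "(\<lambda>n. \<integral>x. f n x * f' n x \<partial>lborel) \<longlonglongrightarrow> (\<integral>x. g x * g' x \<partial>lborel)"
proof (rule LIM_zero_cancel, rule Lim_null_comparison[where g = "\<lambda>n. L2_norm (\<lambda>x. f n x - g x) * L2_norm (f' n) + L2_norm g * L2_norm (\<lambda>x. f' n x - g' x)"])
  have "(\<integral>x. f n x * f' n x \<partial>lborel) - (\<integral>x. g x * g' x \<partial>lborel)
      = (\<integral>x. (f n x - g x) * f' n x \<partial>lborel) + (\<integral>x. g x * (f' n x - g' x) \<partial>lborel)" for n
    using assms by (simp add: L2_mult_integrable left_diff_distrib right_diff_distrib)
  moreover have "cmod (\<integral>x. (f n x - g x) * f' n x \<partial>lborel) \<le> L2_norm (\<lambda>x. f n x - g x) * L2_norm (f' n)"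
      "cmod (\<integral>x. g x * (f' n x - g' x) \<partial>lborel) \<le> L2_norm g * L2_norm (\<lambda>x. f' n x - g' x)" for n
    using assms by (intro L2_cauchy_schwarz L2_diff; simp)+
  ultimately have "cmod ((\<integral>x. f n x * f' n x \<partial>lborel) - (\<integral>x. g x * g' x \<partial>lborel))
      \<le> L2_norm (\<lambda>x. f n x - g x) * L2_norm (f' n) + L2_norm g * L2_norm (\<lambda>x. f' n x - g' x)" for n
    by (simp only: ) (rule norm_triangle_le, rule add_mono)
  then show "\<forall>\<^sub>F n in sequentially. cmod ((\<integral>x. f n x * f' n x \<partial>lborel) - (\<integral>x. g x * g' x \<partial>lborel))
      \<le> L2_norm (\<lambda>x. f n x - g x) * L2_norm (f' n) + L2_norm g * L2_norm (\<lambda>x. f' n x - g' x)"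
    by (simp add: always_eventually)
  have "(\<lambda>n. L2_norm (\<lambda>x. f n x - g x) * L2_norm (f' n) + L2_norm g * L2_norm (\<lambda>x. f' n x - g' x)) \<longlonglongrightarrow> 0 * L2_norm g' + L2_norm g * 0"
    by (intro tendsto_intros assms L2_tendsto_norm)
  then show "(\<lambda>n. L2_norm (\<lambda>x. f n x - g x) * L2_norm (f' n) + L2_norm g * L2_norm (\<lambda>x. f' n x - g' x)) \<longlonglongrightarrow> 0"
    by simp
qed

text \<open>Square integrability is a conclusion here: estimates carried out in [0, \<infinity>] are
  fed into \<open>L2\<close> through this lemma.\<close>

lemma L2_iff_nn_integral:
  assumes "f \<in> borel_measurable borel" "c \<ge> 0" "(\<integral>\<^sup>+x. ennreal ((cmod (f x))\<^sup>2) \<partial>lborel) \<le> ennreal (c\<^sup>2)"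
  shows "f \<in> L2" "L2_norm f \<le> c"
proof -
  have "integrable lborel (\<lambda>x. (cmod (f x))\<^sup>2)"
    using assms by (intro integrableI_bounded) (auto intro: le_less_trans)
  then show "f \<in> L2" using assms(1) by (simp add: L2_def)
  then have "(\<integral>\<^sup>+x. ennreal ((cmod (f x))\<^sup>2) \<partial>lborel) = ennreal ((L2_norm f)\<^sup>2)"
    by (simp add: L2_norm_square nn_integral_eq_integral L2_integrable)
  then have "(L2_norm f)\<^sup>2 \<le> c\<^sup>2"
    using assms(3) by simp
  then show "L2_norm f \<le> c"
    using assms(2) by (rule power2_le_imp_le)
qed

lemma L2_nn_integral:
  assumes "f \<in> L2"
  shows "(\<integral>\<^sup>+x. ennreal ((cmod (f x))\<^sup>2) \<partial>lborel) = ennreal ((L2_norm f)\<^sup>2)"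
  using assms by (simp add: L2_norm_square nn_integral_eq_integral L2_integrable)

lemma L2_telescope:
  assumes "\<And>n. f n \<in> L2" "\<And>n. L2_norm (\<lambda>x. f (Suc n) x - f n x) \<le> C * (1/2) ^ n"
  shows "L2_norm (\<lambda>x. f (n + m) x - f n x) \<le> C * (1/2) ^ n * (2 - 2 * (1/2) ^ m)"
proof (induction m)
  case (Suc m)
  have "L2_norm (\<lambda>x. f (n + Suc m) x - f n x) \<le> L2_norm (\<lambda>x. f (n + Suc m) x - f (n + m) x) + L2_norm (\<lambda>x. f (n + m) x - f n x)"
    by (intro L2_norm_triangle_diff assms)
  also have "\<dots> \<le> C * (1/2) ^ (n + m) + C * (1/2) ^ n * (2 - 2 * (1/2) ^ m)"
    using assms(2)[of "n + m"] Suc by simp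
  also have "\<dots> = C * (1/2) ^ n * (2 - 2 * (1/2) ^ Suc m)"
    by (simp add: power_add algebra_simps)
  finally show ?case .
qed (simp add: L2_zero)

text \<open>Riesz-Fischer for geometric increments, where the whole sequence converges both in norm
  and almost everywhere. The pointwise limit is needed to identify limits after multiplication by an
  unbounded potential.\<close>

lemma L2_complete:
  assumes f: "\<And>n. f n \<in> L2" and d: "\<And>n. L2_norm (\<lambda>x. f (Suc n) x - f n x) \<le> C * (1/2) ^ n"
  obtains g where "g \<in> L2" "(\<lambda>n. L2_norm (\<lambda>x. f n x - g x)) \<longlonglongrightarrow> 0" "AE x in lborel. (\<lambda>n. f n x) \<longlonglongrightarrow> g x"
proof -
  have C: "C \<ge> 0" using order_trans[OF L2_norm_nonneg d[of 0]] by simp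
  have [measurable]: "f n \<in> borel_measurable borel" for n using f L2_borel by blast
  define D where "D n x = cmod (f (Suc n) x - f n x)" for n x
  define a where "a N x = (\<Sum>n<N. D n x)" for N x
  have DL2: "(\<lambda>x. complex_of_real (D n x)) \<in> L2" "L2_norm (\<lambda>x. complex_of_real (D n x)) \<le> C * (1/2) ^ n" for n
  proof -
    have "(\<lambda>x. complex_of_real (D n x)) \<in> borel_measurable borel" by (simp add: D_def)
    from L2_bound[OF L2_diff[OF f[of "Suc n"] f[of n]] this, of 1]
    show "(\<lambda>x. complex_of_real (D n x)) \<in> L2" "L2_norm (\<lambda>x. complex_of_real (D n x)) \<le> C * (1/2) ^ n"
      using d[of n] by (auto simp: D_def)
  qed
  have aL2: "(\<lambda>x. complex_of_real (a N x)) \<in> L2 \<and> L2_norm (\<lambda>x. complex_of_real (a N x)) \<le> C * (2 - 2 * (1/2) ^ N)" for N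
  proof (induction N)
    case (Suc N)
    have "L2_norm (\<lambda>x. complex_of_real (a N x) + complex_of_real (D N x)) \<le> C * (2 - 2 * (1/2) ^ N) + C * (1/2) ^ N"
      using L2_norm_triangle[OF conjunct1[OF Suc] DL2(1)[of N]] Suc DL2(2)[of N] by linarith
    then show ?case
      using L2_add[OF conjunct1[OF Suc] DL2(1)[of N]] by (simp add: a_def algebra_simps)
  qed (simp add: a_def L2_zero)
  \<comment> \<open>The partial sums of the increments have L^2 norm at most \<open>2 * C\<close>,
    so by monotone convergence their supremum is square integrable and hence finite almost
    everywhere.\<close>
  have "(\<integral>\<^sup>+x. (SUP N. ennreal ((a N x)\<^sup>2)) \<partial>lborel) = (SUP N. \<integral>\<^sup>+x. ennreal ((a N x)\<^sup>2) \<partial>lborel)"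
  proof (rule nn_integral_monotone_convergence_SUP)
    show "incseq (\<lambda>N x. ennreal ((a N x)\<^sup>2))"
      by (auto simp: incseq_def le_fun_def a_def D_def intro!: ennreal_leI power_mono sum_mono2 sum_nonneg)
    show "(\<lambda>x. ennreal ((a N x)\<^sup>2)) \<in> borel_measurable lborel" for N
      by (simp add: a_def D_def)
  qed
  also have "\<dots> \<le> ennreal ((2 * C)\<^sup>2)"
  proof (rule SUP_least)
    fix N
    have "(\<integral>\<^sup>+x. ennreal ((a N x)\<^sup>2) \<partial>lborel) = ennreal ((L2_norm (\<lambda>x. complex_of_real (a N x)))\<^sup>2)"
      using L2_nn_integral[OF conjunct1[OF aL2[of N]]] by simp
    also have "L2_norm (\<lambda>x. complex_of_real (a N x)) \<le> 2 * C"
    proof -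
      have "C * (2 - 2 * (1/2) ^ N) \<le> C * 2" using C by (intro mult_left_mono) auto
      then show ?thesis using aL2[of N] by linarith
    qed
    then have "ennreal ((L2_norm (\<lambda>x. complex_of_real (a N x)))\<^sup>2) \<le> ennreal ((2 * C)\<^sup>2)"
      by (intro ennreal_leI power_mono L2_norm_nonneg)
    finally show "(\<integral>\<^sup>+x. ennreal ((a N x)\<^sup>2) \<partial>lborel) \<le> ennreal ((2 * C)\<^sup>2)" .
  qed
  finally have "(\<integral>\<^sup>+x. (SUP N. ennreal ((a N x)\<^sup>2)) \<partial>lborel) \<noteq> \<infinity>"
    by (auto simp: top_unique)
  then have AEfin: "AE x in lborel. (SUP N. ennreal ((a N x)\<^sup>2)) \<noteq> \<infinity>"
    by (intro nn_integral_noteq_infinite) (auto simp: a_def D_def)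
  \<comment> \<open>Where the sequence diverges, \<open>lim\<close> is an unspecified value;
    \<open>g\<close> is Borel all the same, and these points form a null set.\<close>
  define g where "g x = lim (\<lambda>n. f n x)" for x
  have gm[measurable]: "g \<in> borel_measurable borel" unfolding g_def by measurable
  have conv: "AE x in lborel. (\<lambda>n. f n x) \<longlonglongrightarrow> g x"
    using AEfin
  proof eventually_elim
    case (elim x)
    then obtain K where K: "K \<ge> 0" "(SUP N. ennreal ((a N x)\<^sup>2)) = ennreal K"
      by (cases "SUP N. ennreal ((a N x)\<^sup>2)") auto
    have "a N x \<le> sqrt K" for N
    proof -
      have "ennreal ((a N x)\<^sup>2) \<le> ennreal K" unfolding K(2)[symmetric] by (rule SUP_upper) simp
      then show ?thesis using K(1) real_le_rsqrt by simp
    qed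
    then have "summable (\<lambda>n. D n x)"
      using \<open>\<And>N. a N x \<le> sqrt K\<close>
      by (intro bounded_imp_summable[where B = "sqrt K"])
        (auto simp: D_def a_def simp flip: lessThan_Suc_atMost simp del: sum.lessThan_Suc)
    then have "summable (\<lambda>n. f (Suc n) x - f n x)"
      unfolding D_def by (rule summable_norm_cancel)
    then have "(\<lambda>N. \<Sum>n<N. f (Suc n) x - f n x) \<longlonglongrightarrow> (\<Sum>n. f (Suc n) x - f n x)"
      by (rule summable_LIMSEQ)
    then have "(\<lambda>N. f N x - f 0 x) \<longlonglongrightarrow> (\<Sum>n. f (Suc n) x - f n x)"
      by (simp only: sum_lessThan_telescope[where f = "\<lambda>n. f n x"])
    then have "(\<lambda>N. f N x - f 0 x + f 0 x) \<longlonglongrightarrow> (\<Sum>n. f (Suc n) x - f n x) + f 0 x"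
      by (intro tendsto_intros)
    then have "convergent (\<lambda>n. f n x)" by (auto simp: convergent_def)
    then show ?case by (simp add: g_def convergent_LIMSEQ_iff)
  qed
  have gn: "(\<lambda>x. g x - f n x) \<in> L2 \<and> L2_norm (\<lambda>x. g x - f n x) \<le> 2 * C * (1/2) ^ n" for n
  proof -
    \<comment> \<open>Fatou's lemma transfers the bound on \<open>f (n + m) x - f n x\<close> to
      \<open>g x - f n x\<close>.\<close>
    have "(\<integral>\<^sup>+x. ennreal ((cmod (g x - f n x))\<^sup>2) \<partial>lborel) = (\<integral>\<^sup>+x. liminf (\<lambda>m. ennreal ((cmod (f (n + m) x - f n x))\<^sup>2)) \<partial>lborel)"
    proof (rule nn_integral_cong_AE)
      show "AE x in lborel. ennreal ((cmod (g x - f n x))\<^sup>2) = liminf (\<lambda>m. ennreal ((cmod (f (n + m) x - f n x))\<^sup>2))"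
        using conv
      proof eventually_elim
        case (elim x)
        then have "(\<lambda>m. f (m + n) x) \<longlonglongrightarrow> g x" by (rule LIMSEQ_ignore_initial_segment)
        then have "(\<lambda>m. ennreal ((cmod (f (n + m) x - f n x))\<^sup>2)) \<longlonglongrightarrow> ennreal ((cmod (g x - f n x))\<^sup>2)"
          unfolding add.commute[of n] by (intro tendsto_ennrealI tendsto_intros)
        then show ?case by (metis lim_imp_Liminf trivial_limit_sequentially)
      qed
    qed
    also have "\<dots> \<le> liminf (\<lambda>m. \<integral>\<^sup>+x. ennreal ((cmod (f (n + m) x - f n x))\<^sup>2) \<partial>lborel)"
      by (rule nn_integral_liminf) simp
    also have "\<dots> \<le> ennreal ((2 * C * (1/2) ^ n)\<^sup>2)"
    proof -
      have "(\<integral>\<^sup>+x. ennreal ((cmod (f (n + m) x - f n x))\<^sup>2) \<partial>lborel) \<le> ennreal ((2 * C * (1/2) ^ n)\<^sup>2)" for m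
      proof -
        have "L2_norm (\<lambda>x. f (n + m) x - f n x) \<le> C * (1/2) ^ n * (2 - 2 * (1/2) ^ m)"
          by (rule L2_telescope[OF f d])
        also have "\<dots> \<le> C * (1/2) ^ n * 2" using C by (intro mult_left_mono) auto
        finally show ?thesis
          using L2_nn_integral[OF L2_diff[OF f f], of "n + m" n]
          by (auto intro!: ennreal_leI power_mono L2_norm_nonneg simp: mult_ac)
      qed
      then show ?thesis by (intro Liminf_le) (auto intro!: always_eventually)
    qed
    finally have "(\<integral>\<^sup>+x. ennreal ((cmod (g x - f n x))\<^sup>2) \<partial>lborel) \<le> ennreal ((2 * C * (1/2) ^ n)\<^sup>2)" .
    from L2_iff_nn_integral[OF _ _ this] C show ?thesis by simp
  qed
  have "g \<in> L2" using L2_add[OF conjunct1[OF gn[of 0]] f[of 0]] by simp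
  moreover have "(\<lambda>n. L2_norm (\<lambda>x. f n x - g x)) \<longlonglongrightarrow> 0"
  proof (rule Lim_null_comparison)
    show "\<forall>\<^sub>F n in sequentially. norm (L2_norm (\<lambda>x. f n x - g x)) \<le> 2 * C * (1/2) ^ n"
    proof (intro always_eventually allI)
      show "norm (L2_norm (\<lambda>x. f n x - g x)) \<le> 2 * C * (1/2) ^ n" for n
        using conjunct2[OF gn[of n]] L2_norm_nonneg[of "\<lambda>x. f n x - g x"] L2_norm_minus_commute[of "f n" g] by simp
    qed
    have "(\<lambda>n. 2 * C * (1/2) ^ n) \<longlonglongrightarrow> 2 * C * 0"
      by (intro tendsto_intros) auto
    then show "(\<lambda>n. 2 * C * (1/2) ^ n) \<longlonglongrightarrow> 0" by simp
  qed
  ultimately show thesis using that conv by blast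
qed

lemma L2_dominated_convergence:
  assumes [measurable]: "\<And>n. f n \<in> borel_measurable borel" "g \<in> borel_measurable borel" and w: "w \<in> L2"
    and lim: "AE x in lborel. (\<lambda>n. f n x) \<longlonglongrightarrow> g x"
    and bd: "\<And>n. AE x in lborel. cmod (f n x) \<le> cmod (w x)"
  shows "\<And>n. f n \<in> L2" "g \<in> L2" "(\<lambda>n. L2_norm (\<lambda>x. f n x - g x)) \<longlonglongrightarrow> 0"
proof -
  show fn: "f n \<in> L2" for n
    using L2_bound(1)[OF w assms(1), of n 1] bd[of n] by simp
  have "AE x in lborel. \<forall>n. cmod (f n x) \<le> cmod (w x)" using bd by (simp add: AE_all_countable)
  with lim have gb: "AE x in lborel. cmod (g x) \<le> cmod (w x)"
  proof eventually_elim
    case (elim x)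
    then show ?case by (intro tendsto_upperbound[OF tendsto_norm[OF elim(1)]]) auto
  qed
  then show gL: "g \<in> L2" using L2_bound(1)[OF w assms(2), of 1] by simp
  have [measurable]: "w \<in> borel_measurable borel" using w L2_borel by blast
  have "(\<lambda>n. \<integral>x. (cmod (f n x - g x))\<^sup>2 \<partial>lborel) \<longlonglongrightarrow> (\<integral>x. 0 \<partial>(lborel :: (real^'a) measure))"
  proof (rule integral_dominated_convergence[where w = "\<lambda>x. 4 * (cmod (w x))\<^sup>2"])
    show "integrable lborel (\<lambda>x. 4 * (cmod (w x))\<^sup>2)" using L2_integrable[OF w] by simp
    show "AE x in lborel. (\<lambda>i. (cmod (f i x - g x))\<^sup>2) \<longlonglongrightarrow> 0"
      using lim
    proof eventually_elim
      case (elim x)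
      then have "(\<lambda>i. (cmod (f i x - g x))\<^sup>2) \<longlonglongrightarrow> (cmod (g x - g x))\<^sup>2" by (intro tendsto_intros)
      then show ?case by simp
    qed
    show "AE x in lborel. norm ((cmod (f n x - g x))\<^sup>2) \<le> 4 * (cmod (w x))\<^sup>2" for n
      using bd[of n] gb
    proof eventually_elim
      case (elim x)
      have "cmod (f n x - g x) \<le> 2 * cmod (w x)" using norm_triangle_ineq4[of "f n x" "g x"] elim by simp
      then have "(cmod (f n x - g x))\<^sup>2 \<le> (2 * cmod (w x))\<^sup>2" by (intro power_mono) auto
      then show ?case by simp
    qed
  qed auto
  then have "(\<lambda>n. sqrt (\<integral>x. (cmod (f n x - g x))\<^sup>2 \<partial>lborel)) \<longlonglongrightarrow> sqrt 0"
    by (intro tendsto_real_sqrt) simp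
  then show "(\<lambda>n. L2_norm (\<lambda>x. f n x - g x)) \<longlonglongrightarrow> 0" by (simp add: L2_norm_def)
qed

section \<open>A countable dense family of test functions\<close>

type_synonym 'd dense_index = "(rat \<times> rat) \<times> nat \<times> (rat ^ 'd) \<times> (rat ^ 'd)"

definition rat_point :: "rat ^ 'd \<Rightarrow> real ^ 'd" where
  "rat_point a = (\<chi> i. of_rat (a $ i))"

definition dense_term :: "'d dense_index \<Rightarrow> real^'d \<Rightarrow> complex" where
  "dense_term = (\<lambda>((p, q), n, a, b) x. Complex (of_rat p) (of_rat q) * soft_indicator n (rat_point a) (rat_point b) x)"

text \<open>Lists of indices form a countable type; concatenation represents addition, and scaling
  by rational complex numbers acts on the coefficients.\<close>

definition dense_function :: "'d dense_index list \<Rightarrow> real^'d \<Rightarrow> complex" where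
  "dense_function l x = (\<Sum>t\<leftarrow>l. dense_term t x)"

lemma test_function_dense_function: "test_function (dense_function l)"
proof (induction l)
  case Nil
  then show ?case by (simp add: dense_function_def[abs_def] test_function_zero)
next
  case (Cons t l)
  have "test_function (dense_term t)"
    by (cases t) (auto simp: dense_term_def[abs_def] intro!: test_function_cmult test_function_soft_indicator)
  from test_function_add[OF this Cons] show ?case
    by (simp add: dense_function_def[abs_def])
qed

text \<open>Membership spreads from rational boxes to all boxes, to Borel subsets of a box, to
  simple functions and finally to every element of \<open>L2\<close>.\<close>

definition L2_closure :: "(real^'d \<Rightarrow> complex) set" where
  "L2_closure = {f\<in>L2. \<forall>\<epsilon>>0. \<exists>l. L2_norm (\<lambda>x. f x - dense_function l x) < \<epsilon>}"

lemma dense_function_L2: "dense_function l \<in> L2"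
  by (intro test_function_L2 test_function_dense_function)

lemma L2_closure_limit:
  assumes "f \<in> L2" "\<And>n. g n \<in> L2_closure" "(\<lambda>n. L2_norm (\<lambda>x. g n x - f x)) \<longlonglongrightarrow> 0"
  shows "f \<in> L2_closure"
  unfolding L2_closure_def mem_Collect_eq
proof (intro conjI allI impI assms)
  fix \<epsilon> :: real assume e: "\<epsilon> > 0"
  then have "\<forall>\<^sub>F n in sequentially. L2_norm (\<lambda>x. g n x - f x) < \<epsilon> / 2"
    using assms(3) order_tendstoD(2)[of _ 0 sequentially "\<epsilon> / 2"] by simp
  then obtain n where n: "L2_norm (\<lambda>x. g n x - f x) < \<epsilon> / 2"
    using eventually_happens'[OF sequentially_bot] by blast
  obtain l where l: "L2_norm (\<lambda>x. g n x - dense_function l x) < \<epsilon> / 2"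
    using assms(2)[of n] e unfolding L2_closure_def by (auto dest!: spec[of _ "\<epsilon> / 2"])
  have "g n \<in> L2" using assms(2)[of n] by (simp add: L2_closure_def)
  then have "L2_norm (\<lambda>x. f x - dense_function l x) \<le> L2_norm (\<lambda>x. f x - g n x) + L2_norm (\<lambda>x. g n x - dense_function l x)"
    by (intro L2_norm_triangle_diff assms dense_function_L2)
  then show "\<exists>l. L2_norm (\<lambda>x. f x - dense_function l x) < \<epsilon>"
    using n l by (intro exI[of _ l]) (simp add: L2_norm_minus_commute[of f])
qed

lemma L2_closure_add:
  assumes "f \<in> L2_closure" "g \<in> L2_closure"
  shows "(\<lambda>x. f x + g x) \<in> L2_closure"
  unfolding L2_closure_def mem_Collect_eq
proof (intro conjI allI impI)
  have L: "f \<in> L2" "g \<in> L2" using assms by (auto simp: L2_closure_def)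
  then show "(\<lambda>x. f x + g x) \<in> L2" by (rule L2_add)
  fix \<epsilon> :: real assume e: "\<epsilon> > 0"
  obtain k where k: "L2_norm (\<lambda>x. f x - dense_function k x) < \<epsilon> / 2"
    using assms(1) e unfolding L2_closure_def by (auto dest!: spec[of _ "\<epsilon> / 2"])
  obtain l where l: "L2_norm (\<lambda>x. g x - dense_function l x) < \<epsilon> / 2"
    using assms(2) e unfolding L2_closure_def by (auto dest!: spec[of _ "\<epsilon> / 2"])
  have "L2_norm (\<lambda>x. (f x - dense_function k x) + (g x - dense_function l x)) \<le> L2_norm (\<lambda>x. f x - dense_function k x) + L2_norm (\<lambda>x. g x - dense_function l x)"
    by (intro L2_norm_triangle L2_diff L dense_function_L2)
  also have "(\<lambda>x. (f x - dense_function k x) + (g x - dense_function l x)) = (\<lambda>x. f x + g x - dense_function (k @ l) x)"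
    by (auto simp: dense_function_def)
  finally show "\<exists>l. L2_norm (\<lambda>x. f x + g x - dense_function l x) < \<epsilon>"
    using k l by (intro exI[of _ "k @ l"]) linarith
qed

lemma rational_complex_dense:
  assumes "e > 0"
  obtains p q :: rat where "cmod (c - Complex (of_rat p) (of_rat q)) < e"
proof -
  obtain p where p: "Re c - e / 2 < of_rat p" "of_rat p < Re c + e / 2"
    using of_rat_dense[of "Re c - e / 2" "Re c + e / 2"] assms by auto
  obtain q where q: "Im c - e / 2 < of_rat q" "of_rat q < Im c + e / 2"
    using of_rat_dense[of "Im c - e / 2" "Im c + e / 2"] assms by auto
  have "cmod (c - Complex (of_rat p) (of_rat q)) \<le> \<bar>Re c - of_rat p\<bar> + \<bar>Im c - of_rat q\<bar>"
    using cmod_le[of "c - Complex (of_rat p) (of_rat q)"] by simp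
  also have "\<dots> < e" using p q by (auto simp: abs_if)
  finally show thesis by (rule that)
qed

lemma dense_function_scale:
  "\<exists>k. dense_function k = (\<lambda>x. Complex (of_rat p) (of_rat q) * dense_function l x)"
proof (induction l)
  case (Cons t l)
  then obtain k where k: "dense_function k = (\<lambda>x. Complex (of_rat p) (of_rat q) * dense_function l x)" by blast
  obtain p' q' r where t: "t = ((p', q'), r)" by (metis prod.exhaust)
  have "dense_term ((p * p' - q * q', p * q' + q * p'), r) x = Complex (of_rat p) (of_rat q) * dense_term t x" for x
    by (cases r) (simp add: t dense_term_def complex_mult of_rat_mult of_rat_diff of_rat_add mult.assoc[symmetric])
  then have "dense_function (((p * p' - q * q', p * q' + q * p'), r) # k) = (\<lambda>x. Complex (of_rat p) (of_rat q) * dense_function (t # l) x)"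
    using fun_cong[OF k] by (auto simp: dense_function_def algebra_simps)
  then show ?case by blast
qed (auto simp: dense_function_def fun_eq_iff intro!: exI[of _ "[]"])

lemma L2_closure_cmult:
  assumes "f \<in> L2_closure"
  shows "(\<lambda>x. c * f x) \<in> L2_closure"
  unfolding L2_closure_def mem_Collect_eq
proof (intro conjI allI impI)
  have L: "f \<in> L2" using assms by (auto simp: L2_closure_def)
  then show "(\<lambda>x. c * f x) \<in> L2" by (rule L2_cmult)
  fix \<epsilon> :: real assume e: "\<epsilon> > 0"
  define N where "N = L2_norm f + 1"
  have N: "N > 0" "L2_norm f < N" using L2_norm_nonneg[of f] by (auto simp: N_def)
  obtain p q :: rat where pq: "cmod (c - Complex (of_rat p) (of_rat q)) < \<epsilon> / (2 * N)"
    using rational_complex_dense[of "\<epsilon> / (2 * N)" c] e N by auto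
  define z where "z = Complex (of_rat p) (of_rat q)"
  have z1: "cmod z + 1 > 0" using norm_ge_zero[of z] by linarith
  \<comment> \<open>The tolerance is divided by \<open>cmod z + 1\<close> because \<open>z\<close>
    may be 0.\<close>
  obtain l where l: "L2_norm (\<lambda>x. f x - dense_function l x) < \<epsilon> / (2 * (cmod z + 1))"
    using assms(1) e z1 unfolding L2_closure_def by (auto dest!: spec[of _ "\<epsilon> / (2 * (cmod z + 1))"])
  obtain k where k: "dense_function k = (\<lambda>x. z * dense_function l x)"
    using dense_function_scale unfolding z_def by blast
  have "L2_norm (\<lambda>x. c * f x - dense_function k x) = L2_norm (\<lambda>x. (c - z) * f x + z * (f x - dense_function l x))"
    by (simp add: k algebra_simps)
  also have "\<dots> \<le> L2_norm (\<lambda>x. (c - z) * f x) + L2_norm (\<lambda>x. z * (f x - dense_function l x))"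
    by (intro L2_norm_triangle L2_cmult L2_diff L dense_function_L2)
  also have "\<dots> = cmod (c - z) * L2_norm f + cmod z * L2_norm (\<lambda>x. f x - dense_function l x)"
    by (simp add: L2_cmult L L2_diff dense_function_L2)
  also have "\<dots> < \<epsilon>"
  proof -
    have "cmod (c - z) * L2_norm f \<le> \<epsilon> / (2 * N) * N"
      using pq N e by (intro mult_mono) (auto simp: z_def L2_norm_nonneg)
    moreover have "cmod z * L2_norm (\<lambda>x. f x - dense_function l x) \<le> cmod z * (\<epsilon> / (2 * (cmod z + 1)))"
      using l by (intro mult_left_mono) auto
    moreover have "cmod z * (\<epsilon> / (2 * (cmod z + 1))) < \<epsilon> / 2"
    proof -
      have "cmod z / (cmod z + 1) < 1" using z1 by simp
      then have "\<epsilon> / 2 * (cmod z / (cmod z + 1)) < \<epsilon> / 2 * 1" using e by (intro mult_strict_left_mono) auto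
      then show ?thesis by (simp add: mult.commute)
    qed
    moreover have "\<epsilon> / (2 * N) * N = \<epsilon> / 2" using N by simp
    ultimately show ?thesis by linarith
  qed
  finally show "\<exists>l. L2_norm (\<lambda>x. c * f x - dense_function l x) < \<epsilon>" by blast
qed

lemma L2_closure_diff: "f \<in> L2_closure \<Longrightarrow> g \<in> L2_closure \<Longrightarrow> (\<lambda>x. f x - g x) \<in> L2_closure"
  using L2_closure_add[OF _ L2_closure_cmult[of g "-1"]] by simp

lemma L2_closure_zero: "(\<lambda>x. 0) \<in> L2_closure"
  by (auto simp: L2_closure_def L2_zero dense_function_def intro!: exI[of _ "[]"])

lemma L2_closure_sum: "(\<And>i. i \<in> I \<Longrightarrow> f i \<in> L2_closure) \<Longrightarrow> (\<lambda>x. \<Sum>i\<in>I. f i x) \<in> L2_closure"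
  by (induction I rule: infinite_finite_induct) (auto intro: L2_closure_add L2_closure_zero)

lemma indicator_L2:
  assumes "A \<in> sets borel" "emeasure lborel A < \<infinity>"
  shows "(\<lambda>x::real^'d. indicator A x :: complex) \<in> L2"
proof -
  have "(\<lambda>x. (cmod (indicator A x))\<^sup>2) = (\<lambda>x. indicator A x :: real)"
    by (auto simp: indicator_def)
  then show ?thesis using assms by (simp add: L2_def)
qed

lemma L2_closure_rat_box: "(\<lambda>x. indicator (box (rat_point a) (rat_point b)) x) \<in> L2_closure"
proof (rule L2_closure_limit)
  let ?w = "\<lambda>x. indicator (box (rat_point a) (rat_point b)) x :: complex"
  have w: "?w \<in> L2" by (rule indicator_L2) (auto simp: emeasure_lborel_box_eq)
  show "?w \<in> L2" by fact
  show "soft_indicator n (rat_point a) (rat_point b) \<in> L2_closure" for n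
  proof -
    have "dense_function [((1, 0), n, a, b)] = soft_indicator n (rat_point a) (rat_point b)"
      by (auto simp: dense_function_def dense_term_def Complex_eq_1)
    then show ?thesis using dense_function_L2[of "[((1, 0), n, a, b)]"]
      by (auto simp: L2_closure_def L2_zero intro!: exI[of _ "[((1, 0), n, a, b)]"])
  qed
  show "(\<lambda>n. L2_norm (\<lambda>x. soft_indicator n (rat_point a) (rat_point b) x - ?w x)) \<longlonglongrightarrow> 0"
  proof (rule L2_dominated_convergence(3)[OF _ _ w])
    show "AE x in lborel. (\<lambda>n. soft_indicator n (rat_point a) (rat_point b) x) \<longlonglongrightarrow> ?w x"
      by (simp add: soft_indicator_tendsto)
    show "AE x in lborel. cmod (soft_indicator n (rat_point a) (rat_point b) x) \<le> cmod (?w x)" for n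
      using norm_soft_indicator soft_indicator_outside by (intro AE_I2) (auto simp: indicator_def)
  qed (auto intro: test_function_borel test_function_soft_indicator)
qed

lemma rat_between:
  assumes "\<And>i. x $ i < (y::real^'d) $ i"
  shows "\<exists>a. (\<forall>i. x $ i < rat_point a $ i) \<and> (\<forall>i. rat_point a $ i < y $ i)"
proof -
  have "\<exists>q. x $ i < of_rat q \<and> of_rat q < y $ i" for i using of_rat_dense assms by blast
  then obtain q where "\<And>i. x $ i < of_rat (q i) \<and> of_rat (q i) < y $ i" by metis
  then show ?thesis by (intro exI[of _ "\<chi> i. q i"]) (simp add: rat_point_def)
qed

lemma L2_closure_box: "(\<lambda>x. indicator (box a b) x) \<in> L2_closure"
proof -
  \<comment> \<open>Rational corners are chosen strictly inside the box, off by less than 1/(n+1) in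
    each coordinate: the inner boxes exhaust the open box, and its indicator dominates
    theirs.\<close>
  define r :: "nat \<Rightarrow> real^'a" where "r n = (\<chi> i. inverse (Suc n))" for n
  have "\<exists>c. (\<forall>i. a $ i < rat_point c $ i) \<and> (\<forall>i. rat_point c $ i < (a + r n) $ i)" for n
    by (rule rat_between) (simp add: r_def)
  then obtain p where p: "\<And>n i. a $ i < rat_point (p n) $ i" "\<And>n i. rat_point (p n) $ i < (a + r n) $ i" by metis
  have "\<exists>c. (\<forall>i. (b - r n) $ i < rat_point c $ i) \<and> (\<forall>i. rat_point c $ i < b $ i)" for n
    by (rule rat_between) (simp add: r_def)
  then obtain q where q: "\<And>n i. (b - r n) $ i < rat_point (q n) $ i" "\<And>n i. rat_point (q n) $ i < b $ i" by metis
  let ?w = "\<lambda>x. indicator (box a b) x :: complex"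
  have w: "?w \<in> L2" by (rule indicator_L2) (auto simp: emeasure_lborel_box_eq)
  show ?thesis
  proof (rule L2_closure_limit[OF w L2_closure_rat_box])
    show "(\<lambda>n. L2_norm (\<lambda>x. indicator (box (rat_point (p n)) (rat_point (q n))) x - ?w x)) \<longlonglongrightarrow> 0"
    proof (rule L2_dominated_convergence(3)[OF _ _ w])
      have sub: "box (rat_point (p n)) (rat_point (q n)) \<subseteq> box a b" for n
      proof
        fix x assume "x \<in> box (rat_point (p n)) (rat_point (q n))"
        then have "rat_point (p n) $ i < x $ i" "x $ i < rat_point (q n) $ i" for i
          by (auto simp: mem_box_cart)
        then show "x \<in> box a b"
          using less_trans[OF p(1)[of _ n]] less_trans[OF _ q(2)[of n]] by (simp add: mem_box_cart)
      qed
      then show "AE x in lborel. cmod (indicator (box (rat_point (p n)) (rat_point (q n))) x) \<le> cmod (?w x)" for n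
        by (intro AE_I2) (auto simp: indicator_def)
      have "(\<lambda>n. indicator (box (rat_point (p n)) (rat_point (q n))) x) \<longlonglongrightarrow> ?w x" for x
      proof (cases "x \<in> box a b")
        case True
        have "\<forall>\<^sub>F n in sequentially. \<forall>i. inverse (Suc n) < x $ i - a $ i \<and> inverse (Suc n) < b $ i - x $ i"
        proof (rule eventually_all_finite, intro eventually_conj)
          fix i
          show "\<forall>\<^sub>F n in sequentially. inverse (real (Suc n)) < x $ i - a $ i"
            using True by (intro order_tendstoD(2)[OF LIMSEQ_inverse_real_of_nat]) (simp add: mem_box_cart)
          show "\<forall>\<^sub>F n in sequentially. inverse (real (Suc n)) < b $ i - x $ i"
            using True by (intro order_tendstoD(2)[OF LIMSEQ_inverse_real_of_nat]) (simp add: mem_box_cart)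
        qed
        then have "\<forall>\<^sub>F n in sequentially. indicator (box (rat_point (p n)) (rat_point (q n))) x = ?w x"
        proof eventually_elim
          case (elim n)
          have "rat_point (p n) $ i < x $ i \<and> x $ i < rat_point (q n) $ i" for i
            using spec[OF elim, of i] p(2)[of n i] q(1)[of n i] by (simp add: r_def)
          then have "x \<in> box (rat_point (p n)) (rat_point (q n))" by (simp add: mem_box_cart)
          then show ?case using True by simp
        qed
        then show ?thesis by (rule tendsto_eventually)
      next
        case False
        then show ?thesis using sub by (intro tendsto_eventually always_eventually) (auto simp: indicator_def)
      qed
      then show "AE x in lborel. (\<lambda>n. indicator (box (rat_point (p n)) (rat_point (q n))) x) \<longlonglongrightarrow> ?w x"
        by simp
    qed auto
  qed
qed

lemma Int_stable_box: "Int_stable (range (\<lambda>(a, b). box a b :: (real^'d) set))"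
proof (rule Int_stableI)
  fix A B :: "(real^'d) set"
  assume "A \<in> range (\<lambda>(a, b). box a b)" "B \<in> range (\<lambda>(a, b). box a b)"
  then obtain a b c d where "A = box a b" "B = box c d" by auto
  then have "A \<inter> B = box (\<chi> i. max (a $ i) (c $ i)) (\<chi> i. min (b $ i) (d $ i))"
    by (auto simp: mem_box_cart)
  then show "A \<inter> B \<in> range (\<lambda>(a, b). box a b)" by auto
qed

text \<open>A pi-lambda argument over boxes. Intersecting with a fixed box keeps all measures
  finite, so that complements stay in the class.\<close>

lemma L2_closure_indicator:
  assumes "A \<in> sets (borel :: (real^'d) measure)"
  shows "(\<lambda>x. indicator (A \<inter> box a b) x) \<in> L2_closure"
proof -
  let ?G = "range (\<lambda>(a, b). box a b :: (real^'d) set)"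
  have fin: "emeasure lborel (B \<inter> box a b) < \<infinity>" for B
  proof -
    have "emeasure lborel (B \<inter> box a b) \<le> emeasure lborel (box a b)" by (rule emeasure_mono) auto
    also have "\<dots> < \<infinity>" by (simp add: emeasure_lborel_box_eq)
    finally show ?thesis .
  qed
  have b: "box a b \<in> sets borel" by simp
  have A: "A \<in> sigma_sets UNIV ?G" using assms by (subst (asm) borel_eq_box) simp
  have "?G \<subseteq> Pow UNIV" by simp
  from Int_stable_box this A show ?thesis
  proof (induction rule: sigma_sets_induct_disjoint)
    case (basic B)
    then obtain c d where B: "B = box c d" by auto
    have "B \<inter> box a b \<in> ?G" using Int_stableD[OF Int_stable_box, of B "box a b"] B by auto
    then obtain c d where "B \<inter> box a b = box c d" by auto
    then show ?case by (simp add: L2_closure_box)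
  next
    case empty
    then show ?case by (simp add: L2_closure_zero)
  next
    case (compl B)
    have "(\<lambda>x. indicator (box a b) x - indicator (B \<inter> box a b) x) \<in> L2_closure"
      using compl by (intro L2_closure_diff L2_closure_box)
    moreover have "(\<lambda>x. indicator (box a b) x - indicator (B \<inter> box a b) x :: complex) = (\<lambda>x. indicator ((UNIV - B) \<inter> box a b) x)"
      by (auto simp: indicator_def)
    ultimately show ?case by simp
  next
    case (union B)
    have m: "B i \<in> sets borel" for i using union(2) by (auto simp: borel_eq_box)
    let ?w = "\<lambda>x. indicator (box a b) x :: complex"
    have w: "?w \<in> L2" by (rule indicator_L2) (auto simp: emeasure_lborel_box_eq)
    let ?f = "\<lambda>n x. \<Sum>i<n. indicator (B i \<inter> box a b) x :: complex"
    have feq: "?f n x = indicator ((\<Union>i<n. B i) \<inter> box a b) x" for n x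
    proof -
      have "?f n x = (\<Sum>i<n. indicator (B i) x) * indicator (box a b) x"
        by (simp add: sum_distrib_right indicator_inter_arith)
      also have "(\<Sum>i<n. indicator (B i) x) = (indicator (\<Union>i<n. B i) x :: complex)"
        using union(1) by (intro indicator_UN_disjoint[symmetric]) (auto simp: disjoint_family_on_def)
      finally show ?thesis by (simp add: indicator_inter_arith)
    qed
    have "(\<lambda>x. indicator ((\<Union>i. B i) \<inter> box a b) x) \<in> L2_closure"
    proof (rule L2_closure_limit[where g = ?f])
      have U: "(\<Union>i. B i) \<inter> box a b \<in> sets borel" using m by auto
      show "(\<lambda>x. indicator ((\<Union>i. B i) \<inter> box a b) x) \<in> L2"
        by (rule indicator_L2[OF U fin])
      show "?f n \<in> L2_closure" for n using union by (intro L2_closure_sum) auto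
      show "(\<lambda>n. L2_norm (\<lambda>x. ?f n x - indicator ((\<Union>i. B i) \<inter> box a b) x)) \<longlonglongrightarrow> 0"
      proof (rule L2_dominated_convergence(3)[OF _ _ w])
        show "?f n \<in> borel_measurable borel" for n using m by (intro borel_measurable_sum borel_measurable_indicator) auto
        show "(\<lambda>x. indicator ((\<Union>i. B i) \<inter> box a b) x :: complex) \<in> borel_measurable borel" using U by (rule borel_measurable_indicator)
        show "AE x in lborel. cmod (?f n x) \<le> cmod (?w x)" for n
          unfolding feq by (intro AE_I2) (auto simp: indicator_def)
        have "(\<lambda>n. ?f n x) \<longlonglongrightarrow> indicator ((\<Union>i. B i) \<inter> box a b) x" for x
        proof (cases "x \<in> (\<Union>i. B i) \<inter> box a b")
          case True
          then obtain i where i: "x \<in> B i" by auto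
          show ?thesis unfolding feq
            by (rule tendsto_eventually, rule eventually_sequentiallyI[of "Suc i"]) (use True i in \<open>auto simp: indicator_def\<close>)
        next
          case False
          then show ?thesis unfolding feq
            by (intro tendsto_eventually always_eventually) (auto simp: indicator_def)
        qed
        then show "AE x in lborel. (\<lambda>n. ?f n x) \<longlonglongrightarrow> indicator ((\<Union>i. B i) \<inter> box a b) x" by simp
      qed
    qed
    then show ?case .
  qed
qed

lemma L2_closure_eq: "L2_closure = (L2 :: (real^'d \<Rightarrow> complex) set)"
proof (intro equalityI subsetI)
  fix f :: "real^'d \<Rightarrow> complex" assume f: "f \<in> L2"
  then have [measurable]: "f \<in> borel_measurable borel" by (rule L2_borel)
  obtain s where s: "\<And>i. simple_function borel (s i)" "\<And>x. (\<lambda>i. s i x) \<longlonglongrightarrow> f x"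
    and sb: "\<And>i x. dist (s i x) 0 \<le> 2 * dist (f x) 0"
    using borel_measurable_implies_sequence_metric[of f borel 0] by auto
  \<comment> \<open>Cutting off at cubes brings the level sets of the simple functions into the form
    required by \<open>L2_closure_indicator\<close>; domination is by
    \<open>2 * f x\<close>.\<close>
  define Q :: "nat \<Rightarrow> (real^'d) set" where "Q n = box (\<chi> i. - real n) (\<chi> i. real n)" for n
  show "f \<in> L2_closure"
  proof (rule L2_closure_limit[OF f, where g = "\<lambda>n x. s n x * indicator (Q n) x"])
    show "(\<lambda>x. s n x * indicator (Q n) x) \<in> L2_closure" for n
    proof -
      have fin: "finite (range (s n))" using s(1)[of n] by (simp add: simple_function_def)
      have "s n x * indicator (Q n) x = (\<Sum>y\<in>range (s n). y * indicator (s n -` {y} \<inter> Q n) x)" for x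
      proof -
        have "(\<Sum>y\<in>range (s n). y * indicator (s n -` {y} \<inter> Q n) x) = (\<Sum>y\<in>range (s n). if s n x = y then y * indicator (Q n) x else 0)"
          by (intro sum.cong) (auto simp: indicator_def)
        then show ?thesis using fin by (simp add: sum.delta)
      qed
      then have eq: "(\<lambda>x. s n x * indicator (Q n) x) = (\<lambda>x. \<Sum>y\<in>range (s n). y * indicator (s n -` {y} \<inter> Q n) x)" by blast
      have m: "s n -` {y} \<in> sets borel" for y using simple_functionD(2)[OF s(1)[of n], of "{y}"] by simp
      show ?thesis unfolding eq unfolding Q_def
        by (intro L2_closure_sum L2_closure_cmult L2_closure_indicator m)
    qed
    show "(\<lambda>n. L2_norm (\<lambda>x. s n x * indicator (Q n) x - f x)) \<longlonglongrightarrow> 0"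
    proof (rule L2_dominated_convergence(3)[OF _ _ L2_cmult(1)[OF f, of 2]])
      show "(\<lambda>x. s n x * indicator (Q n) x) \<in> borel_measurable borel" for n
        using borel_measurable_simple_function[OF s(1)[of n]] by (auto simp: Q_def)
      show "AE x in lborel. cmod (s n x * indicator (Q n) x) \<le> cmod (2 * f x)" for n
        using sb by (intro AE_I2) (auto simp: indicator_def norm_mult)
      have "(\<lambda>n. s n x * indicator (Q n) x) \<longlonglongrightarrow> f x" for x
      proof -
        obtain N :: nat where N: "norm x < real N" using reals_Archimedean2 by blast
        have "\<forall>\<^sub>F n in sequentially. s n x = s n x * indicator (Q n) x"
        proof (rule eventually_sequentiallyI[of N])
          fix n assume "n \<ge> N"
          then have "\<bar>x $ i\<bar> < real n" for i
            using component_le_norm_cart[of x i] N by linarith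
          then have "- real n < x $ i \<and> x $ i < real n" for i by (auto simp: abs_less_iff minus_less_iff)
          then show "s n x = s n x * indicator (Q n) x" by (simp add: Q_def mem_box_cart)
        qed
        then show ?thesis using s(2)[of x] by (rule tendsto_cong[THEN iffD1])
      qed
      then show "AE x in lborel. (\<lambda>n. s n x * indicator (Q n) x) \<longlonglongrightarrow> f x" by simp
    qed auto
  qed
qed (auto simp: L2_closure_def)

lemma test_functions_dense:
  assumes "f \<in> L2" "\<epsilon> > 0"
  obtains \<phi> where "test_function \<phi>" "L2_norm (\<lambda>x. f x - \<phi> x) < \<epsilon>"
proof -
  have "f \<in> L2_closure" using assms(1) by (simp add: L2_closure_eq)
  then obtain l where "L2_norm (\<lambda>x. f x - dense_function l x) < \<epsilon>"
    using assms(2) by (auto simp: L2_closure_def)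
  then show thesis by (rule that[OF test_function_dense_function])
qed

lemma L2_separable:
  obtains X :: "(real^'d \<Rightarrow> complex) set" where "countable X" "X \<subseteq> L2"
    "\<And>f \<epsilon>. f \<in> L2 \<Longrightarrow> \<epsilon> > 0 \<Longrightarrow> \<exists>g\<in>X. L2_norm (\<lambda>x. f x - g x) < \<epsilon>"
proof (rule that[of "range dense_function"])
  show "\<exists>g\<in>range dense_function. L2_norm (\<lambda>x. f x - g x) < \<epsilon>" if "f \<in> L2" "\<epsilon> > 0" for f :: "real^'d \<Rightarrow> complex" and \<epsilon>
  proof -
    have "f \<in> L2_closure" using that(1) by (simp add: L2_closure_eq)
    then show ?thesis using that(2) by (auto simp: L2_closure_def)
  qed
qed (auto simp: dense_function_L2)

section \<open>A compactly supported Green identity\<close>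

text \<open>The scaling \<open>cap = 4 (1 - |y|\<^sup>2)\<^sub>+\<close> makes \<open>\<nabla> sq_cap = - y cap\<close>, so that the derivative in \<open>r\<close> of the
  average of \<open>g (x + r y)\<close> against \<open>cap y\<close> is \<open>r\<close> times the average of \<open>\<Delta> g (x + r y)\<close> against \<open>sq_cap y\<close>.\<close>

definition sq_cap :: "real^'d \<Rightarrow> real" where "sq_cap y = (max 0 (1 - (norm y)\<^sup>2))\<^sup>2"

definition cap :: "real^'d \<Rightarrow> real" where "cap y = 4 * max 0 (1 - (norm y)\<^sup>2)"

lemma sq_cap_bounds: "0 \<le> sq_cap y" "sq_cap y \<le> 1"
  unfolding sq_cap_def by (auto intro!: power_le_one)

lemma cap_nonneg: "0 \<le> cap y" by (simp add: cap_def)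

lemma cap_le: "cap y \<le> 4" by (simp add: cap_def)

lemma sq_cap_le_cap: "4 * sq_cap y \<le> cap y"
proof -
  have "max 0 (1 - (norm y)\<^sup>2) * max 0 (1 - (norm y)\<^sup>2) \<le> 1 * max 0 (1 - (norm y)\<^sup>2)"
    by (intro mult_right_mono) auto
  then show ?thesis by (simp add: sq_cap_def cap_def power2_eq_square)
qed

lemma cap_zero:
  assumes "norm y > 1"
  shows "sq_cap y = 0" "cap y = 0"
proof -
  have "(norm y)\<^sup>2 > 1" using assms by (simp add: one_less_power)
  then show "sq_cap y = 0" "cap y = 0" by (simp_all add: sq_cap_def cap_def)
qed

lemma continuous_sq_cap: "continuous_on UNIV sq_cap"
  unfolding sq_cap_def[abs_def] by (intro continuous_intros)

lemma continuous_cap: "continuous_on UNIV cap"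
  unfolding cap_def[abs_def] by (intro continuous_intros)

lemma max_square_derivative: "((\<lambda>t::real. (max 0 t)\<^sup>2) has_real_derivative 2 * max 0 t) (at t)"
proof -
  consider "t > 0" | "t < 0" | "t = 0" by linarith
  then show ?thesis
  proof cases
    case 1
    have "((\<lambda>t. t\<^sup>2) has_real_derivative 2 * max 0 t) (at t)"
      using 1 by (auto intro!: derivative_eq_intros)
    then show ?thesis
      by (rule has_field_derivative_transform_within_open[where S = "{0<..}"]) (use 1 in auto)
  next
    case 2
    have "((\<lambda>t. 0) has_real_derivative 2 * max 0 t) (at t)"
      using 2 by auto
    then show ?thesis
      by (rule has_field_derivative_transform_within_open[where S = "{..<0}"]) (use 2 in auto)
  next
    case 3
    have "((\<lambda>h::real. (max 0 h)\<^sup>2 / h) \<longlongrightarrow> 0) (at 0)"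
    proof (rule Lim_null_comparison)
      show "\<forall>\<^sub>F h in at 0. norm ((max 0 h)\<^sup>2 / h) \<le> \<bar>h::real\<bar>"
        by (intro always_eventually) (auto simp: max_def power2_eq_square)
      show "((\<lambda>h::real. \<bar>h\<bar>) \<longlongrightarrow> 0) (at 0)"
        using tendsto_rabs[OF tendsto_ident_at[of "0::real" UNIV]] by simp
    qed
    then show ?thesis using 3 by (simp add: has_field_derivative_iff)
  qed
qed

lemma sq_cap_has_derivative:
  "((\<lambda>y. complex_of_real (sq_cap y)) has_derivative (\<lambda>v. - complex_of_real (cap y * (y \<bullet> v)))) (at y)"
proof -
  have "((\<lambda>y::real^'a. 1 - (norm y)\<^sup>2) has_derivative (\<lambda>v. - (2 * (y \<bullet> v)))) (at y)"
    unfolding power2_norm_eq_inner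
    by (auto intro!: derivative_eq_intros simp: inner_commute)
  from has_derivative_compose[OF this max_square_derivative[unfolded has_field_derivative_def]]
  have "(sq_cap has_derivative (\<lambda>v. - (cap y * (y \<bullet> v)))) (at y)"
    by (simp add: sq_cap_def[abs_def] cap_def algebra_simps)
  then have "((\<lambda>y. complex_of_real (sq_cap y)) has_derivative (\<lambda>v. complex_of_real (- (cap y * (y \<bullet> v))))) (at y)"
    by (rule bounded_linear.has_derivative[OF bounded_linear_of_real])
  then show ?thesis by simp
qed

lemma partial_sq_cap:
  "partial i (\<lambda>y. complex_of_real (sq_cap y)) = (\<lambda>y. - complex_of_real (cap y * (y $ i)))"
  by (rule ext, subst partial_eq[OF sq_cap_has_derivative]) (simp add: inner_axis)

text \<open>For weights supported in the unit ball this is a weighted integral of \<open>g\<close>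
  over the ball of radius \<open>r\<close> about \<open>x\<close>, pulled back to the unit ball. The
  radius sits inside \<open>g\<close>, so it can be differentiated, also at
  \<open>r = 0\<close>.\<close>

definition radial :: "(real^'d \<Rightarrow> real) \<Rightarrow> (real^'d \<Rightarrow> complex) \<Rightarrow> real^'d \<Rightarrow> real \<Rightarrow> complex" where
  "radial w g x r = (\<integral>y. complex_of_real (w y) * g (x + r *\<^sub>R y) \<partial>lborel)"

lemma dilate_has_derivative:
  assumes "smooth g"
  shows "((\<lambda>y. g (x + r *\<^sub>R y)) has_derivative (\<lambda>v. frechet_derivative g (at (x + r *\<^sub>R y)) (r *\<^sub>R v))) (at y)"
proof -
  have "((\<lambda>y. x + r *\<^sub>R y) has_derivative (\<lambda>v. r *\<^sub>R v)) (at y)"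
    by (auto intro!: derivative_eq_intros)
  from has_derivative_compose[OF this smooth_has_derivative[OF assms]] show ?thesis .
qed

lemma partial_dilate:
  assumes "smooth g"
  shows "partial i (\<lambda>y. g (x + r *\<^sub>R y)) = (\<lambda>y. complex_of_real r * partial i g (x + r *\<^sub>R y))"
  by (rule ext, subst partial_eq[OF dilate_has_derivative[OF assms]],
      unfold linear_scale[OF linear_frechet_derivative[OF smooth_differentiable[OF assms]]] partial_def)
    (rule scaleR_conv_of_real)

lemma smooth_continuous_dilate:
  assumes "smooth g"
  shows "continuous_on UNIV (\<lambda>y. g (x + r *\<^sub>R y))"
  by (intro continuous_on_compose2[OF smooth_continuous_on[OF assms, of UNIV]] continuous_intros) auto

lemma radial_has_derivative:
  assumes g: "test_function g" and w: "continuous_on UNIV w" "\<And>y. w y \<ge> 0" "\<And>y. norm y > 1 \<Longrightarrow> w y = 0"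
  shows "(radial w g x has_derivative (\<lambda>h. \<integral>y. complex_of_real (w y) * frechet_derivative g (at (x + r *\<^sub>R y)) (h *\<^sub>R y) \<partial>lborel)) (at r)"
proof -
  obtain L where L: "L \<ge> 0" "\<And>x y. cmod (g y - g x) \<le> L * norm (y - x)"
    using g test_function_lipschitz by blast
  have gs: "smooth g" using g by (rule test_function_smooth)
  show ?thesis
    unfolding radial_def[abs_def]
  proof (rule has_derivative_integral_dominated[where \<delta> = 1 and B = "\<lambda>y. L * (w y * norm y)"])
    show "integrable lborel (\<lambda>z. complex_of_real (w z) * g (x + y *\<^sub>R z))" for y
      by (rule bounded_support_integrable[where R = 1])
        (use w smooth_continuous_dilate[OF gs] in \<open>auto intro!: continuous_intros\<close>)
    show "((\<lambda>r. complex_of_real (w z) * g (x + r *\<^sub>R z)) has_derivative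
        (\<lambda>h. complex_of_real (w z) * frechet_derivative g (at (x + r *\<^sub>R z)) (h *\<^sub>R z))) (at r)" for z
    proof -
      have "((\<lambda>r. x + r *\<^sub>R z) has_derivative (\<lambda>h. h *\<^sub>R z)) (at r)"
        by (auto intro!: derivative_eq_intros)
      from has_derivative_compose[OF this smooth_has_derivative[OF gs]] show ?thesis
        by (rule has_derivative_mult_right)
    qed
    show "cmod (complex_of_real (w z) * g (x + y *\<^sub>R z) - complex_of_real (w z) * g (x + r *\<^sub>R z)) \<le> L * (w z * norm z) * norm (y - r)" for y z
    proof -
      have "cmod (complex_of_real (w z) * g (x + y *\<^sub>R z) - complex_of_real (w z) * g (x + r *\<^sub>R z))
          = w z * cmod (g (x + y *\<^sub>R z) - g (x + r *\<^sub>R z))"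
        using w(2) by (simp add: norm_mult flip: right_diff_distrib)
      also have "\<dots> \<le> w z * (L * norm ((x + y *\<^sub>R z) - (x + r *\<^sub>R z)))"
        by (intro mult_left_mono L w)
      also have "\<dots> = L * (w z * norm z) * norm (y - r)"
        by (simp flip: scaleR_diff_left)
      finally show ?thesis .
    qed
    show "integrable lborel (\<lambda>y. L * (w y * norm y))"
      by (rule bounded_support_integrable[where R = 1]) (use w in \<open>auto intro!: continuous_intros\<close>)
  qed (use L(1) w(2) in auto)
qed

lemma radial_continuous:
  assumes "test_function g" "continuous_on UNIV w" "\<And>y. w y \<ge> 0" "\<And>y. norm y > 1 \<Longrightarrow> w y = 0"
  shows "continuous_on A (radial w g x)"
  by (intro continuous_at_imp_continuous_on ballI has_derivative_continuous[OF radial_has_derivative[OF assms]])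

text \<open>The derivative in \<open>r\<close> brings down y . \<nabla>g(x + r y). Since y
  \<open>cap\<close> = -\<nabla>\<open>sq_cap\<close>, integration by parts moves a derivative onto
  \<nabla>g(x + r y), and the chain rule supplies the factor \<open>r\<close>. This is the
  divergence theorem behind the mean value formula, with smoothed spheres.\<close>

lemma radial_cap_derivative:
  assumes g: "test_function g"
  shows "(radial cap g x has_vector_derivative complex_of_real r * radial sq_cap (classical_laplacian g) x r) (at r)"
proof -
  have gs: "smooth g" using g by (rule test_function_smooth)
  have parts: "(\<integral>y. complex_of_real (cap y) * (complex_of_real (y $ i) * partial i g (x + r *\<^sub>R y)) \<partial>lborel)
      = complex_of_real r * (\<integral>y. complex_of_real (sq_cap y) * partial i (partial i g) (x + r *\<^sub>R y) \<partial>lborel)" for i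
  proof -
    have s1: "smooth (partial i g)" "smooth (partial i (partial i g))" using gs smooth_partial by auto
    have "(\<integral>y. partial i (\<lambda>y. partial i g (x + r *\<^sub>R y)) y * complex_of_real (sq_cap y) \<partial>lborel)
        = - (\<integral>y. partial i g (x + r *\<^sub>R y) * partial i (\<lambda>y. complex_of_real (sq_cap y)) y \<partial>lborel)"
    proof (rule integral_by_parts[where R = 1])
      show "(\<lambda>y. partial i g (x + r *\<^sub>R y)) differentiable (at y)" for y
        using dilate_has_derivative[OF s1(1)] by (rule differentiableI)
      show "(\<lambda>y. complex_of_real (sq_cap y)) differentiable (at y)" for y :: "real^'a"
        using sq_cap_has_derivative by (rule differentiableI)
      show "continuous_on UNIV (partial i (\<lambda>y. partial i g (x + r *\<^sub>R y)))"
        unfolding partial_dilate[OF s1(1)] by (intro continuous_intros smooth_continuous_dilate s1)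
      show "continuous_on UNIV (partial i (\<lambda>y::real^'a. complex_of_real (sq_cap y)))"
        unfolding partial_sq_cap by (intro continuous_intros continuous_cap)
    qed (simp add: cap_zero)
    then show ?thesis
      unfolding partial_dilate[OF s1(1)] partial_sq_cap by (simp add: mult_ac)
  qed
  have i1: "integrable lborel (\<lambda>y. complex_of_real (cap y) * (complex_of_real (y $ i) * partial i g (x + r *\<^sub>R y)))" for i
    by (rule bounded_support_integrable[where R = 1])
      (use smooth_continuous_dilate[OF smooth_partial[OF gs]] in \<open>auto simp: cap_zero intro!: continuous_intros continuous_cap\<close>)
  have i2: "integrable lborel (\<lambda>y. complex_of_real (sq_cap y) * partial i (partial i g) (x + r *\<^sub>R y))" for i
    by (rule bounded_support_integrable[where R = 1])
      (use smooth_continuous_dilate[OF smooth_partial[OF smooth_partial[OF gs]]] in \<open>auto simp: cap_zero intro!: continuous_intros continuous_sq_cap\<close>)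
  have "(\<integral>y. complex_of_real (cap y) * frechet_derivative g (at (x + r *\<^sub>R y)) (h *\<^sub>R y) \<partial>lborel)
      = h *\<^sub>R (complex_of_real r * radial sq_cap (classical_laplacian g) x r)" for h
  proof -
    have "(\<integral>y. complex_of_real (cap y) * frechet_derivative g (at (x + r *\<^sub>R y)) (h *\<^sub>R y) \<partial>lborel)
        = (\<integral>y. complex_of_real h * (\<Sum>i\<in>UNIV. complex_of_real (cap y) * (complex_of_real (y $ i) * partial i g (x + r *\<^sub>R y))) \<partial>lborel)"
      by (simp add: frechet_eq_sum_partial[OF smooth_differentiable[OF gs]] sum_distrib_left mult_ac)
    also have "\<dots> = complex_of_real h * (\<Sum>i\<in>UNIV. \<integral>y. complex_of_real (cap y) * (complex_of_real (y $ i) * partial i g (x + r *\<^sub>R y)) \<partial>lborel)"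
      using i1 by (simp add: Bochner_Integration.integral_sum)
    also have "\<dots> = complex_of_real h * (complex_of_real r * (\<Sum>i\<in>UNIV. \<integral>y. complex_of_real (sq_cap y) * partial i (partial i g) (x + r *\<^sub>R y) \<partial>lborel))"
      by (simp only: parts sum_distrib_left)
    also have "(\<Sum>i\<in>UNIV. \<integral>y. complex_of_real (sq_cap y) * partial i (partial i g) (x + r *\<^sub>R y) \<partial>lborel)
        = radial sq_cap (classical_laplacian g) x r"
      unfolding radial_def classical_laplacian_def sum_distrib_left
      by (rule Bochner_Integration.integral_sum[symmetric]) (rule i2)
    finally show ?thesis by (simp add: scaleR_conv_of_real)
  qed
  then show ?thesis
    using radial_has_derivative[OF g continuous_cap cap_nonneg cap_zero(2), of x r]
    by (simp add: has_vector_derivative_def)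
qed

lemma integral_cap_pos: "(\<integral>y. cap (y :: real^'d) \<partial>lborel) > 0" "(\<integral>y. sq_cap (y :: real^'d) \<partial>lborel) > 0"
proof -
  have fin: "emeasure lborel (ball (0::real^'d) (1/2)) < \<infinity>" by (rule emeasure_lborel_ball_finite)
  have m: "measure lborel (ball (0::real^'d) (1/2)) > 0"
    by (rule content_ball_pos) simp
  have low: "sq_cap y \<ge> (1/4) * indicator (ball 0 (1/2)) y" for y :: "real^'d"
  proof (cases "y \<in> ball 0 (1/2)")
    case True
    then have "(norm y)\<^sup>2 \<le> (1/2)\<^sup>2" by (intro power_mono) auto
    then have "1 / 2 \<le> max 0 (1 - (norm y)\<^sup>2)" by (simp add: power2_eq_square)
    then have "(1/2)\<^sup>2 \<le> sq_cap y" unfolding sq_cap_def by (rule power_mono) simp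
    then show ?thesis using True by (simp add: power2_eq_square)
  qed (simp add: sq_cap_bounds)
  have i: "integrable lborel (\<lambda>y::real^'d. (1/4) * indicator (ball 0 (1/2)) y :: real)"
    using fin by simp
  have ic: "integrable lborel (sq_cap :: real^'d \<Rightarrow> real)" "integrable lborel (cap :: real^'d \<Rightarrow> real)"
    by (rule bounded_support_integrable[where R = 1]; simp add: continuous_sq_cap continuous_cap cap_zero)+
  have "0 < (\<integral>y. (1/4::real) * indicator (ball 0 (1/2)) (y::real^'d) \<partial>lborel)"
    using m by simp
  also have "\<dots> \<le> (\<integral>y. sq_cap (y :: real^'d) \<partial>lborel)"
    by (rule integral_mono[OF i ic(1) low])
  finally show *: "(\<integral>y. sq_cap (y :: real^'d) \<partial>lborel) > 0" .
  have "(\<integral>y. sq_cap (y :: real^'d) \<partial>lborel) \<le> (\<integral>y. cap (y :: real^'d) \<partial>lborel)"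
  proof (rule integral_mono[OF ic])
    show "sq_cap y \<le> cap y" for y :: "real^'d"
      using sq_cap_le_cap[of y] sq_cap_bounds(1)[of y] by linarith
  qed
  with * show "(\<integral>y. cap (y :: real^'d) \<partial>lborel) > 0" by linarith
qed

text \<open>The fundamental theorem of calculus for F(r) = (1 - r^2/s^2)
  \<open>radial cap g x r\<close> on [0, s]. The cutoff removes the boundary term at r = s, and F(0)
  is the wanted multiple of g(x). Differentiating the cutoff gives the averaging term,
  differentiating the mean gives the Laplacian term.\<close>

lemma radial_representation:
  fixes g :: "real^'d \<Rightarrow> complex"
  assumes g: "test_function g" and s: "s > 0"
  shows "complex_of_real (\<integral>y. cap (y::real^'d) \<partial>lborel) * g x =
    (\<integral>r. indicator {0..s} r *\<^sub>R (complex_of_real (2 * r / s\<^sup>2) * radial cap g x r) \<partial>lborel)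
    - (\<integral>r. indicator {0..s} r *\<^sub>R (complex_of_real ((1 - r\<^sup>2 / s\<^sup>2) * r) * radial sq_cap (classical_laplacian g) x r) \<partial>lborel)"
proof -
  let ?F = "\<lambda>r. complex_of_real (1 - r\<^sup>2 / s\<^sup>2) * radial cap g x r"
  let ?a = "\<lambda>r. complex_of_real (2 * r / s\<^sup>2) * radial cap g x r"
  let ?b = "\<lambda>r. complex_of_real ((1 - r\<^sup>2 / s\<^sup>2) * r) * radial sq_cap (classical_laplacian g) x r"
  have ra: "continuous_on {0..s} (radial cap g x)"
    by (rule radial_continuous[OF g continuous_cap cap_nonneg cap_zero(2)])
  have rb: "continuous_on {0..s} (radial sq_cap (classical_laplacian g) x)"
    by (rule radial_continuous[OF test_function_laplacian[OF g] continuous_sq_cap sq_cap_bounds(1) cap_zero(1)])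
  have ca: "continuous_on {0..s} ?a" and cb: "continuous_on {0..s} ?b"
    by (intro continuous_intros ra rb; use s in simp)+
  have ia: "integrable lborel (\<lambda>r. indicator {0..s} r *\<^sub>R ?a r)"
    by (rule borel_integrable_compact[OF compact_Icc ca])
  have ib: "integrable lborel (\<lambda>r. indicator {0..s} r *\<^sub>R ?b r)"
    by (rule borel_integrable_compact[OF compact_Icc cb])
  have "(\<integral>r. indicator {0..s} r *\<^sub>R (?b r - ?a r) \<partial>lborel) = ?F s - ?F 0"
  proof (rule integral_FTC_Icc)
    fix r assume "0 \<le> r" "r \<le> s"
    have k: "((\<lambda>r. complex_of_real (1 - r\<^sup>2 / s\<^sup>2)) has_vector_derivative complex_of_real (- (2 * r / s\<^sup>2))) (at r)"
      by (rule has_vector_derivative_of_real)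
        (use s in \<open>auto intro!: derivative_eq_intros simp: power2_eq_square power4_eq_xxxx divide_simps\<close>)
    have "(?F has_vector_derivative complex_of_real (1 - r\<^sup>2 / s\<^sup>2) * (complex_of_real r * radial sq_cap (classical_laplacian g) x r)
        + complex_of_real (- (2 * r / s\<^sup>2)) * radial cap g x r) (at r)"
      by (rule has_vector_derivative_mult[OF k radial_cap_derivative[OF g]])
    then have "(?F has_vector_derivative ?b r - ?a r) (at r)"
      by (simp add: mult_ac)
    then show "(?F has_vector_derivative ?b r - ?a r) (at r within {0..s})"
      by (rule has_vector_derivative_at_within)
  qed (use s ca cb in \<open>auto intro!: continuous_intros simp del: of_real_mult of_real_diff of_real_divide\<close>)
  moreover have "?F s = 0" using s by simp
  moreover have "?F 0 = complex_of_real (\<integral>y. cap (y::real^'d) \<partial>lborel) * g x"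
    by (simp add: radial_def)
  moreover have "(\<integral>r. indicator {0..s} r *\<^sub>R (?b r - ?a r) \<partial>lborel) = (\<integral>r. indicator {0..s} r *\<^sub>R ?b r \<partial>lborel) - (\<integral>r. indicator {0..s} r *\<^sub>R ?a r \<partial>lborel)"
    unfolding scaleR_diff_right by (rule Bochner_Integration.integral_diff[OF ib ia])
  ultimately have "(\<integral>r. indicator {0..s} r *\<^sub>R ?b r \<partial>lborel) - (\<integral>r. indicator {0..s} r *\<^sub>R ?a r \<partial>lborel)
      = 0 - complex_of_real (\<integral>y. cap (y::real^'d) \<partial>lborel) * g x"
    by (simp only:)
  moreover have "c = a - b" if "b - a = 0 - c" for a b c :: complex
    using that by (simp add: algebra_simps)
  ultimately show ?thesis by blast
qed

section \<open>Averaging kernels in the coordinates (r, y)\<close>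

definition ray_domain :: "real \<Rightarrow> (real \<times> (real^'d)) set" where
  "ray_domain s = {0..s} \<times> cball 0 1"

text \<open>As a function of the displacement r y the Green kernel is singular at the origin, like
  |r y|^(2 - d) if d > 2. On pairs (r, y) its density is continuous on a compact set, and no
  Jacobian has to be computed.\<close>

definition ray :: "real \<times> (real^'d) \<Rightarrow> real^'d" where
  "ray z = fst z *\<^sub>R snd z"

definition kernel :: "real \<Rightarrow> (real \<times> (real^'d) \<Rightarrow> real) \<Rightarrow> (real \<times> (real^'d)) measure" where
  "kernel s q = density lborel (\<lambda>z. ennreal (indicator (ray_domain s) z * q z))"

definition kernel_mass :: "real \<Rightarrow> (real \<times> (real^'d) \<Rightarrow> real) \<Rightarrow> real" where
  "kernel_mass s q = (\<integral>z. indicator (ray_domain s) z * q z \<partial>lborel)"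

lemma compact_ray_domain: "compact (ray_domain s)"
  unfolding ray_domain_def by (intro compact_Times compact_Icc compact_cball)

lemma sets_ray_domain[measurable]: "ray_domain s \<in> sets borel"
  using compact_ray_domain borel_compact by blast

lemma borel_measurable_ray[measurable]: "ray \<in> borel_measurable borel"
  unfolding ray_def[abs_def] by (intro borel_measurable_continuous_onI continuous_intros)

lemma space_kernel: "space (kernel s q) = UNIV" and sets_kernel[measurable_cong]: "sets (kernel s q) = sets borel"
  by (simp_all add: kernel_def)

lemma norm_ray: "z \<in> ray_domain s \<Longrightarrow> norm (ray z) \<le> s"
  by (auto simp: ray_domain_def ray_def intro: order_trans[OF mult_mono[of _ s _ 1]])

lemma kernel_integrable:
  fixes h :: "real \<times> (real^'d) \<Rightarrow> 'b::{banach,second_countable_topology}"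
  assumes "continuous_on UNIV h"
  shows "integrable lborel (\<lambda>z. indicator (ray_domain s) z *\<^sub>R h z)"
  using assms by (intro borel_integrable_compact compact_ray_domain) (auto intro: continuous_on_subset)

context
  fixes q :: "real \<times> (real^'d) \<Rightarrow> real" and s :: real
  assumes cont: "continuous_on UNIV q"
    and nonneg: "\<forall>z\<in>ray_domain s. q z \<ge> 0"
begin

lemma kernel_density_nonneg: "indicator (ray_domain s) z * q z \<ge> 0"
  using nonneg by (auto simp: indicator_def)

lemma kernel_density_borel[measurable]: "q \<in> borel_measurable borel"
  using cont by (rule borel_measurable_continuous_onI)

lemma emeasure_kernel: "emeasure (kernel s q) UNIV = ennreal (kernel_mass s q)"
proof -
  have "emeasure (kernel s q) UNIV = (\<integral>\<^sup>+z. ennreal (indicator (ray_domain s) z * q z) \<partial>lborel)"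
    unfolding kernel_def by (subst emeasure_density) auto
  also have "\<dots> = ennreal (kernel_mass s q)"
    unfolding kernel_mass_def
    by (rule nn_integral_eq_integral) (use kernel_integrable[OF cont, of s] kernel_density_nonneg in auto)
  finally show ?thesis .
qed

lemma finite_measure_kernel: "finite_measure (kernel s q)"
  by (rule finite_measureI) (simp add: space_kernel emeasure_kernel)

lemma kernel_mass_nonneg: "kernel_mass s q \<ge> 0"
  unfolding kernel_mass_def by (intro Bochner_Integration.integral_nonneg kernel_density_nonneg)

lemma ray_measurable_kernel: "ray \<in> borel_measurable (kernel s q)"
  by (simp add: measurable_cong_sets[OF sets_kernel refl])

lemma AE_kernel: "AE z in kernel s q. norm (ray z) \<le> s"
  unfolding kernel_def
  by (subst AE_density) (use norm_ray in \<open>auto simp: indicator_def intro!: AE_I2\<close>)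

lemma avg_kernel:
  assumes g: "smooth g"
  shows "avg (kernel s q) ray g x = (\<integral>z. indicator (ray_domain s) z *\<^sub>R (complex_of_real (q z) * g (x + ray z)) \<partial>lborel)"
proof -
  have [measurable]: "g \<in> borel_measurable borel" using g by (rule smooth_borel_measurable)
  show ?thesis
    unfolding avg_def kernel_def
    by (subst integral_density) (auto simp: kernel_density_nonneg scaleR_conv_of_real mult.assoc)
qed

lemma test_function_avg_kernel: "test_function g \<Longrightarrow> test_function (avg (kernel s q) ray g)"
  by (rule test_function_avg[OF finite_measure_kernel ray_measurable_kernel _ AE_kernel])

lemma classical_laplacian_avg_kernel:
  "test_function g \<Longrightarrow> classical_laplacian (avg (kernel s q) ray g) = avg (kernel s q) ray (classical_laplacian g)"
  by (rule classical_laplacian_avg[OF finite_measure_kernel ray_measurable_kernel])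

end

text \<open>Fubini in (r, y); since \<open>w\<close> vanishes off the unit ball, restricting
  \<open>y\<close> to that ball loses nothing.\<close>

lemma avg_kernel_product:
  fixes g :: "real^'d \<Rightarrow> complex"
  assumes k: "continuous_on UNIV k" "\<And>r. 0 \<le> r \<Longrightarrow> r \<le> s \<Longrightarrow> k r \<ge> 0"
    and w: "continuous_on UNIV w" "\<And>y. w y \<ge> 0" "\<And>y. norm y > 1 \<Longrightarrow> w y = 0"
    and g: "smooth g"
  shows "avg (kernel s (\<lambda>z. k (fst z) * w (snd z))) ray g x
    = (\<integral>r. indicator {0..s} r *\<^sub>R (complex_of_real (k r) * radial w g x r) \<partial>lborel)"
proof -
  let ?q = "\<lambda>z::real \<times> (real^'d). k (fst z) * w (snd z)"
  have cq: "continuous_on UNIV ?q"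
    by (intro continuous_intros continuous_on_compose2[OF k(1)] continuous_on_compose2[OF w(1)]) auto
  have nq: "\<forall>z\<in>ray_domain s. ?q z \<ge> 0"
    using k(2) w(2) by (auto simp: ray_domain_def)
  have cg: "continuous_on UNIV (\<lambda>z. complex_of_real (?q z) * g (x + ray z))"
    unfolding ray_def
    by (intro continuous_intros continuous_on_compose2[OF smooth_continuous_on[OF g, of UNIV]] cq) auto
  let ?f = "\<lambda>z. indicator (ray_domain s) z *\<^sub>R (complex_of_real (?q z) * g (x + ray z))"
  have "avg (kernel s ?q) ray g x = (\<integral>z. ?f z \<partial>(lborel \<Otimes>\<^sub>M lborel))"
    by (subst lborel_prod) (rule avg_kernel[OF cq nq g])
  also have "\<dots> = (\<integral>r. \<integral>y. ?f (r, y) \<partial>lborel \<partial>lborel)"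
    by (rule lborel_pair.integral_fst'[symmetric]) (use kernel_integrable[OF cg, of s] in \<open>simp add: lborel_prod\<close>)
  also have "\<dots> = (\<integral>r. indicator {0..s} r *\<^sub>R (complex_of_real (k r) * radial w g x r) \<partial>lborel)"
  proof (rule Bochner_Integration.integral_cong[OF refl])
    fix r
    have "?f (r, y) = (indicator {0..s} r *\<^sub>R complex_of_real (k r)) * (complex_of_real (w y) * g (x + r *\<^sub>R y))" for y
      using w(3)[of y] by (cases "norm y > 1") (auto simp: indicator_def ray_domain_def ray_def)
    then show "(\<integral>y. ?f (r, y) \<partial>lborel) = indicator {0..s} r *\<^sub>R (complex_of_real (k r) * radial w g x r)"
      by (simp add: radial_def)
  qed
  finally show ?thesis .
qed

text \<open>Together with \<open>q_green\<close> below: the integrands of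
  \<open>radial_representation\<close>, read as densities on \<open>ray_domain s\<close>.\<close>

definition q_avg :: "real \<Rightarrow> real \<times> (real^'d) \<Rightarrow> real" where
  "q_avg s z = (2 * fst z / s\<^sup>2) * cap (snd z)"

definition q_green :: "real \<Rightarrow> real \<times> (real^'d) \<Rightarrow> real" where
  "q_green s z = ((1 - (fst z)\<^sup>2 / s\<^sup>2) * fst z) * sq_cap (snd z)"

lemma square_quotient_le: "0 \<le> r \<Longrightarrow> r \<le> s \<Longrightarrow> r\<^sup>2 / s\<^sup>2 \<le> (1::real)"
  by (auto simp: divide_le_eq intro!: power_mono)

lemma continuous_q_avg: "s > 0 \<Longrightarrow> continuous_on UNIV (q_avg s)"
  unfolding q_avg_def[abs_def]
  by (intro continuous_intros continuous_on_compose2[OF continuous_cap]) auto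

lemma continuous_q_green: "s > 0 \<Longrightarrow> continuous_on UNIV (q_green s)"
  unfolding q_green_def[abs_def]
  by (intro continuous_intros continuous_on_compose2[OF continuous_sq_cap]) auto

lemma q_avg_bounds: "z \<in> ray_domain s \<Longrightarrow> 0 \<le> q_avg s z" "z \<in> ray_domain s \<Longrightarrow> q_avg s z \<le> 8 / s\<^sup>2 * fst z"
proof -
  assume z: "z \<in> ray_domain s"
  then have f: "fst z \<ge> 0" by (auto simp: ray_domain_def)
  then show "0 \<le> q_avg s z" by (simp add: q_avg_def cap_nonneg)
  have "q_avg s z \<le> (2 * fst z / s\<^sup>2) * 4"
    unfolding q_avg_def using f by (intro mult_left_mono cap_le) auto
  then show "q_avg s z \<le> 8 / s\<^sup>2 * fst z" by simp
qed

text \<open>The bound by \<open>fst z\<close> leads to \<open>ray_potential\<close>; the one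
  retaining \<open>sq_cap\<close> is for the comparison with \<open>q_avg\<close>, which goes
  through \<open>sq_cap_le_cap\<close>.\<close>

lemma q_green_bounds: "z \<in> ray_domain s \<Longrightarrow> 0 \<le> q_green s z" "z \<in> ray_domain s \<Longrightarrow> q_green s z \<le> fst z"
  "z \<in> ray_domain s \<Longrightarrow> q_green s z \<le> fst z * sq_cap (snd z)"
proof -
  assume z: "z \<in> ray_domain s"
  then have f: "0 \<le> fst z" "fst z \<le> s" by (auto simp: ray_domain_def)
  then have k: "0 \<le> 1 - (fst z)\<^sup>2 / s\<^sup>2" "1 - (fst z)\<^sup>2 / s\<^sup>2 \<le> 1" using square_quotient_le[OF f] by auto
  then show "0 \<le> q_green s z" using f unfolding q_green_def by (intro mult_nonneg_nonneg sq_cap_bounds)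
  show *: "q_green s z \<le> fst z * sq_cap (snd z)"
    unfolding q_green_def by (intro mult_right_mono mult_left_le_one_le f k sq_cap_bounds)
  also have "\<dots> \<le> fst z * 1" by (intro mult_left_mono f sq_cap_bounds)
  finally show "q_green s z \<le> fst z" by simp
qed

lemma kernels_nonneg: "\<forall>z\<in>ray_domain s. 0 \<le> q_avg s z" "\<forall>z\<in>ray_domain s. 0 \<le> q_green s z"
  using q_avg_bounds(1) q_green_bounds(1) by auto

text \<open>The radius \<open>s\<close> is free. Small \<open>s\<close> will make the relative bound
  of the potential small; the choice \<open>\<mu> * s\<^sup>2 = 8\<close> will make the averaging
  kernel minus \<mu> times the Green kernel nonnegative.\<close>

lemma green_identity:
  assumes g: "test_function g" and s: "s > 0"
  shows "complex_of_real (\<integral>y. cap (y::real^'d) \<partial>lborel) * g (x::real^'d) =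
    avg (kernel s (q_avg s)) ray g x - avg (kernel s (q_green s)) ray (classical_laplacian g) x"
proof -
  have "avg (kernel s (q_avg s)) ray g x
      = (\<integral>r. indicator {0..s} r *\<^sub>R (complex_of_real (2 * r / s\<^sup>2) * radial cap g x r) \<partial>lborel)"
    unfolding q_avg_def[abs_def]
    by (rule avg_kernel_product) (use s g in \<open>auto intro!: continuous_intros continuous_cap simp: cap_nonneg cap_zero test_function_smooth\<close>)
  moreover have "avg (kernel s (q_green s)) ray (classical_laplacian g) x
      = (\<integral>r. indicator {0..s} r *\<^sub>R (complex_of_real ((1 - r\<^sup>2 / s\<^sup>2) * r) * radial sq_cap (classical_laplacian g) x r) \<partial>lborel)"
    unfolding q_green_def[abs_def]
    by (rule avg_kernel_product)
      (use s test_function_laplacian[OF g] in \<open>auto intro!: continuous_intros continuous_sq_cap mult_nonneg_nonneg square_quotient_le simp: sq_cap_bounds cap_zero test_function_smooth\<close>)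
  ultimately show ?thesis using radial_representation[OF g s, of x] by simp
qed

lemma kernel_mass_product:
  fixes w :: "real^'d \<Rightarrow> real"
  assumes k: "continuous_on UNIV k"
    and w: "continuous_on UNIV w" "\<And>y. norm y > 1 \<Longrightarrow> w y = 0"
  shows "kernel_mass s (\<lambda>z. k (fst z) * w (snd z)) = (\<integral>r. indicator {0..s} r * k r \<partial>lborel) * (\<integral>y. w y \<partial>lborel)"
proof -
  let ?q = "\<lambda>z::real \<times> (real^'d). k (fst z) * w (snd z)"
  have cq: "continuous_on UNIV ?q"
    by (intro continuous_intros continuous_on_compose2[OF k(1)] continuous_on_compose2[OF w(1)]) auto
  have "kernel_mass s ?q = (\<integral>z. indicator (ray_domain s) z * ?q z \<partial>(lborel \<Otimes>\<^sub>M lborel))"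
    unfolding kernel_mass_def by (subst lborel_prod) (rule refl)
  also have "\<dots> = (\<integral>r. \<integral>y. indicator (ray_domain s) (r, y) * ?q (r, y) \<partial>lborel \<partial>lborel)"
    by (rule lborel_pair.integral_fst'[symmetric]) (use kernel_integrable[OF cq, of s] in \<open>simp add: lborel_prod\<close>)
  also have "\<dots> = (\<integral>r. (indicator {0..s} r * k r) * (\<integral>y. w y \<partial>lborel) \<partial>lborel)"
  proof (rule Bochner_Integration.integral_cong[OF refl])
    fix r
    have "indicator (ray_domain s) (r, y) * ?q (r, y) = (indicator {0..s} r * k r) * w y" for y
      using w(2)[of y] by (cases "norm y > 1") (auto simp: indicator_def ray_domain_def ray_def)
    then show "(\<integral>y. indicator (ray_domain s) (r, y) * ?q (r, y) \<partial>lborel) = (indicator {0..s} r * k r) * (\<integral>y. w y \<partial>lborel)"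
      by (simp only: integral_mult_right_zero)
  qed
  finally show ?thesis by simp
qed

text \<open>The radial weight 2 r / s^2 has integral 1 on [0, s], so the averaging kernel has
  exactly the mass that stands before \<open>g x\<close> in \<open>green_identity\<close>. Removing
  any positive part of it therefore leaves a strict contraction.\<close>

lemma kernel_mass_q_avg:
  assumes "s > 0"
  shows "kernel_mass s (q_avg s :: real \<times> (real^'d) \<Rightarrow> real) = (\<integral>y. cap (y::real^'d) \<partial>lborel)"
proof -
  have "(\<integral>r. indicator {0..s} r *\<^sub>R (2 * r / s\<^sup>2) \<partial>lborel) = s\<^sup>2 / s\<^sup>2 - 0\<^sup>2 / s\<^sup>2"
    by (rule integral_FTC_Icc)
      (use assms in \<open>auto intro!: derivative_eq_intros continuous_intros simp: divide_simps power2_eq_square power4_eq_xxxx simp flip: has_real_derivative_iff_has_vector_derivative\<close>)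
  also have "\<dots> = 1" using assms by simp
  finally have "(\<integral>r. indicator {0..s} r * (2 * r / s\<^sup>2) \<partial>lborel) = 1" by (simp only: real_scaleR_def)
  then show ?thesis
    unfolding q_avg_def[abs_def]
    by (subst kernel_mass_product) (use assms in \<open>auto intro!: continuous_intros continuous_cap simp: cap_zero\<close>)
qed

lemma kernel_mass_q_green:
  assumes "s > 0"
  shows "kernel_mass s (q_green s :: real \<times> (real^'d) \<Rightarrow> real) > 0"
proof -
  have "(\<integral>r. indicator {0..s} r *\<^sub>R ((1 - r\<^sup>2 / s\<^sup>2) * r) \<partial>lborel) = (s\<^sup>2 / 2 - s ^ 4 / (4 * s\<^sup>2)) - (0\<^sup>2 / 2 - 0 ^ 4 / (4 * s\<^sup>2))"
    by (rule integral_FTC_Icc)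
      (use assms in \<open>auto intro!: derivative_eq_intros continuous_intros simp: field_simps power2_eq_square power3_eq_cube power4_eq_xxxx simp flip: has_real_derivative_iff_has_vector_derivative\<close>)
  also have "\<dots> = s\<^sup>2 / 4" using assms by (simp add: field_simps power2_eq_square power4_eq_xxxx)
  finally have "(\<integral>r. indicator {0..s} r * ((1 - r\<^sup>2 / s\<^sup>2) * r) \<partial>lborel) = s\<^sup>2 / 4" by (simp only: real_scaleR_def)
  then have "kernel_mass s (q_green s :: real \<times> (real^'d) \<Rightarrow> real) = s\<^sup>2 / 4 * (\<integral>y. sq_cap (y::real^'d) \<partial>lborel)"
    unfolding q_green_def[abs_def]
    by (subst kernel_mass_product) (use assms in \<open>auto intro!: continuous_intros continuous_sq_cap simp: cap_zero\<close>)
  then show ?thesis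
    using assms by (simp only:) (intro mult_pos_pos integral_cap_pos(2); simp)
qed

section \<open>Cauchy-Schwarz in [0, \<infinity>] and the L^2 bound for averages\<close>

lemma two_mult_le_ennreal:
  assumes "t > 0"
  shows "2 * (x * y) \<le> ennreal t * x\<^sup>2 + ennreal (1 / t) * (y::ennreal)\<^sup>2"
proof (cases "x = \<infinity> \<or> y = \<infinity>")
  case True
  then show ?thesis using assms by (auto simp: power2_eq_square ennreal_mult_top ennreal_top_mult top_unique)
next
  case False
  then obtain a b where ab: "a \<ge> 0" "b \<ge> 0" "x = ennreal a" "y = ennreal b"
    by (metis ennreal_cases infinity_ennreal_def)
  have "2 * (sqrt t * a) * (b / sqrt t) \<le> (sqrt t * a)\<^sup>2 + (b / sqrt t)\<^sup>2"
    by (rule sum_squares_bound)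
  then have "2 * (a * b) \<le> t * a\<^sup>2 + (1 / t) * b\<^sup>2"
    using assms by (simp add: power_mult_distrib power_divide)
  then have "ennreal (2 * (a * b)) \<le> ennreal (t * a\<^sup>2 + (1 / t) * b\<^sup>2)" by (rule ennreal_leI)
  moreover have "ennreal (t * a\<^sup>2 + (1 / t) * b\<^sup>2) = ennreal t * x\<^sup>2 + ennreal (1 / t) * y\<^sup>2"
    using ab assms by (subst ennreal_plus) (auto simp: ennreal_mult[symmetric] ennreal_power)
  moreover have "ennreal (2 * (a * b)) = 2 * (x * y)"
    using ab by (simp add: ennreal_mult)
  ultimately show ?thesis by simp
qed

lemma nn_integral_cauchy_schwarz:
  assumes [measurable]: "f \<in> borel_measurable M" "g \<in> borel_measurable M"
  shows "(\<integral>\<^sup>+x. f x * g x \<partial>M)\<^sup>2 \<le> (\<integral>\<^sup>+x. (f x)\<^sup>2 \<partial>M) * (\<integral>\<^sup>+x. (g x)\<^sup>2 \<partial>M)"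
proof -
  let ?A = "\<integral>\<^sup>+x. (f x)\<^sup>2 \<partial>M" and ?B = "\<integral>\<^sup>+x. (g x)\<^sup>2 \<partial>M" and ?C = "\<integral>\<^sup>+x. f x * g x \<partial>M"
  have zero: "?C = 0" if "?A = 0 \<or> ?B = 0"
  proof -
    have "AE x in M. f x * g x = 0"
      using that by (auto simp: nn_integral_0_iff_AE elim!: eventually_mono)
    then show ?thesis by (simp add: nn_integral_0_iff_AE)
  qed
  consider "?A = 0 \<or> ?B = 0" | "?A \<noteq> 0" "?B \<noteq> 0" "?A = \<infinity> \<or> ?B = \<infinity>" | "?A \<noteq> 0" "?B \<noteq> 0" "?A \<noteq> \<infinity>" "?B \<noteq> \<infinity>" by blast
  then show ?thesis
  proof cases
    case 1
    then show ?thesis using zero by simp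
  next
    case 2
    then have "?A * ?B = \<infinity>" by (auto simp: ennreal_mult_top ennreal_top_mult)
    then show ?thesis by simp
  next
    case 3
    then obtain a b where ab: "a > 0" "b > 0" "?A = ennreal a" "?B = ennreal b"
      by (metis ennreal_cases infinity_ennreal_def ennreal_0 less_eq_real_def)
    \<comment> \<open>The minimiser of t a + b / t.\<close>
    define t where "t = sqrt (b / a)"
    have t: "t > 0" using ab by (simp add: t_def)
    have "2 * ?C = (\<integral>\<^sup>+x. 2 * (f x * g x) \<partial>M)" by (simp add: nn_integral_cmult)
    also have "\<dots> \<le> (\<integral>\<^sup>+x. ennreal t * (f x)\<^sup>2 + ennreal (1 / t) * (g x)\<^sup>2 \<partial>M)"
      by (intro nn_integral_mono two_mult_le_ennreal t)
    also have "\<dots> = ennreal t * ?A + ennreal (1 / t) * ?B"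
      by (simp add: nn_integral_add nn_integral_cmult)
    also have "\<dots> = ennreal (t * a + 1 / t * b)"
      using ab t by (subst ennreal_plus) (auto simp: ennreal_mult[symmetric])
    also have "t * a + 1 / t * b = 2 * sqrt (a * b)"
    proof -
      have "t * a = sqrt (a * b)" "1 / t * b = sqrt (a * b)"
        using ab by (simp_all add: t_def real_sqrt_divide real_sqrt_mult field_simps)
      then show ?thesis by simp
    qed
    finally have le: "2 * ?C \<le> ennreal (2 * sqrt (a * b))" .
    have "?C \<noteq> \<infinity>" using le by (auto simp: ennreal_mult_top top_unique)
    then obtain c where c: "c \<ge> 0" "?C = ennreal c" by (metis ennreal_cases infinity_ennreal_def)
    have "ennreal (2 * c) \<le> ennreal (2 * sqrt (a * b))" using le c by (simp add: ennreal_mult)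
    then have "c \<le> sqrt (a * b)" using ab by simp
    then have "c\<^sup>2 \<le> a * b" using c(1) ab by (metis power_mono real_sqrt_pow2 mult_nonneg_nonneg less_imp_le)
    then show ?thesis using ab c by (simp add: ennreal_power flip: ennreal_mult)
  qed
qed

lemma nn_integral_lborel_translate:
  fixes f :: "'a::euclidean_space \<Rightarrow> ennreal"
  assumes [measurable]: "f \<in> borel_measurable borel"
  shows "(\<integral>\<^sup>+x. f (x + c) \<partial>lborel) = (\<integral>\<^sup>+x. f x \<partial>lborel)"
proof -
  have "(\<integral>\<^sup>+x. f x \<partial>lborel) = (\<integral>\<^sup>+x. f x \<partial>distr lborel borel ((+) c))" by (simp add: lborel_distr_plus)
  also have "\<dots> = (\<integral>\<^sup>+x. f (c + x) \<partial>lborel)" by (rule nn_integral_distr) auto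
  finally show ?thesis by (simp add: add.commute)
qed

text \<open>Minkowski's inequality for superpositions of translates: Cauchy-Schwarz against the
  total mass, then Tonelli and translation invariance.\<close>

lemma avg_L2_norm:
  fixes \<psi> :: "real^'d \<Rightarrow> complex"
  assumes \<nu>: "finite_measure \<nu>" "sets \<nu> = sets borel" and \<tau>[measurable]: "\<tau> \<in> borel_measurable borel"
    and \<psi>: "test_function \<psi>"
  shows "avg \<nu> \<tau> \<psi> \<in> L2" "L2_norm (avg \<nu> \<tau> \<psi>) \<le> measure \<nu> (space \<nu>) * L2_norm \<psi>"
proof -
  interpret finite_measure \<nu> by fact
  interpret pair_sigma_finite \<nu> "lborel :: (real^'d) measure" ..
  have [measurable_cong]: "sets \<nu> = sets borel" by fact
  have [measurable]: "\<psi> \<in> borel_measurable borel" using \<psi> by (rule test_function_borel)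
  have \<tau>\<nu>: "\<tau> \<in> borel_measurable \<nu>" by measurable
  define m where "m = measure \<nu> (space \<nu>)"
  have m: "m \<ge> 0" "emeasure \<nu> (space \<nu>) = ennreal m" by (simp_all add: m_def emeasure_eq_measure)
  have pt: "ennreal ((cmod (avg \<nu> \<tau> \<psi> x))\<^sup>2) \<le> ennreal m * (\<integral>\<^sup>+z. ennreal ((cmod (\<psi> (x + \<tau> z)))\<^sup>2) \<partial>\<nu>)" for x
  proof -
    have "ennreal (cmod (avg \<nu> \<tau> \<psi> x)) \<le> (\<integral>\<^sup>+z. ennreal (cmod (\<psi> (x + \<tau> z))) \<partial>\<nu>)"
      unfolding avg_def by (rule integral_norm_bound_ennreal) (rule integrable_avg[OF \<nu>(1) \<tau>\<nu> \<psi>])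
    then have "(ennreal (cmod (avg \<nu> \<tau> \<psi> x)))\<^sup>2 \<le> (\<integral>\<^sup>+z. 1 * ennreal (cmod (\<psi> (x + \<tau> z))) \<partial>\<nu>)\<^sup>2"
      by (intro power_mono) auto
    also have "\<dots> \<le> (\<integral>\<^sup>+z. 1\<^sup>2 \<partial>\<nu>) * (\<integral>\<^sup>+z. (ennreal (cmod (\<psi> (x + \<tau> z))))\<^sup>2 \<partial>\<nu>)"
      by (rule nn_integral_cauchy_schwarz) auto
    finally show ?thesis by (simp add: ennreal_power m(2))
  qed
  have "(\<integral>\<^sup>+x. ennreal ((cmod (avg \<nu> \<tau> \<psi> x))\<^sup>2) \<partial>lborel) \<le> (\<integral>\<^sup>+x. ennreal m * (\<integral>\<^sup>+z. ennreal ((cmod (\<psi> (x + \<tau> z)))\<^sup>2) \<partial>\<nu>) \<partial>lborel)"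
    by (intro nn_integral_mono pt)
  also have "\<dots> = ennreal m * (\<integral>\<^sup>+x. \<integral>\<^sup>+z. ennreal ((cmod (\<psi> (x + \<tau> z)))\<^sup>2) \<partial>\<nu> \<partial>lborel)"
    by (rule nn_integral_cmult) measurable
  also have "(\<integral>\<^sup>+x. \<integral>\<^sup>+z. ennreal ((cmod (\<psi> (x + \<tau> z)))\<^sup>2) \<partial>\<nu> \<partial>lborel) = (\<integral>\<^sup>+z. \<integral>\<^sup>+x. ennreal ((cmod (\<psi> (x + \<tau> z)))\<^sup>2) \<partial>lborel \<partial>\<nu>)"
    by (rule Fubini') measurable
  also have "\<dots> = (\<integral>\<^sup>+z. ennreal ((L2_norm \<psi>)\<^sup>2) \<partial>\<nu>)"
    using L2_nn_integral[OF test_function_L2[OF \<psi>]]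
    by (intro nn_integral_cong, subst nn_integral_lborel_translate[where f = "\<lambda>x. ennreal ((cmod (\<psi> x))\<^sup>2)"]) auto
  also have "ennreal m * \<dots> = ennreal ((m * L2_norm \<psi>)\<^sup>2)"
    using m by (simp add: power_mult_distrib ennreal_mult power2_eq_square mult_ac)
  finally have *: "(\<integral>\<^sup>+x. ennreal ((cmod (avg \<nu> \<tau> \<psi> x))\<^sup>2) \<partial>lborel) \<le> ennreal ((m * L2_norm \<psi>)\<^sup>2)" .
  have "avg \<nu> \<tau> \<psi> \<in> borel_measurable borel"
    by (intro smooth_borel_measurable smooth_avg[OF \<nu>(1) \<tau>\<nu> \<psi>])
  from L2_iff_nn_integral[OF this mult_nonneg_nonneg[OF m(1) L2_norm_nonneg] *]
  show "avg \<nu> \<tau> \<psi> \<in> L2" "L2_norm (avg \<nu> \<tau> \<psi>) \<le> measure \<nu> (space \<nu>) * L2_norm \<psi>"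
    by (auto simp: m_def)
qed

section \<open>Operators with dense range\<close>

definition dense_range :: "((real^'d \<Rightarrow> complex) \<Rightarrow> real^'d \<Rightarrow> complex) \<Rightarrow> bool" where
  "dense_range T \<longleftrightarrow> (\<forall>h\<in>L2. \<forall>\<epsilon>>0. \<exists>\<phi>. test_function \<phi> \<and> L2_norm (\<lambda>x. h x - T \<phi> x) < \<epsilon>)"

definition additive_operator :: "((real^'d \<Rightarrow> complex) \<Rightarrow> real^'d \<Rightarrow> complex) \<Rightarrow> bool" where
  "additive_operator T \<longleftrightarrow> (\<forall>\<phi>. test_function \<phi> \<longrightarrow> T \<phi> \<in> L2) \<and>
     (\<forall>\<phi> \<psi>. test_function \<phi> \<longrightarrow> test_function \<psi> \<longrightarrow> T (\<lambda>x. \<phi> x + \<psi> x) = (\<lambda>x. T \<phi> x + T \<psi> x))"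

lemma additive_operator_add:
  "additive_operator T \<Longrightarrow> test_function \<phi> \<Longrightarrow> test_function \<psi> \<Longrightarrow> T (\<lambda>x. \<phi> x + \<psi> x) = (\<lambda>x. T \<phi> x + T \<psi> x)"
  by (simp add: additive_operator_def)

lemma additive_operator_zero:
  assumes "additive_operator T"
  shows "T (\<lambda>x. 0) = (\<lambda>x. 0)"
  using additive_operator_add[OF assms test_function_zero test_function_zero] by (simp add: fun_eq_iff)

text \<open>A Neumann series in approximate form: an approximate solution that removes a fixed
  fraction of the error is sought again for the remainder, whose norm after n rounds is at most
  \<open>b ^ n * L2_norm h\<close>.\<close>

lemma dense_range_contraction:
  assumes T: "additive_operator T" and a: "a < 1"
    and contr: "\<And>h. h \<in> L2 \<Longrightarrow> L2_norm h > 0 \<Longrightarrow> \<exists>\<phi>. test_function \<phi> \<and> L2_norm (\<lambda>x. h x - T \<phi> x) \<le> a * L2_norm h"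
  shows "dense_range T"
  unfolding dense_range_def
proof (intro ballI allI impI)
  fix h :: "real^'a \<Rightarrow> complex" and \<epsilon> :: real assume h: "h \<in> L2" and e: "\<epsilon> > 0"
  \<comment> \<open>The sign of \<open>a\<close> is open; powers are taken of a nonnegative ratio
    below 1.\<close>
  define b where "b = max a 0"
  have b: "0 \<le> b" "b < 1" using a by (auto simp: b_def)
  have contr': "\<exists>\<phi>. test_function \<phi> \<and> L2_norm (\<lambda>x. h x - T \<phi> x) \<le> b * L2_norm h" if hL: "h \<in> L2" for h
  proof (cases "L2_norm h > 0")
    case True
    then obtain \<phi> where \<phi>: "test_function \<phi>" "L2_norm (\<lambda>x. h x - T \<phi> x) \<le> a * L2_norm h"
      using contr[OF hL] by blast
    moreover have "a * L2_norm h \<le> b * L2_norm h" using True by (intro mult_right_mono) (auto simp: b_def)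
    ultimately show ?thesis by (meson order_trans)
  next
    case False
    then have "L2_norm h = 0" using L2_norm_nonneg[of h] by simp
    then show ?thesis
      by (intro exI[of _ "\<lambda>x. 0"]) (simp add: test_function_zero additive_operator_zero[OF T])
  qed
  have "\<exists>\<phi>. test_function \<phi> \<and> L2_norm (\<lambda>x. h x - T \<phi> x) \<le> b ^ n * L2_norm h" for n
  proof (induction n)
    case 0
    show ?case
      by (intro exI[of _ "\<lambda>x. 0"]) (simp add: test_function_zero additive_operator_zero[OF T])
  next
    case (Suc n)
    then obtain \<phi> where \<phi>: "test_function \<phi>" "L2_norm (\<lambda>x. h x - T \<phi> x) \<le> b ^ n * L2_norm h" by blast
    have d: "(\<lambda>x. h x - T \<phi> x) \<in> L2" using T \<phi> h by (intro L2_diff) (auto simp: additive_operator_def)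
    obtain \<psi> where \<psi>: "test_function \<psi>" "L2_norm (\<lambda>x. h x - T \<phi> x - T \<psi> x) \<le> b * L2_norm (\<lambda>x. h x - T \<phi> x)"
      using contr'[OF d] by blast
    have "(\<lambda>x. h x - T \<phi> x - T \<psi> x) = (\<lambda>x. h x - T (\<lambda>x. \<phi> x + \<psi> x) x)"
      using T \<phi>(1) \<psi>(1) by (simp add: additive_operator_def diff_diff_eq)
    moreover have "b * L2_norm (\<lambda>x. h x - T \<phi> x) \<le> b * (b ^ n * L2_norm h)"
      using \<phi>(2) b(1) by (rule mult_left_mono)
    ultimately show ?case
      using \<psi> test_function_add[OF \<phi>(1) \<psi>(1)] by (intro exI[of _ "\<lambda>x. \<phi> x + \<psi> x"]) (simp add: mult.assoc)
  qed
  moreover have "(\<lambda>n. b ^ n * L2_norm h) \<longlonglongrightarrow> 0 * L2_norm h"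
    using b by (intro tendsto_intros LIMSEQ_realpow_zero) auto
  then have "\<forall>\<^sub>F n in sequentially. b ^ n * L2_norm h < \<epsilon>"
    using e by (intro order_tendstoD(2)) auto
  then obtain n where "b ^ n * L2_norm h < \<epsilon>"
    using eventually_happens'[OF sequentially_bot] by blast
  ultimately show "\<exists>\<phi>. test_function \<phi> \<and> L2_norm (\<lambda>x. h x - T \<phi> x) < \<epsilon>"
    by (meson le_less_trans)
qed

text \<open>The Kato-Rellich argument at the level of ranges: choose \<phi> with
  \<open>S \<phi>\<close> close to \<open>h\<close>; then \<open>T \<phi>\<close> misses
  \<open>h\<close> by little more than a times the norm of \<open>h\<close>, which is a definite
  fraction of it.\<close>

lemma dense_range_perturb:
  assumes S: "additive_operator S" "dense_range S" and T: "additive_operator T"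
    and a: "0 \<le> a" "a < 1"
    and bd: "\<And>\<phi>. test_function \<phi> \<Longrightarrow> L2_norm (\<lambda>x. S \<phi> x - T \<phi> x) \<le> a * L2_norm (S \<phi>)"
  shows "dense_range T"
proof (rule dense_range_contraction[OF T])
  show "(1 + a) / 2 < 1" using a by simp
  fix h :: "real^'a \<Rightarrow> complex" assume h: "h \<in> L2" "L2_norm h > 0"
  \<comment> \<open>With this \<delta> the total error factor \<delta> + a + a \<delta> is at most
    (1 + a) / 2.\<close>
  define \<delta> where "\<delta> = (1 - a) / 4"
  have \<delta>: "\<delta> > 0" "\<delta> + a + \<delta> = (1 + a) / 2" using a by (auto simp: \<delta>_def field_simps)
  then have "a * \<delta> \<le> \<delta>" using a by (intro mult_left_le_one_le) auto
  note \<delta> = \<delta> this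
  have "\<delta> * L2_norm h > 0" using \<delta>(1) h(2) by simp
  then obtain \<phi> where \<phi>: "test_function \<phi>" "L2_norm (\<lambda>x. h x - S \<phi> x) < \<delta> * L2_norm h"
    using S(2) h(1) unfolding dense_range_def by blast
  have L: "S \<phi> \<in> L2" "T \<phi> \<in> L2" using S(1) T \<phi>(1) by (auto simp: additive_operator_def)
  have "L2_norm (S \<phi>) \<le> (1 + \<delta>) * L2_norm h"
    using L2_norm_reverse_triangle[OF h(1) L(1)] \<phi>(2) by (simp add: algebra_simps)
  then have "a * L2_norm (S \<phi>) \<le> a * ((1 + \<delta>) * L2_norm h)" using a(1) by (rule mult_left_mono)
  then have "L2_norm (\<lambda>x. h x - T \<phi> x) \<le> \<delta> * L2_norm h + a * ((1 + \<delta>) * L2_norm h)"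
    using L2_norm_triangle_diff[OF h(1) L] \<phi> bd[OF \<phi>(1)] by linarith
  also have "\<dots> = (\<delta> + a + a * \<delta>) * L2_norm h" by (simp add: algebra_simps)
  also have "\<dots> \<le> (1 + a) / 2 * L2_norm h" using \<delta> h(2) by (intro mult_right_mono) linarith+
  finally show "\<exists>\<phi>. test_function \<phi> \<and> L2_norm (\<lambda>x. h x - T \<phi> x) \<le> (1 + a) / 2 * L2_norm h"
    using \<phi>(1) by blast
qed

definition shifted_laplacian :: "real \<Rightarrow> (real^'d \<Rightarrow> complex) \<Rightarrow> real^'d \<Rightarrow> complex" where
  "shifted_laplacian \<mu> \<phi> x = complex_of_real \<mu> * \<phi> x - classical_laplacian \<phi> x"

lemma test_function_shifted_laplacian: "test_function \<phi> \<Longrightarrow> test_function (shifted_laplacian \<mu> \<phi>)"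
  unfolding shifted_laplacian_def[abs_def]
  by (intro test_function_diff test_function_cmult test_function_laplacian)

lemma additive_shifted_laplacian: "additive_operator (shifted_laplacian \<mu>)"
  unfolding additive_operator_def
proof (intro conjI allI impI)
  fix \<phi> :: "real^'a \<Rightarrow> complex" assume \<phi>: "test_function \<phi>"
  then show "shifted_laplacian \<mu> \<phi> \<in> L2" by (intro test_function_L2 test_function_shifted_laplacian)
  fix \<psi> :: "real^'a \<Rightarrow> complex" assume "test_function \<psi>"
  with \<phi> show "shifted_laplacian \<mu> (\<lambda>x. \<phi> x + \<psi> x) = (\<lambda>x. shifted_laplacian \<mu> \<phi> x + shifted_laplacian \<mu> \<psi> x)"
    by (simp add: shifted_laplacian_def fun_eq_iff classical_laplacian_add test_function_smooth algebra_simps)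
qed

text \<open>If \<open>\<mu> s\<^sup>2 \<le> 8\<close>, then \<open>q_avg s - \<mu> q_green s\<close> is a nonnegative kernel whose mass is less
  than that of \<open>q_avg s\<close>; hence \<open>\<mu> - \<Delta>\<close> applied to the average of \<open>\<psi>\<close> against \<open>q_green s\<close> is a
  multiple of \<open>\<psi>\<close> up to a strictly smaller error.\<close>

lemma dense_range_shifted_laplacian:
  assumes \<mu>: "\<mu> > 0"
  shows "dense_range (shifted_laplacian \<mu> :: (real^'d \<Rightarrow> complex) \<Rightarrow> _)"
proof -
  \<comment> \<open>Equality in \<open>\<mu> * s\<^sup>2 = 8\<close> turns \<mu> r
    \<open>sq_cap\<close> into (2 r / s^2) (4 \<open>sq_cap\<close>), which
    \<open>sq_cap_le_cap\<close> compares with \<open>q_avg\<close>.\<close>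
  define s where "s = sqrt (8 / \<mu>)"
  have s: "s > 0" "\<mu> * s\<^sup>2 = 8" using \<mu> by (simp_all add: s_def)
  define c where "c = (\<integral>y. cap (y::real^'d) \<partial>lborel)"
  have c: "c > 0" unfolding c_def by (rule integral_cap_pos)
  define q :: "real \<times> (real^'d) \<Rightarrow> real" where "q z = q_avg s z - \<mu> * q_green s z" for z
  have qc: "continuous_on UNIV q" unfolding q_def[abs_def]
    by (intro continuous_intros continuous_q_avg continuous_q_green s)
  have qn: "\<forall>z\<in>ray_domain s. q z \<ge> 0"
  proof
    fix z :: "real \<times> (real^'d)" assume z: "z \<in> ray_domain s"
    have f: "fst z \<ge> 0" using z by (auto simp: ray_domain_def)
    have "\<mu> * q_green s z \<le> \<mu> * (fst z * sq_cap (snd z))" using \<mu> by (intro mult_left_mono q_green_bounds z) auto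
    also have "\<dots> = 2 * fst z / s\<^sup>2 * (4 * sq_cap (snd z))" using s by (simp add: field_simps)
    also have "\<dots> \<le> q_avg s z" unfolding q_avg_def using f by (intro mult_left_mono sq_cap_le_cap) auto
    finally show "q z \<ge> 0" by (simp add: q_def)
  qed
  note A = continuous_q_avg[OF s(1), where 'a = 'd] kernels_nonneg(1)
  note N = continuous_q_green[OF s(1), where 'a = 'd] kernels_nonneg(2)
  have fin: "finite_measure (kernel s q)" by (rule finite_measure_kernel[OF qc qn])
  define m where "m = kernel_mass s (q_green s :: real \<times> (real^'d) \<Rightarrow> real)"
  have m: "m > 0" unfolding m_def by (rule kernel_mass_q_green[OF s(1)])
  have mass: "kernel_mass s q = c - \<mu> * m"
  proof -
    have "kernel_mass s q = (\<integral>z. indicator (ray_domain s) z *\<^sub>R (q_avg s :: real \<times> (real^'d) \<Rightarrow> real) z - \<mu> * (indicator (ray_domain s) z *\<^sub>R q_green s z) \<partial>lborel)"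
      unfolding kernel_mass_def q_def by (simp add: algebra_simps)
    also have "\<dots> = kernel_mass s (q_avg s :: real \<times> (real^'d) \<Rightarrow> real) - \<mu> * m"
      unfolding kernel_mass_def m_def
      using kernel_integrable[OF A(1), of s] kernel_integrable[OF N(1), of s] by simp
    finally show ?thesis by (simp add: c_def kernel_mass_q_avg[OF s(1)])
  qed
  have mass0: "c - \<mu> * m \<ge> 0" using kernel_mass_nonneg[OF qc qn] mass by simp
  have meas: "measure (kernel s q) (space (kernel s q)) = c - \<mu> * m"
    using mass0 by (simp add: measure_def space_kernel emeasure_kernel[OF qc qn] mass)
  define a where "a = (c - \<mu> * m) / c"
  have a: "0 \<le> a" "a < 1" using c mass0 \<mu> m by (auto simp: a_def)
  have avgE: "avg (kernel s q) ray \<psi> x = avg (kernel s (q_avg s)) ray \<psi> x - complex_of_real \<mu> * avg (kernel s (q_green s)) ray \<psi> x"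
    if \<psi>: "test_function \<psi>" for \<psi> :: "real^'d \<Rightarrow> complex" and x
  proof -
    note sm = test_function_smooth[OF \<psi>]
    have ct: "continuous_on UNIV (\<lambda>z::real \<times> (real^'d). \<psi> (x + ray z))"
      unfolding ray_def by (intro continuous_on_compose2[OF smooth_continuous_on[OF sm, of UNIV]] continuous_intros) auto
    have i: "integrable lborel (\<lambda>z. indicator (ray_domain s) z *\<^sub>R (complex_of_real (k z) * \<psi> (x + ray z)))"
      if "continuous_on UNIV k" for k :: "real \<times> (real^'d) \<Rightarrow> real"
      using that ct by (intro kernel_integrable continuous_intros)
    have "avg (kernel s q) ray \<psi> x = (\<integral>z. indicator (ray_domain s) z *\<^sub>R (complex_of_real (q_avg s z) * \<psi> (x + ray z))
        - complex_of_real \<mu> * (indicator (ray_domain s) z *\<^sub>R (complex_of_real (q_green s z) * \<psi> (x + ray z))) \<partial>lborel)"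
      unfolding avg_kernel[OF qc qn sm] by (rule Bochner_Integration.integral_cong) (auto simp: q_def algebra_simps scaleR_conv_of_real)
    also have "\<dots> = avg (kernel s (q_avg s)) ray \<psi> x - complex_of_real \<mu> * avg (kernel s (q_green s)) ray \<psi> x"
      unfolding avg_kernel[OF A sm] avg_kernel[OF N sm]
      by (subst Bochner_Integration.integral_diff[OF i[OF A(1)] integrable_mult_right[OF i[OF N(1)]]]) (simp only: integral_mult_right_zero)
    finally show ?thesis .
  qed
  show ?thesis
  proof (rule dense_range_contraction[OF additive_shifted_laplacian])
    show "(1 + a) / 2 < 1" using a by simp
    fix h :: "real^'d \<Rightarrow> complex" assume h: "h \<in> L2" "L2_norm h > 0"
    define \<delta> where "\<delta> = (1 - a) / 4"
    have \<delta>: "\<delta> > 0" "\<delta> + a + \<delta> = (1 + a) / 2" using a by (auto simp: \<delta>_def field_simps)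
    then have "a * \<delta> \<le> \<delta>" using a by (intro mult_left_le_one_le) auto
    note \<delta> = \<delta> this
    have "\<delta> * L2_norm h > 0" using \<delta>(1) h(2) by simp
    then obtain \<psi> where \<psi>: "test_function \<psi>" "L2_norm (\<lambda>x. h x - \<psi> x) < \<delta> * L2_norm h"
      using test_functions_dense[OF h(1)] by blast
    have \<psi>L: "\<psi> \<in> L2" by (rule test_function_L2[OF \<psi>(1)])
    \<comment> \<open>Write A and G for the averages against \<open>q_avg s\<close> and
      \<open>q_green s\<close>. By the Green identity c \<psi> = A \<psi> - G \<Delta>\<psi>, so u =
      G \<psi> / c satisfies \<psi> - (\<mu> - \<Delta>) u = (A - \<mu> G) \<psi> / c, which is the
      remainder \<open>e\<close>.\<close>
    define u where "u x = complex_of_real (1 / c) * avg (kernel s (q_green s)) ray \<psi> x" for x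
    have ut: "test_function u"
      unfolding u_def[abs_def] by (intro test_function_cmult test_function_avg_kernel[OF N] \<psi>)
    have Lu: "classical_laplacian u x = complex_of_real (1 / c) * avg (kernel s (q_green s)) ray (classical_laplacian \<psi>) x" for x
      unfolding u_def[abs_def]
      by (subst classical_laplacian_cmult) (use test_function_smooth[OF test_function_avg_kernel[OF N \<psi>(1)]] classical_laplacian_avg_kernel[OF N \<psi>(1)] in auto)
    define e where "e x = complex_of_real (1 / c) * avg (kernel s q) ray \<psi> x" for x
    have dif: "\<psi> x - shifted_laplacian \<mu> u x = e x" for x
    proof -
      have g: "complex_of_real c * \<psi> x = avg (kernel s (q_avg s)) ray \<psi> x - avg (kernel s (q_green s)) ray (classical_laplacian \<psi>) x"
        using green_identity[OF \<psi>(1) s(1)] by (simp add: c_def)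
      then have "\<psi> x = complex_of_real (1 / c) * (avg (kernel s (q_avg s)) ray \<psi> x - avg (kernel s (q_green s)) ray (classical_laplacian \<psi>) x)"
        using c by (simp flip: g)
      then show ?thesis
        unfolding shifted_laplacian_def Lu e_def avgE[OF \<psi>(1)] by (simp add: u_def algebra_simps)
    qed
    have eL: "e \<in> L2" "L2_norm e \<le> a * L2_norm \<psi>"
    proof -
      have *: "avg (kernel s q) ray \<psi> \<in> L2" "L2_norm (avg (kernel s q) ray \<psi>) \<le> (c - \<mu> * m) * L2_norm \<psi>"
        using avg_L2_norm[OF fin sets_kernel borel_measurable_ray \<psi>(1)] by (simp_all add: meas)
      show "e \<in> L2" unfolding e_def[abs_def] by (rule L2_cmult(1)[OF *(1)])
      have "L2_norm e = (1 / c) * L2_norm (avg (kernel s q) ray \<psi>)"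
        unfolding e_def[abs_def] using c by (subst L2_cmult(2)[OF *(1)], subst norm_of_real) simp
      also have "\<dots> \<le> (1 / c) * ((c - \<mu> * m) * L2_norm \<psi>)" using c by (intro mult_left_mono *) auto
      finally show "L2_norm e \<le> a * L2_norm \<psi>" by (simp add: a_def)
    qed
    have "L2_norm \<psi> \<le> (1 + \<delta>) * L2_norm h"
      using L2_norm_reverse_triangle[OF h(1) \<psi>L] \<psi>(2) by (simp add: algebra_simps)
    then have "a * L2_norm \<psi> \<le> a * ((1 + \<delta>) * L2_norm h)" using a(1) by (rule mult_left_mono)
    moreover have "L2_norm (\<lambda>x. h x - shifted_laplacian \<mu> u x) \<le> L2_norm (\<lambda>x. h x - \<psi> x) + L2_norm e"
      using L2_norm_triangle_diff[OF h(1) \<psi>L test_function_L2[OF test_function_shifted_laplacian[OF ut, of \<mu>]]] by (simp add: dif)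
    ultimately have "L2_norm (\<lambda>x. h x - shifted_laplacian \<mu> u x) \<le> \<delta> * L2_norm h + a * ((1 + \<delta>) * L2_norm h)"
      using \<psi>(2) eL(2) by linarith
    also have "\<dots> = (\<delta> + a + a * \<delta>) * L2_norm h" by (simp add: algebra_simps)
    also have "\<dots> \<le> (1 + a) / 2 * L2_norm h" using \<delta> h(2) by (intro mult_right_mono) linarith+
    finally show "\<exists>\<phi>. test_function \<phi> \<and> L2_norm (\<lambda>x. h x - shifted_laplacian \<mu> \<phi> x) \<le> (1 + a) / 2 * L2_norm h"
      using ut by blast
  qed
qed

section \<open>Infinitesimal Laplace-boundedness\<close>

text \<open>Both kernel densities are at most a constant times r, so this dominates both averages.
  In the displacement w = r y it is a truncated Riesz potential of order 2, with kernel comparable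
  to |w|^(2 - d) near 0 if d > 2.\<close>

definition ray_potential :: "real \<Rightarrow> (real^'d \<Rightarrow> ennreal) \<Rightarrow> real^'d \<Rightarrow> ennreal" where
  "ray_potential s f x = (\<integral>\<^sup>+z. indicator (ray_domain s) z * ennreal (fst z) * f (x + ray z) \<partial>lborel)"

lemma nn_integral_powr:
  assumes e: "e > -1" and s: "s > 0"
  shows "(\<integral>\<^sup>+r. indicator {0..s} r * ennreal (r powr e) \<partial>lborel) = ennreal (s powr (e + 1) / (e + 1))"
proof -
  have "((\<lambda>r. r powr e) has_integral (s powr (e + 1) / (e + 1))) {0..s}"
    using has_integral_powr_from_0[OF e, of s] s by simp
  then have "((\<lambda>r. if r \<in> {0..s} then r powr e else 0) has_integral (s powr (e + 1) / (e + 1))) UNIV"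
    by (simp only: has_integral_restrict_UNIV)
  moreover have "(\<lambda>r. if r \<in> {0..s} then r powr e else 0) = (\<lambda>r. indicator {0..s} r * r powr e)"
    by (auto simp: indicator_def)
  ultimately have "(\<integral>\<^sup>+r. ennreal (indicator {0..s} r * r powr e) \<partial>lborel) = ennreal (s powr (e + 1) / (e + 1))"
    by (intro nn_integral_has_integral_lborel) auto
  then show ?thesis by (simp add: ennreal_mult' ennreal_indicator)
qed

lemma nn_integral_unit_ball_dilate:
  fixes F :: "real^'d \<Rightarrow> ennreal"
  assumes [measurable]: "F \<in> borel_measurable borel" and r: "r > 0"
  shows "ennreal (r ^ CARD('d)) * (\<integral>\<^sup>+y. indicator (cball 0 1) y * F (z - r *\<^sub>R y) \<partial>lborel) = (\<integral>\<^sup>+w. indicator (cball z r) w * F w \<partial>lborel)"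
proof -
  define H where "H w = indicator (cball z r) w * F w" for w
  have [measurable]: "H \<in> borel_measurable borel" unfolding H_def[abs_def]
    by (intro borel_measurable_times_ennreal borel_measurable_indicator assms(1)) simp
  have "(\<integral>\<^sup>+w. H w \<partial>lborel)
      = (\<integral>\<^sup>+w. H w \<partial>density (distr lborel borel (\<lambda>x. z + (- r) *\<^sub>R x)) (\<lambda>_. \<bar>- r\<bar> ^ DIM(real^'d)))"
    by (subst lborel_affine[of "- r" z]) (use r in auto)
  also have "\<dots> = (\<integral>\<^sup>+w. ennreal (r ^ CARD('d)) * H w \<partial>distr lborel borel (\<lambda>x. z + (- r) *\<^sub>R x))"
    using r by (subst nn_integral_density) auto
  also have "\<dots> = (\<integral>\<^sup>+y. ennreal (r ^ CARD('d)) * H (z + (- r) *\<^sub>R y) \<partial>lborel)"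
    by (subst nn_integral_distr) auto
  also have "\<dots> = ennreal (r ^ CARD('d)) * (\<integral>\<^sup>+y. H (z + (- r) *\<^sub>R y) \<partial>lborel)"
    by (rule nn_integral_cmult) simp
  also have "(\<integral>\<^sup>+y. H (z + (- r) *\<^sub>R y) \<partial>lborel) = (\<integral>\<^sup>+y. indicator (cball 0 1) y * F (z - r *\<^sub>R y) \<partial>lborel)"
    by (rule nn_integral_cong) (use r in \<open>auto simp: H_def indicator_def dist_norm\<close>)
  finally show ?thesis by (simp add: H_def)
qed

text \<open>Splitting at the height \<open>T = r powr (- d / p)\<close> balances the two contributions.\<close>

lemma square_average_bound:
  fixes W :: "real^'d \<Rightarrow> real"
  assumes [measurable]: "W \<in> borel_measurable borel" and W: "\<And>x. W x \<ge> 0"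
    and p: "p > 2" and K: "K \<ge> 0" and r: "0 < r" "r \<le> s0"
    and bd: "\<And>z. (\<integral>\<^sup>+w. indicator (cball z s0) w * ennreal (W w powr p) \<partial>lborel) \<le> ennreal K"
  shows "(\<integral>\<^sup>+y. indicator (cball 0 1) y * ennreal ((W (z - r *\<^sub>R y))\<^sup>2) \<partial>lborel)
    \<le> ennreal ((measure lborel (cball (0::real^'d) 1) + K) * r powr (- 2 * CARD('d) / p))"
proof -
  define d where "d = real CARD('d)"
  define B where "B = measure lborel (cball (0::real^'d) 1)"
  have B: "B \<ge> 0" "emeasure lborel (cball (0::real^'d) 1) = ennreal B"
    using emeasure_lborel_cball_finite[of "0::real^'d" 1] by (auto simp: B_def emeasure_eq_ennreal_measure less_top)
  define T where "T = r powr (- d / p)"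
  have T: "T > 0" using r by (simp add: T_def)
  have sq: "w\<^sup>2 \<le> T\<^sup>2 + T powr (2 - p) * w powr p" if w: "w \<ge> 0" for w :: real
  proof (cases "w \<le> T")
    case True
    then have "w\<^sup>2 \<le> T\<^sup>2" using w by (rule power_mono)
    then show ?thesis using T by (simp add: add_increasing2)
  next
    case False
    then have w0: "w > 0" using T by simp
    have "w powr (2 - p) \<le> T powr (2 - p)" using False T p by (intro powr_mono2') auto
    then have "w powr (2 - p) * w powr p \<le> T powr (2 - p) * w powr p" by (rule mult_right_mono) simp
    then have "w\<^sup>2 \<le> T powr (2 - p) * w powr p" using w0 by (simp add: powr_add[symmetric])
    then show ?thesis by (simp add: add_increasing)
  qed
  have avg: "(\<integral>\<^sup>+y. indicator (cball 0 1) y * ennreal (W (z - r *\<^sub>R y) powr p) \<partial>lborel) \<le> ennreal (r powr (- d) * K)"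
  proof -
    have "ennreal (r ^ CARD('d)) * (\<integral>\<^sup>+y. indicator (cball 0 1) y * ennreal (W (z - r *\<^sub>R y) powr p) \<partial>lborel)
        = (\<integral>\<^sup>+w. indicator (cball z r) w * ennreal (W w powr p) \<partial>lborel)"
      by (rule nn_integral_unit_ball_dilate) (use r in auto)
    also have "\<dots> \<le> (\<integral>\<^sup>+w. indicator (cball z s0) w * ennreal (W w powr p) \<partial>lborel)"
      using r by (intro nn_integral_mono mult_right_mono) (auto simp: indicator_def)
    also have "\<dots> \<le> ennreal K" by (rule bd)
    finally have "ennreal (r powr (- d)) * (ennreal (r ^ CARD('d)) * (\<integral>\<^sup>+y. indicator (cball 0 1) y * ennreal (W (z - r *\<^sub>R y) powr p) \<partial>lborel)) \<le> ennreal (r powr (- d)) * ennreal K"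
      by (rule mult_left_mono) simp
    moreover have "ennreal (r powr (- d)) * ennreal (r ^ CARD('d)) = 1"
      using r by (simp add: d_def ennreal_mult[symmetric] powr_minus powr_realpow)
    ultimately show ?thesis using K by (simp add: mult.assoc[symmetric] ennreal_mult)
  qed
  have "(\<integral>\<^sup>+y. indicator (cball 0 1) y * ennreal ((W (z - r *\<^sub>R y))\<^sup>2) \<partial>lborel)
      \<le> (\<integral>\<^sup>+y. ennreal (T\<^sup>2) * indicator (cball 0 1) y + ennreal (T powr (2 - p)) * (indicator (cball 0 1) y * ennreal (W (z - r *\<^sub>R y) powr p)) \<partial>lborel)"
  proof (rule nn_integral_mono)
    fix y :: "real^'d"
    have "ennreal ((W (z - r *\<^sub>R y))\<^sup>2) \<le> ennreal (T\<^sup>2 + T powr (2 - p) * W (z - r *\<^sub>R y) powr p)"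
      by (intro ennreal_leI sq W)
    also have "\<dots> = ennreal (T\<^sup>2) + ennreal (T powr (2 - p)) * ennreal (W (z - r *\<^sub>R y) powr p)"
      by (simp add: ennreal_mult)
    finally show "indicator (cball 0 1) y * ennreal ((W (z - r *\<^sub>R y))\<^sup>2)
        \<le> ennreal (T\<^sup>2) * indicator (cball 0 1) y + ennreal (T powr (2 - p)) * (indicator (cball 0 1) y * ennreal (W (z - r *\<^sub>R y) powr p))"
      by (auto simp: indicator_def)
  qed
  also have "\<dots> = ennreal (T\<^sup>2) * ennreal B + ennreal (T powr (2 - p)) * (\<integral>\<^sup>+y. indicator (cball 0 1) y * ennreal (W (z - r *\<^sub>R y) powr p) \<partial>lborel)"
  proof -
    have m: "(\<lambda>y. indicator (cball 0 1) y * ennreal (W (z - r *\<^sub>R y) powr p)) \<in> borel_measurable lborel"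
      by (intro borel_measurable_times_ennreal borel_measurable_indicator) auto
    have 1: "(\<integral>\<^sup>+y. ennreal (T\<^sup>2) * indicator (cball 0 1) (y::real^'d) \<partial>lborel) = ennreal (T\<^sup>2) * ennreal B"
      by (subst nn_integral_cmult_indicator) (simp_all add: B)
    have m1: "(\<lambda>y::real^'d. ennreal (T\<^sup>2) * indicator (cball 0 1) y) \<in> borel_measurable lborel"
      by (intro borel_measurable_times_ennreal borel_measurable_indicator) auto
    show ?thesis
      using nn_integral_add[OF m1 borel_measurable_times_ennreal[OF borel_measurable_const m], of "ennreal (T powr (2 - p))"]
      unfolding 1 nn_integral_cmult[OF m] .
  qed
  also have "\<dots> \<le> ennreal (T\<^sup>2) * ennreal B + ennreal (T powr (2 - p)) * ennreal (r powr (- d) * K)"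
    by (intro add_left_mono mult_left_mono avg) simp
  also have "\<dots> = ennreal (T\<^sup>2 * B + T powr (2 - p) * (r powr (- d) * K))"
    using B K by (subst ennreal_plus) (auto simp: ennreal_mult)
  \<comment> \<open>Both contributions scale alike: T^2 = r^(-2 d / p) below the threshold, and T^(2
    - p) r^(-d) = r^(-2 d / p) above it.\<close>
  also have "T\<^sup>2 * B + T powr (2 - p) * (r powr (- d) * K) = (B + K) * r powr (- 2 * d / p)"
  proof -
    have "T\<^sup>2 = T powr 2" using T by simp
    also have "\<dots> = r powr (- d / p * 2)" unfolding T_def by (rule powr_powr)
    also have "- d / p * 2 = - 2 * d / p" by simp
    finally have 1: "T\<^sup>2 = r powr (- 2 * d / p)" .
    have "T powr (2 - p) * r powr (- d) = r powr (- d / p * (2 - p) + - d)"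
      unfolding T_def powr_powr by (rule powr_add[symmetric])
    also have "- d / p * (2 - p) + - d = - 2 * d / p" using p by (simp add: field_simps)
    finally have 2: "T powr (2 - p) * r powr (- d) = r powr (- 2 * d / p)" .
    have "T\<^sup>2 * B + T powr (2 - p) * (r powr (- d) * K) = T\<^sup>2 * B + (T powr (2 - p) * r powr (- d)) * K"
      by (simp only: mult.assoc)
    also have "\<dots> = (B + K) * r powr (- 2 * d / p)"
      unfolding 1 2 by (simp add: algebra_simps)
    finally show ?thesis .
  qed
  finally show ?thesis by (simp add: B_def d_def)
qed

lemma ray_domain_indicator: "indicator (ray_domain s) (r, y) = indicator {0..s} r * (indicator (cball 0 1) y :: ennreal)"
  by (auto simp: ray_domain_def indicator_def)

lemma nn_integral_ray_domain:
  fixes f :: "real \<times> (real^'d) \<Rightarrow> ennreal"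
  assumes [measurable]: "f \<in> borel_measurable borel"
  shows "(\<integral>\<^sup>+z. indicator (ray_domain s) z * f z \<partial>lborel) = (\<integral>\<^sup>+r. indicator {0..s} r * (\<integral>\<^sup>+y. indicator (cball 0 1) y * f (r, y) \<partial>lborel) \<partial>lborel)"
proof -
  have m: "(\<lambda>z. indicator (ray_domain s) z * f z) \<in> borel_measurable (lborel \<Otimes>\<^sub>M lborel)"
    unfolding lborel_prod
    by (intro borel_measurable_times_ennreal borel_measurable_indicator) (auto simp: sets_ray_domain)
  have "(\<integral>\<^sup>+z. indicator (ray_domain s) z * f z \<partial>lborel) = (\<integral>\<^sup>+r. \<integral>\<^sup>+y. indicator (ray_domain s) (r, y) * f (r, y) \<partial>lborel \<partial>lborel)"
    unfolding lborel.nn_integral_fst[OF m] lborel_prod ..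
  also have "\<dots> = (\<integral>\<^sup>+r. indicator {0..s} r * (\<integral>\<^sup>+y. indicator (cball 0 1) y * f (r, y) \<partial>lborel) \<partial>lborel)"
  proof (rule nn_integral_cong)
    fix r :: real
    have "(\<lambda>y. f (r, y)) \<in> borel_measurable borel"
      by (rule measurable_compose[OF _ assms]) (simp add: borel_measurable_Pair)
    then have m2: "(\<lambda>y. indicator (cball 0 1) y * f (r, y)) \<in> borel_measurable lborel"
      by (intro borel_measurable_times_ennreal borel_measurable_indicator) auto
    show "(\<integral>\<^sup>+y. indicator (ray_domain s) (r, y) * f (r, y) \<partial>lborel) = indicator {0..s} r * (\<integral>\<^sup>+y. indicator (cball 0 1) y * f (r, y) \<partial>lborel)"
      unfolding ray_domain_indicator mult.assoc by (rule nn_integral_cmult[OF m2])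
  qed
  finally show ?thesis .
qed

lemma borel_measurable_shift_ray:
  fixes f :: "real^'d \<Rightarrow> ennreal"
  assumes "f \<in> borel_measurable borel"
  shows "(\<lambda>z. f (x + ray z)) \<in> borel_measurable borel" "(\<lambda>z. f (x - ray z)) \<in> borel_measurable borel"
    "(\<lambda>(x, z). f (x + ray z)) \<in> borel_measurable (borel \<Otimes>\<^sub>M borel)"
    "(\<lambda>(x, z). f (x - ray z)) \<in> borel_measurable (borel \<Otimes>\<^sub>M borel)"
proof -
  note [measurable] = assms
  have [measurable]: "ray \<in> borel_measurable (borel :: (real \<times> (real^'d)) measure)" by (rule borel_measurable_ray)
  show "(\<lambda>z. f (x + ray z)) \<in> borel_measurable borel" "(\<lambda>z. f (x - ray z)) \<in> borel_measurable borel" by measurable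
  show "(\<lambda>(x, z). f (x + ray z)) \<in> borel_measurable (borel \<Otimes>\<^sub>M borel)"
    "(\<lambda>(x, z). f (x - ray z)) \<in> borel_measurable (borel \<Otimes>\<^sub>M borel)"
    by measurable
qed

text \<open>Tonelli and a translation by \<open>ray z\<close> transpose the averaging operator onto
  the weight \<open>v\<close>, so that only averages of W^2 over small balls remain to be
  bounded.\<close>

lemma weighted_shift_swap:
  fixes v f :: "real^'d \<Rightarrow> ennreal" and k :: "real \<times> (real^'d) \<Rightarrow> ennreal"
  assumes v[measurable]: "v \<in> borel_measurable borel" and f[measurable]: "f \<in> borel_measurable borel"
    and k[measurable]: "k \<in> borel_measurable borel"
  shows "(\<integral>\<^sup>+x. v x * (\<integral>\<^sup>+z. k z * f (x + ray z) \<partial>lborel) \<partial>lborel) = (\<integral>\<^sup>+x. f x * (\<integral>\<^sup>+z. k z * v (x - ray z) \<partial>lborel) \<partial>lborel)"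
proof -
  note [measurable] = borel_measurable_shift_ray[OF v] borel_measurable_shift_ray[OF f]
  have "(\<integral>\<^sup>+x. v x * (\<integral>\<^sup>+z. k z * f (x + ray z) \<partial>lborel) \<partial>lborel) = (\<integral>\<^sup>+x. \<integral>\<^sup>+z. v x * (k z * f (x + ray z)) \<partial>lborel \<partial>lborel)"
    by (intro nn_integral_cong nn_integral_cmult[symmetric]) measurable
  also have "\<dots> = (\<integral>\<^sup>+z. \<integral>\<^sup>+x. v x * (k z * f (x + ray z)) \<partial>lborel \<partial>lborel)"
    by (rule lborel_pair.Fubini') measurable
  also have "\<dots> = (\<integral>\<^sup>+z. \<integral>\<^sup>+x. f x * (k z * v (x - ray z)) \<partial>lborel \<partial>lborel)"
  proof (rule nn_integral_cong)
    fix z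
    have "(\<lambda>x. f x * (k z * v (x - ray z))) \<in> borel_measurable borel" by measurable
    from nn_integral_lborel_translate[OF this, of "ray z"]
    show "(\<integral>\<^sup>+x. v x * (k z * f (x + ray z)) \<partial>lborel) = (\<integral>\<^sup>+x. f x * (k z * v (x - ray z)) \<partial>lborel)"
      by (simp add: mult_ac)
  qed
  also have "\<dots> = (\<integral>\<^sup>+x. \<integral>\<^sup>+z. f x * (k z * v (x - ray z)) \<partial>lborel \<partial>lborel)"
    by (rule lborel_pair.Fubini'[symmetric]) measurable
  also have "\<dots> = (\<integral>\<^sup>+x. f x * (\<integral>\<^sup>+z. k z * v (x - ray z) \<partial>lborel) \<partial>lborel)"
    by (intro nn_integral_cong nn_integral_cmult) measurable
  finally show ?thesis .
qed

text \<open>Cauchy--Schwarz with the weight \<open>r powr (1 - d / p)\<close>; this exponent is integrable at 0 because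
  \<open>p > d / 2\<close>.\<close>

lemma ray_potential_bound:
  fixes W :: "real^'d \<Rightarrow> real" and f :: "real^'d \<Rightarrow> ennreal"
  assumes W[measurable]: "W \<in> borel_measurable borel" and W0: "\<And>x. W x \<ge> 0"
    and p: "p > 2" "p > real CARD('d) / 2" and K: "K \<ge> 0" and s: "0 < s" "s \<le> s0"
    and bd: "\<And>z. (\<integral>\<^sup>+w. indicator (cball z s0) w * ennreal (W w powr p) \<partial>lborel) \<le> ennreal K"
    and f[measurable]: "f \<in> borel_measurable borel"
  defines "B \<equiv> measure lborel (cball (0::real^'d) 1)" and "\<theta> \<equiv> 2 - real CARD('d) / p"
  shows "(\<integral>\<^sup>+x. ennreal ((W x)\<^sup>2) * (ray_potential s f x)\<^sup>2 \<partial>lborel)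
    \<le> ennreal (B * (B + K) * (s powr \<theta> / \<theta>)\<^sup>2) * (\<integral>\<^sup>+x. (f x)\<^sup>2 \<partial>lborel)"
proof -
  define d where "d = real CARD('d)"
  define \<beta> where "\<beta> = 1 - d / p"
  have \<theta>: "\<theta> > 0" "\<theta> = \<beta> + 1" using p by (auto simp: \<theta>_def \<beta>_def d_def field_simps)
  have \<beta>: "\<beta> > -1" using \<theta> by simp
  have B: "B \<ge> 0" "emeasure lborel (cball (0::real^'d) 1) = ennreal B"
    using emeasure_lborel_cball_finite[of "0::real^'d" 1] by (auto simp: B_def emeasure_eq_ennreal_measure less_top)
  define \<gamma> where "\<gamma> = s powr \<theta> / \<theta>"
  have \<gamma>: "\<gamma> \<ge> 0" using \<theta> by (simp add: \<gamma>_def)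
  have powint: "(\<integral>\<^sup>+r. indicator {0..s} r * ennreal (r powr \<beta>) \<partial>lborel) = ennreal \<gamma>"
    unfolding \<gamma>_def \<theta>(2) by (rule nn_integral_powr[OF \<beta> s(1)])
  \<comment> \<open>The factor r of \<open>ray_potential\<close> is split as r^(\<beta>/2) r^((2 -
    \<beta>)/2). The square of the first part integrates to \<open>B * \<gamma>\<close>; the square
    of the second is \<open>k\<close>.\<close>
  define k where "k = (\<lambda>z::real \<times> (real^'d). indicator (ray_domain s) z * ennreal (fst z powr (2 - \<beta>)))"
  have rd[measurable]: "ray_domain s \<in> sets (borel :: (real \<times> (real^'d)) measure)" by (rule sets_ray_domain)
  have fm[measurable]: "(fst :: real \<times> (real^'d) \<Rightarrow> real) \<in> borel_measurable borel"
    by (intro borel_measurable_continuous_onI continuous_intros)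
  have pm: "(\<lambda>z::real \<times> (real^'d). ennreal (fst z powr e)) \<in> borel_measurable borel" for e
    by measurable
  have km: "k \<in> borel_measurable borel"
    unfolding k_def by (intro borel_measurable_times_ennreal borel_measurable_indicator pm rd)
  note fr = borel_measurable_shift_ray(1)[OF f]
  have pt: "(ray_potential s f x)\<^sup>2 \<le> ennreal (B * \<gamma>) * (\<integral>\<^sup>+z. k z * (f (x + ray z))\<^sup>2 \<partial>lborel)" for x
  proof -
    have "ray_potential s f x = (\<integral>\<^sup>+z. (indicator (ray_domain s) z * ennreal (fst z powr (\<beta> / 2)))
        * (indicator (ray_domain s) z * ennreal (fst z powr ((2 - \<beta>) / 2)) * f (x + ray z)) \<partial>lborel)"
      unfolding ray_potential_def
    proof (rule nn_integral_cong)
      fix z :: "real \<times> (real^'d)"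
      have "fst z = fst z powr (\<beta> / 2) * fst z powr ((2 - \<beta>) / 2)" if "z \<in> ray_domain s"
        using that by (cases "fst z = 0") (auto simp: ray_domain_def powr_add[symmetric] field_simps)
      then show "indicator (ray_domain s) z * ennreal (fst z) * f (x + ray z) = (indicator (ray_domain s) z * ennreal (fst z powr (\<beta> / 2)))
        * (indicator (ray_domain s) z * ennreal (fst z powr ((2 - \<beta>) / 2)) * f (x + ray z))"
        by (cases "z \<in> ray_domain s") (simp_all add: ennreal_mult[symmetric] mult.assoc[symmetric])
    qed
    also have "\<dots>\<^sup>2 \<le> (\<integral>\<^sup>+z. (indicator (ray_domain s) (z::real \<times> (real^'d)) * ennreal (fst z powr (\<beta> / 2)))\<^sup>2 \<partial>lborel)
        * (\<integral>\<^sup>+z. (indicator (ray_domain s) z * ennreal (fst z powr ((2 - \<beta>) / 2)) * f (x + ray z))\<^sup>2 \<partial>lborel)"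
      by (rule nn_integral_cauchy_schwarz) (simp_all add: borel_measurable_times_ennreal borel_measurable_indicator pm rd fr)
    also have "(\<integral>\<^sup>+z. (indicator (ray_domain s) z * ennreal (fst z powr ((2 - \<beta>) / 2)) * f (x + ray z))\<^sup>2 \<partial>lborel) = (\<integral>\<^sup>+z. k z * (f (x + ray z))\<^sup>2 \<partial>lborel)"
    proof (rule nn_integral_cong)
      fix z :: "real \<times> (real^'d)"
      have "(fst z powr ((2 - \<beta>) / 2))\<^sup>2 = fst z powr (2 - \<beta>)"
        by (simp add: power2_eq_square powr_add[symmetric])
      then show "(indicator (ray_domain s) z * ennreal (fst z powr ((2 - \<beta>) / 2)) * f (x + ray z))\<^sup>2 = k z * (f (x + ray z))\<^sup>2"
        by (cases "z \<in> ray_domain s") (simp_all add: k_def power_mult_distrib ennreal_power)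
    qed
    also have "(\<integral>\<^sup>+z. (indicator (ray_domain s) (z::real \<times> (real^'d)) * ennreal (fst z powr (\<beta> / 2)))\<^sup>2 \<partial>lborel) = ennreal (B * \<gamma>)"
    proof -
      have "(\<integral>\<^sup>+z. (indicator (ray_domain s) (z::real \<times> (real^'d)) * ennreal (fst z powr (\<beta> / 2)))\<^sup>2 \<partial>lborel) = (\<integral>\<^sup>+z. indicator (ray_domain s) (z::real \<times> (real^'d)) * ennreal (fst z powr \<beta>) \<partial>lborel)"
      proof (rule nn_integral_cong)
        fix z :: "real \<times> (real^'d)"
        have "(fst z powr (\<beta> / 2))\<^sup>2 = fst z powr \<beta>"
          by (simp add: power2_eq_square powr_add[symmetric])
        then show "(indicator (ray_domain s) z * ennreal (fst z powr (\<beta> / 2)))\<^sup>2 = indicator (ray_domain s) z * ennreal (fst z powr \<beta>)"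
          by (cases "z \<in> ray_domain s") (simp_all add: ennreal_power)
      qed
      also have "\<dots> = (\<integral>\<^sup>+r. indicator {0..s} r * (\<integral>\<^sup>+y. indicator (cball 0 1) (y::real^'d) * ennreal (r powr \<beta>) \<partial>lborel) \<partial>lborel)"
        by (subst nn_integral_ray_domain[OF pm]) simp
      also have "\<dots> = (\<integral>\<^sup>+r. (indicator {0..s} r * ennreal (r powr \<beta>)) * ennreal B \<partial>lborel)"
      proof (rule nn_integral_cong)
        fix r :: real
        have "(\<integral>\<^sup>+y. indicator (cball 0 1) (y::real^'d) * ennreal (r powr \<beta>) \<partial>lborel) = ennreal B * ennreal (r powr \<beta>)"
          by (subst nn_integral_multc) (auto intro!: borel_measurable_indicator simp: B(2))
        then show "indicator {0..s} r * (\<integral>\<^sup>+y. indicator (cball 0 1) (y::real^'d) * ennreal (r powr \<beta>) \<partial>lborel)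
            = (indicator {0..s} r * ennreal (r powr \<beta>)) * ennreal B"
          by (simp only: mult_ac)
      qed
      also have "\<dots> = ennreal \<gamma> * ennreal B"
        unfolding powint[symmetric] by (rule nn_integral_multc) simp
      finally show ?thesis using B \<gamma> by (simp add: ennreal_mult mult.commute)
    qed
    finally show ?thesis .
  qed
  have W2m: "(\<lambda>x. ennreal ((W x)\<^sup>2)) \<in> borel_measurable borel" by measurable
  have f2m: "(\<lambda>x. (f x)\<^sup>2) \<in> borel_measurable borel" by measurable
  \<comment> \<open>The exponent \<beta> is balanced: r^(2 - \<beta>) from \<open>k\<close> times
    r^(-2 d / p) from \<open>square_average_bound\<close> is r^\<beta> again. Hence both halves
    contribute the same factor \<gamma>, which tends to 0 with \<open>s\<close>.\<close>
  have inner: "(\<integral>\<^sup>+z. k z * ennreal ((W (x - ray z))\<^sup>2) \<partial>lborel) \<le> ennreal ((B + K) * \<gamma>)" for x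
  proof -
    have m: "(\<lambda>z. ennreal (fst z powr (2 - \<beta>)) * ennreal ((W (x - ray z))\<^sup>2)) \<in> borel_measurable borel"
      by (intro borel_measurable_times_ennreal pm borel_measurable_shift_ray(2)[OF W2m])
    have "(\<integral>\<^sup>+z. k z * ennreal ((W (x - ray z))\<^sup>2) \<partial>lborel)
        = (\<integral>\<^sup>+r. indicator {0..s} r * (\<integral>\<^sup>+y. indicator (cball 0 1) y * (ennreal (r powr (2 - \<beta>)) * ennreal ((W (x - r *\<^sub>R y))\<^sup>2)) \<partial>lborel) \<partial>lborel)"
      unfolding k_def mult.assoc by (subst nn_integral_ray_domain[OF m]) (simp add: ray_def)
    also have "\<dots> \<le> (\<integral>\<^sup>+r. ennreal (B + K) * (indicator {0..s} r * ennreal (r powr \<beta>)) \<partial>lborel)"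
    proof (rule nn_integral_mono)
      fix r :: real
      show "indicator {0..s} r * (\<integral>\<^sup>+y. indicator (cball 0 1) y * (ennreal (r powr (2 - \<beta>)) * ennreal ((W (x - r *\<^sub>R y))\<^sup>2)) \<partial>lborel)
          \<le> ennreal (B + K) * (indicator {0..s} r * ennreal (r powr \<beta>))"
      proof (cases "0 < r \<and> r \<le> s")
        case True
        have "(\<integral>\<^sup>+y. indicator (cball 0 1) y * (ennreal (r powr (2 - \<beta>)) * ennreal ((W (x - r *\<^sub>R y))\<^sup>2)) \<partial>lborel)
            = (\<integral>\<^sup>+y. ennreal (r powr (2 - \<beta>)) * (indicator (cball 0 1) y * ennreal ((W (x - r *\<^sub>R y))\<^sup>2)) \<partial>lborel)"
          by (simp add: mult_ac)
        also have "\<dots> = ennreal (r powr (2 - \<beta>)) * (\<integral>\<^sup>+y. indicator (cball 0 1) y * ennreal ((W (x - r *\<^sub>R y))\<^sup>2) \<partial>lborel)"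
          by (rule nn_integral_cmult, intro borel_measurable_times_ennreal borel_measurable_indicator) auto
        also have "\<dots> \<le> ennreal (r powr (2 - \<beta>)) * ennreal ((B + K) * r powr (- 2 * CARD('d) / p))"
          unfolding B_def using True s by (intro mult_left_mono square_average_bound[OF W W0 p(1) K _ _ bd]) auto
        also have "\<dots> = ennreal ((B + K) * (r powr (2 - \<beta>) * r powr (- 2 * d / p)))"
          using B K by (subst ennreal_mult[symmetric]) (auto simp: d_def mult_ac)
        also have "r powr (2 - \<beta>) * r powr (- 2 * d / p) = r powr \<beta>"
        proof -
          have "2 - \<beta> + - 2 * d / p = \<beta>" using p by (simp add: \<beta>_def field_simps)
          then show ?thesis by (simp only: powr_add[symmetric])
        qed
        finally show ?thesis using True B K by (simp add: ennreal_mult)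
      next
        case False
        \<comment> \<open>At r = 0 both sides vanish, since \<open>0 powr e\<close> is 0 for every
          exponent.\<close>
        then have "r = 0 \<or> indicator {0..s} r = (0::ennreal)" by (auto simp: indicator_def)
        then show ?thesis by auto
      qed
    qed
    also have "\<dots> = ennreal (B + K) * ennreal \<gamma>"
      unfolding powint[symmetric] by (rule nn_integral_cmult) simp
    finally show ?thesis using B K \<gamma> by (simp add: ennreal_mult)
  qed
  have "(\<integral>\<^sup>+x. ennreal ((W x)\<^sup>2) * (\<integral>\<^sup>+z. k z * (f (x + ray z))\<^sup>2 \<partial>lborel) \<partial>lborel)
      = (\<integral>\<^sup>+x. (f x)\<^sup>2 * (\<integral>\<^sup>+z. k z * ennreal ((W (x - ray z))\<^sup>2) \<partial>lborel) \<partial>lborel)"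
    by (rule weighted_shift_swap[OF W2m f2m km])
  also have "\<dots> \<le> (\<integral>\<^sup>+x. (f x)\<^sup>2 * ennreal ((B + K) * \<gamma>) \<partial>lborel)"
    by (intro nn_integral_mono mult_left_mono inner) simp
  also have "\<dots> = (\<integral>\<^sup>+x. (f x)\<^sup>2 \<partial>lborel) * ennreal ((B + K) * \<gamma>)"
    by (rule nn_integral_multc) (use f2m in simp)
  finally have swapped: "(\<integral>\<^sup>+x. ennreal ((W x)\<^sup>2) * (\<integral>\<^sup>+z. k z * (f (x + ray z))\<^sup>2 \<partial>lborel) \<partial>lborel)
      \<le> (\<integral>\<^sup>+x. (f x)\<^sup>2 \<partial>lborel) * ennreal ((B + K) * \<gamma>)" .
  have "(\<integral>\<^sup>+x. ennreal ((W x)\<^sup>2) * (ray_potential s f x)\<^sup>2 \<partial>lborel)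
      \<le> (\<integral>\<^sup>+x. ennreal (B * \<gamma>) * (ennreal ((W x)\<^sup>2) * (\<integral>\<^sup>+z. k z * (f (x + ray z))\<^sup>2 \<partial>lborel)) \<partial>lborel)"
    by (rule nn_integral_mono, subst mult.left_commute, rule mult_left_mono[OF pt]) simp
  also have "\<dots> = ennreal (B * \<gamma>) * (\<integral>\<^sup>+x. ennreal ((W x)\<^sup>2) * (\<integral>\<^sup>+z. k z * (f (x + ray z))\<^sup>2 \<partial>lborel) \<partial>lborel)"
  proof (rule nn_integral_cmult, rule borel_measurable_times_ennreal)
    show "(\<lambda>x. ennreal ((W x)\<^sup>2)) \<in> borel_measurable lborel" using W2m by simp
    have "(\<lambda>(x, z). k z * (f (x + ray z))\<^sup>2) \<in> borel_measurable (borel \<Otimes>\<^sub>M borel)"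
      using borel_measurable_times_ennreal[OF measurable_compose[OF measurable_snd km] borel_measurable_shift_ray(3)[OF f2m]]
      by (simp add: case_prod_beta')
    then show "(\<lambda>x. \<integral>\<^sup>+z. k z * (f (x + ray z))\<^sup>2 \<partial>lborel) \<in> borel_measurable lborel"
      by (intro lborel.borel_measurable_nn_integral) (simp add: measurable_cong_sets[OF sets_pair_measure_cong[OF sets_lborel sets_lborel] refl])
  qed
  also have "\<dots> \<le> ennreal (B * \<gamma>) * ((\<integral>\<^sup>+x. (f x)\<^sup>2 \<partial>lborel) * ennreal ((B + K) * \<gamma>))"
    by (rule mult_left_mono[OF swapped]) simp
  also have "\<dots> = ennreal (B * (B + K) * \<gamma>\<^sup>2) * (\<integral>\<^sup>+x. (f x)\<^sup>2 \<partial>lborel)"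
  proof -
    have "ennreal (B * (B + K) * \<gamma>\<^sup>2) = ennreal (B * \<gamma>) * ennreal ((B + K) * \<gamma>)"
      using B K \<gamma> by (subst ennreal_mult[symmetric]) (auto simp: power2_eq_square mult_ac)
    then show ?thesis by (simp only: mult_ac)
  qed
  finally show ?thesis unfolding \<gamma>_def .
qed

lemma borel_measurable_ray_potential:
  fixes f :: "real^'d \<Rightarrow> ennreal"
  assumes f: "f \<in> borel_measurable borel"
  shows "ray_potential s f \<in> borel_measurable borel"
proof -
  have rd: "ray_domain s \<in> sets (borel :: (real \<times> (real^'d)) measure)" by (rule sets_ray_domain)
  have fm[measurable]: "(fst :: real \<times> (real^'d) \<Rightarrow> real) \<in> borel_measurable borel"
    by (intro borel_measurable_continuous_onI continuous_intros)
  have km: "(\<lambda>z::real \<times> (real^'d). indicator (ray_domain s) z * ennreal (fst z)) \<in> borel_measurable borel"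
    by (intro borel_measurable_times_ennreal borel_measurable_indicator rd) measurable
  have "(\<lambda>(x, z). indicator (ray_domain s) z * ennreal (fst z) * f (x + ray z)) \<in> borel_measurable (borel \<Otimes>\<^sub>M borel)"
    using borel_measurable_times_ennreal[OF measurable_compose[OF measurable_snd km] borel_measurable_shift_ray(3)[OF f]]
    by (simp add: case_prod_beta')
  then have "(\<lambda>x. \<integral>\<^sup>+z. indicator (ray_domain s) z * ennreal (fst z) * f (x + ray z) \<partial>lborel) \<in> borel_measurable lborel"
    by (intro lborel.borel_measurable_nn_integral) (simp add: measurable_cong_sets[OF sets_pair_measure_cong[OF sets_lborel sets_lborel] refl])
  then show ?thesis by (simp add: ray_potential_def[abs_def])
qed

lemma avg_kernel_le_ray_potential:
  fixes g :: "real^'d \<Rightarrow> complex"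
  assumes q: "continuous_on UNIV q" "\<forall>z\<in>ray_domain s. q z \<ge> 0" "\<And>z. z \<in> ray_domain s \<Longrightarrow> q z \<le> C * fst z"
    and C: "C \<ge> 0" and g: "test_function g"
  shows "ennreal (cmod (avg (kernel s q) ray g x)) \<le> ennreal C * ray_potential s (\<lambda>x. ennreal (cmod (g x))) x"
proof -
  note sm = test_function_smooth[OF g]
  have gm[measurable]: "g \<in> borel_measurable borel" using g by (rule test_function_borel)
  have ct: "continuous_on UNIV (\<lambda>z::real \<times> (real^'d). g (x + ray z))"
    unfolding ray_def by (intro continuous_on_compose2[OF smooth_continuous_on[OF sm, of UNIV]] continuous_intros) auto
  have i: "integrable lborel (\<lambda>z. indicator (ray_domain s) z *\<^sub>R (complex_of_real (q z) * g (x + ray z)))"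
    using q(1) ct by (intro kernel_integrable continuous_intros)
  have rd: "ray_domain s \<in> sets (borel :: (real \<times> (real^'d)) measure)" by (rule sets_ray_domain)
  have fm[measurable]: "(fst :: real \<times> (real^'d) \<Rightarrow> real) \<in> borel_measurable borel"
    by (intro borel_measurable_continuous_onI continuous_intros)
  have fe: "(\<lambda>z::real \<times> (real^'d). ennreal (fst z)) \<in> borel_measurable borel" by measurable
  have ge: "(\<lambda>x. ennreal (cmod (g x))) \<in> borel_measurable borel" by measurable
  have m: "(\<lambda>z. indicator (ray_domain s) z * ennreal (fst z) * ennreal (cmod (g (x + ray z)))) \<in> borel_measurable lborel"
    using borel_measurable_times_ennreal[OF borel_measurable_times_ennreal[OF borel_measurable_indicator[OF rd] fe] borel_measurable_shift_ray(1)[OF ge]] by simp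
  have "ennreal (cmod (avg (kernel s q) ray g x)) \<le> (\<integral>\<^sup>+z. ennreal (cmod (indicator (ray_domain s) z *\<^sub>R (complex_of_real (q z) * g (x + ray z)))) \<partial>lborel)"
    unfolding avg_kernel[OF q(1,2) sm] by (rule integral_norm_bound_ennreal[OF i])
  also have "\<dots> \<le> (\<integral>\<^sup>+z. ennreal C * (indicator (ray_domain s) z * ennreal (fst z) * ennreal (cmod (g (x + ray z)))) \<partial>lborel)"
  proof (rule nn_integral_mono)
    fix z :: "real \<times> (real^'d)"
    show "ennreal (cmod (indicator (ray_domain s) z *\<^sub>R (complex_of_real (q z) * g (x + ray z))))
        \<le> ennreal C * (indicator (ray_domain s) z * ennreal (fst z) * ennreal (cmod (g (x + ray z))))"
    proof (cases "z \<in> ray_domain s")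
      case True
      then have f: "fst z \<ge> 0" by (auto simp: ray_domain_def)
      have "cmod (complex_of_real (q z) * g (x + ray z)) \<le> C * fst z * cmod (g (x + ray z))"
        unfolding norm_mult norm_of_real using q(2,3) True by (intro mult_right_mono) auto
      then have "ennreal (cmod (complex_of_real (q z) * g (x + ray z))) \<le> ennreal (C * fst z * cmod (g (x + ray z)))"
        by (rule ennreal_leI)
      also have "\<dots> = ennreal C * (ennreal (fst z) * ennreal (cmod (g (x + ray z))))"
        using C f by (simp add: ennreal_mult mult.assoc)
      finally show ?thesis using True by simp
    qed simp
  qed
  also have "\<dots> = ennreal C * ray_potential s (\<lambda>x. ennreal (cmod (g x))) x"
    unfolding ray_potential_def by (rule nn_integral_cmult[OF m])
  finally show ?thesis .
qed

text \<open>The Green identity bounds c |\<phi>| by 8 / s^2 times the ray potential of |\<phi>| plus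
  the ray potential of |\<Delta>\<phi>|. Multiplication by \<open>W\<close> costs a factor of order
  s^\<theta>, so a small radius \<open>s\<close> achieves any given \<open>a\<close> at the price of
  a large \<open>b\<close>.\<close>

lemma relative_bound:
  fixes W :: "real^'d \<Rightarrow> real"
  assumes W: "W \<in> borel_measurable borel" and W0: "\<And>x. W x \<ge> 0"
    and p: "p > 2" "p > real CARD('d) / 2" and K: "K \<ge> 0" and s0: "0 < s0"
    and bd: "\<And>z. (\<integral>\<^sup>+w. indicator (cball z s0) w * ennreal (W w powr p) \<partial>lborel) \<le> ennreal K"
    and a: "a > 0"
  shows "\<exists>b\<ge>0. \<forall>\<phi>. test_function \<phi> \<longrightarrow> (\<lambda>x. complex_of_real (W x) * \<phi> x) \<in> L2 \<and>
    L2_norm (\<lambda>x. complex_of_real (W x) * \<phi> x) \<le> a * L2_norm (classical_laplacian \<phi>) + b * L2_norm \<phi>"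
proof -
  define c where "c = (\<integral>y. cap (y::real^'d) \<partial>lborel)"
  have c: "c > 0" unfolding c_def by (rule integral_cap_pos)
  define B where "B = measure lborel (cball (0::real^'d) 1)"
  have B: "B \<ge> 0" by (simp add: B_def)
  define \<theta> where "\<theta> = 2 - real CARD('d) / p"
  have \<theta>: "\<theta> > 0" using p by (auto simp: \<theta>_def field_simps)
  \<comment> \<open>The 2 comes from (x + y)^2 <= 2 x^2 + 2 y^2 when the two ray potentials are
    separated.\<close>
  define C0 where "C0 = sqrt (2 * (B * (B + K)))"
  have C0: "C0 \<ge> 0" "C0\<^sup>2 = 2 * (B * (B + K))" using B K by (simp_all add: C0_def)
  \<comment> \<open>Chosen such that s^\<theta> <= \<eta> forces \<open>D / c \<le> a\<close>; the
    \<open>+ 1\<close> spares a case distinction for \<open>C0 = 0\<close>.\<close>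
  define \<eta> where "\<eta> = a * c * \<theta> / (C0 + 1)"
  have \<eta>: "\<eta> > 0" using a c \<theta> C0 by (simp add: \<eta>_def)
  \<comment> \<open>The integral bound on \<open>W\<close> is given for balls of radius
    \<open>s0\<close>, which caps the admissible radii.\<close>
  define s where "s = min s0 (\<eta> powr (1 / \<theta>))"
  have s: "0 < s" "s \<le> s0" using s0 \<eta> by (auto simp: s_def)
  have "s powr \<theta> \<le> (\<eta> powr (1 / \<theta>)) powr \<theta>"
    using s(1) \<theta> by (intro powr_mono2) (auto simp: s_def)
  also have "\<dots> = \<eta>" using \<eta> \<theta> by (simp add: powr_powr)
  finally have s\<theta>: "s powr \<theta> \<le> \<eta>" .
  define D where "D = C0 * (s powr \<theta> / \<theta>)"
  have D0: "D \<ge> 0" using C0 \<theta> by (simp add: D_def)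
  have Da: "D / c \<le> a"
  proof -
    have "D \<le> C0 * (\<eta> / \<theta>)" unfolding D_def using C0 \<theta> s\<theta> by (intro mult_left_mono divide_right_mono) auto
    also have "\<dots> = (C0 / (C0 + 1)) * (a * c)" using \<theta> by (simp add: \<eta>_def)
    also have "\<dots> \<le> 1 * (a * c)" using C0 a c by (intro mult_right_mono) auto
    finally show ?thesis using c by (simp add: pos_divide_le_eq)
  qed
  define A where "A = 8 / s\<^sup>2"
  have A: "A \<ge> 0" by (simp add: A_def)
  define G where "G = B * (B + K) * (s powr \<theta> / \<theta>)\<^sup>2"
  have G: "G \<ge> 0" "2 * G = D\<^sup>2" using B K C0 by (auto simp: G_def D_def power_mult_distrib power_divide)
  have main: "(\<lambda>x. complex_of_real (W x) * \<phi> x) \<in> L2 \<and>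
    L2_norm (\<lambda>x. complex_of_real (W x) * \<phi> x) \<le> a * L2_norm (classical_laplacian \<phi>) + D * A / c * L2_norm \<phi>"
    if \<phi>: "test_function \<phi>" for \<phi> :: "real^'d \<Rightarrow> complex"
  proof -
    note L\<phi> = test_function_laplacian[OF \<phi>]
    have [measurable]: "\<phi> \<in> borel_measurable borel" "classical_laplacian \<phi> \<in> borel_measurable borel"
      using test_function_borel[OF \<phi>] test_function_borel[OF L\<phi>] by auto
    note W[measurable]
    define J1 where "J1 = ray_potential s (\<lambda>x. ennreal (cmod (\<phi> x)))"
    define J2 where "J2 = ray_potential s (\<lambda>x. ennreal (cmod (classical_laplacian \<phi> x)))"
    have [measurable]: "J1 \<in> borel_measurable borel" "J2 \<in> borel_measurable borel"
      unfolding J1_def J2_def by (intro borel_measurable_ray_potential; measurable)+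
    have pt: "ennreal (c * cmod (\<phi> x)) \<le> ennreal A * J1 x + J2 x" for x
    proof -
      have "complex_of_real c * \<phi> x = avg (kernel s (q_avg s)) ray \<phi> x - avg (kernel s (q_green s)) ray (classical_laplacian \<phi>) x"
        using green_identity[OF \<phi> s(1)] by (simp add: c_def)
      then have "c * cmod (\<phi> x) \<le> cmod (avg (kernel s (q_avg s)) ray \<phi> x) + cmod (avg (kernel s (q_green s)) ray (classical_laplacian \<phi>) x)"
        using c norm_triangle_ineq4 by (metis abs_of_pos norm_mult norm_of_real)
      then have "ennreal (c * cmod (\<phi> x)) \<le> ennreal (cmod (avg (kernel s (q_avg s)) ray \<phi> x)) + ennreal (cmod (avg (kernel s (q_green s)) ray (classical_laplacian \<phi>) x))"
        by (simp add: ennreal_leI flip: ennreal_plus)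
      also have "ennreal (cmod (avg (kernel s (q_avg s)) ray \<phi> x)) \<le> ennreal A * J1 x"
        unfolding J1_def A_def
        by (rule avg_kernel_le_ray_potential[OF continuous_q_avg[OF s(1)] kernels_nonneg(1) q_avg_bounds(2) _ \<phi>]) simp_all
      also have "ennreal (cmod (avg (kernel s (q_green s)) ray (classical_laplacian \<phi>) x)) \<le> ennreal 1 * J2 x"
        unfolding J2_def
        by (rule avg_kernel_le_ray_potential[OF continuous_q_green[OF s(1)] kernels_nonneg(2) _ _ L\<phi>]) (simp_all add: q_green_bounds(2))
      finally show ?thesis by (simp add: add_left_mono add_right_mono)
    qed
    have sqb: "ennreal ((cmod (complex_of_real c * (complex_of_real (W x) * \<phi> x)))\<^sup>2)
        \<le> ennreal (2 * A\<^sup>2) * (ennreal ((W x)\<^sup>2) * (J1 x)\<^sup>2) + 2 * (ennreal ((W x)\<^sup>2) * (J2 x)\<^sup>2)" for x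
    proof -
      have "ennreal ((cmod (complex_of_real c * (complex_of_real (W x) * \<phi> x)))\<^sup>2) = ennreal ((W x)\<^sup>2) * (ennreal (c * cmod (\<phi> x)))\<^sup>2"
        using c W0[of x] by (simp add: norm_mult power_mult_distrib ennreal_power ennreal_mult[symmetric] mult_ac)
      also have "\<dots> \<le> ennreal ((W x)\<^sup>2) * (ennreal A * J1 x + J2 x)\<^sup>2"
        by (intro mult_left_mono power_mono pt) auto
      also have "(ennreal A * J1 x + J2 x)\<^sup>2 \<le> 2 * (ennreal A * J1 x)\<^sup>2 + 2 * (J2 x)\<^sup>2"
      proof -
        have "(ennreal A * J1 x + J2 x)\<^sup>2 = (ennreal A * J1 x)\<^sup>2 + (J2 x)\<^sup>2 + 2 * ((ennreal A * J1 x) * J2 x)"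
          by (simp only: power2_sum mult.assoc)
        also have "\<dots> \<le> (ennreal A * J1 x)\<^sup>2 + (J2 x)\<^sup>2 + (ennreal 1 * (ennreal A * J1 x)\<^sup>2 + ennreal (1 / 1) * (J2 x)\<^sup>2)"
          by (intro add_left_mono two_mult_le_ennreal) simp
        also have "\<dots> = 2 * (ennreal A * J1 x)\<^sup>2 + 2 * (J2 x)\<^sup>2" by (simp add: mult_2 add_ac)
        finally show ?thesis .
      qed
      then have "ennreal ((W x)\<^sup>2) * (ennreal A * J1 x + J2 x)\<^sup>2 \<le> ennreal ((W x)\<^sup>2) * (2 * (ennreal A * J1 x)\<^sup>2 + 2 * (J2 x)\<^sup>2)"
        by (rule mult_left_mono) simp
      also have "\<dots> = ennreal (2 * A\<^sup>2) * (ennreal ((W x)\<^sup>2) * (J1 x)\<^sup>2) + 2 * (ennreal ((W x)\<^sup>2) * (J2 x)\<^sup>2)"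
        using A by (simp add: distrib_left power_mult_distrib ennreal_power ennreal_mult mult_ac)
      finally show ?thesis .
    qed
    have "(\<integral>\<^sup>+x. ennreal ((cmod (complex_of_real c * (complex_of_real (W x) * \<phi> x)))\<^sup>2) \<partial>lborel)
        \<le> (\<integral>\<^sup>+x. ennreal (2 * A\<^sup>2) * (ennreal ((W x)\<^sup>2) * (J1 x)\<^sup>2) + 2 * (ennreal ((W x)\<^sup>2) * (J2 x)\<^sup>2) \<partial>lborel)"
      by (rule nn_integral_mono) (rule sqb)
    also have "\<dots> = ennreal (2 * A\<^sup>2) * (\<integral>\<^sup>+x. ennreal ((W x)\<^sup>2) * (J1 x)\<^sup>2 \<partial>lborel) + 2 * (\<integral>\<^sup>+x. ennreal ((W x)\<^sup>2) * (J2 x)\<^sup>2 \<partial>lborel)"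
    proof -
      have m1: "(\<lambda>x. ennreal ((W x)\<^sup>2) * (J1 x)\<^sup>2) \<in> borel_measurable lborel" "(\<lambda>x. ennreal ((W x)\<^sup>2) * (J2 x)\<^sup>2) \<in> borel_measurable lborel"
        by measurable
      show ?thesis
        by (simp only: nn_integral_add[OF borel_measurable_times_ennreal[OF borel_measurable_const m1(1)] borel_measurable_times_ennreal[OF borel_measurable_const m1(2)]]
          nn_integral_cmult[OF m1(1)] nn_integral_cmult[OF m1(2)])
    qed
    also have "\<dots> \<le> ennreal (2 * A\<^sup>2) * (ennreal G * ennreal ((L2_norm \<phi>)\<^sup>2)) + 2 * (ennreal G * ennreal ((L2_norm (classical_laplacian \<phi>))\<^sup>2))"
    proof -
      have "(\<integral>\<^sup>+x. ennreal ((W x)\<^sup>2) * (ray_potential s (\<lambda>x. ennreal (cmod (\<psi> x))) x)\<^sup>2 \<partial>lborel) \<le> ennreal G * ennreal ((L2_norm \<psi>)\<^sup>2)"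
        if "test_function \<psi>" for \<psi> :: "real^'d \<Rightarrow> complex"
      proof -
        have [measurable]: "\<psi> \<in> borel_measurable borel" using that by (rule test_function_borel)
        have "(\<lambda>x. ennreal (cmod (\<psi> x))) \<in> borel_measurable borel" by measurable
        from ray_potential_bound[OF W W0 p K s bd this]
        show ?thesis
          unfolding G_def B_def \<theta>_def using L2_nn_integral[OF test_function_L2[OF that]] by (simp add: ennreal_power)
      qed
      then show ?thesis
        unfolding J1_def J2_def using \<phi> L\<phi> by (intro add_mono mult_left_mono) auto
    qed
    also have "\<dots> = ennreal (D\<^sup>2 * ((A * L2_norm \<phi>)\<^sup>2 + (L2_norm (classical_laplacian \<phi>))\<^sup>2))"
    proof -
      have "ennreal (2 * A\<^sup>2) * (ennreal G * ennreal ((L2_norm \<phi>)\<^sup>2)) + 2 * (ennreal G * ennreal ((L2_norm (classical_laplacian \<phi>))\<^sup>2))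
          = ennreal (2 * A\<^sup>2 * (G * (L2_norm \<phi>)\<^sup>2) + 2 * (G * (L2_norm (classical_laplacian \<phi>))\<^sup>2))"
        using G(1) by (subst ennreal_plus) (auto simp: ennreal_mult)
      also have "2 * A\<^sup>2 * (G * (L2_norm \<phi>)\<^sup>2) + 2 * (G * (L2_norm (classical_laplacian \<phi>))\<^sup>2)
          = (2 * G) * ((A * L2_norm \<phi>)\<^sup>2 + (L2_norm (classical_laplacian \<phi>))\<^sup>2)"
        by (simp add: algebra_simps power_mult_distrib)
      finally show ?thesis by (simp only: G(2))
    qed
    also have "\<dots> \<le> ennreal ((D * (A * L2_norm \<phi> + L2_norm (classical_laplacian \<phi>)))\<^sup>2)"
      unfolding power_mult_distrib[of D]
      using A L2_norm_nonneg[of \<phi>] L2_norm_nonneg[of "classical_laplacian \<phi>"]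
      by (intro ennreal_leI mult_left_mono) (auto simp: power2_sum)
    finally have le: "(\<integral>\<^sup>+x. ennreal ((cmod (complex_of_real c * (complex_of_real (W x) * \<phi> x)))\<^sup>2) \<partial>lborel) \<le> ennreal ((D * (A * L2_norm \<phi> + L2_norm (classical_laplacian \<phi>)))\<^sup>2)" .
    have m: "(\<lambda>x. complex_of_real c * (complex_of_real (W x) * \<phi> x)) \<in> borel_measurable borel" by measurable
    have nn: "D * (A * L2_norm \<phi> + L2_norm (classical_laplacian \<phi>)) \<ge> 0"
      using D0 A by (simp add: L2_norm_nonneg)
    note r = L2_iff_nn_integral[OF m nn le]
    have eq: "(\<lambda>x. complex_of_real (W x) * \<phi> x) = (\<lambda>x. complex_of_real (1 / c) * (complex_of_real c * (complex_of_real (W x) * \<phi> x)))"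
      using c by auto
    have "L2_norm (\<lambda>x. complex_of_real (W x) * \<phi> x) = (1 / c) * L2_norm (\<lambda>x. complex_of_real c * (complex_of_real (W x) * \<phi> x))"
      by (subst eq, subst L2_cmult(2)[OF r(1)], subst norm_of_real) (use c in simp)
    also have "\<dots> \<le> (1 / c) * (D * (A * L2_norm \<phi> + L2_norm (classical_laplacian \<phi>)))"
      using c r(2) by (intro mult_left_mono) auto
    also have "\<dots> = D / c * L2_norm (classical_laplacian \<phi>) + D * A / c * L2_norm \<phi>"
      by (simp add: algebra_simps add_divide_distrib)
    also have "\<dots> \<le> a * L2_norm (classical_laplacian \<phi>) + D * A / c * L2_norm \<phi>"
      by (intro add_right_mono mult_right_mono Da L2_norm_nonneg)
    finally show ?thesis
      using L2_cmult(1)[OF r(1), of "complex_of_real (1 / c)"] eq by simp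
  qed
  moreover have "D * A / c \<ge> 0" using D0 A c by simp
  ultimately show ?thesis by blast
qed

lemma L2_norm_cmult_real: "f \<in> L2 \<Longrightarrow> L2_norm (\<lambda>x. complex_of_real c * f x) = \<bar>c\<bar> * L2_norm f"
  by (simp add: L2_cmult(2))

text \<open>Expanding the square of the norm of \<mu> \<phi> - \<Delta>\<phi>, the cross term is
  nonnegative by \<open>laplacian_nonpos\<close>, so each of the two squares is dominated by the
  whole. A spectral representation of the Laplacian would give the same.\<close>

lemma shifted_laplacian_norm:
  assumes \<phi>: "test_function \<phi>" and \<mu>: "\<mu> \<ge> 0"
  shows "L2_norm (classical_laplacian \<phi>) \<le> L2_norm (shifted_laplacian \<mu> \<phi>)"
    "\<mu> * L2_norm \<phi> \<le> L2_norm (shifted_laplacian \<mu> \<phi>)"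
proof -
  have L: "\<phi> \<in> L2" "classical_laplacian \<phi> \<in> L2"
    using \<phi> test_function_laplacian test_function_L2 by auto
  have "(L2_norm (shifted_laplacian \<mu> \<phi>))\<^sup>2 = (L2_norm (\<lambda>x. - classical_laplacian \<phi> x + complex_of_real \<mu> * \<phi> x))\<^sup>2"
    by (simp add: shifted_laplacian_def[abs_def])
  also have "\<dots> = (L2_norm (\<lambda>x. - classical_laplacian \<phi> x))\<^sup>2 + (L2_norm (\<lambda>x. complex_of_real \<mu> * \<phi> x))\<^sup>2
      + 2 * Re (\<integral>x. - classical_laplacian \<phi> x * cnj (complex_of_real \<mu> * \<phi> x) \<partial>lborel)"
    using L2_cmult(1)[OF L(2), of "-1"] by (intro L2_norm_add_square L2_cmult L) simp
  also have "(\<integral>x. - classical_laplacian \<phi> x * cnj (complex_of_real \<mu> * \<phi> x) \<partial>lborel)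
      = complex_of_real (- \<mu>) * (\<integral>x. classical_laplacian \<phi> x * cnj (\<phi> x) \<partial>lborel)"
    by (subst integral_mult_right_zero[symmetric]) (simp add: mult_ac)
  also have "Re \<dots> = - \<mu> * Re (\<integral>x. classical_laplacian \<phi> x * cnj (\<phi> x) \<partial>lborel)"
    by (simp only: Re_complex_of_real Im_complex_of_real times_complex.simps(1) mult_zero_left diff_0_right)
  finally have eq: "(L2_norm (shifted_laplacian \<mu> \<phi>))\<^sup>2 = (L2_norm (classical_laplacian \<phi>))\<^sup>2 + (\<mu> * L2_norm \<phi>)\<^sup>2
      + 2 * (- \<mu> * Re (\<integral>x. classical_laplacian \<phi> x * cnj (\<phi> x) \<partial>lborel))"
    using \<mu> L2_cmult(2)[OF L(2), of "-1"] L2_norm_cmult_real[OF L(1), of \<mu>] by simp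
  have "\<mu> * Re (\<integral>x. classical_laplacian \<phi> x * cnj (\<phi> x) \<partial>lborel) \<le> 0"
    using \<mu> laplacian_nonpos[OF \<phi>] by (rule mult_nonneg_nonpos)
  then have "(L2_norm (classical_laplacian \<phi>))\<^sup>2 \<le> (L2_norm (shifted_laplacian \<mu> \<phi>))\<^sup>2"
    "(\<mu> * L2_norm \<phi>)\<^sup>2 \<le> (L2_norm (shifted_laplacian \<mu> \<phi>))\<^sup>2"
    unfolding eq using zero_le_power2[of "L2_norm (classical_laplacian \<phi>)"] zero_le_power2[of "\<mu> * L2_norm \<phi>"] by linarith+
  then show "L2_norm (classical_laplacian \<phi>) \<le> L2_norm (shifted_laplacian \<mu> \<phi>)"
    "\<mu> * L2_norm \<phi> \<le> L2_norm (shifted_laplacian \<mu> \<phi>)"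
    using L2_norm_nonneg power2_le_imp_le by blast+
qed

section \<open>The bottom of the spectrum\<close>

text \<open>The relative bound is imposed on test functions; \<open>core_laplacian\<close> carries
  square integrability of \<open>U\<close> times f over to the whole domain of the Laplacian. The
  lower bound \<open>- C0\<close> keeps the form bounded below.\<close>

locale laplace_bounded =
  fixes U :: "real^'d \<Rightarrow> real" and C0 :: real
  assumes borel: "U \<in> borel_measurable borel"
    and lower: "\<And>x. - C0 \<le> U x"
    and bounded: "\<And>a. a > 0 \<Longrightarrow> \<exists>b\<ge>0. \<forall>\<phi>. test_function \<phi> \<longrightarrow> (\<lambda>x. complex_of_real (U x) * \<phi> x) \<in> L2 \<and>
      L2_norm (\<lambda>x. complex_of_real (U x) * \<phi> x) \<le> a * L2_norm (classical_laplacian \<phi>) + b * L2_norm \<phi>"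
begin

definition ham :: "(real^'d \<Rightarrow> complex) \<Rightarrow> real^'d \<Rightarrow> complex" where
  "ham \<phi> x = - classical_laplacian \<phi> x + complex_of_real (U x) * \<phi> x"

definition form :: "(real^'d \<Rightarrow> complex) \<Rightarrow> real" where
  "form \<phi> = Re (\<integral>x. ham \<phi> x * cnj (\<phi> x) \<partial>lborel)"

lemma potential_L2: "test_function \<phi> \<Longrightarrow> (\<lambda>x. complex_of_real (U x) * \<phi> x) \<in> L2"
  using bounded[of 1] by auto

lemma laplacian_L2: "test_function \<phi> \<Longrightarrow> classical_laplacian \<phi> \<in> L2"
  by (intro test_function_L2 test_function_laplacian)

lemma ham_L2: "test_function \<phi> \<Longrightarrow> ham \<phi> \<in> L2"
  unfolding ham_def[abs_def]
  using L2_add[OF L2_cmult(1)[OF laplacian_L2, of \<phi> "-1"] potential_L2] by simp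

lemma ham_add:
  "test_function \<phi> \<Longrightarrow> test_function \<psi> \<Longrightarrow> ham (\<lambda>x. \<phi> x + \<psi> x) = (\<lambda>x. ham \<phi> x + ham \<psi> x)"
  by (simp add: ham_def fun_eq_iff classical_laplacian_add test_function_smooth algebra_simps)

lemma ham_diff:
  "test_function \<phi> \<Longrightarrow> test_function \<psi> \<Longrightarrow> ham (\<lambda>x. \<phi> x - \<psi> x) = (\<lambda>x. ham \<phi> x - ham \<psi> x)"
  by (simp add: ham_def fun_eq_iff classical_laplacian_diff test_function_smooth algebra_simps)

lemma ham_cmult: "test_function \<phi> \<Longrightarrow> ham (\<lambda>x. c * \<phi> x) = (\<lambda>x. c * ham \<phi> x)"
  by (simp add: ham_def fun_eq_iff classical_laplacian_cmult test_function_smooth algebra_simps)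

lemma ham_cnj: "test_function \<phi> \<Longrightarrow> ham (\<lambda>x. cnj (\<phi> x)) = (\<lambda>x. cnj (ham \<phi> x))"
  by (simp add: ham_def fun_eq_iff classical_laplacian_cnj test_function_smooth)

lemma additive_ham_shift: "additive_operator (\<lambda>\<phi> x. ham \<phi> x + z * \<phi> x)"
  unfolding additive_operator_def
proof (intro conjI allI impI)
  fix \<phi> :: "real^'d \<Rightarrow> complex" assume \<phi>: "test_function \<phi>"
  then show "(\<lambda>x. ham \<phi> x + z * \<phi> x) \<in> L2"
    by (intro L2_add ham_L2 L2_cmult test_function_L2)
  fix \<psi> :: "real^'d \<Rightarrow> complex" assume "test_function \<psi>"
  with \<phi> show "(\<lambda>x. ham (\<lambda>x. \<phi> x + \<psi> x) x + z * (\<phi> x + \<psi> x)) = (\<lambda>x. ham \<phi> x + z * \<phi> x + (ham \<psi> x + z * \<psi> x))"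
    by (simp add: ham_add algebra_simps)
qed

lemma ham_symmetric:
  assumes "test_function \<phi>" "test_function \<psi>"
  shows "(\<integral>x. ham \<phi> x * \<psi> x \<partial>lborel) = (\<integral>x. \<phi> x * ham \<psi> x \<partial>lborel)"
proof -
  note i = L2_mult_integrable[OF laplacian_L2 test_function_L2] L2_mult_integrable[OF test_function_L2 laplacian_L2]
    L2_mult_integrable[OF potential_L2 test_function_L2] L2_mult_integrable[OF test_function_L2 potential_L2]
  have "(\<integral>x. ham \<phi> x * \<psi> x \<partial>lborel) = (\<integral>x. complex_of_real (U x) * \<phi> x * \<psi> x - classical_laplacian \<phi> x * \<psi> x \<partial>lborel)"
    by (simp add: ham_def algebra_simps)
  also have "\<dots> = (\<integral>x. complex_of_real (U x) * \<phi> x * \<psi> x \<partial>lborel) - (\<integral>x. classical_laplacian \<phi> x * \<psi> x \<partial>lborel)"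
    by (rule Bochner_Integration.integral_diff) (intro i assms)+
  also have "\<dots> = (\<integral>x. \<phi> x * (complex_of_real (U x) * \<psi> x) \<partial>lborel) - (\<integral>x. \<phi> x * classical_laplacian \<psi> x \<partial>lborel)"
    unfolding laplacian_symmetric[OF assms] by (simp add: mult_ac)
  also have "\<dots> = (\<integral>x. \<phi> x * (complex_of_real (U x) * \<psi> x) - \<phi> x * classical_laplacian \<psi> x \<partial>lborel)"
    by (rule Bochner_Integration.integral_diff[symmetric]) (intro i assms)+
  also have "\<dots> = (\<integral>x. \<phi> x * ham \<psi> x \<partial>lborel)"
    by (simp add: ham_def algebra_simps)
  finally show ?thesis .
qed

lemma integral_norm_square: "(\<integral>x. f x * cnj (f x) \<partial>lborel) = complex_of_real ((L2_norm f)\<^sup>2)"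
  unfolding L2_norm_square
  by (simp only: integral_complex_of_real[symmetric] complex_norm_square[symmetric])

lemma form_lower:
  assumes \<phi>: "test_function \<phi>"
  shows "form \<phi> \<ge> - C0 * (L2_norm \<phi>)\<^sup>2"
proof -
  note i = L2_mult_integrable[OF laplacian_L2[OF \<phi>] L2_cnj(1)[OF test_function_L2[OF \<phi>]]]
    L2_mult_integrable[OF potential_L2[OF \<phi>] L2_cnj(1)[OF test_function_L2[OF \<phi>]]]
  have "(\<integral>x. ham \<phi> x * cnj (\<phi> x) \<partial>lborel) = (\<integral>x. complex_of_real (U x) * \<phi> x * cnj (\<phi> x) - classical_laplacian \<phi> x * cnj (\<phi> x) \<partial>lborel)"
    by (simp add: ham_def algebra_simps)
  also have "\<dots> = (\<integral>x. complex_of_real (U x) * \<phi> x * cnj (\<phi> x) \<partial>lborel) - (\<integral>x. classical_laplacian \<phi> x * cnj (\<phi> x) \<partial>lborel)"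
    by (rule Bochner_Integration.integral_diff[OF i(2,1)])
  finally have "form \<phi> = Re (\<integral>x. complex_of_real (U x) * \<phi> x * cnj (\<phi> x) \<partial>lborel) - Re (\<integral>x. classical_laplacian \<phi> x * cnj (\<phi> x) \<partial>lborel)"
    by (simp add: form_def)
  moreover have "Re (\<integral>x. complex_of_real (U x) * \<phi> x * cnj (\<phi> x) \<partial>lborel) = (\<integral>x. U x * (cmod (\<phi> x))\<^sup>2 \<partial>lborel)"
  proof -
    have "Re (complex_of_real (U x) * \<phi> x * cnj (\<phi> x)) = U x * (cmod (\<phi> x))\<^sup>2" for x
      by (simp add: mult.assoc complex_norm_square[symmetric] flip: of_real_power)
    then show ?thesis using integral_Re[OF i(2)] by simp
  qed
  moreover have "(\<integral>x. U x * (cmod (\<phi> x))\<^sup>2 \<partial>lborel) \<ge> (\<integral>x. - C0 * (cmod (\<phi> x))\<^sup>2 \<partial>lborel)"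
  proof (rule Bochner_Integration.integral_mono)
    show "integrable lborel (\<lambda>x. - C0 * (cmod (\<phi> x))\<^sup>2)"
      using L2_integrable[OF test_function_L2[OF \<phi>]] by simp
    have "Re (complex_of_real (U x) * \<phi> x * cnj (\<phi> x)) = U x * (cmod (\<phi> x))\<^sup>2" for x
      by (simp add: mult.assoc complex_norm_square[symmetric] flip: of_real_power)
    then show "integrable lborel (\<lambda>x. U x * (cmod (\<phi> x))\<^sup>2)"
      using integrable_Re[OF i(2)] by simp
    show "- C0 * (cmod (\<phi> x))\<^sup>2 \<le> U x * (cmod (\<phi> x))\<^sup>2" for x
      by (intro mult_right_mono lower) simp
  qed
  ultimately show ?thesis
    using laplacian_nonpos[OF \<phi>] by (simp add: L2_norm_square)
qed

text \<open>Start from relative bound 1/4. For \<mu> >= 4 b the remaining term b |\<phi>| is at most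
  a quarter of \<mu> |\<phi>|, in L^2 norms; \<open>shifted_laplacian_norm\<close> bounds both
  quarters by the shifted Laplacian.\<close>

lemma large_shift:
  "\<exists>\<mu>\<^sub>0>0. \<forall>\<mu>\<ge>\<mu>\<^sub>0. \<forall>\<phi>. test_function \<phi> \<longrightarrow> L2_norm (\<lambda>x. complex_of_real (U x) * \<phi> x) \<le> 1 / 2 * L2_norm (shifted_laplacian \<mu> \<phi>)"
proof -
  obtain b where b: "b \<ge> 0" and le: "\<And>\<phi>. test_function \<phi> \<Longrightarrow> L2_norm (\<lambda>x. complex_of_real (U x) * \<phi> x) \<le> 1/4 * L2_norm (classical_laplacian \<phi>) + b * L2_norm \<phi>"
    using bounded[of "1/4"] by auto
  have "L2_norm (\<lambda>x. complex_of_real (U x) * \<phi> x) \<le> 1 / 2 * L2_norm (shifted_laplacian \<mu> \<phi>)"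
    if \<mu>: "\<mu> \<ge> 4 * b + 1" and \<phi>: "test_function \<phi>" for \<mu> \<phi>
  proof -
    have m: "\<mu> \<ge> 0" using \<mu> b by simp
    note n = shifted_laplacian_norm[OF \<phi> m]
    have "4 * b * L2_norm \<phi> \<le> \<mu> * L2_norm \<phi>" using \<mu> by (intro mult_right_mono L2_norm_nonneg) simp
    then show ?thesis using le[OF \<phi>] n by linarith
  qed
  then show ?thesis using b by (intro exI[of _ "4 * b + 1"]) auto
qed

definition shift where
  "shift = (SOME \<mu>\<^sub>0. \<mu>\<^sub>0 > 0 \<and> (\<forall>\<mu>\<ge>\<mu>\<^sub>0. \<forall>\<phi>. test_function \<phi> \<longrightarrow> L2_norm (\<lambda>x. complex_of_real (U x) * \<phi> x) \<le> 1 / 2 * L2_norm (shifted_laplacian \<mu> \<phi>)))"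

lemma shift: "shift > 0"
  "\<mu> \<ge> shift \<Longrightarrow> test_function \<phi> \<Longrightarrow> L2_norm (\<lambda>x. complex_of_real (U x) * \<phi> x) \<le> 1 / 2 * L2_norm (shifted_laplacian \<mu> \<phi>)"
  using someI_ex[OF large_shift] unfolding shift_def by blast+

lemma shifted_L2: "test_function \<phi> \<Longrightarrow> shifted_laplacian \<mu> \<phi> \<in> L2"
  by (intro test_function_L2 test_function_shifted_laplacian)

text \<open>Kato-Rellich: H + \<mu> differs from \<mu> - \<Delta> by \<open>U\<close>, which beyond
  \<open>shift\<close> is at most half as large.\<close>

lemma dense_range_ham:
  assumes "\<mu> \<ge> shift"
  shows "dense_range (\<lambda>\<phi> x. ham \<phi> x + complex_of_real \<mu> * \<phi> x)"
proof (rule dense_range_perturb[OF additive_shifted_laplacian dense_range_shifted_laplacian additive_ham_shift])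
  show "\<mu> > 0" using assms shift(1) by simp
  fix \<phi> :: "real^'d \<Rightarrow> complex" assume \<phi>: "test_function \<phi>"
  have "(\<lambda>x. shifted_laplacian \<mu> \<phi> x - (ham \<phi> x + complex_of_real \<mu> * \<phi> x)) = (\<lambda>x. (-1) * (complex_of_real (U x) * \<phi> x))"
    by (auto simp: shifted_laplacian_def ham_def)
  then show "L2_norm (\<lambda>x. shifted_laplacian \<mu> \<phi> x - (ham \<phi> x + complex_of_real \<mu> * \<phi> x)) \<le> 1 / 2 * L2_norm (shifted_laplacian \<mu> \<phi>)"
    using shift(2)[OF assms \<phi>] L2_cmult(2)[OF potential_L2[OF \<phi>], of "-1"] by simp
qed simp_all

text \<open>The term with \<open>U\<close> is absorbed into half of the shifted Laplacian, whence
  the factor 2. Thus sequences that are Cauchy in the graph norm of H have convergent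
  Laplacians.\<close>

lemma laplacian_le_ham:
  assumes \<phi>: "test_function \<phi>"
  shows "L2_norm (classical_laplacian \<phi>) \<le> 2 * L2_norm (\<lambda>x. ham \<phi> x + complex_of_real shift * \<phi> x)"
proof -
  have L: "(\<lambda>x. ham \<phi> x + complex_of_real shift * \<phi> x) \<in> L2"
    by (intro L2_add ham_L2 L2_cmult test_function_L2 \<phi>)
  have "shifted_laplacian shift \<phi> = (\<lambda>x. (ham \<phi> x + complex_of_real shift * \<phi> x) - complex_of_real (U x) * \<phi> x)"
    by (auto simp: shifted_laplacian_def ham_def)
  then have "L2_norm (shifted_laplacian shift \<phi>) \<le> L2_norm (\<lambda>x. ham \<phi> x + complex_of_real shift * \<phi> x) + L2_norm (\<lambda>x. complex_of_real (U x) * \<phi> x)"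
    using L2_norm_triangle_minus[OF L potential_L2[OF \<phi>]] by simp
  then show ?thesis
    using shift(2)[OF order_refl \<phi>] shifted_laplacian_norm(1)[OF \<phi>, of shift] shift(1) by simp
qed

text \<open>Closedness of the graph on limits of test functions. The relative bound makes
  \<open>U\<close> times \<phi>_n Cauchy as well, almost everywhere convergence identifies its limit
  with \<open>U\<close> times f, and the distributional identity passes to the limit against each
  fixed test function.\<close>

lemma graph_limit:
  assumes \<phi>: "\<And>n. test_function (\<phi> n)"
    and d: "\<And>n. L2_norm (\<lambda>x. \<phi> (Suc n) x - \<phi> n x) \<le> C * (1/2) ^ n"
    and dL: "\<And>n. L2_norm (\<lambda>x. classical_laplacian (\<phi> (Suc n)) x - classical_laplacian (\<phi> n) x) \<le> C * (1/2) ^ n"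
  obtains f g where "(f, g) \<in> laplacian" "(\<lambda>x. complex_of_real (U x) * f x) \<in> L2"
    "(\<lambda>n. L2_norm (\<lambda>x. \<phi> n x - f x)) \<longlonglongrightarrow> 0"
    "(\<lambda>n. L2_norm (\<lambda>x. classical_laplacian (\<phi> n) x - g x)) \<longlonglongrightarrow> 0"
    "(\<lambda>n. L2_norm (\<lambda>x. complex_of_real (U x) * \<phi> n x - complex_of_real (U x) * f x)) \<longlonglongrightarrow> 0"
proof -
  note U[measurable] = borel
  obtain f where f: "f \<in> L2" "(\<lambda>n. L2_norm (\<lambda>x. \<phi> n x - f x)) \<longlonglongrightarrow> 0" "AE x in lborel. (\<lambda>n. \<phi> n x) \<longlonglongrightarrow> f x"
    using L2_complete[OF test_function_L2[OF \<phi>] d] by blast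
  obtain g where g: "g \<in> L2" "(\<lambda>n. L2_norm (\<lambda>x. classical_laplacian (\<phi> n) x - g x)) \<longlonglongrightarrow> 0"
    using L2_complete[OF laplacian_L2[OF \<phi>] dL] by blast
  obtain b where b: "b \<ge> 0" and le: "\<And>\<phi>. test_function \<phi> \<Longrightarrow> L2_norm (\<lambda>x. complex_of_real (U x) * \<phi> x) \<le> 1 * L2_norm (classical_laplacian \<phi>) + b * L2_norm \<phi>"
    using bounded[of 1] by auto
  have dU: "L2_norm (\<lambda>x. complex_of_real (U x) * \<phi> (Suc n) x - complex_of_real (U x) * \<phi> n x) \<le> ((1 + b) * C) * (1/2) ^ n" for n
  proof -
    have "L2_norm (\<lambda>x. complex_of_real (U x) * (\<phi> (Suc n) x - \<phi> n x)) \<le> L2_norm (classical_laplacian (\<lambda>x. \<phi> (Suc n) x - \<phi> n x)) + b * L2_norm (\<lambda>x. \<phi> (Suc n) x - \<phi> n x)"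
      using le[OF test_function_diff[OF \<phi> \<phi>], of "Suc n" n] by simp
    also have "\<dots> \<le> C * (1/2) ^ n + b * (C * (1/2) ^ n)"
      using dL[of n] d[of n] b by (intro add_mono mult_left_mono) (simp_all add: classical_laplacian_diff test_function_smooth \<phi>)
    finally show ?thesis by (simp add: algebra_simps)
  qed
  obtain w where w: "w \<in> L2" "(\<lambda>n. L2_norm (\<lambda>x. complex_of_real (U x) * \<phi> n x - w x)) \<longlonglongrightarrow> 0" "AE x in lborel. (\<lambda>n. complex_of_real (U x) * \<phi> n x) \<longlonglongrightarrow> w x"
    using L2_complete[OF potential_L2[OF \<phi>] dU] by blast
  have eq: "AE x in lborel. complex_of_real (U x) * f x = w x"
    using f(3) w(3)
  proof eventually_elim
    case (elim x)
    show ?case by (rule LIMSEQ_unique[OF tendsto_mult[OF tendsto_const elim(1)] elim(2)])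
  qed
  have [measurable]: "f \<in> borel_measurable borel" "w \<in> borel_measurable borel" "\<phi> n \<in> borel_measurable borel" for n
    using f(1) w(1) L2_borel test_function_borel[OF \<phi>] by auto
  have Uf: "(\<lambda>x. complex_of_real (U x) * f x) \<in> L2"
    by (rule L2_bound(1)[OF w(1), of _ 1]) (use eq in \<open>auto elim!: eventually_mono\<close>)
  have "L2_norm (\<lambda>x. complex_of_real (U x) * \<phi> n x - complex_of_real (U x) * f x) = L2_norm (\<lambda>x. complex_of_real (U x) * \<phi> n x - w x)" for n
    by (rule L2_norm_AE_cong) (use eq in \<open>auto elim!: eventually_mono\<close>)
  then have conv: "(\<lambda>n. L2_norm (\<lambda>x. complex_of_real (U x) * \<phi> n x - complex_of_real (U x) * f x)) \<longlonglongrightarrow> 0"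
    using w(2) by simp
  have "(\<integral>x. f x * classical_laplacian \<psi> x \<partial>lborel) = (\<integral>x. g x * \<psi> x \<partial>lborel)" if \<psi>: "test_function \<psi>" for \<psi>
  proof -
    have c: "(\<lambda>n. L2_norm (\<lambda>x. h x - h x)) \<longlonglongrightarrow> 0" for h :: "real^'d \<Rightarrow> complex"
      by (simp add: L2_zero)
    have "(\<lambda>n. \<integral>x. \<phi> n x * classical_laplacian \<psi> x \<partial>lborel) \<longlonglongrightarrow> (\<integral>x. f x * classical_laplacian \<psi> x \<partial>lborel)"
      by (intro L2_tendsto_integral test_function_L2 \<phi> f laplacian_L2 \<psi> c)
    moreover have "(\<lambda>n. \<integral>x. classical_laplacian (\<phi> n) x * \<psi> x \<partial>lborel) \<longlonglongrightarrow> (\<integral>x. g x * \<psi> x \<partial>lborel)"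
      by (intro L2_tendsto_integral laplacian_L2 test_function_L2 \<phi> g \<psi> c)
    ultimately show ?thesis
      using LIMSEQ_unique by (simp add: laplacian_symmetric[OF \<phi> \<psi>])
  qed
  then have "(f, g) \<in> laplacian" using f(1) g(1) by (simp add: laplacian_def)
  then show thesis using that Uf f(2) g(2) conv by blast
qed

text \<open>Approximations are taken at a geometric rate because \<open>L2_complete\<close> works
  with geometric increments.\<close>

lemma half_power_approx:
  assumes "dense_range T" "h \<in> L2"
  obtains \<phi> where "\<And>n. test_function (\<phi> n)" "\<And>n::nat. L2_norm (\<lambda>x. h x - T (\<phi> n) x) < (1/2) ^ n"
proof -
  have "\<exists>\<phi>. test_function \<phi> \<and> L2_norm (\<lambda>x. h x - T \<phi> x) < (1/2) ^ n" for n :: nat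
    using assms unfolding dense_range_def by auto
  then show thesis using that by metis
qed

lemma half_power_diff:
  assumes "f \<in> L2" "g \<in> L2" "h \<in> L2" "L2_norm (\<lambda>x. h x - f x) < (1/2) ^ Suc n" "L2_norm (\<lambda>x. h x - g x) < (1/2) ^ n"
  shows "L2_norm (\<lambda>x. f x - g x) \<le> 2 * (1/2) ^ n"
proof -
  have "L2_norm (\<lambda>x. f x - g x) \<le> L2_norm (\<lambda>x. f x - h x) + L2_norm (\<lambda>x. h x - g x)"
    by (rule L2_norm_triangle_diff[OF assms(1,3,2)])
  also have "\<dots> \<le> (1/2) ^ Suc n + (1/2) ^ n"
    using assms(4,5) unfolding L2_norm_minus_commute[of f h] by linarith
  also have "\<dots> \<le> 2 * (1/2) ^ n" by simp
  finally show ?thesis .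
qed

lemma half_power_limit:
  assumes "f \<in> L2" "h \<in> L2" "\<And>n. t n \<in> L2" "\<And>n::nat. L2_norm (\<lambda>x. h x - t n x) < (1/2) ^ n"
    "(\<lambda>n. L2_norm (\<lambda>x. t n x - f x)) \<longlonglongrightarrow> 0"
  shows "AE x in lborel. f x = h x"
proof -
  have z: "(\<lambda>n::nat. (1/2::real) ^ n) \<longlonglongrightarrow> 0" by (rule LIMSEQ_realpow_zero) auto
  have "(\<lambda>n. L2_norm (\<lambda>x. h x - f x)) \<longlonglongrightarrow> 0"
  proof (rule Lim_null_comparison[OF always_eventually])
    show "\<forall>n. norm (L2_norm (\<lambda>x. h x - f x)) \<le> (1/2) ^ n + L2_norm (\<lambda>x. t n x - f x)"
    proof
      fix n
      show "norm (L2_norm (\<lambda>x. h x - f x)) \<le> (1/2) ^ n + L2_norm (\<lambda>x. t n x - f x)"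
        using L2_norm_triangle_diff[OF assms(2,3,1), of n] assms(4)[of n] L2_norm_nonneg[of "\<lambda>x. h x - f x"] by simp
    qed
    show "(\<lambda>n. (1/2) ^ n + L2_norm (\<lambda>x. t n x - f x)) \<longlonglongrightarrow> 0"
      using tendsto_add[OF z assms(5)] by simp
  qed
  then have "L2_norm (\<lambda>x. h x - f x) = 0" by (simp add: LIMSEQ_const_iff)
  then have "AE x in lborel. h x - f x = 0" by (intro L2_norm_eq_0 L2_diff assms)
  then show ?thesis by (auto elim!: eventually_mono)
qed


text \<open>The test functions are a core of the Laplacian: if \<open>\<phi>\<^sub>n\<close> satisfies
  \<open>(1 - \<Delta>) \<phi>\<^sub>n \<rightarrow> f - \<Delta> f\<close>, then the limit of \<open>\<phi>\<^sub>n\<close> differs from \<open>f\<close> by a function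
  orthogonal to the range of \<open>1 - \<Delta>\<close>.\<close>

lemma core_laplacian:
  assumes fg: "(f, g) \<in> laplacian"
  obtains \<phi> where "\<And>n::nat. test_function (\<phi> n)" "(\<lambda>x. complex_of_real (U x) * f x) \<in> L2"
    "(\<lambda>n. L2_norm (\<lambda>x. \<phi> n x - f x)) \<longlonglongrightarrow> 0"
    "(\<lambda>n. L2_norm (\<lambda>x. classical_laplacian (\<phi> n) x - g x)) \<longlonglongrightarrow> 0"
    "(\<lambda>n. L2_norm (\<lambda>x. complex_of_real (U x) * \<phi> n x - complex_of_real (U x) * f x)) \<longlonglongrightarrow> 0"
proof -
  note U[measurable] = borel
  have fL: "f \<in> L2" and gL: "g \<in> L2"
    and weak: "\<And>\<psi>. test_function \<psi> \<Longrightarrow> (\<integral>x. f x * classical_laplacian \<psi> x \<partial>lborel) = (\<integral>x. g x * \<psi> x \<partial>lborel)"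
    using fg by (auto simp: laplacian_def)
  define h where "h x = f x - g x" for x
  have hL: "h \<in> L2" unfolding h_def[abs_def] by (rule L2_diff[OF fL gL])
  obtain \<phi> where \<phi>: "\<And>n. test_function (\<phi> n)" and ap: "\<And>n::nat. L2_norm (\<lambda>x. h x - shifted_laplacian 1 (\<phi> n) x) < (1/2) ^ n"
    using half_power_approx[OF dense_range_shifted_laplacian[of 1] hL] by auto
  have sd: "L2_norm (shifted_laplacian 1 (\<lambda>x. \<phi> (Suc n) x - \<phi> n x)) \<le> 2 * (1/2) ^ n" for n
  proof -
    have "shifted_laplacian 1 (\<lambda>x. \<phi> (Suc n) x - \<phi> n x) = (\<lambda>x. shifted_laplacian 1 (\<phi> (Suc n)) x - shifted_laplacian 1 (\<phi> n) x)"
      by (auto simp: shifted_laplacian_def classical_laplacian_diff test_function_smooth \<phi>)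
    then show ?thesis using half_power_diff[OF shifted_L2[OF \<phi>] shifted_L2[OF \<phi>] hL ap ap] by simp
  qed
  have tdiff: "test_function (\<lambda>x. \<phi> (Suc n) x - \<phi> n x)" for n by (intro test_function_diff \<phi>)
  have d: "L2_norm (\<lambda>x. \<phi> (Suc n) x - \<phi> n x) \<le> 2 * (1/2) ^ n" for n
    using shifted_laplacian_norm(2)[OF tdiff, of 1 n] sd[of n] by simp
  have dL: "L2_norm (\<lambda>x. classical_laplacian (\<phi> (Suc n)) x - classical_laplacian (\<phi> n) x) \<le> 2 * (1/2) ^ n" for n
    using shifted_laplacian_norm(1)[OF tdiff, of 1 n] sd[of n]
    by (simp add: classical_laplacian_diff test_function_smooth \<phi>)
  obtain f' g' where l: "(f', g') \<in> laplacian" "(\<lambda>x. complex_of_real (U x) * f' x) \<in> L2"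
    and cf: "(\<lambda>n. L2_norm (\<lambda>x. \<phi> n x - f' x)) \<longlonglongrightarrow> 0"
    and cg: "(\<lambda>n. L2_norm (\<lambda>x. classical_laplacian (\<phi> n) x - g' x)) \<longlonglongrightarrow> 0"
    and cU: "(\<lambda>n. L2_norm (\<lambda>x. complex_of_real (U x) * \<phi> n x - complex_of_real (U x) * f' x)) \<longlonglongrightarrow> 0"
    using graph_limit[OF \<phi> d dL] by blast
  have f'L: "f' \<in> L2" and g'L: "g' \<in> L2"
    and weak': "\<And>\<psi>. test_function \<psi> \<Longrightarrow> (\<integral>x. f' x * classical_laplacian \<psi> x \<partial>lborel) = (\<integral>x. g' x * \<psi> x \<partial>lborel)"
    using l by (auto simp: laplacian_def)
  have h'L: "(\<lambda>x. f' x - g' x) \<in> L2" by (rule L2_diff[OF f'L g'L])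
  have "AE x in lborel. f' x - g' x = h x"
  proof (rule half_power_limit[OF h'L hL shifted_L2[OF \<phi>] ap])
    show "(\<lambda>n. L2_norm (\<lambda>x. shifted_laplacian 1 (\<phi> n) x - (f' x - g' x))) \<longlonglongrightarrow> 0"
    proof (rule Lim_null_comparison[OF always_eventually])
      show "\<forall>n. norm (L2_norm (\<lambda>x. shifted_laplacian 1 (\<phi> n) x - (f' x - g' x)))
          \<le> L2_norm (\<lambda>x. \<phi> n x - f' x) + L2_norm (\<lambda>x. classical_laplacian (\<phi> n) x - g' x)"
      proof
        fix n
        have "L2_norm (\<lambda>x. (\<phi> n x - f' x) - (classical_laplacian (\<phi> n) x - g' x)) \<le> L2_norm (\<lambda>x. \<phi> n x - f' x) + L2_norm (\<lambda>x. classical_laplacian (\<phi> n) x - g' x)"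
          by (intro L2_norm_triangle_minus L2_diff f'L g'L test_function_L2 laplacian_L2 \<phi>)
        moreover have "(\<lambda>x. (\<phi> n x - f' x) - (classical_laplacian (\<phi> n) x - g' x)) = (\<lambda>x. shifted_laplacian 1 (\<phi> n) x - (f' x - g' x))"
          by (auto simp: shifted_laplacian_def)
        ultimately show "norm (L2_norm (\<lambda>x. shifted_laplacian 1 (\<phi> n) x - (f' x - g' x)))
          \<le> L2_norm (\<lambda>x. \<phi> n x - f' x) + L2_norm (\<lambda>x. classical_laplacian (\<phi> n) x - g' x)"
          using L2_norm_nonneg[of "\<lambda>x. shifted_laplacian 1 (\<phi> n) x - (f' x - g' x)"] by simp
      qed
      show "(\<lambda>n. L2_norm (\<lambda>x. \<phi> n x - f' x) + L2_norm (\<lambda>x. classical_laplacian (\<phi> n) x - g' x)) \<longlonglongrightarrow> 0"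
        using tendsto_add[OF cf cg] by simp
    qed
  qed
  define e where "e x = f x - f' x" for x
  have eL: "e \<in> L2" unfolding e_def[abs_def] by (rule L2_diff[OF fL f'L])
  \<comment> \<open>Since f - g = h = f' - g' almost everywhere, the difference e = f - f' solves
    \<Delta>e = e in the distributional sense; the rest shows that such an e in L^2
    vanishes.\<close>
  have eg: "AE x in lborel. g x - g' x = e x"
    using \<open>AE x in lborel. f' x - g' x = h x\<close> by eventually_elim (auto simp: e_def h_def algebra_simps)
  have orth: "(\<integral>x. e x * shifted_laplacian 1 \<psi> x \<partial>lborel) = 0" if \<psi>: "test_function \<psi>" for \<psi>
  proof -
    note \<psi>L = test_function_L2[OF \<psi>] laplacian_L2[OF \<psi>]
    have "(\<integral>x. e x * shifted_laplacian 1 \<psi> x \<partial>lborel) = (\<integral>x. e x * \<psi> x - (f x * classical_laplacian \<psi> x - f' x * classical_laplacian \<psi> x) \<partial>lborel)"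
      by (rule Bochner_Integration.integral_cong) (auto simp: e_def shifted_laplacian_def algebra_simps)
    also have "\<dots> = (\<integral>x. e x * \<psi> x \<partial>lborel) - ((\<integral>x. g x * \<psi> x \<partial>lborel) - (\<integral>x. g' x * \<psi> x \<partial>lborel))"
      unfolding weak[OF \<psi>, symmetric] weak'[OF \<psi>, symmetric]
      using L2_mult_integrable[OF eL \<psi>L(1)] L2_mult_integrable[OF fL \<psi>L(2)] L2_mult_integrable[OF f'L \<psi>L(2)] by simp
    also have "(\<integral>x. g x * \<psi> x \<partial>lborel) - (\<integral>x. g' x * \<psi> x \<partial>lborel) = (\<integral>x. g x * \<psi> x - g' x * \<psi> x \<partial>lborel)"
      using L2_mult_integrable[OF gL \<psi>L(1)] L2_mult_integrable[OF g'L \<psi>L(1)] by simp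
    also have "\<dots> = (\<integral>x. e x * \<psi> x \<partial>lborel)"
    proof (rule integral_cong_AE)
      show "AE x in lborel. g x * \<psi> x - g' x * \<psi> x = e x * \<psi> x"
        using eg by eventually_elim (simp add: left_diff_distrib[symmetric])
      show "(\<lambda>x. g x * \<psi> x - g' x * \<psi> x) \<in> borel_measurable lborel" "(\<lambda>x. e x * \<psi> x) \<in> borel_measurable lborel"
        using L2_borel[OF gL] L2_borel[OF g'L] L2_borel[OF eL] L2_borel[OF \<psi>L(1)] by auto
    qed
    finally show ?thesis by simp
  qed
  have "L2_norm e = 0"
  proof (rule ccontr)
    assume "L2_norm e \<noteq> 0"
    then have p: "L2_norm e > 0" using L2_norm_nonneg[of e] by simp
    \<comment> \<open>The pairing in \<open>orth\<close> carries no conjugate, so it is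
      \<open>cnj (e x)\<close> that gets approximated from the range of 1 - \<Delta>.\<close>
    then obtain \<psi> where \<psi>: "test_function \<psi>" "L2_norm (\<lambda>x. cnj (e x) - shifted_laplacian 1 \<psi> x) < L2_norm e"
      using dense_range_shifted_laplacian[OF zero_less_one, unfolded dense_range_def, rule_format, OF L2_cnj(1)[OF eL] p] by blast
    note sL = shifted_L2[OF \<psi>(1), of 1]
    have "complex_of_real ((L2_norm e)\<^sup>2) = (\<integral>x. e x * cnj (e x) \<partial>lborel) - (\<integral>x. e x * shifted_laplacian 1 \<psi> x \<partial>lborel)"
      by (simp add: orth[OF \<psi>(1)] integral_norm_square)
    also have "\<dots> = (\<integral>x. e x * (cnj (e x) - shifted_laplacian 1 \<psi> x) \<partial>lborel)"
      using L2_mult_integrable[OF eL L2_cnj(1)[OF eL]] L2_mult_integrable[OF eL sL] by (simp add: right_diff_distrib)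
    finally have "(L2_norm e)\<^sup>2 = cmod (\<integral>x. e x * (cnj (e x) - shifted_laplacian 1 \<psi> x) \<partial>lborel)"
      by (metis abs_of_nonneg norm_of_real zero_le_power2)
    also have "\<dots> \<le> L2_norm e * L2_norm (\<lambda>x. cnj (e x) - shifted_laplacian 1 \<psi> x)"
      by (intro L2_cauchy_schwarz eL L2_diff L2_cnj sL)
    also have "\<dots> < L2_norm e * L2_norm e" using p \<psi>(2) by simp
    finally show False by (simp add: power2_eq_square)
  qed
  then have e0: "AE x in lborel. e x = 0" by (rule L2_norm_eq_0[OF eL])
  have ff: "AE x in lborel. f x = f' x" using e0 by eventually_elim (simp add: e_def)
  have gg: "AE x in lborel. g x = g' x" using e0 eg by eventually_elim simp
  have [measurable]: "f \<in> borel_measurable borel" "f' \<in> borel_measurable borel" "g \<in> borel_measurable borel" "g' \<in> borel_measurable borel"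
    "\<phi> n \<in> borel_measurable borel" "classical_laplacian (\<phi> n) \<in> borel_measurable borel" for n
    using fL f'L gL g'L L2_borel test_function_borel[OF \<phi>] test_function_borel[OF test_function_laplacian[OF \<phi>]] by auto
  show thesis
  proof (rule that[OF \<phi>])
    show "(\<lambda>x. complex_of_real (U x) * f x) \<in> L2"
      by (rule L2_bound(1)[OF l(2), of _ 1]) (use ff in \<open>auto elim!: eventually_mono\<close>)
    have "L2_norm (\<lambda>x. \<phi> n x - f x) = L2_norm (\<lambda>x. \<phi> n x - f' x)" for n
      by (rule L2_norm_AE_cong) (use ff in \<open>auto elim!: eventually_mono\<close>)
    then show "(\<lambda>n. L2_norm (\<lambda>x. \<phi> n x - f x)) \<longlonglongrightarrow> 0" using cf by simp
    have "L2_norm (\<lambda>x. classical_laplacian (\<phi> n) x - g x) = L2_norm (\<lambda>x. classical_laplacian (\<phi> n) x - g' x)" for n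
      by (rule L2_norm_AE_cong) (use gg in \<open>auto elim!: eventually_mono\<close>)
    then show "(\<lambda>n. L2_norm (\<lambda>x. classical_laplacian (\<phi> n) x - g x)) \<longlonglongrightarrow> 0" using cg by simp
    have "L2_norm (\<lambda>x. complex_of_real (U x) * \<phi> n x - complex_of_real (U x) * f x)
        = L2_norm (\<lambda>x. complex_of_real (U x) * \<phi> n x - complex_of_real (U x) * f' x)" for n
      by (rule L2_norm_AE_cong) (use ff in \<open>auto elim!: eventually_mono\<close>)
    then show "(\<lambda>n. L2_norm (\<lambda>x. complex_of_real (U x) * \<phi> n x - complex_of_real (U x) * f x)) \<longlonglongrightarrow> 0" using cU by simp
  qed
qed

lemma ham_limit:
  assumes \<phi>: "\<And>n::nat. test_function (\<phi> n)" and L: "f \<in> L2" "g \<in> L2" "(\<lambda>x. complex_of_real (U x) * f x) \<in> L2"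
    and cg: "(\<lambda>n. L2_norm (\<lambda>x. classical_laplacian (\<phi> n) x - g x)) \<longlonglongrightarrow> 0"
    and cU: "(\<lambda>n. L2_norm (\<lambda>x. complex_of_real (U x) * \<phi> n x - complex_of_real (U x) * f x)) \<longlonglongrightarrow> 0"
  shows "(\<lambda>n. L2_norm (\<lambda>x. ham (\<phi> n) x - (- g x + complex_of_real (U x) * f x))) \<longlonglongrightarrow> 0"
proof (rule Lim_null_comparison[OF always_eventually])
  show "\<forall>n. norm (L2_norm (\<lambda>x. ham (\<phi> n) x - (- g x + complex_of_real (U x) * f x)))
      \<le> L2_norm (\<lambda>x. complex_of_real (U x) * \<phi> n x - complex_of_real (U x) * f x) + L2_norm (\<lambda>x. classical_laplacian (\<phi> n) x - g x)"
  proof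
    fix n
    have "L2_norm (\<lambda>x. (complex_of_real (U x) * \<phi> n x - complex_of_real (U x) * f x) - (classical_laplacian (\<phi> n) x - g x))
        \<le> L2_norm (\<lambda>x. complex_of_real (U x) * \<phi> n x - complex_of_real (U x) * f x) + L2_norm (\<lambda>x. classical_laplacian (\<phi> n) x - g x)"
      by (intro L2_norm_triangle_minus L2_diff L potential_L2 laplacian_L2 \<phi>)
    moreover have "(\<lambda>x. (complex_of_real (U x) * \<phi> n x - complex_of_real (U x) * f x) - (classical_laplacian (\<phi> n) x - g x))
        = (\<lambda>x. ham (\<phi> n) x - (- g x + complex_of_real (U x) * f x))"
      by (auto simp: ham_def)
    ultimately show "norm (L2_norm (\<lambda>x. ham (\<phi> n) x - (- g x + complex_of_real (U x) * f x)))
      \<le> L2_norm (\<lambda>x. complex_of_real (U x) * \<phi> n x - complex_of_real (U x) * f x) + L2_norm (\<lambda>x. classical_laplacian (\<phi> n) x - g x)"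
      using L2_norm_nonneg[of "\<lambda>x. ham (\<phi> n) x - (- g x + complex_of_real (U x) * f x)"] by simp
  qed
  show "(\<lambda>n. L2_norm (\<lambda>x. complex_of_real (U x) * \<phi> n x - complex_of_real (U x) * f x) + L2_norm (\<lambda>x. classical_laplacian (\<phi> n) x - g x)) \<longlonglongrightarrow> 0"
    using tendsto_add[OF cU cg] by simp
qed

lemma schroedinger_L2: "(f, h) \<in> schroedinger U \<Longrightarrow> f \<in> L2" "(f, h) \<in> schroedinger U \<Longrightarrow> h \<in> L2"
  by (auto simp: schroedinger_def laplacian_def)

lemma core_schroedinger:
  assumes fh: "(f, h) \<in> schroedinger U"
  obtains \<phi> where "\<And>n::nat. test_function (\<phi> n)"
    "(\<lambda>n. L2_norm (\<lambda>x. \<phi> n x - f x)) \<longlonglongrightarrow> 0" "(\<lambda>n. L2_norm (\<lambda>x. ham (\<phi> n) x - h x)) \<longlonglongrightarrow> 0"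
proof -
  note U[measurable] = borel
  obtain g where g: "(f, g) \<in> laplacian" "AE x in lborel. h x = - g x + complex_of_real (U x) * f x" and h: "h \<in> L2"
    using fh by (auto simp: schroedinger_def)
  have fL: "f \<in> L2" "g \<in> L2" using g(1) by (auto simp: laplacian_def)
  obtain \<phi> where \<phi>: "\<And>n::nat. test_function (\<phi> n)" and Uf: "(\<lambda>x. complex_of_real (U x) * f x) \<in> L2"
    and cf: "(\<lambda>n. L2_norm (\<lambda>x. \<phi> n x - f x)) \<longlonglongrightarrow> 0"
    and cg: "(\<lambda>n. L2_norm (\<lambda>x. classical_laplacian (\<phi> n) x - g x)) \<longlonglongrightarrow> 0"
    and cU: "(\<lambda>n. L2_norm (\<lambda>x. complex_of_real (U x) * \<phi> n x - complex_of_real (U x) * f x)) \<longlonglongrightarrow> 0"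
    by (rule core_laplacian[OF g(1)]) (rule that)
  have [measurable]: "f \<in> borel_measurable borel" "g \<in> borel_measurable borel" "h \<in> borel_measurable borel" "ham (\<phi> n) \<in> borel_measurable borel" for n
    using fL h L2_borel ham_L2[OF \<phi>] by auto
  have "L2_norm (\<lambda>x. ham (\<phi> n) x - h x) = L2_norm (\<lambda>x. ham (\<phi> n) x - (- g x + complex_of_real (U x) * f x))" for n
    by (rule L2_norm_AE_cong) (use g(2) in \<open>auto elim!: eventually_mono\<close>)
  then have "(\<lambda>n. L2_norm (\<lambda>x. ham (\<phi> n) x - h x)) \<longlonglongrightarrow> 0"
    using ham_limit[OF \<phi> fL Uf cg cU] by simp
  then show thesis using that \<phi> cf by blast
qed

section \<open>Rayleigh quotients and the resolvent set below their infimum\<close>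

lemma exists_test_function: "\<exists>\<phi>::real^'d \<Rightarrow> complex. test_function \<phi> \<and> L2_norm \<phi> > 0"
proof -
  define I where "I = (\<lambda>x. indicator (ball (0::real^'d) 1) x :: complex)"
  have I: "I \<in> L2" unfolding I_def by (rule indicator_L2) (use emeasure_lborel_ball_finite[of "0::real^'d" 1] in auto)
  have "(L2_norm I)\<^sup>2 = measure lborel (ball (0::real^'d) 1)"
  proof -
    have "(\<lambda>x. (cmod (I x))\<^sup>2) = indicator (ball 0 1)" by (auto simp: I_def indicator_def)
    then show ?thesis unfolding L2_norm_square by simp
  qed
  also have "\<dots> > 0" by (rule content_ball_pos) simp
  finally have p: "L2_norm I > 0" using L2_norm_nonneg[of I] by (simp add: zero_less_power2 less_le)
  obtain \<phi> where \<phi>: "test_function \<phi>" "L2_norm (\<lambda>x. I x - \<phi> x) < L2_norm I"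
    using test_functions_dense[OF I p] by blast
  have "L2_norm \<phi> > 0"
    using L2_norm_reverse_triangle[OF I test_function_L2[OF \<phi>(1)]] \<phi>(2) by simp
  then show ?thesis using \<phi>(1) by blast
qed

text \<open>A real infimum is meaningful here: Rayleigh quotients exist, and
  \<open>form_lower\<close> bounds them below by \<open>- C0\<close>.\<close>

definition bottom :: real where
  "bottom = Inf {form \<phi> / (L2_norm \<phi>)\<^sup>2 | \<phi>. test_function \<phi> \<and> L2_norm \<phi> > 0}"

lemma bottom_le_quotient:
  assumes "test_function \<phi>" "L2_norm \<phi> > 0"
  shows "bottom \<le> form \<phi> / (L2_norm \<phi>)\<^sup>2"
  unfolding bottom_def
proof (rule cInf_lower)
  show "bdd_below {form \<phi> / (L2_norm \<phi>)\<^sup>2 | \<phi>. test_function \<phi> \<and> L2_norm \<phi> > 0}"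
  proof (rule bdd_belowI[of _ "- C0"], safe)
    fix \<phi> :: "real^'d \<Rightarrow> complex" assume \<phi>: "test_function \<phi>" "L2_norm \<phi> > 0"
    show "- C0 \<le> form \<phi> / (L2_norm \<phi>)\<^sup>2"
      using form_lower[OF \<phi>(1)] \<phi>(2) by (simp add: pos_le_divide_eq)
  qed
qed (use assms in blast)

lemma bottom_greatest:
  assumes "\<And>\<phi>. test_function \<phi> \<Longrightarrow> L2_norm \<phi> > 0 \<Longrightarrow> c * (L2_norm \<phi>)\<^sup>2 \<le> form \<phi>"
  shows "c \<le> bottom"
  unfolding bottom_def
proof (rule cInf_greatest)
  show "{form \<phi> / (L2_norm \<phi>)\<^sup>2 | \<phi>. test_function \<phi> \<and> L2_norm \<phi> > 0} \<noteq> {}"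
    using exists_test_function by blast
qed (use assms in \<open>auto simp: pos_le_divide_eq\<close>)

lemma form_ge_bottom:
  assumes \<phi>: "test_function \<phi>"
  shows "bottom * (L2_norm \<phi>)\<^sup>2 \<le> form \<phi>"
proof (cases "L2_norm \<phi> > 0")
  case True
  then show ?thesis using bottom_le_quotient[OF \<phi> True] by (simp add: pos_le_divide_eq)
next
  case False
  then have z: "L2_norm \<phi> = 0" using L2_norm_nonneg[of \<phi>] by simp
  have "cmod (\<integral>x. ham \<phi> x * cnj (\<phi> x) \<partial>lborel) \<le> L2_norm (ham \<phi>) * L2_norm (\<lambda>x. cnj (\<phi> x))"
    by (intro L2_cauchy_schwarz ham_L2 L2_cnj test_function_L2 \<phi>)
  then show ?thesis using z by (simp add: form_def L2_cnj(2))
qed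

text \<open>Pair (H - z) \<phi> with \<phi>: the real part is the form minus Re z times the squared
  norm, and Cauchy-Schwarz bounds it from above.\<close>

lemma ham_lower_bound:
  assumes \<phi>: "test_function \<phi>"
  shows "(bottom - Re z) * L2_norm \<phi> \<le> L2_norm (\<lambda>x. ham \<phi> x - z * \<phi> x)"
proof (cases "L2_norm \<phi> > 0")
  case True
  note L = ham_L2[OF \<phi>] test_function_L2[OF \<phi>]
  have "(\<integral>x. (ham \<phi> x - z * \<phi> x) * cnj (\<phi> x) \<partial>lborel) = (\<integral>x. ham \<phi> x * cnj (\<phi> x) - z * (\<phi> x * cnj (\<phi> x)) \<partial>lborel)"
    by (simp add: algebra_simps)
  also have "\<dots> = (\<integral>x. ham \<phi> x * cnj (\<phi> x) \<partial>lborel) - z * (\<integral>x. \<phi> x * cnj (\<phi> x) \<partial>lborel)"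
    using L2_mult_integrable[OF L(1) L2_cnj(1)[OF L(2)]] L2_mult_integrable[OF L(2) L2_cnj(1)[OF L(2)]] by simp
  finally have "Re (\<integral>x. (ham \<phi> x - z * \<phi> x) * cnj (\<phi> x) \<partial>lborel) = form \<phi> - Re z * (L2_norm \<phi>)\<^sup>2"
    unfolding integral_norm_square form_def by (simp del: of_real_power)
  moreover have "Re (\<integral>x. (ham \<phi> x - z * \<phi> x) * cnj (\<phi> x) \<partial>lborel) \<le> L2_norm (\<lambda>x. ham \<phi> x - z * \<phi> x) * L2_norm \<phi>"
    using order_trans[OF complex_Re_le_cmod L2_cauchy_schwarz[OF L2_diff[OF L(1) L2_cmult(1)[OF L(2), of z]] L2_cnj(1)[OF L(2)]]]
    by (simp add: L2_cnj(2))
  ultimately have "(bottom - Re z) * (L2_norm \<phi>)\<^sup>2 \<le> L2_norm (\<lambda>x. ham \<phi> x - z * \<phi> x) * L2_norm \<phi>"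
    using form_ge_bottom[OF \<phi>] by (simp add: left_diff_distrib)
  then have "((bottom - Re z) * L2_norm \<phi>) * L2_norm \<phi> \<le> L2_norm (\<lambda>x. ham \<phi> x - z * \<phi> x) * L2_norm \<phi>"
    by (simp add: power2_eq_square mult.assoc)
  then show ?thesis using True by (rule mult_right_le_imp_le)
next
  case False
  then have "L2_norm \<phi> = 0" using L2_norm_nonneg[of \<phi>] by simp
  then show ?thesis by (simp add: L2_norm_nonneg)
qed


lemma schroedinger_lower_bound:
  assumes fh: "(f, h) \<in> schroedinger U"
  shows "(bottom - Re z) * L2_norm f \<le> L2_norm (\<lambda>x. h x - z * f x)"
proof -
  note L = schroedinger_L2[OF fh]
  obtain \<phi> where \<phi>: "\<And>n::nat. test_function (\<phi> n)" and cf: "(\<lambda>n. L2_norm (\<lambda>x. \<phi> n x - f x)) \<longlonglongrightarrow> 0"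
    and ch: "(\<lambda>n. L2_norm (\<lambda>x. ham (\<phi> n) x - h x)) \<longlonglongrightarrow> 0"
    by (rule core_schroedinger[OF fh]) (rule that)
  have "(\<lambda>n. L2_norm (\<lambda>x. (ham (\<phi> n) x - z * \<phi> n x) - (h x - z * f x))) \<longlonglongrightarrow> 0"
  proof (rule Lim_null_comparison[OF always_eventually])
    show "\<forall>n. norm (L2_norm (\<lambda>x. (ham (\<phi> n) x - z * \<phi> n x) - (h x - z * f x)))
        \<le> L2_norm (\<lambda>x. ham (\<phi> n) x - h x) + cmod z * L2_norm (\<lambda>x. \<phi> n x - f x)"
    proof
      fix n
      have d: "(\<lambda>x. \<phi> n x - f x) \<in> L2" by (intro L2_diff test_function_L2 \<phi> L)
      have "L2_norm (\<lambda>x. (ham (\<phi> n) x - h x) - z * (\<phi> n x - f x)) \<le> L2_norm (\<lambda>x. ham (\<phi> n) x - h x) + L2_norm (\<lambda>x. z * (\<phi> n x - f x))"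
        by (intro L2_norm_triangle_minus L2_diff ham_L2 \<phi> L L2_cmult d)
      moreover have "(\<lambda>x. (ham (\<phi> n) x - h x) - z * (\<phi> n x - f x)) = (\<lambda>x. (ham (\<phi> n) x - z * \<phi> n x) - (h x - z * f x))"
        by (auto simp: algebra_simps)
      ultimately show "norm (L2_norm (\<lambda>x. (ham (\<phi> n) x - z * \<phi> n x) - (h x - z * f x)))
        \<le> L2_norm (\<lambda>x. ham (\<phi> n) x - h x) + cmod z * L2_norm (\<lambda>x. \<phi> n x - f x)"
        using L2_norm_nonneg[of "\<lambda>x. (ham (\<phi> n) x - z * \<phi> n x) - (h x - z * f x)"] L2_cmult(2)[OF d, of z] by simp
    qed
    show "(\<lambda>n. L2_norm (\<lambda>x. ham (\<phi> n) x - h x) + cmod z * L2_norm (\<lambda>x. \<phi> n x - f x)) \<longlonglongrightarrow> 0"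
      using tendsto_add[OF ch tendsto_mult[OF tendsto_const cf, of "cmod z"]] by simp
  qed
  then have c2: "(\<lambda>n. L2_norm (\<lambda>x. ham (\<phi> n) x - z * \<phi> n x)) \<longlonglongrightarrow> L2_norm (\<lambda>x. h x - z * f x)"
    by (rule L2_tendsto_norm[rotated 2]) (intro L2_diff ham_L2 L2_cmult test_function_L2 \<phi> L)+
  have c1: "(\<lambda>n. L2_norm (\<phi> n)) \<longlonglongrightarrow> L2_norm f"
    by (rule L2_tendsto_norm[OF _ _ cf]) (intro test_function_L2 \<phi> L)+
  show ?thesis
    by (rule LIMSEQ_le[OF tendsto_mult[OF tendsto_const c1] c2]) (use ham_lower_bound[OF \<phi>] in blast)
qed

text \<open>Near the bottom \<open>U\<close> need not be small compared with \<mu> - \<Delta>, so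
  the comparison operator is H + \<mu> for large \<mu>, whose range is already known to be dense.
  Then H - z arises from it by subtracting \<mu> + z, and |\<mu> + z| < \<mu> +
  \<open>bottom\<close> for large \<mu> because Re z < \<open>bottom\<close>.\<close>

lemma dense_range_resolvent:
  assumes z: "Re z < bottom"
  shows "dense_range (\<lambda>\<phi> x. ham \<phi> x - z * \<phi> x)"
proof -
  define l where "l = bottom"
  \<comment> \<open>The entries serve \<open>dense_range_ham\<close>, the positivity of
    \<open>\<mu> + l\<close>, and |\<mu> + z|^2 < (\<mu> + l)^2; the difference of the last two
    sides is 2 \<mu> (l - Re z) + l^2 - |z|^2.\<close>
  define \<mu> where "\<mu> = max (max shift (1 - l)) (((Im z)\<^sup>2 + (Re z)\<^sup>2 + 1) / (2 * (l - Re z)))"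
  have lz: "l - Re z > 0" using z by (simp add: l_def)
  have \<mu>: "\<mu> \<ge> shift" "\<mu> + l \<ge> 1" "\<mu> \<ge> ((Im z)\<^sup>2 + (Re z)\<^sup>2 + 1) / (2 * (l - Re z))" by (auto simp: \<mu>_def)
  have "(Im z)\<^sup>2 + (Re z)\<^sup>2 + 1 \<le> \<mu> * (2 * (l - Re z))"
    using \<mu>(3) lz by (simp add: pos_divide_le_eq)
  moreover have "(\<mu> + l)\<^sup>2 - ((\<mu> + Re z)\<^sup>2 + (Im z)\<^sup>2) = \<mu> * (2 * (l - Re z)) + l\<^sup>2 - (Re z)\<^sup>2 - (Im z)\<^sup>2"
    by (simp add: power2_eq_square algebra_simps)
  ultimately have "(\<mu> + Re z)\<^sup>2 + (Im z)\<^sup>2 < (\<mu> + l)\<^sup>2"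
    using zero_le_power2[of l] by linarith
  then have "(cmod (complex_of_real \<mu> + z))\<^sup>2 < (\<mu> + l)\<^sup>2"
    by (simp add: cmod_power2)
  then have lt: "cmod (complex_of_real \<mu> + z) < \<mu> + l"
    by (rule power_less_imp_less_base) (use \<mu>(2) in simp)
  show ?thesis
  proof (rule dense_range_perturb[OF additive_ham_shift dense_range_ham[OF \<mu>(1)]])
    show "additive_operator (\<lambda>\<phi> x. ham \<phi> x - z * \<phi> x)" using additive_ham_shift[of "- z"] by simp
    show "0 \<le> cmod (complex_of_real \<mu> + z) / (\<mu> + l)" using \<mu>(2) by simp
    show "cmod (complex_of_real \<mu> + z) / (\<mu> + l) < 1" using lt \<mu>(2) by simp
    fix \<phi> :: "real^'d \<Rightarrow> complex" assume \<phi>: "test_function \<phi>"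
    have "(l + \<mu>) * L2_norm \<phi> \<le> L2_norm (\<lambda>x. ham \<phi> x + complex_of_real \<mu> * \<phi> x)"
      using ham_lower_bound[OF \<phi>, of "- complex_of_real \<mu>"] by (simp add: l_def)
    then have le: "L2_norm \<phi> \<le> L2_norm (\<lambda>x. ham \<phi> x + complex_of_real \<mu> * \<phi> x) / (\<mu> + l)"
      using \<mu>(2) by (simp add: pos_le_divide_eq mult.commute add.commute)
    have "(\<lambda>x. ham \<phi> x + complex_of_real \<mu> * \<phi> x - (ham \<phi> x - z * \<phi> x)) = (\<lambda>x. (complex_of_real \<mu> + z) * \<phi> x)"
      by (auto simp: algebra_simps)
    then have "L2_norm (\<lambda>x. ham \<phi> x + complex_of_real \<mu> * \<phi> x - (ham \<phi> x - z * \<phi> x)) = cmod (complex_of_real \<mu> + z) * L2_norm \<phi>"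
      using L2_cmult(2)[OF test_function_L2[OF \<phi>], of "complex_of_real \<mu> + z"] by simp
    also have "\<dots> \<le> cmod (complex_of_real \<mu> + z) * (L2_norm (\<lambda>x. ham \<phi> x + complex_of_real \<mu> * \<phi> x) / (\<mu> + l))"
      by (rule mult_left_mono[OF le]) simp
    finally show "L2_norm (\<lambda>x. ham \<phi> x + complex_of_real \<mu> * \<phi> x - (ham \<phi> x - z * \<phi> x))
        \<le> cmod (complex_of_real \<mu> + z) / (\<mu> + l) * L2_norm (\<lambda>x. ham \<phi> x + complex_of_real \<mu> * \<phi> x)"
      by simp
  qed
qed

text \<open>Approximate solutions with error 2^(-n) are Cauchy by \<open>ham_lower_bound\<close>,
  and so are their Laplacians by \<open>laplacian_le_ham\<close>; closedness of the graph yields an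
  exact solution. The bound on the inverse is \<open>schroedinger_lower_bound\<close>.\<close>

lemma resolvent_below_bottom:
  assumes z: "Re z < bottom"
  shows "z \<in> resolvent_set (schroedinger U)"
proof -
  define c where "c = bottom - Re z"
  have c: "c > 0" using z by (simp add: c_def)
  have surj: "\<exists>(f, g)\<in>schroedinger U. AE x in lborel. g x - z * f x = h x" if h: "h \<in> L2" for h
  proof -
    obtain \<phi> where \<phi>: "\<And>n. test_function (\<phi> n)" and ap: "\<And>n::nat. L2_norm (\<lambda>x. h x - (ham (\<phi> n) x - z * \<phi> n x)) < (1/2) ^ n"
      by (rule half_power_approx[OF dense_range_resolvent[OF z] h]) (rule that)
    have tL: "(\<lambda>x. ham (\<phi> n) x - z * \<phi> n x) \<in> L2" for n by (intro L2_diff ham_L2 L2_cmult test_function_L2 \<phi>)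
    define \<delta> where "\<delta> n = (\<lambda>x. \<phi> (Suc n) x - \<phi> n x)" for n
    have \<delta>t: "test_function (\<delta> n)" for n unfolding \<delta>_def by (intro test_function_diff \<phi>)
    have hd: "L2_norm (\<lambda>x. ham (\<delta> n) x - z * \<delta> n x) \<le> 2 * (1/2) ^ n" for n
    proof -
      have "(\<lambda>x. ham (\<delta> n) x - z * \<delta> n x) = (\<lambda>x. (ham (\<phi> (Suc n)) x - z * \<phi> (Suc n) x) - (ham (\<phi> n) x - z * \<phi> n x))"
        unfolding \<delta>_def by (auto simp: ham_diff[OF \<phi> \<phi>] algebra_simps)
      then show ?thesis using half_power_diff[OF tL tL h ap ap] by simp
    qed
    define C where "C = max (2 / c) (2 * (2 + cmod (z + complex_of_real shift) * (2 / c)))"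
    have d0: "L2_norm (\<delta> n) \<le> 2 / c * (1/2) ^ n" for n
    proof -
      have "c * L2_norm (\<delta> n) \<le> 2 * (1/2) ^ n" using ham_lower_bound[OF \<delta>t, of z n] hd[of n] by (simp add: c_def)
      then show ?thesis using c by (simp add: field_simps)
    qed
    have d1: "L2_norm (classical_laplacian (\<delta> n)) \<le> 2 * (2 + cmod (z + complex_of_real shift) * (2 / c)) * (1/2) ^ n" for n
    proof -
      have "L2_norm (\<lambda>x. (ham (\<delta> n) x - z * \<delta> n x) + (z + complex_of_real shift) * \<delta> n x)
          \<le> L2_norm (\<lambda>x. ham (\<delta> n) x - z * \<delta> n x) + L2_norm (\<lambda>x. (z + complex_of_real shift) * \<delta> n x)"
        by (intro L2_norm_triangle L2_diff ham_L2 L2_cmult test_function_L2 \<delta>t)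
      also have "(\<lambda>x. (ham (\<delta> n) x - z * \<delta> n x) + (z + complex_of_real shift) * \<delta> n x) = (\<lambda>x. ham (\<delta> n) x + complex_of_real shift * \<delta> n x)"
        by (auto simp: algebra_simps)
      also have "L2_norm (\<lambda>x. (z + complex_of_real shift) * \<delta> n x) = cmod (z + complex_of_real shift) * L2_norm (\<delta> n)"
        by (rule L2_cmult(2)[OF test_function_L2[OF \<delta>t]])
      finally have "L2_norm (\<lambda>x. ham (\<delta> n) x + complex_of_real shift * \<delta> n x) \<le> 2 * (1/2) ^ n + cmod (z + complex_of_real shift) * (2 / c * (1/2) ^ n)"
        using hd[of n] mult_left_mono[OF d0[of n], of "cmod (z + complex_of_real shift)"] by simp
      then have "2 * L2_norm (\<lambda>x. ham (\<delta> n) x + complex_of_real shift * \<delta> n x) \<le> 2 * (2 * (1/2) ^ n + cmod (z + complex_of_real shift) * (2 / c * (1/2) ^ n))"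
        by (rule mult_left_mono) simp
      with laplacian_le_ham[OF \<delta>t[of n]] have "L2_norm (classical_laplacian (\<delta> n)) \<le> 2 * (2 * (1/2) ^ n + cmod (z + complex_of_real shift) * (2 / c * (1/2) ^ n))"
        by (rule order_trans)
      then show ?thesis by (simp add: algebra_simps)
    qed
    have d: "L2_norm (\<lambda>x. \<phi> (Suc n) x - \<phi> n x) \<le> C * (1/2) ^ n" for n
    proof -
      have "2 / c * (1/2) ^ n \<le> C * (1/2) ^ n" unfolding C_def by (intro mult_right_mono) auto
      then show ?thesis using d0[of n] by (simp add: \<delta>_def)
    qed
    have dL: "L2_norm (\<lambda>x. classical_laplacian (\<phi> (Suc n)) x - classical_laplacian (\<phi> n) x) \<le> C * (1/2) ^ n" for n
    proof -
      have le: "2 * (2 + cmod (z + complex_of_real shift) * (2 / c)) * (1/2) ^ n \<le> C * (1/2) ^ n" unfolding C_def by (intro mult_right_mono) auto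
      have eq: "classical_laplacian (\<delta> n) = (\<lambda>x. classical_laplacian (\<phi> (Suc n)) x - classical_laplacian (\<phi> n) x)"
        unfolding \<delta>_def by (rule classical_laplacian_diff) (auto intro: test_function_smooth \<phi>)
      show ?thesis using order_trans[OF d1[of n] le] unfolding eq .
    qed
    obtain f g where l: "(f, g) \<in> laplacian" and Uf: "(\<lambda>x. complex_of_real (U x) * f x) \<in> L2"
      and cf: "(\<lambda>n. L2_norm (\<lambda>x. \<phi> n x - f x)) \<longlonglongrightarrow> 0"
      and cg: "(\<lambda>n. L2_norm (\<lambda>x. classical_laplacian (\<phi> n) x - g x)) \<longlonglongrightarrow> 0"
      and cU: "(\<lambda>n. L2_norm (\<lambda>x. complex_of_real (U x) * \<phi> n x - complex_of_real (U x) * f x)) \<longlonglongrightarrow> 0"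
      by (rule graph_limit[OF \<phi> d dL]) (rule that)
    have L: "f \<in> L2" "g \<in> L2" using l by (auto simp: laplacian_def)
    define k where "k x = - g x + complex_of_real (U x) * f x" for x
    have kL: "k \<in> L2" unfolding k_def[abs_def] using L2_add[OF L2_cmult(1)[OF L(2), of "-1"] Uf] by simp
    have mem: "(f, k) \<in> schroedinger U"
      using l kL by (auto simp: schroedinger_def k_def)
    have ch: "(\<lambda>n. L2_norm (\<lambda>x. ham (\<phi> n) x - k x)) \<longlonglongrightarrow> 0"
      unfolding k_def by (rule ham_limit[OF \<phi> L Uf cg cU])
    have kz: "(\<lambda>x. k x - z * f x) \<in> L2" by (intro L2_diff kL L2_cmult L)
    have "AE x in lborel. k x - z * f x = h x"
    proof (rule half_power_limit[OF kz h tL ap])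
      show "(\<lambda>n. L2_norm (\<lambda>x. ham (\<phi> n) x - z * \<phi> n x - (k x - z * f x))) \<longlonglongrightarrow> 0"
      proof (rule Lim_null_comparison[OF always_eventually])
        show "\<forall>n. norm (L2_norm (\<lambda>x. (ham (\<phi> n) x - z * \<phi> n x) - (k x - z * f x)))
            \<le> L2_norm (\<lambda>x. ham (\<phi> n) x - k x) + cmod z * L2_norm (\<lambda>x. \<phi> n x - f x)"
        proof
          fix n
          have df: "(\<lambda>x. \<phi> n x - f x) \<in> L2" by (intro L2_diff test_function_L2 \<phi> L)
          have "L2_norm (\<lambda>x. (ham (\<phi> n) x - k x) - z * (\<phi> n x - f x)) \<le> L2_norm (\<lambda>x. ham (\<phi> n) x - k x) + L2_norm (\<lambda>x. z * (\<phi> n x - f x))"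
            by (intro L2_norm_triangle_minus L2_diff ham_L2 \<phi> kL L2_cmult df)
          moreover have "(\<lambda>x. (ham (\<phi> n) x - k x) - z * (\<phi> n x - f x)) = (\<lambda>x. (ham (\<phi> n) x - z * \<phi> n x) - (k x - z * f x))"
            by (auto simp: algebra_simps)
          ultimately show "norm (L2_norm (\<lambda>x. (ham (\<phi> n) x - z * \<phi> n x) - (k x - z * f x)))
            \<le> L2_norm (\<lambda>x. ham (\<phi> n) x - k x) + cmod z * L2_norm (\<lambda>x. \<phi> n x - f x)"
            using L2_norm_nonneg[of "\<lambda>x. (ham (\<phi> n) x - z * \<phi> n x) - (k x - z * f x)"] L2_cmult(2)[OF df, of z] by simp
        qed
        show "(\<lambda>n. L2_norm (\<lambda>x. ham (\<phi> n) x - k x) + cmod z * L2_norm (\<lambda>x. \<phi> n x - f x)) \<longlonglongrightarrow> 0"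
          using tendsto_add[OF ch tendsto_mult[OF tendsto_const cf, of "cmod z"]] by simp
      qed
    qed
    then show ?thesis using mem by blast
  qed
  have "L2_norm f \<le> 1 / c * L2_norm (\<lambda>x. g x - z * f x)" if "(f, g) \<in> schroedinger U" for f g
    using schroedinger_lower_bound[OF that, of z] c by (simp add: c_def field_simps)
  then show ?thesis
    unfolding resolvent_set_def using surj by blast
qed

text \<open>Write \<open>A = H - bottom\<close>, which is nonnegative. If \<open>A\<close> had an inverse bounded by \<open>C\<close>, then for
  \<open>\<psi> = A\<^bsup>-1\<^esup> \<phi>\<close> the inequality \<open>0 \<le> \<langle>C \<phi> - \<psi>, A (C \<phi> - \<psi>)\<rangle>\<close> would give
  \<open>\<parallel>\<phi>\<parallel>\<^sup>2 \<le> C \<langle>\<phi>, A \<phi>\<rangle>\<close>, contradicting the choice of the bottom.\<close>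

lemma bottom_in_spectrum: "complex_of_real bottom \<in> spectrum (schroedinger U)"
proof (rule ccontr)
  define b where "b = complex_of_real bottom"
  assume "complex_of_real bottom \<notin> spectrum (schroedinger U)"
  then have res: "b \<in> resolvent_set (schroedinger U)" by (simp add: spectrum_def b_def)
  then obtain C' where C'0: "\<forall>(f, g)\<in>schroedinger U. L2_norm f \<le> C' * L2_norm (\<lambda>x. g x - b * f x)"
    by (auto simp: resolvent_set_def)
  have C': "L2_norm f \<le> C' * L2_norm (\<lambda>x. g x - b * f x)" if "(f, g) \<in> schroedinger U" for f g
    using bspec[OF C'0 that] by simp
  \<comment> \<open>The constant supplied by the resolvent set need not be positive, and the
    argument divides by it.\<close>
  define C where "C = max C' 1"
  have C: "C > 0" by (simp add: C_def)
  define A where "A \<phi> x = ham \<phi> x - b * \<phi> x" for \<phi> x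
  have AL: "A \<phi> \<in> L2" if "test_function \<phi>" for \<phi>
    unfolding A_def by (intro L2_diff ham_L2 L2_cmult test_function_L2 that)
  have Anonneg: "Re (\<integral>x. A \<phi> x * cnj (\<phi> x) \<partial>lborel) = form \<phi> - bottom * (L2_norm \<phi>)\<^sup>2" if \<phi>: "test_function \<phi>" for \<phi>
  proof -
    note L = ham_L2[OF \<phi>] test_function_L2[OF \<phi>]
    have "(\<integral>x. A \<phi> x * cnj (\<phi> x) \<partial>lborel) = (\<integral>x. ham \<phi> x * cnj (\<phi> x) - b * (\<phi> x * cnj (\<phi> x)) \<partial>lborel)"
      by (simp add: A_def algebra_simps)
    also have "\<dots> = (\<integral>x. ham \<phi> x * cnj (\<phi> x) \<partial>lborel) - b * (\<integral>x. \<phi> x * cnj (\<phi> x) \<partial>lborel)"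
      using L2_mult_integrable[OF L(1) L2_cnj(1)[OF L(2)]] L2_mult_integrable[OF L(2) L2_cnj(1)[OF L(2)]] by simp
    finally show ?thesis
      unfolding integral_norm_square form_def by (simp add: b_def del: of_real_power)
  qed
  have Asym: "(\<integral>x. A \<phi> x * cnj (\<psi> x) \<partial>lborel) = (\<integral>x. \<phi> x * cnj (A \<psi> x) \<partial>lborel)"
    if \<phi>: "test_function \<phi>" and \<psi>: "test_function \<psi>" for \<phi> \<psi>
  proof -
    note L = ham_L2[OF \<phi>] test_function_L2[OF \<phi>] ham_L2[OF \<psi>] test_function_L2[OF \<psi>]
    have "(\<integral>x. A \<phi> x * cnj (\<psi> x) \<partial>lborel) = (\<integral>x. ham \<phi> x * cnj (\<psi> x) - b * (\<phi> x * cnj (\<psi> x)) \<partial>lborel)"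
      by (simp add: A_def algebra_simps)
    also have "\<dots> = (\<integral>x. ham \<phi> x * cnj (\<psi> x) \<partial>lborel) - b * (\<integral>x. \<phi> x * cnj (\<psi> x) \<partial>lborel)"
      using L2_mult_integrable[OF L(1) L2_cnj(1)[OF L(4)]] L2_mult_integrable[OF L(2) L2_cnj(1)[OF L(4)]] by simp
    also have "(\<integral>x. ham \<phi> x * cnj (\<psi> x) \<partial>lborel) = (\<integral>x. \<phi> x * cnj (ham \<psi> x) \<partial>lborel)"
      using ham_symmetric[OF \<phi> test_function_cnj[OF \<psi>]] by (simp add: ham_cnj[OF \<psi>])
    also have "(\<integral>x. \<phi> x * cnj (ham \<psi> x) \<partial>lborel) - b * (\<integral>x. \<phi> x * cnj (\<psi> x) \<partial>lborel)
        = (\<integral>x. \<phi> x * cnj (ham \<psi> x) - b * (\<phi> x * cnj (\<psi> x)) \<partial>lborel)"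
      using L2_mult_integrable[OF L(2) L2_cnj(1)[OF L(3)]] L2_mult_integrable[OF L(2) L2_cnj(1)[OF L(4)]] by simp
    also have "\<dots> = (\<integral>x. \<phi> x * cnj (A \<psi> x) \<partial>lborel)"
      by (simp add: A_def b_def algebra_simps)
    finally show ?thesis .
  qed
  have key: "(bottom + 1 / C) * (L2_norm \<phi>)\<^sup>2 \<le> form \<phi>" if \<phi>: "test_function \<phi>" for \<phi>
  proof -
    note \<phi>L = test_function_L2[OF \<phi>]
    obtain \<psi> g where \<psi>: "(\<psi>, g) \<in> schroedinger U" "AE x in lborel. g x - b * \<psi> x = \<phi> x"
      using res \<phi>L unfolding resolvent_set_def by blast
    note L = schroedinger_L2[OF \<psi>(1)]
    have gb: "(\<lambda>x. g x - b * \<psi> x) \<in> L2" by (intro L2_diff L L2_cmult)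
    have ng: "L2_norm (\<lambda>x. g x - b * \<psi> x) = L2_norm \<phi>"
      by (rule L2_norm_AE_cong[OF L2_borel[OF gb] L2_borel[OF \<phi>L] \<psi>(2)])
    have n\<psi>: "L2_norm \<psi> \<le> C * L2_norm \<phi>"
      using C'[OF \<psi>(1)] mult_right_mono[of C' C "L2_norm \<phi>"] L2_norm_nonneg[of \<phi>] by (simp add: ng C_def)
    obtain \<eta> where \<eta>: "\<And>n::nat. test_function (\<eta> n)" and c\<psi>: "(\<lambda>n. L2_norm (\<lambda>x. \<eta> n x - \<psi> x)) \<longlonglongrightarrow> 0"
      and cg: "(\<lambda>n. L2_norm (\<lambda>x. ham (\<eta> n) x - g x)) \<longlonglongrightarrow> 0"
      by (rule core_schroedinger[OF \<psi>(1)]) (rule that)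
    have cA: "(\<lambda>n. L2_norm (\<lambda>x. A (\<eta> n) x - \<phi> x)) \<longlonglongrightarrow> 0"
    proof (rule Lim_null_comparison[OF always_eventually])
      show "\<forall>n. norm (L2_norm (\<lambda>x. A (\<eta> n) x - \<phi> x)) \<le> L2_norm (\<lambda>x. ham (\<eta> n) x - g x) + cmod b * L2_norm (\<lambda>x. \<eta> n x - \<psi> x)"
      proof
        fix n
        have d: "(\<lambda>x. \<eta> n x - \<psi> x) \<in> L2" by (intro L2_diff test_function_L2 \<eta> L)
        have "L2_norm (\<lambda>x. A (\<eta> n) x - \<phi> x) = L2_norm (\<lambda>x. (ham (\<eta> n) x - g x) - b * (\<eta> n x - \<psi> x))"
        proof (rule L2_norm_AE_cong)
          show "(\<lambda>x. A (\<eta> n) x - \<phi> x) \<in> borel_measurable borel" by (intro L2_borel L2_diff AL \<eta> \<phi>L)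
          show "(\<lambda>x. (ham (\<eta> n) x - g x) - b * (\<eta> n x - \<psi> x)) \<in> borel_measurable borel"
            by (intro L2_borel L2_diff ham_L2 \<eta> L L2_cmult test_function_L2)
          show "AE x in lborel. A (\<eta> n) x - \<phi> x = (ham (\<eta> n) x - g x) - b * (\<eta> n x - \<psi> x)"
            using \<psi>(2) by eventually_elim (auto simp: A_def algebra_simps)
        qed
        also have "\<dots> \<le> L2_norm (\<lambda>x. ham (\<eta> n) x - g x) + L2_norm (\<lambda>x. b * (\<eta> n x - \<psi> x))"
          by (intro L2_norm_triangle_minus L2_diff ham_L2 \<eta> L L2_cmult d)
        finally show "norm (L2_norm (\<lambda>x. A (\<eta> n) x - \<phi> x)) \<le> L2_norm (\<lambda>x. ham (\<eta> n) x - g x) + cmod b * L2_norm (\<lambda>x. \<eta> n x - \<psi> x)"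
          using L2_norm_nonneg[of "\<lambda>x. A (\<eta> n) x - \<phi> x"] L2_cmult(2)[OF d, of b] by simp
      qed
      show "(\<lambda>n. L2_norm (\<lambda>x. ham (\<eta> n) x - g x) + cmod b * L2_norm (\<lambda>x. \<eta> n x - \<psi> x)) \<longlonglongrightarrow> 0"
        using tendsto_add[OF cg tendsto_mult[OF tendsto_const c\<psi>, of "cmod b"]] by simp
    qed
    have cnj_conv: "(\<lambda>n. L2_norm (\<lambda>x. cnj (s n x) - cnj (t x))) \<longlonglongrightarrow> 0" if "(\<lambda>n. L2_norm (\<lambda>x. s n x - t x)) \<longlonglongrightarrow> 0"
      for s :: "nat \<Rightarrow> real^'d \<Rightarrow> complex" and t
      using that L2_cnj(2)[of "\<lambda>x. s n x - t x" for n] by simp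
    have cc: "(\<lambda>n. L2_norm (\<lambda>x. \<phi> x - \<phi> x)) \<longlonglongrightarrow> 0" by (simp add: L2_zero)
    have l1: "(\<lambda>n. \<integral>x. \<phi> x * cnj (A (\<eta> n) x) \<partial>lborel) \<longlonglongrightarrow> (\<integral>x. \<phi> x * cnj (\<phi> x) \<partial>lborel)"
      by (intro L2_tendsto_integral \<phi>L L2_cnj AL \<eta> cc cnj_conv[OF cA])
    have l2: "(\<lambda>n. \<integral>x. A (\<eta> n) x * cnj (\<eta> n x) \<partial>lborel) \<longlonglongrightarrow> (\<integral>x. \<phi> x * cnj (\<psi> x) \<partial>lborel)"
      by (intro L2_tendsto_integral \<phi>L L2_cnj AL \<eta> L cA cnj_conv[OF c\<psi>] test_function_L2)
    define q where "q = form \<phi> - bottom * (L2_norm \<phi>)\<^sup>2"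
    \<comment> \<open>Nonnegativity of \<open>A\<close> is available on test functions, so C \<phi>
      - \<psi> is replaced by C \<phi> - \<eta>_n; here \<open>q\<close> is the form of
      \<open>A\<close> at \<phi>.\<close>
    have ineq: "0 \<le> C\<^sup>2 * q - 2 * C * Re (\<integral>x. \<phi> x * cnj (A (\<eta> n) x) \<partial>lborel) + Re (\<integral>x. A (\<eta> n) x * cnj (\<eta> n x) \<partial>lborel)" for n
    proof -
      define v where "v x = complex_of_real C * \<phi> x - \<eta> n x" for x
      have vt: "test_function v" unfolding v_def[abs_def] by (intro test_function_diff test_function_cmult \<phi> \<eta>)
      have Av: "A v x = complex_of_real C * A \<phi> x - A (\<eta> n) x" for x
        unfolding A_def v_def[abs_def]
        by (simp add: ham_diff[OF test_function_cmult[OF \<phi>] \<eta>] ham_cmult[OF \<phi>] algebra_simps)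
      note i = L2_mult_integrable[OF AL[OF \<phi>] L2_cnj(1)[OF \<phi>L]] L2_mult_integrable[OF AL[OF \<phi>] L2_cnj(1)[OF test_function_L2[OF \<eta>[of n]]]]
        L2_mult_integrable[OF AL[OF \<eta>[of n]] L2_cnj(1)[OF \<phi>L]] L2_mult_integrable[OF AL[OF \<eta>[of n]] L2_cnj(1)[OF test_function_L2[OF \<eta>[of n]]]]
      have "(\<integral>x. A v x * cnj (v x) \<partial>lborel) = (\<integral>x. complex_of_real (C\<^sup>2) * (A \<phi> x * cnj (\<phi> x)) - complex_of_real C * (A \<phi> x * cnj (\<eta> n x))
          - complex_of_real C * (A (\<eta> n) x * cnj (\<phi> x)) + A (\<eta> n) x * cnj (\<eta> n x) \<partial>lborel)"
        by (rule Bochner_Integration.integral_cong) (auto simp: Av v_def algebra_simps power2_eq_square)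
      also have "\<dots> = complex_of_real (C\<^sup>2) * (\<integral>x. A \<phi> x * cnj (\<phi> x) \<partial>lborel) - complex_of_real C * (\<integral>x. A \<phi> x * cnj (\<eta> n x) \<partial>lborel)
          - complex_of_real C * (\<integral>x. A (\<eta> n) x * cnj (\<phi> x) \<partial>lborel) + (\<integral>x. A (\<eta> n) x * cnj (\<eta> n x) \<partial>lborel)"
        using i by simp
      finally have "Re (\<integral>x. A v x * cnj (v x) \<partial>lborel) = C\<^sup>2 * q - C * Re (\<integral>x. A \<phi> x * cnj (\<eta> n x) \<partial>lborel)
          - C * Re (\<integral>x. A (\<eta> n) x * cnj (\<phi> x) \<partial>lborel) + Re (\<integral>x. A (\<eta> n) x * cnj (\<eta> n x) \<partial>lborel)"
        using Anonneg[OF \<phi>] by (simp add: q_def del: of_real_power)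
      moreover have "(\<integral>x. A \<phi> x * cnj (\<eta> n x) \<partial>lborel) = (\<integral>x. \<phi> x * cnj (A (\<eta> n) x) \<partial>lborel)"
        by (rule Asym[OF \<phi> \<eta>])
      moreover have "Re (\<integral>x. A (\<eta> n) x * cnj (\<phi> x) \<partial>lborel) = Re (\<integral>x. \<phi> x * cnj (A (\<eta> n) x) \<partial>lborel)"
      proof -
        have "cnj (\<integral>x. A (\<eta> n) x * cnj (\<phi> x) \<partial>lborel) = (\<integral>x. \<phi> x * cnj (A (\<eta> n) x) \<partial>lborel)"
          using integral_bounded_linear[OF bounded_linear_cnj i(3)] by (simp add: mult.commute)
        then show ?thesis by (metis complex_cnj_cnj complex.sel(1) cnj.simps(1))
      qed
      moreover have "0 \<le> Re (\<integral>x. A v x * cnj (v x) \<partial>lborel)"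
        using form_ge_bottom[OF vt] Anonneg[OF vt] by simp
      ultimately show ?thesis by simp
    qed
    \<comment> \<open>In the limit C^2 q - 2 C |\<phi>|^2 + Re <\<phi>, \<psi>> >= 0, with |\<phi>|
      the L^2 norm. The inner product is at most C |\<phi>|^2 because
      \<open>L2_norm \<psi> \<le> C * L2_norm \<phi>\<close>, hence |\<phi>|^2 <= C q.\<close>
    have "(\<lambda>n. C\<^sup>2 * q - 2 * C * Re (\<integral>x. \<phi> x * cnj (A (\<eta> n) x) \<partial>lborel) + Re (\<integral>x. A (\<eta> n) x * cnj (\<eta> n x) \<partial>lborel))
        \<longlonglongrightarrow> C\<^sup>2 * q - 2 * C * Re (\<integral>x. \<phi> x * cnj (\<phi> x) \<partial>lborel) + Re (\<integral>x. \<phi> x * cnj (\<psi> x) \<partial>lborel)"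
      by (intro tendsto_intros l1 l2)
    then have "0 \<le> C\<^sup>2 * q - 2 * C * Re (\<integral>x. \<phi> x * cnj (\<phi> x) \<partial>lborel) + Re (\<integral>x. \<phi> x * cnj (\<psi> x) \<partial>lborel)"
      by (rule tendsto_lowerbound) (use ineq in auto)
    moreover have "Re (\<integral>x. \<phi> x * cnj (\<phi> x) \<partial>lborel) = (L2_norm \<phi>)\<^sup>2"
      unfolding integral_norm_square by simp
    moreover have "Re (\<integral>x. \<phi> x * cnj (\<psi> x) \<partial>lborel) \<le> C * (L2_norm \<phi>)\<^sup>2"
    proof -
      have "Re (\<integral>x. \<phi> x * cnj (\<psi> x) \<partial>lborel) \<le> L2_norm \<phi> * L2_norm \<psi>"
        using order_trans[OF complex_Re_le_cmod L2_cauchy_schwarz[OF \<phi>L L2_cnj(1)[OF L(1)]]] by (simp add: L2_cnj(2))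
      also have "\<dots> \<le> L2_norm \<phi> * (C * L2_norm \<phi>)" by (intro mult_left_mono n\<psi> L2_norm_nonneg)
      finally show ?thesis by (simp add: power2_eq_square mult_ac)
    qed
    ultimately have "C * (L2_norm \<phi>)\<^sup>2 \<le> C\<^sup>2 * q" by simp
    then have "(L2_norm \<phi>)\<^sup>2 \<le> C * q" using C by (simp add: power2_eq_square mult.assoc)
    then have "1 / C * (L2_norm \<phi>)\<^sup>2 \<le> q" using C by (simp add: pos_divide_le_eq mult.commute)
    then show ?thesis by (simp add: q_def algebra_simps)
  qed
  have "bottom + 1 / C \<le> bottom"
    by (rule bottom_greatest) (rule key)
  then show False using C by simp
qed

theorem inf_spectrum_eq_bottom: "inf_spectrum (schroedinger U) = ereal bottom"
  unfolding inf_spectrum_def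
proof (rule antisym)
  show "(INF z\<in>spectrum (schroedinger U). ereal (Re z)) \<le> ereal bottom"
    using INF_lower[OF bottom_in_spectrum, of "\<lambda>z. ereal (Re z)"] by simp
  show "ereal bottom \<le> (INF z\<in>spectrum (schroedinger U). ereal (Re z))"
  proof (rule INF_greatest)
    fix z assume "z \<in> spectrum (schroedinger U)"
    then have "\<not> Re z < bottom" using resolvent_below_bottom by (auto simp: spectrum_def)
    then show "ereal bottom \<le> ereal (Re z)" by simp
  qed
qed

text \<open>The slack 1/(n+1) converts a closed condition into strict inequalities, which survive
  small changes of the trial function. Multiplying out the squared norm excludes null functions
  automatically, since their form is nonnegative.\<close>

lemma inf_spectrum_le_iff:
  "inf_spectrum (schroedinger U) \<le> ereal c \<longleftrightarrow> (\<forall>n::nat. \<exists>\<phi>. test_function \<phi> \<and> form \<phi> < (c + 1 / Suc n) * (L2_norm \<phi>)\<^sup>2)"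
proof
  assume "inf_spectrum (schroedinger U) \<le> ereal c"
  then have bc: "bottom \<le> c" by (simp add: inf_spectrum_eq_bottom)
  show "\<forall>n::nat. \<exists>\<phi>. test_function \<phi> \<and> form \<phi> < (c + 1 / Suc n) * (L2_norm \<phi>)\<^sup>2"
  proof (rule allI, rule ccontr)
    fix n :: nat assume "\<not> (\<exists>\<phi>. test_function \<phi> \<and> form \<phi> < (c + 1 / Suc n) * (L2_norm \<phi>)\<^sup>2)"
    then have "c + 1 / Suc n \<le> bottom" by (intro bottom_greatest) (auto simp: not_less)
    moreover have "1 / real (Suc n) > 0" by simp
    ultimately show False using bc by linarith
  qed
next
  assume *: "\<forall>n::nat. \<exists>\<phi>. test_function \<phi> \<and> form \<phi> < (c + 1 / Suc n) * (L2_norm \<phi>)\<^sup>2"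
  have "bottom \<le> c + inverse (real (Suc n))" for n
  proof -
    obtain \<phi> where \<phi>: "test_function \<phi>" "form \<phi> < (c + 1 / Suc n) * (L2_norm \<phi>)\<^sup>2" using * by blast
    then have "bottom * (L2_norm \<phi>)\<^sup>2 < (c + 1 / Suc n) * (L2_norm \<phi>)\<^sup>2" using form_ge_bottom[OF \<phi>(1)] by linarith
    then have "bottom < c + 1 / Suc n" by (meson mult_right_less_imp_less zero_le_power2)
    then show ?thesis by (simp add: inverse_eq_divide)
  qed
  moreover have "(\<lambda>n. c + inverse (real (Suc n))) \<longlonglongrightarrow> c + 0"
    by (intro tendsto_intros LIMSEQ_inverse_real_of_nat)
  ultimately have "bottom \<le> c + 0" by (intro LIMSEQ_le_const) auto
  then show "inf_spectrum (schroedinger U) \<le> ereal c" by (simp add: inf_spectrum_eq_bottom)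
qed

end

text \<open>Density in L^2 alone would not do, since the form sees the Laplacian. The pairs (\<phi>,
  \<Delta>\<phi>) are a subset of a separable space and hence separable themselves: for
  \<open>a\<close>, \<open>b\<close> from a countable dense set and each \<open>n\<close>, one test
  function with \<phi> near \<open>a\<close> and \<Delta>\<phi> near \<open>b\<close> is kept
  whenever there is one.\<close>

lemma countable_core:
  obtains X :: "(real^'d \<Rightarrow> complex) set" where "countable X" "\<And>\<psi>. \<psi> \<in> X \<Longrightarrow> test_function \<psi>"
    "\<And>\<phi> \<epsilon>. test_function \<phi> \<Longrightarrow> \<epsilon> > 0 \<Longrightarrow> \<exists>\<psi>\<in>X. L2_norm (\<lambda>x. \<psi> x - \<phi> x) < \<epsilon> \<and>
      L2_norm (\<lambda>x. classical_laplacian \<psi> x - classical_laplacian \<phi> x) < \<epsilon>"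
proof -
  obtain Y :: "(real^'d \<Rightarrow> complex) set" where Y: "countable Y" "Y \<subseteq> L2"
    and ap: "\<And>f \<epsilon>. f \<in> L2 \<Longrightarrow> \<epsilon> > 0 \<Longrightarrow> \<exists>g\<in>Y. L2_norm (\<lambda>x. f x - g x) < \<epsilon>"
    by (rule L2_separable) (rule that)
  define good where "good = (\<lambda>(a :: real^'d \<Rightarrow> complex, b :: real^'d \<Rightarrow> complex, n :: nat) \<psi>. test_function \<psi> \<and> L2_norm (\<lambda>x. \<psi> x - a x) < 1 / Suc n \<and>
    L2_norm (\<lambda>x. classical_laplacian \<psi> x - b x) < 1 / Suc n)"
  define T where "T = {t \<in> Y \<times> Y \<times> UNIV. \<exists>\<psi>. good t \<psi>}"
  define X where "X = (\<lambda>t. SOME \<psi>. good t \<psi>) ` T"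
  have good: "good t (SOME \<psi>. good t \<psi>)" if tT: "t \<in> T" for t
  proof -
    obtain \<psi> where "good t \<psi>" using tT unfolding T_def by blast
    then show ?thesis by (rule someI[of "good t"])
  qed
  show thesis
  proof (rule that[of X])
    have c: "countable (Y \<times> Y \<times> (UNIV::nat set))" using Y(1) by (intro countable_SIGMA) auto
    have "T \<subseteq> Y \<times> Y \<times> UNIV" unfolding T_def by blast
    then show "countable X" unfolding X_def using c by (intro countable_image) (rule countable_subset)
    have goodD: "test_function \<psi>" "L2_norm (\<lambda>x. \<psi> x - a x) < 1 / Suc n" "L2_norm (\<lambda>x. classical_laplacian \<psi> x - b x) < 1 / Suc n"
      if "good (a, b, n) \<psi>" for a b n \<psi>
      using that unfolding good_def by simp_all
    show "test_function \<psi>" if pX: "\<psi> \<in> X" for \<psi>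
    proof -
      obtain t where t: "t \<in> T" "\<psi> = (SOME \<psi>. good t \<psi>)" using pX unfolding X_def by auto
      obtain a b n where [simp]: "t = (a, b, n)" by (cases t)
      show ?thesis using goodD(1)[of a b n \<psi>] good[OF t(1)] t(2) by simp
    qed
    fix \<phi> :: "real^'d \<Rightarrow> complex" and \<epsilon> :: real assume \<phi>: "test_function \<phi>" and e: "\<epsilon> > 0"
    obtain n where n: "1 / real (Suc n) < \<epsilon> / 2" using nat_approx_posE[of "\<epsilon> / 2"] e by auto
    have L: "\<phi> \<in> L2" "classical_laplacian \<phi> \<in> L2" using \<phi> by (auto intro: test_function_L2 test_function_laplacian)
    obtain a where a: "a \<in> Y" "L2_norm (\<lambda>x. \<phi> x - a x) < 1 / Suc n" using ap[OF L(1), of "1 / Suc n"] by auto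
    obtain b where b: "b \<in> Y" "L2_norm (\<lambda>x. classical_laplacian \<phi> x - b x) < 1 / Suc n" using ap[OF L(2), of "1 / Suc n"] by auto
    have g: "good (a, b, n) \<phi>" using \<phi> a b by (simp add: good_def)
    have t: "(a, b, n) \<in> T" unfolding T_def using a(1) b(1) g by blast
    define \<psi> where "\<psi> = (SOME \<psi>. good (a, b, n) \<psi>)"
    have \<psi>: "test_function \<psi>" "L2_norm (\<lambda>x. \<psi> x - a x) < 1 / Suc n" "L2_norm (\<lambda>x. classical_laplacian \<psi> x - b x) < 1 / Suc n"
      using goodD[OF good[OF t]] unfolding \<psi>_def by simp_all
    have L': "\<psi> \<in> L2" "classical_laplacian \<psi> \<in> L2" "a \<in> L2" "b \<in> L2"
      using \<psi> a b Y(2) by (auto intro: test_function_L2 test_function_laplacian)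
    have "L2_norm (\<lambda>x. \<psi> x - \<phi> x) \<le> L2_norm (\<lambda>x. \<psi> x - a x) + L2_norm (\<lambda>x. a x - \<phi> x)"
      by (intro L2_norm_triangle_diff L L')
    moreover have "L2_norm (\<lambda>x. classical_laplacian \<psi> x - classical_laplacian \<phi> x) \<le> L2_norm (\<lambda>x. classical_laplacian \<psi> x - b x) + L2_norm (\<lambda>x. b x - classical_laplacian \<phi> x)"
      by (intro L2_norm_triangle_diff L L')
    ultimately have "L2_norm (\<lambda>x. \<psi> x - \<phi> x) < \<epsilon>" "L2_norm (\<lambda>x. classical_laplacian \<psi> x - classical_laplacian \<phi> x) < \<epsilon>"
      using \<psi> a b n L2_norm_minus_commute[of a \<phi>] L2_norm_minus_commute[of b "classical_laplacian \<phi>"] by linarith+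
    moreover have "\<psi> \<in> X" unfolding X_def \<psi>_def using t by (rule imageI)
    ultimately show "\<exists>\<psi>\<in>X. L2_norm (\<lambda>x. \<psi> x - \<phi> x) < \<epsilon> \<and> L2_norm (\<lambda>x. classical_laplacian \<psi> x - classical_laplacian \<phi> x) < \<epsilon>" by blast
  qed
qed

context laplace_bounded
begin

lemma form_eq:
  assumes \<phi>: "test_function \<phi>"
  shows "integrable lborel (\<lambda>x. U x * (cmod (\<phi> x))\<^sup>2)"
    "form \<phi> = (\<integral>x. U x * (cmod (\<phi> x))\<^sup>2 \<partial>lborel) - Re (\<integral>x. classical_laplacian \<phi> x * cnj (\<phi> x) \<partial>lborel)"
proof -
  note i = L2_mult_integrable[OF laplacian_L2[OF \<phi>] L2_cnj(1)[OF test_function_L2[OF \<phi>]]]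
    L2_mult_integrable[OF potential_L2[OF \<phi>] L2_cnj(1)[OF test_function_L2[OF \<phi>]]]
  have r: "Re (complex_of_real (U x) * \<phi> x * cnj (\<phi> x)) = U x * (cmod (\<phi> x))\<^sup>2" for x
    by (simp add: mult.assoc complex_norm_square[symmetric] flip: of_real_power)
  show "integrable lborel (\<lambda>x. U x * (cmod (\<phi> x))\<^sup>2)"
    using integrable_Re[OF i(2)] by (simp only: r)
  have "(\<integral>x. ham \<phi> x * cnj (\<phi> x) \<partial>lborel) = (\<integral>x. complex_of_real (U x) * \<phi> x * cnj (\<phi> x) - classical_laplacian \<phi> x * cnj (\<phi> x) \<partial>lborel)"
    by (simp add: ham_def algebra_simps)
  also have "\<dots> = (\<integral>x. complex_of_real (U x) * \<phi> x * cnj (\<phi> x) \<partial>lborel) - (\<integral>x. classical_laplacian \<phi> x * cnj (\<phi> x) \<partial>lborel)"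
    by (rule Bochner_Integration.integral_diff[OF i(2,1)])
  finally have "form \<phi> = Re (\<integral>x. complex_of_real (U x) * \<phi> x * cnj (\<phi> x) \<partial>lborel) - Re (\<integral>x. classical_laplacian \<phi> x * cnj (\<phi> x) \<partial>lborel)"
    by (simp add: form_def)
  also have "Re (\<integral>x. complex_of_real (U x) * \<phi> x * cnj (\<phi> x) \<partial>lborel) = (\<integral>x. U x * (cmod (\<phi> x))\<^sup>2 \<partial>lborel)"
    using integral_Re[OF i(2)] by (simp only: r)
  finally show "form \<phi> = (\<integral>x. U x * (cmod (\<phi> x))\<^sup>2 \<partial>lborel) - Re (\<integral>x. classical_laplacian \<phi> x * cnj (\<phi> x) \<partial>lborel)" .
qed

text \<open>Continuity in the graph norm of the Laplacian: the relative bound carries convergence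
  over to \<open>U\<close> times \<psi>_n, hence to \<open>ham (\<psi> n)\<close>.\<close>

lemma form_continuous:
  assumes \<phi>: "test_function \<phi>" and \<psi>: "\<And>n::nat. test_function (\<psi> n)"
    and c: "(\<lambda>n. L2_norm (\<lambda>x. \<psi> n x - \<phi> x)) \<longlonglongrightarrow> 0"
    and cL: "(\<lambda>n. L2_norm (\<lambda>x. classical_laplacian (\<psi> n) x - classical_laplacian \<phi> x)) \<longlonglongrightarrow> 0"
  shows "(\<lambda>n. form (\<psi> n)) \<longlonglongrightarrow> form \<phi>"
proof -
  obtain b where b: "b \<ge> 0" and le: "\<And>\<phi>. test_function \<phi> \<Longrightarrow> L2_norm (\<lambda>x. complex_of_real (U x) * \<phi> x) \<le> 1 * L2_norm (classical_laplacian \<phi>) + b * L2_norm \<phi>"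
    using bounded[of 1] by auto
  have cU: "(\<lambda>n. L2_norm (\<lambda>x. complex_of_real (U x) * \<psi> n x - complex_of_real (U x) * \<phi> x)) \<longlonglongrightarrow> 0"
  proof (rule Lim_null_comparison[OF always_eventually])
    show "\<forall>n. norm (L2_norm (\<lambda>x. complex_of_real (U x) * \<psi> n x - complex_of_real (U x) * \<phi> x))
        \<le> L2_norm (\<lambda>x. classical_laplacian (\<psi> n) x - classical_laplacian \<phi> x) + b * L2_norm (\<lambda>x. \<psi> n x - \<phi> x)"
    proof
      fix n
      have "L2_norm (\<lambda>x. complex_of_real (U x) * (\<psi> n x - \<phi> x)) \<le> 1 * L2_norm (classical_laplacian (\<lambda>x. \<psi> n x - \<phi> x)) + b * L2_norm (\<lambda>x. \<psi> n x - \<phi> x)"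
        by (rule le[OF test_function_diff[OF \<psi> \<phi>]])
      then show "norm (L2_norm (\<lambda>x. complex_of_real (U x) * \<psi> n x - complex_of_real (U x) * \<phi> x))
        \<le> L2_norm (\<lambda>x. classical_laplacian (\<psi> n) x - classical_laplacian \<phi> x) + b * L2_norm (\<lambda>x. \<psi> n x - \<phi> x)"
        unfolding classical_laplacian_diff[OF test_function_smooth[OF \<psi>] test_function_smooth[OF \<phi>]]
        by (simp add: right_diff_distrib L2_norm_nonneg)
    qed
    show "(\<lambda>n. L2_norm (\<lambda>x. classical_laplacian (\<psi> n) x - classical_laplacian \<phi> x) + b * L2_norm (\<lambda>x. \<psi> n x - \<phi> x)) \<longlonglongrightarrow> 0"
      using tendsto_add[OF cL tendsto_mult[OF tendsto_const c, of b]] by simp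
  qed
  have cH: "(\<lambda>n. L2_norm (\<lambda>x. ham (\<psi> n) x - ham \<phi> x)) \<longlonglongrightarrow> 0"
    using ham_limit[OF \<psi> test_function_L2[OF \<phi>] laplacian_L2[OF \<phi>] potential_L2[OF \<phi>] cL cU] by (simp add: ham_def)
  have cc: "(\<lambda>n. L2_norm (\<lambda>x. cnj (\<psi> n x) - cnj (\<phi> x))) \<longlonglongrightarrow> 0"
    using c L2_cnj(2)[of "\<lambda>x. \<psi> n x - \<phi> x" for n] by simp
  show ?thesis
    unfolding form_def
    by (intro tendsto_Re L2_tendsto_integral ham_L2 \<psi> \<phi> L2_cnj test_function_L2 cH cc)
qed

text \<open>Each strict inequality is open in the graph norm, so a witness can be replaced by a
  nearby element of \<open>X\<close>.\<close>

lemma inf_spectrum_le_iff_countable: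
  assumes X: "\<And>\<psi>. \<psi> \<in> X \<Longrightarrow> test_function \<psi>"
    and dense: "\<And>\<phi> \<epsilon>. test_function \<phi> \<Longrightarrow> \<epsilon> > 0 \<Longrightarrow> \<exists>\<psi>\<in>X. L2_norm (\<lambda>x. \<psi> x - \<phi> x) < \<epsilon> \<and>
      L2_norm (\<lambda>x. classical_laplacian \<psi> x - classical_laplacian \<phi> x) < \<epsilon>"
  shows "inf_spectrum (schroedinger U) \<le> ereal c \<longleftrightarrow> (\<forall>n::nat. \<exists>\<phi>\<in>X. form \<phi> < (c + 1 / Suc n) * (L2_norm \<phi>)\<^sup>2)"
proof -
  have "\<exists>\<psi>\<in>X. form \<psi> < k * (L2_norm \<psi>)\<^sup>2" if \<phi>: "test_function \<phi>" "form \<phi> < k * (L2_norm \<phi>)\<^sup>2" for \<phi> k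
  proof -
    have "\<exists>\<psi>\<in>X. L2_norm (\<lambda>x. \<psi> x - \<phi> x) < inverse (real (Suc n)) \<and> L2_norm (\<lambda>x. classical_laplacian \<psi> x - classical_laplacian \<phi> x) < inverse (real (Suc n))" for n
      by (rule dense[OF \<phi>(1)]) simp
    then obtain \<psi> where \<psi>: "\<And>n. \<psi> n \<in> X" "\<And>n. L2_norm (\<lambda>x. \<psi> n x - \<phi> x) < inverse (real (Suc n))"
      "\<And>n. L2_norm (\<lambda>x. classical_laplacian (\<psi> n) x - classical_laplacian \<phi> x) < inverse (real (Suc n))" by metis
    have t: "test_function (\<psi> n)" for n by (rule X[OF \<psi>(1)])
    have c: "(\<lambda>n. L2_norm (\<lambda>x. \<psi> n x - \<phi> x)) \<longlonglongrightarrow> 0"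
      by (rule Lim_null_comparison[OF always_eventually LIMSEQ_inverse_real_of_nat])
        (use \<psi>(2) in \<open>auto simp: L2_norm_nonneg intro: less_imp_le\<close>)
    have cL: "(\<lambda>n. L2_norm (\<lambda>x. classical_laplacian (\<psi> n) x - classical_laplacian \<phi> x)) \<longlonglongrightarrow> 0"
      by (rule Lim_null_comparison[OF always_eventually LIMSEQ_inverse_real_of_nat])
        (use \<psi>(3) in \<open>auto simp: L2_norm_nonneg intro: less_imp_le\<close>)
    have "(\<lambda>n. L2_norm (\<psi> n)) \<longlonglongrightarrow> L2_norm \<phi>"
      by (rule L2_tendsto_norm[OF test_function_L2[OF t] test_function_L2[OF \<phi>(1)] c])
    then have "(\<lambda>n. k * (L2_norm (\<psi> n))\<^sup>2 - form (\<psi> n)) \<longlonglongrightarrow> k * (L2_norm \<phi>)\<^sup>2 - form \<phi>"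
      by (intro tendsto_intros form_continuous[OF \<phi>(1) t c cL])
    then have "\<forall>\<^sub>F n in sequentially. 0 < k * (L2_norm (\<psi> n))\<^sup>2 - form (\<psi> n)"
      using \<phi>(2) by (intro order_tendstoD(1)) auto
    then obtain n where "0 < k * (L2_norm (\<psi> n))\<^sup>2 - form (\<psi> n)"
      using eventually_happens'[OF sequentially_bot] by blast
    then show ?thesis using \<psi>(1)[of n] by (intro bexI[of _ "\<psi> n"]) simp_all
  qed
  then show ?thesis unfolding inf_spectrum_le_iff using X by blast
qed

end

text \<open>The operator sees only the class of the potential. This permits passing from a Lebesgue
  measurable, essentially bounded \<open>V\<close> to a bounded Borel representative, to which the
  estimates apply.\<close>

lemma schroedinger_AE_cong:
  assumes "AE x in lborel. V x = V' x"
  shows "schroedinger V = schroedinger V'"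
proof -
  have "schroedinger V1 \<subseteq> schroedinger V2" if "AE x in lborel. V1 x = V2 x" for V1 V2 :: "real^'a \<Rightarrow> real"
  proof
    fix t assume "t \<in> schroedinger V1"
    then obtain f h g where t: "t = (f, h)" "h \<in> L2" "(f, g) \<in> laplacian" and ae: "AE x in lborel. h x = - g x + complex_of_real (V1 x) * f x"
      by (auto simp: schroedinger_def)
    have "AE x in lborel. h x = - g x + complex_of_real (V2 x) * f x"
      using ae that by eventually_elim simp
    then show "t \<in> schroedinger V2" using t by (auto simp: schroedinger_def)
  qed
  from this[OF assms] this[of V' V] assms show ?thesis
    by (auto elim!: eventually_mono simp: eq_commute)
qed

lemma laplace_bounded_sum:
  fixes V W :: "real^'d \<Rightarrow> real"
  assumes V: "V \<in> borel_measurable borel" "\<And>x. \<bar>V x\<bar> \<le> C"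
    and W: "W \<in> borel_measurable borel" "\<And>x. W x \<ge> 0"
    and p: "p > 2" "p > real CARD('d) / 2" and K: "K \<ge> 0" and s0: "0 < s0"
    and bd: "\<And>z. (\<integral>\<^sup>+w. indicator (cball z s0) w * ennreal (W w powr p) \<partial>lborel) \<le> ennreal K"
  shows "laplace_bounded (\<lambda>x. V x + W x) C"
proof
  have C: "C \<ge> 0" using V(2)[of 0] by simp
  show "(\<lambda>x. V x + W x) \<in> borel_measurable borel" using V W by simp
  show "- C \<le> V x + W x" for x using V(2)[of x] W(2)[of x] by (simp add: abs_le_iff)
  fix a :: real assume a: "a > 0"
  obtain b where b: "b \<ge> 0" and le: "\<And>\<phi>. test_function \<phi> \<Longrightarrow> (\<lambda>x. complex_of_real (W x) * \<phi> x) \<in> L2 \<and>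
    L2_norm (\<lambda>x. complex_of_real (W x) * \<phi> x) \<le> a * L2_norm (classical_laplacian \<phi>) + b * L2_norm \<phi>"
    using relative_bound[OF W p K s0 bd a] by blast
  show "\<exists>b\<ge>0. \<forall>\<phi>. test_function \<phi> \<longrightarrow> (\<lambda>x. complex_of_real (V x + W x) * \<phi> x) \<in> L2 \<and>
      L2_norm (\<lambda>x. complex_of_real (V x + W x) * \<phi> x) \<le> a * L2_norm (classical_laplacian \<phi>) + b * L2_norm \<phi>"
  proof (intro exI[of _ "b + C"] conjI allI impI)
    show "b + C \<ge> 0" using b C by simp
    fix \<phi> :: "real^'d \<Rightarrow> complex" assume \<phi>: "test_function \<phi>"
    note V(1)[measurable]
    have [measurable]: "\<phi> \<in> borel_measurable borel" using \<phi> by (rule test_function_borel)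
    have vm: "(\<lambda>x. complex_of_real (V x) * \<phi> x) \<in> borel_measurable borel" by measurable
    have vb: "AE x in lborel. cmod (complex_of_real (V x) * \<phi> x) \<le> C * cmod (\<phi> x)"
      using V(2) by (intro AE_I2) (auto simp: norm_mult intro!: mult_right_mono)
    note v = L2_bound[OF test_function_L2[OF \<phi>] vm vb C]
    have eq: "(\<lambda>x. complex_of_real (V x + W x) * \<phi> x) = (\<lambda>x. complex_of_real (V x) * \<phi> x + complex_of_real (W x) * \<phi> x)"
      by (auto simp: algebra_simps)
    show "(\<lambda>x. complex_of_real (V x + W x) * \<phi> x) \<in> L2"
      unfolding eq using v(1) le[OF \<phi>] by (intro L2_add) auto
    show "L2_norm (\<lambda>x. complex_of_real (V x + W x) * \<phi> x) \<le> a * L2_norm (classical_laplacian \<phi>) + (b + C) * L2_norm \<phi>"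
      unfolding eq using L2_norm_triangle[OF v(1) conjunct1[OF le[OF \<phi>]]] v(2) conjunct2[OF le[OF \<phi>]] by (simp add: algebra_simps)
  qed
qed

section \<open>Random potentials\<close>

lemma Linfty_bounded_representative:
  assumes "V \<in> Linfty"
  obtains V' C where "V' \<in> borel_measurable borel" "\<And>x. \<bar>V' x\<bar> \<le> C" "AE x in lborel. V x = V' x"
proof -
  obtain C where m: "V \<in> borel_measurable lebesgue" and C: "AE x in lborel. \<bar>V x\<bar> \<le> C" using assms by (auto simp: Linfty_def)
  obtain g where g: "g \<in> borel_measurable lborel" "AE x in lborel. V x = g x"
    using completion_ex_borel_measurable_real[OF m] by blast
  define V' where "V' x = max (- \<bar>C\<bar>) (min \<bar>C\<bar> (g x))" for x
  show thesis
  proof (rule that[of V' "\<bar>C\<bar>"])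
    show "V' \<in> borel_measurable borel" using g(1) unfolding V'_def[abs_def] by simp
    show "\<bar>V' x\<bar> \<le> \<bar>C\<bar>" for x by (auto simp: V'_def)
    show "AE x in lborel. V x = V' x"
      using C g(2) by eventually_elim (auto simp: V'_def)
  qed
qed

lemma unit_cell_contains_ball:
  assumes "det (M :: real^'d^'d) > 0"
  obtains s where "s > 0" "cball 0 s \<subseteq> unit_cell M"
proof -
  have "invertible M" using assms by (simp add: invertible_det_nz)
  then obtain N where inv: "M ** N = mat 1" unfolding invertible_def by blast
  obtain B where B: "B > 0" "\<And>x. norm (N *v x) \<le> norm x * B"
    using bounded_linear.pos_bounded[OF matrix_vector_mul_bounded_linear[of "N"]] by blast
  show thesis
  \<comment> \<open>The coordinates of \<open>N *v x\<close> then have modulus at most 1/4, safely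
    inside the open cube of half-width 1/2.\<close>
  proof (rule that[of "1 / (4 * B)"])
    show "1 / (4 * B) > 0" using B by simp
    show "cball 0 (1 / (4 * B)) \<subseteq> unit_cell M"
    proof
      fix x :: "real^'d" assume "x \<in> cball 0 (1 / (4 * B))"
      then have "norm x * B \<le> 1 / (4 * B) * B" using B by (intro mult_right_mono) auto
      then have "norm (N *v x) \<le> 1 / 4" using B(1) B(2)[of x] by simp
      then have "\<bar>(N *v x) $ i\<bar> \<le> 1 / 4" for i
        by (rule order_trans[OF component_le_norm_cart])
      then have "- (1 / 4) \<le> (N *v x) $ i" "(N *v x) $ i \<le> 1 / 4" for i
        unfolding abs_le_iff by (simp_all add: minus_le_iff)
      then have "- 1 / 2 < (N *v x) $ i \<and> (N *v x) $ i < 1 / 2" for i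
        using less_le_trans[of "- 1 / 2" "- (1 / 4)" "(N *v x) $ i"] le_less_trans[of "(N *v x) $ i" "1 / 4" "1 / 2"] by simp
      moreover have "x = M *v (N *v x)" by (simp add: matrix_vector_mul_assoc inv)
      ultimately show "x \<in> unit_cell M" unfolding unit_cell_def by blast
    qed
  qed
qed

lemma countable_lattice: "countable (lattice (M :: real^'d^'d))"
proof -
  have "lattice M \<subseteq> range (\<lambda>a::int^'d. M *v (\<chi> i. of_int (a $ i)))"
  proof
    fix x assume "x \<in> lattice M"
    then obtain z where z: "x = M *v z" "\<forall>i. z $ i \<in> \<int>" by (auto simp: lattice_def)
    have "\<exists>m. z $ i = of_int m" for i using z(2) by (auto elim: Ints_cases)
    then obtain a where "\<And>i. z $ i = of_int (a i)" by metis
    then have "z = (\<chi> i. of_int ((\<chi> i. a i) $ i))" by (simp add: vec_eq_iff)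
    then show "x \<in> range (\<lambda>a::int^'d. M *v (\<chi> i. of_int (a $ i)))" using z(1) by blast
  qed
  then show ?thesis by (rule countable_subset) simp
qed

text \<open>Unordered sums become ordinary series, for which measurability and the exchange with
  integrals are available; positions outside the range of the enumeration contribute 0.\<close>

lemma infsum_ennreal_eq_suminf:
  fixes f :: "'a \<Rightarrow> ennreal"
  assumes "countable A"
  shows "(\<Sum>\<^sub>\<infinity>k\<in>A. f k) = (\<Sum>n. if n \<in> to_nat_on A ` A then f (from_nat_into A n) else 0)"
proof -
  let ?g = "\<lambda>n. if n \<in> to_nat_on A ` A then f (from_nat_into A n) else 0"
  have "infsum ?g UNIV = infsum (\<lambda>n. f (from_nat_into A n)) (to_nat_on A ` A)"
    by (rule infsum_cong_neutral) auto
  also have "\<dots> = infsum ((\<lambda>n. f (from_nat_into A n)) \<circ> to_nat_on A) A"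
    by (rule infsum_reindex) (use assms in auto)
  also have "\<dots> = infsum f A"
    by (rule infsum_cong) (use assms in \<open>auto simp: from_nat_into_to_nat_on\<close>)
  finally have eq: "infsum f A = infsum ?g UNIV" by simp
  have "?g summable_on UNIV" by (rule nonneg_summable_on_complete) simp
  then have "?g sums infsum ?g UNIV" by (intro has_sum_imp_sums has_sum_infsum)
  then show ?thesis unfolding eq by (simp add: sums_iff)
qed

lemma Lp_norm_le_imp:
  assumes p: "p > 0" and c: "c \<ge> 0" and le: "Lp_norm p f \<le> ennreal c"
  shows "(\<integral>\<^sup>+x. ennreal_powr (f x) p \<partial>lborel) \<le> ennreal (c powr p)"
proof -
  define I where "I = (\<integral>\<^sup>+x. ennreal_powr (f x) p \<partial>lborel)"
  have le': "ennreal_powr I (1 / p) \<le> ennreal c" using le unfolding Lp_norm_def I_def .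
  then have "I \<noteq> \<infinity>" by (auto simp: ennreal_powr_def top_unique)
  then obtain i where i: "i \<ge> 0" "I = ennreal i" by (cases I) auto
  then have "ennreal (i powr (1 / p)) \<le> ennreal c"
    using le' by (simp add: ennreal_powr_def)
  then have "i powr (1 / p) \<le> c" using c by simp
  then have "(i powr (1 / p)) powr p \<le> c powr p" using p by (intro powr_mono2) auto
  then have "i \<le> c powr p" using p i(1) by (simp add: powr_powr)
  then show ?thesis unfolding I_def[symmetric] i(2) by (rule ennreal_leI)
qed

text \<open>At infinity the left side is 0, because \<open>enn2real\<close> sends infinity to
  0.\<close>

lemma enn2real_powr_le: "ennreal (enn2real x powr p) \<le> ennreal_powr x p"
  by (simp add: ennreal_powr_def)

lemma le_one_plus_ennreal_powr:
  assumes "p \<ge> 1"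
  shows "x \<le> 1 + ennreal_powr x p"
proof (cases x)
  case (real r)
  have "r \<le> 1 + r powr p"
  proof (cases "r \<le> 1")
    case False
    then have "r powr 1 \<le> r powr p" using assms by (intro powr_mono) auto
    then show ?thesis using False by simp
  qed (simp add: add_increasing2)
  then have "ennreal r \<le> ennreal (1 + r powr p)" by (rule ennreal_leI)
  then show ?thesis using real by (simp add: ennreal_powr_def ennreal_plus)
qed (simp add: ennreal_powr_def)

lemma le_threshold_plus_powr:
  fixes v T p :: real
  assumes "v \<ge> 0" "T > 0" "p \<ge> 1"
  shows "v \<le> T + T powr (1 - p) * v powr p"
proof (cases "v \<le> T")
  case True
  then show ?thesis by (simp add: add_increasing2)
next
  case False
  have "v powr (1 - p) \<le> T powr (1 - p)" using False assms by (intro powr_mono2') auto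
  then have "v powr (1 - p) * v powr p \<le> T powr (1 - p) * v powr p" by (rule mult_right_mono) simp
  moreover have "v powr (1 - p) * v powr p = v" using False assms by (simp add: powr_add[symmetric])
  ultimately show ?thesis using assms by simp
qed

text \<open>Smallness of the sum needs only first moments for the tail (Markov) and independence of the
  tail from finitely many summands.\<close>

lemma (in prob_space) independent_sum_small:
  fixes Z :: "'i \<Rightarrow> 'a \<Rightarrow> ennreal"
  assumes ind: "indep_vars (\<lambda>_. borel) Z A" and A: "countable A"
    and small: "\<And>k \<delta>. k \<in> A \<Longrightarrow> \<delta> > 0 \<Longrightarrow> prob {\<omega>\<in>space M. Z k \<omega> \<le> ennreal \<delta>} > 0"
    and bound: "\<And>\<omega>. \<omega> \<in> space M \<Longrightarrow> (\<Sum>\<^sub>\<infinity>k\<in>A. Z k \<omega>) \<le> ennreal K"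
    and \<eta>: "\<eta> > 0"
  shows "prob {\<omega>\<in>space M. (\<Sum>\<^sub>\<infinity>k\<in>A. Z k \<omega>) \<le> ennreal \<eta>} > 0"
proof -
  define e where "e = from_nat_into A"
  define I where "I = to_nat_on A ` A"
  have eI: "e n \<in> A" if "n \<in> I" for n using that A by (auto simp: e_def I_def)
  have e_inj: "n = m" if "n \<in> I" "m \<in> I" "e n = e m" for n m
    using that A by (auto simp: e_def I_def)
  have rv: "Z k \<in> borel_measurable M" if "k \<in> A" for k
    using ind that by (auto simp: indep_vars_def)
  \<comment> \<open>Off the range of the enumeration the summand is 0, so finite and infinite
    \<open>A\<close> are treated alike.\<close>
  define Y where "Y n \<omega> = (if n \<in> I then Z (e n) \<omega> else 0)" for n \<omega>
  have Ym[measurable]: "Y n \<in> borel_measurable M" for n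
    unfolding Y_def[abs_def] using rv[OF eI] by (cases "n \<in> I") auto
  have sumY: "(\<Sum>\<^sub>\<infinity>k\<in>A. Z k \<omega>) = (\<Sum>n. Y n \<omega>)" for \<omega>
    unfolding infsum_ennreal_eq_suminf[OF A] Y_def e_def I_def ..
  define a where "a n = (\<integral>\<^sup>+\<omega>. Y n \<omega> \<partial>M)" for n
  \<comment> \<open>The pointwise bound \<open>K\<close> on the sum makes the series of means
    converge, and with it the means of the tails tend to 0.\<close>
  have "(\<Sum>n. a n) = (\<integral>\<^sup>+\<omega>. (\<Sum>n. Y n \<omega>) \<partial>M)"
    unfolding a_def by (rule nn_integral_suminf[symmetric]) simp
  also have "\<dots> \<le> (\<integral>\<^sup>+\<omega>. ennreal K \<partial>M)"
    by (rule nn_integral_mono) (use bound sumY in auto)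
  also have "\<dots> = ennreal K" by (simp add: emeasure_space_1)
  finally have sa: "(\<Sum>n. a n) \<le> ennreal K" .
  have "a n \<noteq> \<infinity>" for n
  proof -
    have "a n \<le> (\<Sum>n. a n)" using sum_le_suminf[of a "{n}"] by simp
    then show ?thesis using sa by (auto simp: top_unique)
  qed
  then have "\<exists>b. \<forall>n. b n \<ge> 0 \<and> a n = ennreal (b n)"
    by (intro exI[of _ "\<lambda>n. enn2real (a n)"]) (auto simp: less_top)
  then obtain b where b: "\<And>n. b n \<ge> 0" "\<And>n. a n = ennreal (b n)" by blast
  have bs: "summable b"
    using sa b by (intro summable_suminf_not_top) (auto simp: top_unique)
  have "(\<lambda>N. (\<Sum>n. b n) - (\<Sum>n<N. b n)) \<longlonglongrightarrow> (\<Sum>n. b n) - (\<Sum>n. b n)"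
    by (intro tendsto_diff tendsto_const summable_LIMSEQ bs)
  then have "\<forall>\<^sub>F N in sequentially. (\<Sum>n. b n) - (\<Sum>n<N. b n) < \<eta> / 4"
    using \<eta> by (intro order_tendstoD(2)) auto
  then obtain N where N: "(\<Sum>n. b n) - (\<Sum>n<N. b n) < \<eta> / 4"
    using eventually_happens'[OF sequentially_bot] by blast
  define F where "F = e ` (I \<inter> {..<N})"
  have F: "finite F" "F \<subseteq> A" using eI by (auto simp: F_def)
  define tail where "tail \<omega> = (\<Sum>n. if n < N then 0 else Y n \<omega>)" for \<omega>
  have tm[measurable]: "tail \<in> borel_measurable M" unfolding tail_def[abs_def] by measurable
  have split: "(\<Sum>n. Y n \<omega>) = (\<Sum>n<N. Y n \<omega>) + tail \<omega>" for \<omega>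
  proof -
    have "(\<Sum>n. Y n \<omega>) = (\<Sum>n. (if n < N then Y n \<omega> else 0) + (if n < N then 0 else Y n \<omega>))"
      by (rule suminf_cong) simp
    also have "\<dots> = (\<Sum>n. if n < N then Y n \<omega> else 0) + tail \<omega>"
      unfolding tail_def by (rule suminf_add[symmetric]) auto
    also have "(\<Sum>n. if n < N then Y n \<omega> else 0) = (\<Sum>n<N. if n < N then Y n \<omega> else 0)"
      by (rule suminf_finite) auto
    finally show ?thesis by simp
  qed
  have tail_mean: "(\<integral>\<^sup>+\<omega>. tail \<omega> \<partial>M) \<le> ennreal (\<eta> / 4)"
  proof -
    define c where "c n = (if n < N then 0 else b n)" for n
    have cs: "c sums ((\<Sum>n. b n) - (\<Sum>n<N. b n))"
    proof -
      have "(\<lambda>n. b n - (if n \<in> {..<N} then b n else 0)) sums ((\<Sum>n. b n) - (\<Sum>n<N. b n))"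
        by (intro sums_diff summable_sums bs sums_If_finite_set) simp
      moreover have "(\<lambda>n. b n - (if n \<in> {..<N} then b n else 0)) = c" by (auto simp: c_def)
      ultimately show ?thesis by simp
    qed
    have "(\<integral>\<^sup>+\<omega>. tail \<omega> \<partial>M) = (\<Sum>n. \<integral>\<^sup>+\<omega>. (if n < N then 0 else Y n \<omega>) \<partial>M)"
      unfolding tail_def by (rule nn_integral_suminf) simp
    also have "\<dots> = (\<Sum>n. ennreal (c n))"
      by (rule suminf_cong) (auto simp: c_def a_def[symmetric] b(2))
    also have "\<dots> = ennreal (\<Sum>n. c n)"
      by (intro suminf_ennreal2 sums_summable[OF cs]) (simp add: c_def b(1))
    also have "(\<Sum>n. c n) = (\<Sum>n. b n) - (\<Sum>n<N. b n)" using cs by (simp add: sums_iff)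
    finally show ?thesis using N by (simp add: ennreal_leI)
  qed
  define E1 where "E1 = {\<omega>\<in>space M. tail \<omega> \<le> ennreal (\<eta> / 2)}"
  have E1: "E1 \<in> events" unfolding E1_def by measurable
  have "prob E1 > 0"
  proof -
    \<comment> \<open>Mean at most \<eta>/4 against threshold \<eta>/2: the tail is too large with
      probability at most 1/2.\<close>
    have "emeasure M {\<omega>\<in>space M. 1 \<le> ennreal (2 / \<eta>) * tail \<omega>} \<le> ennreal (2 / \<eta>) * (\<integral>\<^sup>+\<omega>. tail \<omega> * indicator (space M) \<omega> \<partial>M)"
      by (rule nn_integral_Markov_inequality) auto
    also have "(\<integral>\<^sup>+\<omega>. tail \<omega> * indicator (space M) \<omega> \<partial>M) = (\<integral>\<^sup>+\<omega>. tail \<omega> \<partial>M)"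
      by (rule nn_integral_cong) simp
    also have "ennreal (2 / \<eta>) * \<dots> \<le> ennreal (2 / \<eta>) * ennreal (\<eta> / 4)"
      by (rule mult_left_mono[OF tail_mean]) simp
    also have "\<dots> = ennreal (1 / 2)" using \<eta> by (simp add: ennreal_mult[symmetric])
    finally have "prob {\<omega>\<in>space M. 1 \<le> ennreal (2 / \<eta>) * tail \<omega>} \<le> 1 / 2"
      unfolding emeasure_eq_measure by (subst (asm) ennreal_le_iff) simp_all
    moreover have "space M - E1 \<subseteq> {\<omega>\<in>space M. 1 \<le> ennreal (2 / \<eta>) * tail \<omega>}"
    proof
      fix \<omega> assume \<omega>: "\<omega> \<in> space M - E1"
      then have "ennreal (\<eta> / 2) \<le> tail \<omega>" by (auto simp: E1_def not_le)
      then have "ennreal (2 / \<eta>) * ennreal (\<eta> / 2) \<le> ennreal (2 / \<eta>) * tail \<omega>" by (rule mult_left_mono) simp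
      moreover have "ennreal (2 / \<eta>) * ennreal (\<eta> / 2) = 1" using \<eta> by (simp add: ennreal_mult[symmetric])
      ultimately show "\<omega> \<in> {\<omega>\<in>space M. 1 \<le> ennreal (2 / \<eta>) * tail \<omega>}" using \<omega> by simp
    qed
    moreover have "{\<omega>\<in>space M. 1 \<le> ennreal (2 / \<eta>) * tail \<omega>} \<in> events" by measurable
    ultimately have "prob (space M - E1) \<le> 1 / 2"
      using finite_measure_mono order_trans by blast
    then show ?thesis using prob_compl[OF E1] by simp
  qed
  \<comment> \<open>\<open>N\<close> summands of size \<delta> use up at most half of \<eta>; the
    \<open>+ 1\<close> allows \<open>N = 0\<close>.\<close>
  define \<delta> where "\<delta> = \<eta> / (2 * (real N + 1))"
  have \<delta>: "\<delta> > 0" using \<eta> by (simp add: \<delta>_def)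
  define E0 where "E0 = {\<omega>\<in>space M. \<forall>k\<in>F. Z k \<omega> \<le> ennreal \<delta>}"
  have "prob E0 > 0"
  \<comment> \<open>The product formula of \<open>indep_varsD\<close> asks for a nonempty index
    set.\<close>
  proof (cases "F = {}")
    case True
    then show ?thesis by (simp add: E0_def prob_space)
  next
    case False
    have "prob (\<Inter>k\<in>F. Z k -` {..ennreal \<delta>} \<inter> space M) = (\<Prod>k\<in>F. prob (Z k -` {..ennreal \<delta>} \<inter> space M))"
      by (rule indep_varsD[OF ind False F]) simp
    moreover have "(\<Inter>k\<in>F. Z k -` {..ennreal \<delta>} \<inter> space M) = E0" using False by (auto simp: E0_def)
    moreover have "prob (Z k -` {..ennreal \<delta>} \<inter> space M) > 0" if "k \<in> F" for k
    proof -
      have "Z k -` {..ennreal \<delta>} \<inter> space M = {\<omega>\<in>space M. Z k \<omega> \<le> ennreal \<delta>}" by auto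
      then show ?thesis using small[of k \<delta>] \<delta> F that by auto
    qed
    ultimately show ?thesis by (metis (no_types, lifting) prod_pos)
  qed
  have "prob (E0 \<inter> E1) = prob E0 * prob E1"
  proof -
    \<comment> \<open>Independence of the two events comes from grouping the family into the
      disjoint blocks \<open>F\<close> (index 0) and \<open>A - F\<close> (index 1).\<close>
    define J where "J j = (if j = (0::nat) then F else A - F)" for j
    define X where "X j \<omega> = restrict (\<lambda>k. Z k \<omega>) (J j)" for j \<omega>
    have iX: "indep_vars (\<lambda>j. PiM (J j) (\<lambda>_. borel)) X {0, 1}"
      unfolding X_def
      by (rule indep_vars_restrict[OF ind]) (use F in \<open>auto simp: J_def disjoint_family_on_def\<close>)
    \<comment> \<open>The tail as a measurable function of the coordinates in \<open>A - F\<close>: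
      for \<open>n \<ge> N\<close> in \<open>I\<close> the index \<open>e n\<close> lies outside
      \<open>F\<close>, because the enumeration is injective on \<open>I\<close>.\<close>
    define g where "g n y = (if n < N then 0 else if n \<in> I then y (e n) else (0::ennreal))" for n y
    define S0 where "S0 = {y \<in> space (PiM F (\<lambda>_. borel :: ennreal measure)). \<forall>k\<in>F. y k \<le> ennreal \<delta>}"
    define S1 where "S1 = {y \<in> space (PiM (A - F) (\<lambda>_. borel :: ennreal measure)). (\<Sum>n. g n y) \<le> ennreal (\<eta> / 2)}"
    define S where "S j = (if j = (0::nat) then S0 else S1)" for j
    have nF: "e n \<in> A - F" if "n \<in> I" "\<not> n < N" for n
      using that eI e_inj unfolding F_def by blast
    have gm: "g n \<in> borel_measurable (PiM (A - F) (\<lambda>_. borel))" for n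
    proof (cases "n < N \<or> n \<notin> I")
      case True
      then have "g n = (\<lambda>_. 0)" by (auto simp: g_def fun_eq_iff)
      then show ?thesis by simp
    next
      case False
      then have "g n = (\<lambda>y. y (e n))" by (auto simp: g_def fun_eq_iff)
      then show ?thesis using nF[of n] False by simp
    qed
    have "S0 \<in> sets (PiM F (\<lambda>_. borel))"
      unfolding S0_def using F(1) by (intro sets.sets_Collect_finite_All borel_measurable_le) auto
    moreover have "S1 \<in> sets (PiM (A - F) (\<lambda>_. borel))"
      unfolding S1_def by (intro borel_measurable_le borel_measurable_suminf_order gm borel_measurable_const)
    ultimately have Sm: "S j \<in> sets (PiM (J j) (\<lambda>_. borel))" for j by (simp add: S_def J_def)
    have "prob (\<Inter>j\<in>{0,1}. X j -` S j \<inter> space M) = (\<Prod>j\<in>{0,1}. prob (X j -` S j \<inter> space M))"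
      by (rule indep_varsD[OF iX]) (use Sm in auto)
    moreover have "X 0 -` S 0 \<inter> space M = E0"
      by (auto simp: X_def S_def J_def S0_def E0_def space_PiM)
    moreover have "X 1 -` S 1 \<inter> space M = E1"
    proof -
      have "g n (X 1 \<omega>) = (if n < N then 0 else Y n \<omega>)" for n \<omega>
        using nF[of n] by (auto simp: g_def X_def J_def Y_def)
      then have "(\<Sum>n. g n (X 1 \<omega>)) = tail \<omega>" for \<omega> by (simp add: tail_def)
      moreover have "X 1 \<omega> \<in> space (PiM (A - F) (\<lambda>_. borel :: ennreal measure))" for \<omega>
        by (auto simp: X_def J_def space_PiM)
      ultimately show ?thesis by (auto simp: S_def S1_def E1_def)
    qed
    ultimately show ?thesis by simp
  qed
  then have "prob (E0 \<inter> E1) > 0" using \<open>prob E0 > 0\<close> \<open>prob E1 > 0\<close> by simp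
  also have "prob (E0 \<inter> E1) \<le> prob {\<omega>\<in>space M. (\<Sum>\<^sub>\<infinity>k\<in>A. Z k \<omega>) \<le> ennreal \<eta>}"
  proof (rule finite_measure_mono)
    show "{\<omega>\<in>space M. (\<Sum>\<^sub>\<infinity>k\<in>A. Z k \<omega>) \<le> ennreal \<eta>} \<in> events"
      unfolding sumY by measurable
    show "E0 \<inter> E1 \<subseteq> {\<omega>\<in>space M. (\<Sum>\<^sub>\<infinity>k\<in>A. Z k \<omega>) \<le> ennreal \<eta>}"
    proof
      fix \<omega> assume \<omega>: "\<omega> \<in> E0 \<inter> E1"
      have "(\<Sum>n<N. Y n \<omega>) \<le> (\<Sum>n<N. ennreal \<delta>)"
        by (rule sum_mono) (use \<omega> in \<open>auto simp: Y_def E0_def F_def\<close>)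
      also have "\<dots> = ennreal (real N * \<delta>)"
        using \<delta> by (simp add: ennreal_of_nat_eq_real_of_nat ennreal_mult)
      also have "real N * \<delta> \<le> \<eta> / 2"
        using \<eta> by (simp add: \<delta>_def field_simps)
      finally have "(\<Sum>n<N. Y n \<omega>) \<le> ennreal (\<eta> / 2)" by (simp add: ennreal_leI)
      moreover have "tail \<omega> \<le> ennreal (\<eta> / 2)" using \<omega> by (simp add: E1_def)
      ultimately have "(\<Sum>n. Y n \<omega>) \<le> ennreal (\<eta> / 2) + ennreal (\<eta> / 2)"
        unfolding split by (rule add_mono)
      also have "\<dots> = ennreal \<eta>" using \<eta> by (simp add: ennreal_plus[symmetric] del: ennreal_plus)
      finally show "\<omega> \<in> {\<omega>\<in>space M. (\<Sum>\<^sub>\<infinity>k\<in>A. Z k \<omega>) \<le> ennreal \<eta>}"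
        using \<omega> by (simp add: sumY E0_def)
    qed
  qed
  finally show ?thesis .
qed

section \<open>Countable sums, local integral bounds and the random perturbation\<close>

lemma borel_measurable_ennreal_powr [measurable (raw)]:
  assumes [measurable]: "f \<in> borel_measurable M"
  shows "(\<lambda>x. ennreal_powr (f x) p) \<in> borel_measurable M"
  unfolding ennreal_powr_def by measurable

lemma borel_measurable_infsum_ennreal:
  fixes f :: "'i \<Rightarrow> 'a \<Rightarrow> ennreal"
  assumes A: "countable A" and f: "\<And>k. k \<in> A \<Longrightarrow> f k \<in> borel_measurable M"
  shows "(\<lambda>x. \<Sum>\<^sub>\<infinity>k\<in>A. f k x) \<in> borel_measurable M"
proof -
  have "(\<lambda>x. if n \<in> to_nat_on A ` A then f (from_nat_into A n) x else 0) \<in> borel_measurable M" for n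
    using f[of "from_nat_into A n"] A by (cases "n \<in> to_nat_on A ` A") auto
  then show ?thesis unfolding infsum_ennreal_eq_suminf[OF A] by (rule borel_measurable_suminf_order)
qed

lemma nn_integral_infsum:
  fixes f :: "'i \<Rightarrow> 'a \<Rightarrow> ennreal"
  assumes A: "countable A" and f: "\<And>k. k \<in> A \<Longrightarrow> f k \<in> borel_measurable M"
  shows "(\<integral>\<^sup>+x. (\<Sum>\<^sub>\<infinity>k\<in>A. f k x) \<partial>M) = (\<Sum>\<^sub>\<infinity>k\<in>A. \<integral>\<^sup>+x. f k x \<partial>M)"
proof -
  have "(\<lambda>x. if n \<in> to_nat_on A ` A then f (from_nat_into A n) x else 0) \<in> borel_measurable M" for n
    using f[of "from_nat_into A n"] A by (cases "n \<in> to_nat_on A ` A") auto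
  then have "(\<integral>\<^sup>+x. (\<Sum>\<^sub>\<infinity>k\<in>A. f k x) \<partial>M) = (\<Sum>n. \<integral>\<^sup>+x. (if n \<in> to_nat_on A ` A then f (from_nat_into A n) x else 0) \<partial>M)"
    unfolding infsum_ennreal_eq_suminf[OF A] by (rule nn_integral_suminf)
  also have "\<dots> = (\<Sum>n. if n \<in> to_nat_on A ` A then \<integral>\<^sup>+x. f (from_nat_into A n) x \<partial>M else 0)"
    by (rule suminf_cong) simp
  also have "\<dots> = (\<Sum>\<^sub>\<infinity>k\<in>A. \<integral>\<^sup>+x. f k x \<partial>M)"
    by (rule infsum_ennreal_eq_suminf[OF A, symmetric])
  finally show ?thesis .
qed

lemma emeasure_cball_eq: "emeasure lborel (cball (z :: real^'d) r) = ennreal (measure lborel (cball z r))"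
  using emeasure_bounded_finite[OF bounded_cball] by (intro emeasure_eq_ennreal_measure) (simp add: less_top)

text \<open>Cover the large ball by finitely many small ones and use f <= 1 + f^p on each. The
  constant is fixed before \<open>f\<close>, so a single \<open>B\<close> serves all realisations of
  the potential.\<close>

lemma locally_uniform_integral_bound:
  fixes s0 p K R :: real
  assumes p: "p \<ge> 1" and s0: "s0 > 0" and K: "K \<ge> 0"
  shows "\<exists>B. \<forall>f\<in>borel_measurable (borel :: (real^'d) measure).
    (\<forall>z. (\<integral>\<^sup>+y. indicator (cball z s0) y * ennreal_powr (f y) p \<partial>lborel) \<le> ennreal K) \<longrightarrow>
    (\<integral>\<^sup>+y. indicator (cball 0 R) y * f y \<partial>lborel) \<le> ennreal B"
proof -
  have "compact (cball (0 :: real^'d) R)" by simp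
  then obtain F where F: "finite F" "cball (0 :: real^'d) R \<subseteq> (\<Union>z\<in>F. ball z s0)"
    using s0 unfolding compact_eq_totally_bounded by blast
  define B where "B = (\<Sum>z\<in>F. measure lborel (cball z s0) + K)"
  show ?thesis
  proof (intro exI[of _ B] ballI impI)
    fix f :: "real^'d \<Rightarrow> ennreal" assume [measurable]: "f \<in> borel_measurable borel"
      and bd: "\<forall>z. (\<integral>\<^sup>+y. indicator (cball z s0) y * ennreal_powr (f y) p \<partial>lborel) \<le> ennreal K"
    have [measurable]: "(indicator (cball z s0) :: real^'d \<Rightarrow> ennreal) \<in> borel_measurable borel" for z
      by (rule borel_measurable_indicator) auto
    have "(\<integral>\<^sup>+y. indicator (cball 0 R) y * f y \<partial>lborel)
      \<le> (\<integral>\<^sup>+y. (\<Sum>z\<in>F. indicator (cball z s0) y + indicator (cball z s0) y * ennreal_powr (f y) p) \<partial>lborel)"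
    proof (rule nn_integral_mono)
      fix y :: "real^'d"
      show "indicator (cball 0 R) y * f y \<le> (\<Sum>z\<in>F. indicator (cball z s0) y + indicator (cball z s0) y * ennreal_powr (f y) p)"
      proof (cases "y \<in> cball 0 R")
        case True
        then obtain z where z: "z \<in> F" "y \<in> cball z s0" using F(2) by (auto simp: less_imp_le)
        have "f y \<le> indicator (cball z s0) y + indicator (cball z s0) y * ennreal_powr (f y) p"
          using z(2) le_one_plus_ennreal_powr[OF p, of "f y"] by simp
        also have "\<dots> \<le> (\<Sum>z\<in>F. indicator (cball z s0) y + indicator (cball z s0) y * ennreal_powr (f y) p)"
          by (rule member_le_sum[OF z(1)]) (use F(1) in simp_all)
        finally show ?thesis using True by simp
      qed simp
    qed
    also have "\<dots> = (\<Sum>z\<in>F. \<integral>\<^sup>+y. indicator (cball z s0) y + indicator (cball z s0) y * ennreal_powr (f y) p \<partial>lborel)"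
      by (rule nn_integral_sum) measurable
    also have "\<dots> \<le> (\<Sum>z\<in>F. ennreal (measure lborel (cball z s0) + K))"
    proof (rule sum_mono)
      fix z
      have "(\<integral>\<^sup>+y. indicator (cball z s0) y + indicator (cball z s0) y * ennreal_powr (f y) p \<partial>lborel)
        = emeasure lborel (cball z s0) + (\<integral>\<^sup>+y. indicator (cball z s0) y * ennreal_powr (f y) p \<partial>lborel)"
        by (subst nn_integral_add) simp_all
      also have "\<dots> \<le> ennreal (measure lborel (cball z s0)) + ennreal K"
        unfolding emeasure_cball_eq using bd by (intro add_left_mono) simp
      finally show "(\<integral>\<^sup>+y. indicator (cball z s0) y + indicator (cball z s0) y * ennreal_powr (f y) p \<partial>lborel)
        \<le> ennreal (measure lborel (cball z s0) + K)" using K by simp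
    qed
    also have "\<dots> = ennreal B" unfolding B_def using K by (intro sum_ennreal) simp
    finally show "(\<integral>\<^sup>+y. indicator (cball 0 R) y * f y \<partial>lborel) \<le> ennreal B" .
  qed
qed

lemma form_sum:
  assumes V: "laplace_bounded V C" and VW: "laplace_bounded (\<lambda>x. V x + W x) C" and \<phi>: "test_function \<phi>"
  shows "integrable lborel (\<lambda>x. W x * (cmod (\<phi> x))\<^sup>2)"
    "laplace_bounded.form (\<lambda>x. V x + W x) \<phi> = laplace_bounded.form V \<phi> + (\<integral>x. W x * (cmod (\<phi> x))\<^sup>2 \<partial>lborel)"
proof -
  note i = laplace_bounded.form_eq(1)[OF V \<phi>] laplace_bounded.form_eq(1)[OF VW \<phi>]
  have eq: "(V x + W x) * (cmod (\<phi> x))\<^sup>2 - V x * (cmod (\<phi> x))\<^sup>2 = W x * (cmod (\<phi> x))\<^sup>2" for x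
    by (simp add: algebra_simps)
  show "integrable lborel (\<lambda>x. W x * (cmod (\<phi> x))\<^sup>2)"
    using Bochner_Integration.integrable_diff[OF i(2,1)] by (simp only: eq)
  have "(\<integral>x. W x * (cmod (\<phi> x))\<^sup>2 \<partial>lborel) = (\<integral>x. (V x + W x) * (cmod (\<phi> x))\<^sup>2 \<partial>lborel) - (\<integral>x. V x * (cmod (\<phi> x))\<^sup>2 \<partial>lborel)"
    using Bochner_Integration.integral_diff[OF i(2,1)] by (simp only: eq)
  then show "laplace_bounded.form (\<lambda>x. V x + W x) \<phi> = laplace_bounded.form V \<phi> + (\<integral>x. W x * (cmod (\<phi> x))\<^sup>2 \<partial>lborel)"
    unfolding laplace_bounded.form_eq(2)[OF V \<phi>] laplace_bounded.form_eq(2)[OF VW \<phi>] by simp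
qed

text \<open>The lattice has been distilled into two properties of the random potential: a uniform
  local L^p bound, and small mass on any given ball with positive probability. The trial function
  belongs to \<open>V\<close> alone, so it is independent of \<omega>, and the potential raises its
  energy by at most B^2 times the mass on its support ball.\<close>

lemma (in prob_space) random_perturbation_inf_spectrum:
  fixes V :: "real^'d \<Rightarrow> real" and a :: "'a \<Rightarrow> real^'d \<Rightarrow> ennreal"
  assumes V: "V \<in> borel_measurable borel" "\<And>x. \<bar>V x\<bar> \<le> C"
    and p: "p > 2" "p > real CARD('d) / 2" and K: "K \<ge> 0" and s0: "s0 > 0"
    and jm: "(\<lambda>(\<omega>, x). a \<omega> x) \<in> borel_measurable (M \<Otimes>\<^sub>M lborel)"
    and loc: "\<And>\<omega> z. \<omega> \<in> space M \<Longrightarrow> (\<integral>\<^sup>+y. indicator (cball z s0) y * ennreal_powr (a \<omega> y) p \<partial>lborel) \<le> ennreal K"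
    and small: "\<And>R \<eta>. \<eta> > 0 \<Longrightarrow> prob {\<omega>\<in>space M. (\<integral>\<^sup>+y. indicator (cball 0 R) y * a \<omega> y \<partial>lborel) \<le> ennreal \<eta>} > 0"
    and \<epsilon>: "\<epsilon> > 0"
  shows "prob {\<omega>\<in>space M. inf_spectrum (schroedinger (\<lambda>x. V x + enn2real (a \<omega> x)))
    \<le> inf_spectrum (schroedinger V) + ereal \<epsilon>} > 0"
proof -
  define w where "w \<omega> x = enn2real (a \<omega> x)" for \<omega> x
  have wm: "(\<lambda>(\<omega>, x). w \<omega> x) \<in> borel_measurable (M \<Otimes>\<^sub>M lborel)"
    using measurable_compose[OF jm borel_measurable_enn2real[OF measurable_ident]]
    by (simp add: w_def case_prod_beta')
  have wb: "w \<omega> \<in> borel_measurable borel" if "\<omega> \<in> space M" for \<omega>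
    using measurable_Pair2[OF wm that] by simp
  have V0: "laplace_bounded V C"
    using laplace_bounded_sum[OF V borel_measurable_const[of 0] order_refl p order_refl s0] by simp
  have Vw: "laplace_bounded (\<lambda>x. V x + w \<omega> x) C" if \<omega>: "\<omega> \<in> space M" for \<omega>
  proof (rule laplace_bounded_sum[OF V wb[OF \<omega>] _ p K s0])
    show "0 \<le> w \<omega> x" for x by (simp add: w_def)
    show "(\<integral>\<^sup>+y. indicator (cball z s0) y * ennreal (w \<omega> y powr p) \<partial>lborel) \<le> ennreal K" for z
      by (rule order_trans[OF nn_integral_mono loc[OF \<omega>, of z]])
        (auto simp: w_def intro!: mult_left_mono enn2real_powr_le)
  qed
  define E where "E = laplace_bounded.bottom V"
  have E: "inf_spectrum (schroedinger V) = ereal E"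
    unfolding E_def by (rule laplace_bounded.inf_spectrum_eq_bottom[OF V0])
  \<comment> \<open>A trial energy below E + 1/(n+1) leaves a strict gap to E + \<epsilon>, which is
    the allowance \<gamma> for the random part.\<close>
  obtain n where n: "1 / real (Suc n) < \<epsilon>" using nat_approx_posE[OF \<epsilon>] by blast
  have "\<exists>\<phi>. test_function \<phi> \<and> laplace_bounded.form V \<phi> < (E + 1 / Suc n) * (L2_norm \<phi>)\<^sup>2"
    using laplace_bounded.inf_spectrum_le_iff[OF V0, of E] E by auto
  then obtain \<phi> :: "real^'d \<Rightarrow> complex" where \<phi>: "test_function \<phi>" "laplace_bounded.form V \<phi> < (E + 1 / Suc n) * (L2_norm \<phi>)\<^sup>2" by blast
  obtain B where B: "\<And>x. cmod (\<phi> x) \<le> B" using test_function_bounded[OF \<phi>(1)] by blast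
  obtain R where R: "\<And>x. x \<notin> cball 0 R \<Longrightarrow> \<phi> x = 0" using test_function_support[OF \<phi>(1)] by (metis mem_cball_0 not_le)
  define \<gamma> where "\<gamma> = (E + \<epsilon>) * (L2_norm \<phi>)\<^sup>2 - laplace_bounded.form V \<phi>"
  have "(E + 1 / Suc n) * (L2_norm \<phi>)\<^sup>2 \<le> (E + \<epsilon>) * (L2_norm \<phi>)\<^sup>2"
    using n by (intro mult_right_mono) simp_all
  then have \<gamma>: "\<gamma> > 0" using \<phi>(2) unfolding \<gamma>_def by linarith
  \<comment> \<open>The \<open>+ 1\<close> avoids division by zero and makes
    \<open>B\<^sup>2 * \<eta> < \<gamma>\<close> strict.\<close>
  define \<eta> where "\<eta> = \<gamma> / (B\<^sup>2 + 1)"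
  have B1: "0 < B\<^sup>2 + 1" by (simp add: add_nonneg_pos)
  have \<eta>: "\<eta> > 0" using \<gamma> B1 by (simp add: \<eta>_def)
  have B\<eta>: "B\<^sup>2 * \<eta> < \<gamma>"
  proof -
    have "(B\<^sup>2 + 1) * \<eta> = \<gamma>" using B1 by (simp add: \<eta>_def)
    then show ?thesis using \<eta> by (simp add: distrib_right)
  qed
  define A where "A = {\<omega>\<in>space M. (\<integral>\<^sup>+y. indicator (cball 0 R) y * a \<omega> y \<partial>lborel) \<le> ennreal \<eta>}"
  let ?event = "{\<omega>\<in>space M. inf_spectrum (schroedinger (\<lambda>x. V x + w \<omega> x)) \<le> ereal (E + \<epsilon>)}"
  have "A \<subseteq> ?event"
  proof
    fix \<omega> assume "\<omega> \<in> A"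
    then have \<omega>: "\<omega> \<in> space M" and le: "(\<integral>\<^sup>+y. indicator (cball 0 R) y * a \<omega> y \<partial>lborel) \<le> ennreal \<eta>" by (auto simp: A_def)
    have am: "a \<omega> \<in> borel_measurable borel"
      using measurable_Pair2[OF jm \<omega>] by simp
    note i = form_sum[OF V0 Vw[OF \<omega>] \<phi>(1)]
    have "ennreal (\<integral>x. w \<omega> x * (cmod (\<phi> x))\<^sup>2 \<partial>lborel) = (\<integral>\<^sup>+x. ennreal (w \<omega> x * (cmod (\<phi> x))\<^sup>2) \<partial>lborel)"
      by (rule nn_integral_eq_integral[OF i(1), symmetric]) (simp add: w_def)
    also have "\<dots> \<le> (\<integral>\<^sup>+x. ennreal (B\<^sup>2) * (indicator (cball 0 R) x * a \<omega> x) \<partial>lborel)"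
    proof (rule nn_integral_mono)
      fix x :: "real^'d"
      show "ennreal (w \<omega> x * (cmod (\<phi> x))\<^sup>2) \<le> ennreal (B\<^sup>2) * (indicator (cball 0 R) x * a \<omega> x)"
      proof (cases "x \<in> cball 0 R")
        case True
        have "(cmod (\<phi> x))\<^sup>2 \<le> B\<^sup>2" using B[of x] by (intro power_mono) simp_all
        then have "ennreal (w \<omega> x * (cmod (\<phi> x))\<^sup>2) \<le> ennreal (B\<^sup>2 * w \<omega> x)"
          by (intro ennreal_leI) (simp add: mult.commute mult_left_mono w_def)
        also have "\<dots> = ennreal (B\<^sup>2) * ennreal (w \<omega> x)" by (rule ennreal_mult) (simp_all add: w_def)
        also have "\<dots> \<le> ennreal (B\<^sup>2) * a \<omega> x"
          by (intro mult_left_mono) (simp_all add: w_def ennreal_enn2real_if)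
        finally show ?thesis using True by simp
      qed (simp add: R)
    qed
    also have "\<dots> = ennreal (B\<^sup>2) * (\<integral>\<^sup>+x. indicator (cball 0 R) x * a \<omega> x \<partial>lborel)"
    proof (rule nn_integral_cmult)
      have "(indicator (cball 0 R) :: real^'d \<Rightarrow> ennreal) \<in> borel_measurable borel"
        by (rule borel_measurable_indicator) auto
      then have "(\<lambda>x. indicator (cball 0 R) x * a \<omega> x) \<in> borel_measurable borel"
        using am by (rule borel_measurable_times_ennreal)
      then show "(\<lambda>x. indicator (cball 0 R) x * a \<omega> x) \<in> borel_measurable lborel" by simp
    qed
    also have "\<dots> \<le> ennreal (B\<^sup>2) * ennreal \<eta>" by (rule mult_left_mono[OF le]) simp
    also have "\<dots> = ennreal (B\<^sup>2 * \<eta>)" using \<eta> by (simp add: ennreal_mult)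
    finally have "(\<integral>x. w \<omega> x * (cmod (\<phi> x))\<^sup>2 \<partial>lborel) \<le> B\<^sup>2 * \<eta>" using \<eta> by (simp add: ennreal_le_iff)
    then have f: "laplace_bounded.form (\<lambda>x. V x + w \<omega> x) \<phi> < (E + \<epsilon>) * (L2_norm \<phi>)\<^sup>2"
      using B\<eta> unfolding i(2) \<gamma>_def by linarith
    have "laplace_bounded.form (\<lambda>x. V x + w \<omega> x) \<phi> < (E + \<epsilon> + 1 / Suc m) * (L2_norm \<phi>)\<^sup>2" for m
    proof -
      have "(E + \<epsilon>) * (L2_norm \<phi>)\<^sup>2 \<le> (E + \<epsilon> + 1 / Suc m) * (L2_norm \<phi>)\<^sup>2" by (intro mult_right_mono) simp_all
      then show ?thesis using f by linarith
    qed
    then show "\<omega> \<in> ?event" using \<omega> \<phi>(1) laplace_bounded.inf_spectrum_le_iff[OF Vw[OF \<omega>], of "E + \<epsilon>"] by blast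
  qed
  \<comment> \<open>Monotonicity from \<open>A\<close> to the event requires this:
    \<open>measure\<close> is 0 on non-measurable sets, so containing a set of positive probability
    would not be enough.\<close>
  moreover have "?event \<in> events"
  proof -
    obtain X :: "(real^'d \<Rightarrow> complex) set" where X: "countable X" and Xt: "\<And>\<psi>. \<psi> \<in> X \<Longrightarrow> test_function \<psi>"
      and Xd: "\<And>\<phi> \<epsilon>. test_function \<phi> \<Longrightarrow> \<epsilon> > 0 \<Longrightarrow> \<exists>\<psi>\<in>X. L2_norm (\<lambda>x. \<psi> x - \<phi> x) < \<epsilon> \<and>
        L2_norm (\<lambda>x. classical_laplacian \<psi> x - classical_laplacian \<phi> x) < \<epsilon>"
      by (rule countable_core) (rule that)
    let ?I = "\<lambda>\<psi> \<omega>. \<integral>x. w \<omega> x * (cmod (\<psi> x))\<^sup>2 \<partial>lborel"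
    \<comment> \<open>The random parameter now enters only through the integrals \<open>?I\<close>,
      countably many measurable functions of \<omega>.\<close>
    let ?Q = "\<lambda>\<omega>. \<forall>m::nat. \<exists>\<psi>\<in>X. laplace_bounded.form V \<psi> + ?I \<psi> \<omega> < (E + \<epsilon> + 1 / Suc m) * (L2_norm \<psi>)\<^sup>2"
    have "inf_spectrum (schroedinger (\<lambda>x. V x + w \<omega> x)) \<le> ereal (E + \<epsilon>) \<longleftrightarrow> ?Q \<omega>" if \<omega>: "\<omega> \<in> space M" for \<omega>
    proof -
      have eq: "laplace_bounded.form (\<lambda>x. V x + w \<omega> x) \<psi> = laplace_bounded.form V \<psi> + ?I \<psi> \<omega>" if "\<psi> \<in> X" for \<psi>
        by (rule form_sum(2)[OF V0 Vw[OF \<omega>] Xt[OF that]])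
      have "inf_spectrum (schroedinger (\<lambda>x. V x + w \<omega> x)) \<le> ereal (E + \<epsilon>) \<longleftrightarrow>
        (\<forall>m::nat. \<exists>\<psi>\<in>X. laplace_bounded.form (\<lambda>x. V x + w \<omega> x) \<psi> < (E + \<epsilon> + 1 / Suc m) * (L2_norm \<psi>)\<^sup>2)"
        by (rule laplace_bounded.inf_spectrum_le_iff_countable[OF Vw[OF \<omega>] Xt Xd])
      also have "\<dots> \<longleftrightarrow> ?Q \<omega>" by (intro all_cong1 bex_cong refl) (simp only: eq)
      finally show ?thesis .
    qed
    then have "?event = {\<omega>\<in>space M. ?Q \<omega>}" by blast
    also have "\<dots> \<in> events"
    proof (intro sets.sets_Collect_countable_All sets.sets_Collect_countable_Ex'[OF _ X] borel_measurable_less borel_measurable_const borel_measurable_add)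
      fix \<psi> assume "\<psi> \<in> X"
      then have "\<psi> \<in> borel_measurable borel" by (intro test_function_borel Xt)
      then have "(\<lambda>z. (cmod (\<psi> (snd z)))\<^sup>2) \<in> borel_measurable (M \<Otimes>\<^sub>M lborel)" by measurable
      then have "(\<lambda>z. (case z of (\<omega>, x) \<Rightarrow> w \<omega> x) * (cmod (\<psi> (snd z)))\<^sup>2) \<in> borel_measurable (M \<Otimes>\<^sub>M lborel)"
        by (rule borel_measurable_times[OF wm])
      then have "(\<lambda>(\<omega>, x). w \<omega> x * (cmod (\<psi> x))\<^sup>2) \<in> borel_measurable (M \<Otimes>\<^sub>M lborel)"
        by (simp add: case_prod_beta')
      then show "?I \<psi> \<in> borel_measurable M" by (rule lborel.borel_measurable_lebesgue_integral)
    qed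
    finally show ?thesis .
  qed
  ultimately have "prob A \<le> prob ?event" by (rule finite_measure_mono)
  moreover have "prob A > 0" unfolding A_def by (rule small[OF \<eta>])
  ultimately show ?thesis by (simp add: E w_def)
qed

text \<open>The hypothesis speaks of translates of the cell, the potential estimates of balls; the
  ball about \<open>z\<close> fits into the cell translated by \<open>z\<close>.\<close>

lemma local_powr_bound_of_Lp_cell:
  fixes f :: "real^'d \<Rightarrow> ennreal"
  assumes p: "p > 0" and c: "c \<ge> 0" and s: "cball 0 s \<subseteq> unit_cell M"
    and le: "Lp_norm p (\<lambda>y. f y * indicator ((\<lambda>t. t + z) ` unit_cell M) y) \<le> ennreal c"
  shows "(\<integral>\<^sup>+y. indicator (cball z s) y * ennreal_powr (f y) p \<partial>lborel) \<le> ennreal (c powr p)"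
proof -
  have "indicator (cball z s) y * ennreal_powr (f y) p \<le> ennreal_powr (f y * indicator ((\<lambda>t. t + z) ` unit_cell M) y) p" for y
  proof (cases "y \<in> cball z s")
    case True
    then have "y - z \<in> cball 0 s" by (simp add: dist_norm norm_minus_commute)
    then have "y - z \<in> unit_cell M" using s by blast
    then have "y \<in> (\<lambda>t. t + z) ` unit_cell M" by (intro image_eqI[of _ _ "y - z"]) simp_all
    then show ?thesis using True by simp
  qed simp
  then have "(\<integral>\<^sup>+y. indicator (cball z s) y * ennreal_powr (f y) p \<partial>lborel)
      \<le> (\<integral>\<^sup>+y. ennreal_powr (f y * indicator ((\<lambda>t. t + z) ` unit_cell M) y) p \<partial>lborel)"
    by (intro nn_integral_mono)
  also have "\<dots> \<le> ennreal (c powr p)" by (rule Lp_norm_le_imp[OF p c le])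
  finally show ?thesis .
qed

text \<open>A small L^p norm gives small mass on the ball through v <= T + T^(1 - p) v^p in place of
  Hoelder's inequality. By translation invariance \<kappa> serves all \<open>k\<close> at
  once.\<close>

lemma ball_integral_small_of_Lp_norm:
  fixes R \<delta> p :: real
  assumes p: "p \<ge> 1" and \<delta>: "\<delta> > 0"
  shows "\<exists>\<kappa>>0. \<forall>v\<in>borel_measurable (borel :: (real^'d) measure). \<forall>k.
    (\<forall>x. 0 \<le> v x) \<longrightarrow> Lp_norm p (\<lambda>x. ennreal (v x)) \<le> ennreal \<kappa> \<longrightarrow>
    (\<integral>\<^sup>+x. indicator (cball 0 R) x * ennreal (v (x - k)) \<partial>lborel) \<le> ennreal \<delta>"
proof -
  define b where "b = measure lborel (cball (0 :: real^'d) R)"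
  have b: "b \<ge> 0" by (simp add: b_def)
  \<comment> \<open>Makes the constant part \<open>T * b\<close> at most \<delta>/2.\<close>
  define T where "T = \<delta> / (2 * (b + 1))"
  have T: "T > 0" using b \<delta> by (simp add: T_def)
  \<comment> \<open>Solves \<open>T powr (1 - p) * \<kappa> powr p = \<delta> / 2\<close>.\<close>
  define \<kappa> where "\<kappa> = (\<delta> / 2 * T powr (p - 1)) powr (1 / p)"
  have \<kappa>: "\<kappa> > 0" using T \<delta> by (simp add: \<kappa>_def)
  have \<kappa>p: "\<kappa> powr p = \<delta> / 2 * T powr (p - 1)" using T \<delta> p by (simp add: \<kappa>_def powr_powr)
  show ?thesis
  proof (intro exI[of _ \<kappa>] conjI ballI allI impI \<kappa>)
    fix v :: "real^'d \<Rightarrow> real" and k assume [measurable]: "v \<in> borel_measurable borel" and v: "\<forall>x. 0 \<le> v x"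
      and le: "Lp_norm p (\<lambda>x. ennreal (v x)) \<le> ennreal \<kappa>"
    have [measurable]: "(indicator (cball 0 R) :: real^'d \<Rightarrow> ennreal) \<in> borel_measurable borel"
      by (rule borel_measurable_indicator) auto
    have "(\<integral>\<^sup>+x. ennreal_powr (ennreal (v x)) p \<partial>lborel) \<le> ennreal (\<kappa> powr p)"
      using p \<kappa> by (intro Lp_norm_le_imp[OF _ _ le]) simp_all
    then have vp: "(\<integral>\<^sup>+x. ennreal (v x powr p) \<partial>lborel) \<le> ennreal (\<kappa> powr p)"
      using v by (simp add: ennreal_powr_def)
    have "(\<integral>\<^sup>+x. indicator (cball 0 R) x * ennreal (v (x - k)) \<partial>lborel)
      \<le> (\<integral>\<^sup>+x. ennreal T * indicator (cball 0 R) x + ennreal (T powr (1 - p)) * ennreal (v (x - k) powr p) \<partial>lborel)"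
    proof (rule nn_integral_mono)
      fix x :: "real^'d"
      show "indicator (cball 0 R) x * ennreal (v (x - k)) \<le> ennreal T * indicator (cball 0 R) x + ennreal (T powr (1 - p)) * ennreal (v (x - k) powr p)"
      proof (cases "x \<in> cball 0 R")
        case True
        have "ennreal (v (x - k)) \<le> ennreal (T + T powr (1 - p) * v (x - k) powr p)"
          using v by (intro ennreal_leI le_threshold_plus_powr T p) simp
        also have "\<dots> = ennreal T + ennreal (T powr (1 - p)) * ennreal (v (x - k) powr p)"
          using T by (subst ennreal_plus) (simp_all add: ennreal_mult)
        finally show ?thesis using True by simp
      qed simp
    qed
    also have "\<dots> = ennreal T * emeasure lborel (cball (0 :: real^'d) R) + ennreal (T powr (1 - p)) * (\<integral>\<^sup>+x. ennreal (v (x - k) powr p) \<partial>lborel)"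
    proof -
      have m: "(\<lambda>x. ennreal (v (x - k) powr p)) \<in> borel_measurable lborel" by measurable
      have i: "(\<lambda>x. ennreal T * indicator (cball (0 :: real^'d) R) x) \<in> borel_measurable lborel" by measurable
      have "cball (0 :: real^'d) R \<in> sets lborel" by simp
      then show ?thesis
        unfolding nn_integral_add[OF i borel_measurable_times_ennreal[OF borel_measurable_const m]] nn_integral_cmult[OF m]
        by (simp only: nn_integral_cmult_indicator)
    qed
    also have "(\<integral>\<^sup>+x. ennreal (v (x - k) powr p) \<partial>lborel) = (\<integral>\<^sup>+x. ennreal (v x powr p) \<partial>lborel)"
      using nn_integral_lborel_translate[of "\<lambda>x. ennreal (v x powr p)" "- k"] by simp
    also have "ennreal T * emeasure lborel (cball (0 :: real^'d) R) + ennreal (T powr (1 - p)) * (\<integral>\<^sup>+x. ennreal (v x powr p) \<partial>lborel)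
      \<le> ennreal T * ennreal b + ennreal (T powr (1 - p)) * ennreal (\<kappa> powr p)"
      unfolding emeasure_cball_eq b_def by (intro add_left_mono mult_left_mono vp) simp
    also have "\<dots> = ennreal (T * b + T powr (1 - p) * \<kappa> powr p)"
      using T b by (subst ennreal_plus) (simp_all add: ennreal_mult)
    also have "\<dots> \<le> ennreal \<delta>"
    proof (rule ennreal_leI)
      have "T * b \<le> \<delta> / 2" using b \<delta> by (simp add: T_def field_simps)
      moreover have "T powr (1 - p) * T powr (p - 1) = 1" using T by (simp add: powr_add[symmetric])
      then have "T powr (1 - p) * \<kappa> powr p = \<delta> / 2" unfolding \<kappa>p by (simp add: mult.left_commute)
      ultimately show "T * b + T powr (1 - p) * \<kappa> powr p \<le> \<delta>" by linarith
    qed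
    finally show "(\<integral>\<^sup>+x. indicator (cball 0 R) x * ennreal (v (x - k)) \<partial>lborel) \<le> ennreal \<delta>" .
  qed
qed

theorem lemma4p7:
  fixes M :: "real^'d^'d"
    and p :: real
    and P :: "'w measure"
    and N :: "'o measure"
    and lam :: "real^'d \<Rightarrow> 'w \<Rightarrow> 'o"
    and u :: "'o \<Rightarrow> real^'d \<Rightarrow> real"
    and V :: "real^'d \<Rightarrow> real"
    and \<epsilon> :: real
  assumes "det M > 0"
    and "p > max 2 (real CARD('d) / 2)"
    and "prob_space P"
    and "prob_space.indep_vars P (\<lambda>_. N) lam (lattice M)"
    and "(\<lambda>(l, x). u l x) \<in> borel_measurable (N \<Otimes>\<^sub>M borel)"
    and "\<And>l x. l \<in> space N \<Longrightarrow> 0 \<le> u l x"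
    and "(SUP \<omega>\<in>space P. SUP x. Lp_norm p
           (\<lambda>y. alloy_potential M u lam \<omega> y * indicator ((\<lambda>t. t + x) ` unit_cell M) y)) < \<infinity>"
    and "\<And>\<kappa> k. \<kappa> > 0 \<Longrightarrow> k \<in> lattice M \<Longrightarrow>
           measure P {\<omega> \<in> space P. Lp_norm p (\<lambda>x. ennreal (u (lam k \<omega>) x)) \<le> ennreal \<kappa>} > 0"
    and "V \<in> Linfty"
    and "periodic (lattice M) V"
    and "\<epsilon> > 0"
  shows "measure P {\<omega> \<in> space P.
           inf_spectrum (schroedinger (\<lambda>x. V x + enn2real (alloy_potential M u lam \<omega> x)))
             \<le> inf_spectrum (schroedinger V) + ereal \<epsilon>} > 0"
proof -
  interpret prob_space P by fact
  have p: "p > 2" "p > real CARD('d) / 2" "p \<ge> 1" "p > 0" using assms(2) by auto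
  let ?a = "alloy_potential M u lam"
  obtain V' C where V': "V' \<in> borel_measurable borel" "\<And>x. \<bar>V' x\<bar> \<le> C" "AE x in lborel. V x = V' x"
    by (rule Linfty_bounded_representative[OF assms(9)]) (rule that)
  obtain s where s: "s > 0" "cball 0 s \<subseteq> unit_cell M" by (rule unit_cell_contains_ball[OF assms(1)]) (rule that)
  define S where "S = (SUP \<omega>\<in>space P. SUP x. Lp_norm p (\<lambda>y. ?a \<omega> y * indicator ((\<lambda>t. t + x) ` unit_cell M) y))"
  have Sfin: "S < \<infinity>" using assms(7) unfolding S_def .
  define c where "c = enn2real S"
  have c: "c \<ge> 0" "S = ennreal c" using Sfin by (simp_all add: c_def less_top)
  have cell: "Lp_norm p (\<lambda>y. ?a \<omega> y * indicator ((\<lambda>t. t + z) ` unit_cell M) y) \<le> ennreal c" if \<omega>: "\<omega> \<in> space P" for \<omega> z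
    unfolding c(2)[symmetric] S_def by (intro SUP_upper2[OF \<omega>] SUP_upper UNIV_I)
  have loc: "(\<integral>\<^sup>+y. indicator (cball z s) y * ennreal_powr (?a \<omega> y) p \<partial>lborel) \<le> ennreal (c powr p)" if \<omega>: "\<omega> \<in> space P" for \<omega> z
    by (rule local_powr_bound_of_Lp_cell[OF p(4) c(1) s(2) cell[OF \<omega>]])
  have lam: "lam k \<in> P \<rightarrow>\<^sub>M N" if "k \<in> lattice M" for k
    using assms(4) that by (auto simp: indep_vars_def)
  have lam': "lam k \<omega> \<in> space N" if "k \<in> lattice M" "\<omega> \<in> space P" for k \<omega>
    by (rule measurable_space[OF lam[OF that(1)] that(2)])
  have ul: "u l \<in> borel_measurable borel" if "l \<in> space N" for l
    using measurable_Pair2[OF assms(5) that] by simp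
  have shift: "(\<lambda>(l, x). ennreal (u l (x - k))) \<in> borel_measurable (N \<Otimes>\<^sub>M lborel)" for k
  proof -
    have "(\<lambda>z. (fst z, snd z - k)) \<in> N \<Otimes>\<^sub>M lborel \<rightarrow>\<^sub>M N \<Otimes>\<^sub>M borel" by measurable
    from measurable_compose[OF this assms(5)] show ?thesis
      by (simp add: case_prod_beta')
  qed
  have jk: "(\<lambda>z. ennreal (u (lam k (fst z)) (snd z - k))) \<in> borel_measurable (P \<Otimes>\<^sub>M lborel)" if k: "k \<in> lattice M" for k
  proof -
    note lam[OF k, measurable]
    have "(\<lambda>z. (lam k (fst z), snd z)) \<in> P \<Otimes>\<^sub>M lborel \<rightarrow>\<^sub>M N \<Otimes>\<^sub>M lborel" by measurable
    from measurable_compose[OF this shift] show ?thesis by simp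
  qed
  have jm: "(\<lambda>(\<omega>, x). ?a \<omega> x) \<in> borel_measurable (P \<Otimes>\<^sub>M lborel)"
    using borel_measurable_infsum_ennreal[OF countable_lattice jk]
    by (simp add: alloy_potential_def case_prod_beta')
  have small: "prob {\<omega>\<in>space P. (\<integral>\<^sup>+y. indicator (cball 0 R) y * ?a \<omega> y \<partial>lborel) \<le> ennreal \<eta>} > 0" if \<eta>: "\<eta> > 0" for R \<eta>
  proof -
    define G where "G k l = (\<integral>\<^sup>+x. indicator (cball 0 R) x * ennreal (u l (x - k)) \<partial>lborel)" for k l
    have ind: "(indicator (cball 0 R) :: real^'d \<Rightarrow> ennreal) \<in> borel_measurable borel"
      by (rule borel_measurable_indicator) auto
    have Gm: "G k \<in> borel_measurable N" for k
    proof -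
      have "(\<lambda>z. indicator (cball 0 R) (snd z)) \<in> (borel_measurable (N \<Otimes>\<^sub>M (lborel :: (real^'d) measure)) :: (_ \<Rightarrow> ennreal) set)"
        using ind by (intro measurable_compose[OF measurable_snd]) simp
      from borel_measurable_times_ennreal[OF this shift[of k]]
      have "(\<lambda>(l, x). indicator (cball 0 R) x * ennreal (u l (x - k))) \<in> borel_measurable (N \<Otimes>\<^sub>M lborel)"
        by (simp add: case_prod_beta')
      then show ?thesis unfolding G_def[abs_def] by (rule lborel.borel_measurable_nn_integral)
    qed
    \<comment> \<open>The mass that site \<open>k\<close> contributes to the ball. Being a
      measurable function of \<open>lam k\<close> alone, it inherits independence from the family
      \<open>lam\<close>.\<close>
    define Z where "Z k \<omega> = G k (lam k \<omega>)" for k \<omega>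
    have indZ: "indep_vars (\<lambda>_. borel) Z (lattice M)"
      unfolding Z_def[abs_def] by (rule indep_vars_compose2[OF assms(4) Gm])
    have Zsum: "(\<integral>\<^sup>+y. indicator (cball 0 R) y * ?a \<omega> y \<partial>lborel) = (\<Sum>\<^sub>\<infinity>k\<in>lattice M. Z k \<omega>)" if \<omega>: "\<omega> \<in> space P" for \<omega>
    proof -
      have "indicator (cball 0 R) y * ?a \<omega> y = (\<Sum>\<^sub>\<infinity>k\<in>lattice M. indicator (cball 0 R) y * ennreal (u (lam k \<omega>) (y - k)))" for y
        by (cases "y \<in> cball 0 R") (simp_all add: alloy_potential_def)
      moreover have "(\<lambda>y. indicator (cball 0 R) y * ennreal (u (lam k \<omega>) (y - k))) \<in> borel_measurable lborel" if k: "k \<in> lattice M" for k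
      proof -
        have "(\<lambda>y. ennreal (u (lam k \<omega>) (y - k))) \<in> borel_measurable borel"
          using measurable_Pair2[OF shift lam'[OF k \<omega>]] by simp
        from borel_measurable_times_ennreal[OF ind this] show ?thesis by simp
      qed
      ultimately show ?thesis
        by (simp only: Z_def G_def nn_integral_infsum[OF countable_lattice])
    qed
    \<comment> \<open>\<open>B\<close> is fixed before \<omega>, as the uniform bound on the sum of
      the \<open>Z k\<close> requires.\<close>
    obtain B where B: "\<forall>f\<in>borel_measurable (borel :: (real^'d) measure).
        (\<forall>z. (\<integral>\<^sup>+y. indicator (cball z s) y * ennreal_powr (f y) p \<partial>lborel) \<le> ennreal (c powr p)) \<longrightarrow>
        (\<integral>\<^sup>+y. indicator (cball 0 R) y * f y \<partial>lborel) \<le> ennreal B"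
      using locally_uniform_integral_bound[OF p(3) s(1) powr_ge_zero] by blast
    have bound: "(\<Sum>\<^sub>\<infinity>k\<in>lattice M. Z k \<omega>) \<le> ennreal B" if \<omega>: "\<omega> \<in> space P" for \<omega>
    proof -
      have "?a \<omega> \<in> borel_measurable borel" using measurable_Pair2[OF jm \<omega>] by simp
      then show ?thesis using B loc[OF \<omega>] unfolding Zsum[OF \<omega>, symmetric] by blast
    qed
    have Zsmall: "prob {\<omega>\<in>space P. Z k \<omega> \<le> ennreal \<delta>} > 0" if k: "k \<in> lattice M" and \<delta>: "\<delta> > 0" for k \<delta>
    proof -
      obtain \<kappa> where \<kappa>: "\<kappa> > 0" and \<kappa>le: "\<forall>v\<in>borel_measurable (borel :: (real^'d) measure). \<forall>k.
          (\<forall>x. 0 \<le> v x) \<longrightarrow> Lp_norm p (\<lambda>x. ennreal (v x)) \<le> ennreal \<kappa> \<longrightarrow>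
          (\<integral>\<^sup>+x. indicator (cball 0 R) x * ennreal (v (x - k)) \<partial>lborel) \<le> ennreal \<delta>"
        using ball_integral_small_of_Lp_norm[OF p(3) \<delta>] by blast
      have Zm: "Z k \<in> borel_measurable P" unfolding Z_def[abs_def] by (rule measurable_compose[OF lam[OF k] Gm])
      have "{\<omega>\<in>space P. Lp_norm p (\<lambda>x. ennreal (u (lam k \<omega>) x)) \<le> ennreal \<kappa>} \<subseteq> {\<omega>\<in>space P. Z k \<omega> \<le> ennreal \<delta>}"
        using \<kappa>le ul[OF lam'[OF k]] assms(6)[OF lam'[OF k]] unfolding Z_def G_def by blast
      \<comment> \<open>Only the larger event has to be shown measurable for monotonicity; the
        smaller one has positive probability by hypothesis.\<close>
      moreover have "{\<omega>\<in>space P. Z k \<omega> \<le> ennreal \<delta>} \<in> events"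
        using Zm by (intro borel_measurable_le) simp_all
      ultimately have "prob {\<omega>\<in>space P. Lp_norm p (\<lambda>x. ennreal (u (lam k \<omega>) x)) \<le> ennreal \<kappa>} \<le> prob {\<omega>\<in>space P. Z k \<omega> \<le> ennreal \<delta>}"
        by (rule finite_measure_mono)
      then show ?thesis using assms(8)[OF \<kappa> k] by linarith
    qed
    have "prob {\<omega>\<in>space P. (\<Sum>\<^sub>\<infinity>k\<in>lattice M. Z k \<omega>) \<le> ennreal \<eta>} > 0"
      by (rule independent_sum_small[OF indZ countable_lattice Zsmall bound \<eta>])
    also have "{\<omega>\<in>space P. (\<Sum>\<^sub>\<infinity>k\<in>lattice M. Z k \<omega>) \<le> ennreal \<eta>} = {\<omega>\<in>space P. (\<integral>\<^sup>+y. indicator (cball 0 R) y * ?a \<omega> y \<partial>lborel) \<le> ennreal \<eta>}"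
      using Zsum by auto
    finally show ?thesis .
  qed
  have "schroedinger V = schroedinger V'" by (rule schroedinger_AE_cong[OF V'(3)])
  moreover have "schroedinger (\<lambda>x. V x + enn2real (?a \<omega> x)) = schroedinger (\<lambda>x. V' x + enn2real (?a \<omega> x))" for \<omega>
    by (rule schroedinger_AE_cong) (use V'(3) in eventually_elim, simp)
  ultimately show ?thesis
    using random_perturbation_inf_spectrum[OF V'(1,2) p(1,2) powr_ge_zero s(1) jm loc small assms(11)] by simp
qed

end
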